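(* Let $V$ be a category, $(E,u,\sigma)$ a multitensor on $V$ and $(T,\eta,\mu)$ a monad on $V$. Then there is a bijection between the following types of data: (1) Morphisms $\tau_{X_i}:E_iTX_i\to TE_iX_i$ of $V$ providing the coherences making $T$ into a monoidal monad on $(V,E)$. (2) Morphisms $\sigma'_{X_{ij}}:TE_iTE_jX_{ij}\to TE_{ij}X_{ij}$ of $V$ providing the substitutions for a multitensor $(TE,u',\sigma')$, where $u'_X=\eta_{E_1X}u_X$, such that $\eta E:E\to TE$ is a multitensor map, $Tu:T\to TE_1$ is a monad map, and the composite $$TE_i\xrightarrow{\;Tu\eta E_i\;}TE_1TE_i\xrightarrow{\;\sigma'\;}TE_i$$ is the identity. If in addition $V$ has (small) coproducts and $E$ is distributive, then the data (1)-(2) are also in bijection with: (3) Identity-on-objects morphisms $\lambda_X:\Gamma(E)\mathcal{G}(T)(X)\to\mathcal{G}(T)\Gamma(E)(X)$ of $\mathcal{G}V$ providing a monad distributive law of $\mathcal{G}(T)$ over $\Gamma(E)$. (4) Liftings of the monad $\mathcal{G}(T)$ to a monad $T'$ on $E\text{-Cat}$. And for any given instance of such data one has an isomorphism of categories $$(TE)\text{-Cat}\cong(E\text{-Cat})^{T'}$$ commuting with the forgetful functors into $\mathcal{G}V$.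
   Context: Enriched graphs. A $V$-graph $X$ consists of a set $X_0$ and objects $X(a,b)$ of $V$ for $(a,b)\in X_0\times X_0$; a morphism $f:X\to Y$ is a function $f_0:X_0\to Y_0$ with maps $f_{a,b}:X(a,b)\to Y(fa,fb)$. They form $\mathcal{G}V$. For a functor or natural transformation $H$, $\mathcal{G}H$ leaves objects unchanged and applies $H$ on homs; so a monad $T$ on $V$ gives a monad $\mathcal{G}(T)$ on $\mathcal{G}V$. Multitensors. Let $MV=\coprod_nV^n$ be the category of finite sequences in $V$. A multitensor $(E,u,\sigma)$ is a functor $E:MV\to V$, $E(X_1,\dots,X_n)=E_iX_i$, unary part $E_1$, with natural families $u_X:X\to E_1X$, $\sigma:E_iE_jX_{ij}\to E_{ij}X_{ij}$ (target: $E$ of the concatenated sequence) with $\sigma\circ u_{E_iX_i}=1$, $\sigma\circ E_i(u_{X_i})=1$ and the two composites $E_iE_jE_kX_{ijk}\to E_{ijk}X_{ijk}$ equal. Its unary part is a monad $(E_1,u,\sigma)$. It is distributive when each $V^n\to V$ preserves coproducts in each variable. A multitensor map $\theta:(E,u,\sigma)\to(F,v,\rho)$ is a natural transformation $\theta:E\to F$ with $\theta u=v$ and $\theta\sigma=\rho\circ(\theta\theta)$, where $\theta\theta:E_iE_j\to F_iF_j$. $TE$ denotes the functor $(X_i)_i\mapsto T(E_iX_i)$, and in (2) $TE_1$ is the monad given by the unary part of $(TE,u',\sigma')$. $E$-categories. An $E$-category is $X\in\mathcal{G}V$ with maps $\kappa_{x_i}:E_iX(x_{i-1},x_i)\to X(x_0,x_n)$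 for all $n\in\mathbb{N}$ and sequences $(x_0,\dots,x_n)$ in $X_0$, such that $\kappa\circ u_{X(x_0,x_1)}=1$ and $\kappa\circ\sigma=\kappa\circ E_i(\kappa)$ on $E_iE_jX(x_{ij-1},x_{ij})$ for doubly nested composable sequences. $E$-functors are $V$-graph maps compatible with the $\kappa$'s. $U^E:E\text{-Cat}\to\mathcal{G}V$ is the forgetful functor. A lifting of a monad $(S,\eta,\mu)$ on $\mathcal{G}V$ to $E\text{-Cat}$ is a monad $(S',\eta',\mu')$ on $E\text{-Cat}$ with $SU^E=U^ES'$, $\eta U^E=U^E\eta'$, $\mu U^E=U^E\mu'$. $(E\text{-Cat})^{T'}$ is the category of $T'$-algebras. Monoidal monads. $(T,\eta,\mu)$ with maps $\tau_{X_i}:E_iTX_i\to TE_iX_i$ natural in the $X_i$ is a monoidal monad on $(V,E)$ (a monad in the 2-category of lax monoidal categories, lax monoidal functors and monoidal natural transformations) when: $\tau\circ u_{TX}=T(u_X)$; $\tau\circ\sigma_{TX_{ij}}=T(\sigma)\circ\tau_{E_jX_{ij}}\circ E_i(\tau)$ as maps $E_iE_jTX_{ij}\to TE_{ij}X_{ij}$; $\tau\circ E_i(\eta_{X_i})=\eta_{E_iX_i}$; $\tau\circ E_i(\mu_{X_i})=\mu\circ T(\tau)\circ\tau_{TX_i}$. $\Gamma E$ (for $V$ with coproducts, $E$ distributive) is the monad on $\mathcal{G}V$ with $\Gamma E(X)_0=X_0$ and $\Gamma E(X)(a,b)=\coprod_{a=x_0,\dots,x_n=b}E_iX(x_{i-1},x_i)$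 (over all finite sequences of objects from $a$ to $b$), unit and multiplication the identity on objects and induced on homs by $u$ and $\sigma$ on summands (using distributivity to write $(\Gamma E)^2(X)(a,b)$ as the coproduct of the $E_iE_jX(x_{ij-1},x_{ij})$). A monad distributive law of a monad $R$ over a monad $S$ on the same category is a natural transformation $\lambda:SR\to RS$ with $\lambda\circ\eta^SR=R\eta^S$, $\lambda\circ S\eta^R=\eta^RS$, $\lambda\circ\mu^SR=R\mu^S\circ\lambda S\circ S\lambda$, $\lambda\circ S\mu^R=\mu^RS\circ R\lambda\circ\lambda R$. *)

theory Defs
  imports "HOL-Library.FuncSet"
begin

section \<open>Categories, functors, natural transformations\<close>

record ('o, 'm) cat =
  Ob :: "'o set"
  Ar :: "'m set"
  Dom :: "'m \<Rightarrow> 'o"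
  Cod :: "'m \<Rightarrow> 'o"
  Id :: "'o \<Rightarrow> 'm"
  Comp :: "'m \<Rightarrow> 'm \<Rightarrow> 'm"  (infixr "\<cdot>\<index>" 55)

definition hom :: "('o, 'm) cat \<Rightarrow> 'o \<Rightarrow> 'o \<Rightarrow> 'm set" where
  "hom C a b = {f \<in> Ar C. Dom C f = a \<and> Cod C f = b}"

locale category =
  fixes C :: "('o, 'm) cat"
  assumes dom_ob: "f \<in> Ar C \<Longrightarrow> Dom C f \<in> Ob C"
    and cod_ob: "f \<in> Ar C \<Longrightarrow> Cod C f \<in> Ob C"
    and id_hom: "a \<in> Ob C \<Longrightarrow> Id C a \<in> hom C a a"
    and comp_hom: "f \<in> hom C a b \<Longrightarrow> g \<in> hom C b c \<Longrightarrow> g \<cdot>\<^bsub>C\<^esub> f \<in> hom C a c"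
    and comp_id_left: "f \<in> hom C a b \<Longrightarrow> Id C b \<cdot>\<^bsub>C\<^esub> f = f"
    and comp_id_right: "f \<in> hom C a b \<Longrightarrow> f \<cdot>\<^bsub>C\<^esub> Id C a = f"
    and comp_assoc: "f \<in> hom C a b \<Longrightarrow> g \<in> hom C b c \<Longrightarrow> h \<in> hom C c d \<Longrightarrow>
      (h \<cdot>\<^bsub>C\<^esub> g) \<cdot>\<^bsub>C\<^esub> f = h \<cdot>\<^bsub>C\<^esub> (g \<cdot>\<^bsub>C\<^esub> f)"

record ('o, 'm, 'p, 'n) func =
  fobj :: "'o \<Rightarrow> 'p"
  farr :: "'m \<Rightarrow> 'n"

locale cat_functor = A: category A + B: category B
  for A :: "('o, 'm) cat" and B :: "('p, 'n) cat" +
  fixes F :: "('o, 'm, 'p, 'n, 'z) func_scheme"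
  assumes fobj_ob: "a \<in> Ob A \<Longrightarrow> fobj F a \<in> Ob B"
    and farr_hom: "f \<in> hom A a b \<Longrightarrow> farr F f \<in> hom B (fobj F a) (fobj F b)"
    and farr_id: "a \<in> Ob A \<Longrightarrow> farr F (Id A a) = Id B (fobj F a)"
    and farr_comp: "f \<in> hom A a b \<Longrightarrow> g \<in> hom A b c \<Longrightarrow>
      farr F (g \<cdot>\<^bsub>A\<^esub> f) = farr F g \<cdot>\<^bsub>B\<^esub> farr F f"

definition id_func :: "('o, 'm, 'o, 'm) func" where
  "id_func = \<lparr>fobj = (\<lambda>a. a), farr = (\<lambda>f. f)\<rparr>"

definition comp_func :: "('p, 'n, 'q, 'k, 'y) func_scheme \<Rightarrow> ('o, 'm, 'p, 'n, 'z) func_scheme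
    \<Rightarrow> ('o, 'm, 'q, 'k) func"  (infixr "\<circ>\<^sub>F" 55) where
  "G \<circ>\<^sub>F F = \<lparr>fobj = fobj G \<circ> fobj F, farr = farr G \<circ> farr F\<rparr>"

text \<open>Functors are total HOL functions of which only the values on the source category matter;
  this is equality of functors on that category.\<close>

definition func_eq :: "('o, 'm) cat \<Rightarrow> ('o, 'm, 'p, 'n, 'y) func_scheme
    \<Rightarrow> ('o, 'm, 'p, 'n, 'z) func_scheme \<Rightarrow> bool" where
  "func_eq A F G \<longleftrightarrow> (\<forall>a\<in>Ob A. fobj F a = fobj G a) \<and> (\<forall>f\<in>Ar A. farr F f = farr G f)"

definition cat_iso :: "('o, 'm) cat \<Rightarrow> ('p, 'n) cat \<Rightarrow> ('o, 'm, 'p, 'n) func \<Rightarrow> bool" where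
  "cat_iso A B F \<longleftrightarrow> cat_functor A B F \<and>
    (\<exists>G :: ('p, 'n, 'o, 'm) func. cat_functor B A G \<and>
       func_eq A (G \<circ>\<^sub>F F) id_func \<and> func_eq B (F \<circ>\<^sub>F G) id_func)"

locale nat_trans = F: cat_functor A B F + G: cat_functor A B G
  for A :: "('o, 'm) cat" and B :: "('p, 'n) cat"
    and F :: "('o, 'm, 'p, 'n, 'y) func_scheme" and G :: "('o, 'm, 'p, 'n, 'z) func_scheme" +
  fixes t :: "'o \<Rightarrow> 'n"
  assumes component: "a \<in> Ob A \<Longrightarrow> t a \<in> hom B (fobj F a) (fobj G a)"
    and natural: "f \<in> hom A a b \<Longrightarrow> t b \<cdot>\<^bsub>B\<^esub> farr F f = farr G f \<cdot>\<^bsub>B\<^esub> t a"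


section \<open>Monads\<close>

record ('o, 'm) monad_struct = "('o, 'm, 'o, 'm) func" +
  m_unit :: "'o \<Rightarrow> 'm"
  m_mult :: "'o \<Rightarrow> 'm"

locale monad = category C for C :: "('o, 'm) cat" +
  fixes T :: "('o, 'm) monad_struct"
  assumes unit_nat: "nat_trans C C id_func T (m_unit T)"
    and mult_nat: "nat_trans C C (T \<circ>\<^sub>F T) T (m_mult T)"
    and unit_left: "a \<in> Ob C \<Longrightarrow> m_mult T a \<cdot>\<^bsub>C\<^esub> m_unit T (fobj T a) = Id C (fobj T a)"
    and unit_right: "a \<in> Ob C \<Longrightarrow> m_mult T a \<cdot>\<^bsub>C\<^esub> farr T (m_unit T a) = Id C (fobj T a)"
    and mult_assoc: "a \<in> Ob C \<Longrightarrow>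
      m_mult T a \<cdot>\<^bsub>C\<^esub> m_mult T (fobj T a) = m_mult T a \<cdot>\<^bsub>C\<^esub> farr T (m_mult T a)"

definition monad_map :: "('o, 'm) cat \<Rightarrow> ('o, 'm) monad_struct \<Rightarrow> ('o, 'm) monad_struct
    \<Rightarrow> ('o \<Rightarrow> 'm) \<Rightarrow> bool" where
  "monad_map C S R \<phi> \<longleftrightarrow> nat_trans C C S R \<phi> \<and>
    (\<forall>a\<in>Ob C. \<phi> a \<cdot>\<^bsub>C\<^esub> m_unit S a = m_unit R a) \<and>
    (\<forall>a\<in>Ob C. \<phi> a \<cdot>\<^bsub>C\<^esub> m_mult S a
       = m_mult R a \<cdot>\<^bsub>C\<^esub> \<phi> (fobj R a) \<cdot>\<^bsub>C\<^esub> farr S (\<phi> a))"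

text \<open>A distributive law of the monad \<open>R\<close> over the monad \<open>S\<close>.\<close>

definition distributive_law :: "('o, 'm) cat \<Rightarrow> ('o, 'm) monad_struct \<Rightarrow> ('o, 'm) monad_struct
    \<Rightarrow> ('o \<Rightarrow> 'm) \<Rightarrow> bool" where
  "distributive_law C R S l \<longleftrightarrow> nat_trans C C (S \<circ>\<^sub>F R) (R \<circ>\<^sub>F S) l \<and>
    (\<forall>a\<in>Ob C. l a \<cdot>\<^bsub>C\<^esub> m_unit S (fobj R a) = farr R (m_unit S a)) \<and>
    (\<forall>a\<in>Ob C. l a \<cdot>\<^bsub>C\<^esub> farr S (m_unit R a) = m_unit R (fobj S a)) \<and>
    (\<forall>a\<in>Ob C. l a \<cdot>\<^bsub>C\<^esub> m_mult S (fobj R a)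
       = farr R (m_mult S a) \<cdot>\<^bsub>C\<^esub> l (fobj S a) \<cdot>\<^bsub>C\<^esub> farr S (l a)) \<and>
    (\<forall>a\<in>Ob C. l a \<cdot>\<^bsub>C\<^esub> farr S (m_mult R a)
       = m_mult R (fobj S a) \<cdot>\<^bsub>C\<^esub> farr R (l a) \<cdot>\<^bsub>C\<^esub> l (fobj R a))"

text \<open>The category whose objects are the elements of \<open>S\<close>, regarded as objects of \<open>C\<close> with extra
  structure via \<open>U\<close>, and whose arrows are the arrows of \<open>C\<close> satisfying the predicate \<open>P\<close>. An arrow
  records its structured source and target.\<close>

definition struct_cat :: "('o, 'm) cat \<Rightarrow> 's set \<Rightarrow> ('s \<Rightarrow> 'o) \<Rightarrow> ('s \<Rightarrow> 's \<Rightarrow> 'm \<Rightarrow> bool)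
    \<Rightarrow> ('s, 's \<times> 's \<times> 'm) cat" where
  "struct_cat C S U P =
    \<lparr>Ob = S,
     Ar = {(s, t, f). s \<in> S \<and> t \<in> S \<and> f \<in> hom C (U s) (U t) \<and> P s t f},
     Dom = (\<lambda>(s, t, f). s),
     Cod = (\<lambda>(s, t, f). t),
     Id = (\<lambda>s. (s, s, Id C (U s))),
     Comp = (\<lambda>(s', t', g) (s, t, f). (s, t', g \<cdot>\<^bsub>C\<^esub> f))\<rparr>"

definition forget_func :: "('s \<Rightarrow> 'o) \<Rightarrow> ('s, 's \<times> 's \<times> 'm, 'o, 'm) func" where
  "forget_func U = \<lparr>fobj = U, farr = (\<lambda>(s, t, f). f)\<rparr>"

definition monad_algebras :: "('o, 'm) cat \<Rightarrow> ('o, 'm) monad_struct \<Rightarrow> ('o \<times> 'm) set" where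
  "monad_algebras C T = {(A, x). A \<in> Ob C \<and> x \<in> hom C (fobj T A) A \<and>
     x \<cdot>\<^bsub>C\<^esub> m_unit T A = Id C A \<and> x \<cdot>\<^bsub>C\<^esub> m_mult T A = x \<cdot>\<^bsub>C\<^esub> farr T x}"

definition alg_cat :: "('o, 'm) cat \<Rightarrow> ('o, 'm) monad_struct
    \<Rightarrow> ('o \<times> 'm, ('o \<times> 'm) \<times> ('o \<times> 'm) \<times> 'm) cat" where
  "alg_cat C T = struct_cat C (monad_algebras C T) fst
     (\<lambda>(A, x) (B, y) f. f \<cdot>\<^bsub>C\<^esub> x = y \<cdot>\<^bsub>C\<^esub> farr T f)"

definition alg_forget :: "('o \<times> 'm, ('o \<times> 'm) \<times> ('o \<times> 'm) \<times> 'm, 'o, 'm) func" where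
  "alg_forget = forget_func fst"


section \<open>Multitensors\<close>

text \<open>The category \<open>MV\<close> of finite sequences; there are no arrows between sequences of different
  lengths.\<close>

definition seq_cat :: "('o, 'm) cat \<Rightarrow> ('o list, 'm list) cat" where
  "seq_cat V = \<lparr>Ob = lists (Ob V), Ar = lists (Ar V), Dom = map (Dom V), Cod = map (Cod V),
     Id = map (Id V), Comp = map2 (Comp V)\<rparr>"

definition seq_func :: "('o, 'm, 'p, 'n, 'z) func_scheme \<Rightarrow> ('o list, 'm list, 'p list, 'n list) func"
  where "seq_func F = \<lparr>fobj = map (fobj F), farr = map (farr F)\<rparr>"

definition concat_func :: "('o list list, 'm list list, 'o list, 'm list) func" where
  "concat_func = \<lparr>fobj = concat, farr = concat\<rparr>"

definition singleton_func :: "('o, 'm, 'o list, 'm list) func" where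
  "singleton_func = \<lparr>fobj = (\<lambda>X. [X]), farr = (\<lambda>f. [f])\<rparr>"

record ('o, 'm) multitensor_struct = "('o list, 'm list, 'o, 'm) func" +
  mt_unit :: "'o \<Rightarrow> 'm"
  mt_subst :: "'o list list \<Rightarrow> 'm"

locale multitensor = category V for V :: "('o, 'm) cat" +
  fixes E :: "('o, 'm) multitensor_struct"
  assumes functor_E: "cat_functor (seq_cat V) V E"
    and unit_nat: "nat_trans V V id_func (E \<circ>\<^sub>F singleton_func) (mt_unit E)"
    and subst_nat:
      "nat_trans (seq_cat (seq_cat V)) V (E \<circ>\<^sub>F seq_func E) (E \<circ>\<^sub>F concat_func) (mt_subst E)"
    and unit_outer: "Xs \<in> lists (Ob V) \<Longrightarrow>
      mt_subst E [Xs] \<cdot>\<^bsub>V\<^esub> mt_unit E (fobj E Xs) = Id V (fobj E Xs)"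
    and unit_inner: "Xs \<in> lists (Ob V) \<Longrightarrow>
      mt_subst E (map (\<lambda>X. [X]) Xs) \<cdot>\<^bsub>V\<^esub> farr E (map (mt_unit E) Xs) = Id V (fobj E Xs)"
    and subst_assoc: "Xsss \<in> lists (lists (lists (Ob V))) \<Longrightarrow>
      mt_subst E (concat Xsss) \<cdot>\<^bsub>V\<^esub> mt_subst E (map (map (fobj E)) Xsss)
      = mt_subst E (map concat Xsss) \<cdot>\<^bsub>V\<^esub> farr E (map (mt_subst E) Xsss)"

definition unary_monad :: "('o, 'm) multitensor_struct \<Rightarrow> ('o, 'm) monad_struct" where
  "unary_monad E = \<lparr>fobj = (\<lambda>X. fobj E [X]), farr = (\<lambda>f. farr E [f]),
     m_unit = mt_unit E, m_mult = (\<lambda>X. mt_subst E [[X]])\<rparr>"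

definition multitensor_map :: "('o, 'm) cat \<Rightarrow> ('o, 'm) multitensor_struct
    \<Rightarrow> ('o, 'm) multitensor_struct \<Rightarrow> ('o list \<Rightarrow> 'm) \<Rightarrow> bool" where
  "multitensor_map V E F \<theta> \<longleftrightarrow> nat_trans (seq_cat V) V E F \<theta> \<and>
    (\<forall>X\<in>Ob V. \<theta> [X] \<cdot>\<^bsub>V\<^esub> mt_unit E X = mt_unit F X) \<and>
    (\<forall>Xss\<in>lists (lists (Ob V)).
       \<theta> (concat Xss) \<cdot>\<^bsub>V\<^esub> mt_subst E Xss
       = mt_subst F Xss \<cdot>\<^bsub>V\<^esub> \<theta> (map (fobj F) Xss) \<cdot>\<^bsub>V\<^esub> farr E (map \<theta> Xss))"


section \<open>Monoidal monads and composite multitensors\<close>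

text \<open>In this and the later sets of data, the families are required to be \<open>extensional\<close>, so that
  each datum is represented by exactly one HOL function.\<close>

definition monoidal_monad_data :: "('o, 'm) cat \<Rightarrow> ('o, 'm) multitensor_struct
    \<Rightarrow> ('o, 'm) monad_struct \<Rightarrow> ('o list \<Rightarrow> 'm) set" where
  "monoidal_monad_data V E T = {\<tau> \<in> extensional (lists (Ob V)).
    nat_trans (seq_cat V) V (E \<circ>\<^sub>F seq_func T) (T \<circ>\<^sub>F E) \<tau> \<and>
    (\<forall>X\<in>Ob V. \<tau> [X] \<cdot>\<^bsub>V\<^esub> mt_unit E (fobj T X) = farr T (mt_unit E X)) \<and>
    (\<forall>Xss\<in>lists (lists (Ob V)).
       \<tau> (concat Xss) \<cdot>\<^bsub>V\<^esub> mt_subst E (map (map (fobj T)) Xss)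
       = farr T (mt_subst E Xss) \<cdot>\<^bsub>V\<^esub> \<tau> (map (fobj E) Xss) \<cdot>\<^bsub>V\<^esub> farr E (map \<tau> Xss)) \<and>
    (\<forall>Xs\<in>lists (Ob V). \<tau> Xs \<cdot>\<^bsub>V\<^esub> farr E (map (m_unit T) Xs) = m_unit T (fobj E Xs)) \<and>
    (\<forall>Xs\<in>lists (Ob V). \<tau> Xs \<cdot>\<^bsub>V\<^esub> farr E (map (m_mult T) Xs)
       = m_mult T (fobj E Xs) \<cdot>\<^bsub>V\<^esub> farr T (\<tau> Xs) \<cdot>\<^bsub>V\<^esub> \<tau> (map (fobj T) Xs))}"

definition composite_struct :: "('o, 'm) cat \<Rightarrow> ('o, 'm) multitensor_struct
    \<Rightarrow> ('o, 'm) monad_struct \<Rightarrow> ('o list list \<Rightarrow> 'm) \<Rightarrow> ('o, 'm) multitensor_struct" where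
  "composite_struct V E T \<sigma>' =
    \<lparr>fobj = fobj T \<circ> fobj E, farr = farr T \<circ> farr E,
     mt_unit = (\<lambda>X. m_unit T (fobj E [X]) \<cdot>\<^bsub>V\<^esub> mt_unit E X), mt_subst = \<sigma>'\<rparr>"

text \<open>In the last clause, \<open>Tu\<eta>E\<^sub>i\<close> is the horizontal composite of \<open>Tu : T \<rightarrow> TE\<^sub>1\<close> and
  \<open>\<eta>E : E \<rightarrow> TE\<close>.\<close>

definition composite_data :: "('o, 'm) cat \<Rightarrow> ('o, 'm) multitensor_struct
    \<Rightarrow> ('o, 'm) monad_struct \<Rightarrow> ('o list list \<Rightarrow> 'm) set" where
  "composite_data V E T = {\<sigma>' \<in> extensional (lists (lists (Ob V))).
    (let TE = composite_struct V E T \<sigma>' in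
      multitensor V TE \<and>
      multitensor_map V E TE (\<lambda>Xs. m_unit T (fobj E Xs)) \<and>
      monad_map V T (unary_monad TE) (\<lambda>X. farr T (mt_unit E X)) \<and>
      (\<forall>Xs\<in>lists (Ob V).
         \<sigma>' [Xs] \<cdot>\<^bsub>V\<^esub> farr T (mt_unit E (fobj T (fobj E Xs)))
           \<cdot>\<^bsub>V\<^esub> farr T (m_unit T (fobj E Xs))
         = Id V (fobj T (fobj E Xs))))}"

text \<open>The passage from \<open>\<tau>\<close> to \<open>\<sigma>'\<close>:
  \<open>TE\<^sub>iTE\<^sub>j \<rightarrow> TTE\<^sub>iE\<^sub>j \<rightarrow> TE\<^sub>iE\<^sub>j \<rightarrow> TE\<^sub>i\<^sub>j\<close>.\<close>

definition subst_of :: "('o, 'm) cat \<Rightarrow> ('o, 'm) multitensor_struct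
    \<Rightarrow> ('o, 'm) monad_struct \<Rightarrow> ('o list \<Rightarrow> 'm) \<Rightarrow> 'o list list \<Rightarrow> 'm" where
  "subst_of V E T \<tau> = (\<lambda>Xss\<in>lists (lists (Ob V)).
     farr T (mt_subst E Xss) \<cdot>\<^bsub>V\<^esub> m_mult T (fobj E (map (fobj E) Xss))
       \<cdot>\<^bsub>V\<^esub> farr T (\<tau> (map (fobj E) Xss)))"


section \<open>Small sets and coproducts\<close>

text \<open>Vertex sets and index sets of coproducts range over the small subsets of a type \<open>'a\<close>.
  Smallness is a parameter: the conditions below hold for the sets belonging to a Grothendieck
  universe, and for the predicate that is true of every subset of an infinite type.\<close>

definition small_universe :: "('a set \<Rightarrow> bool) \<Rightarrow> bool" where
  "small_universe small \<longleftrightarrow>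
    (\<exists>A. small A \<and> infinite A) \<and>
    (\<forall>A B f. small A \<and> B \<subseteq> f ` A \<longrightarrow> small B) \<and>
    (\<forall>I F. small I \<and> (\<forall>i\<in>I. small (F i)) \<longrightarrow> small (\<Union>i\<in>I. F i))"

definition is_coproduct :: "('o, 'm) cat \<Rightarrow> 'i set \<Rightarrow> ('i \<Rightarrow> 'o) \<Rightarrow> 'o \<Rightarrow> ('i \<Rightarrow> 'm) \<Rightarrow> bool" where
  "is_coproduct C I X c \<iota> \<longleftrightarrow>
    c \<in> Ob C \<and> (\<forall>i\<in>I. X i \<in> Ob C \<and> \<iota> i \<in> hom C (X i) c) \<and>
    (\<forall>d\<in>Ob C. \<forall>g. (\<forall>i\<in>I. g i \<in> hom C (X i) d) \<longrightarrow>
       (\<exists>!h. h \<in> hom C c d \<and> (\<forall>i\<in>I. h \<cdot>\<^bsub>C\<^esub> \<iota> i = g i)))"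

definition has_coproducts :: "('a set \<Rightarrow> bool) \<Rightarrow> ('o, 'm) cat \<Rightarrow> bool" where
  "has_coproducts small C \<longleftrightarrow>
    (\<forall>(I :: 'a set) X. small I \<and> (\<forall>i\<in>I. X i \<in> Ob C) \<longrightarrow> (\<exists>c \<iota>. is_coproduct C I X c \<iota>))"

definition distributive :: "('a set \<Rightarrow> bool) \<Rightarrow> ('o, 'm) cat \<Rightarrow> ('o, 'm) multitensor_struct \<Rightarrow> bool"
  where
  "distributive small V E \<longleftrightarrow>
    (\<forall>(I :: 'a set) X c \<iota>. \<forall>Ys\<in>lists (Ob V). \<forall>Zs\<in>lists (Ob V).
       small I \<and> is_coproduct V I X c \<iota> \<longrightarrow>
       is_coproduct V I (\<lambda>i. fobj E (Ys @ [X i] @ Zs)) (fobj E (Ys @ [c] @ Zs))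
         (\<lambda>i. farr E (map (Id V) Ys @ [\<iota> i] @ map (Id V) Zs)))"

definition coprod :: "('o, 'm) cat \<Rightarrow> 'i set \<Rightarrow> ('i \<Rightarrow> 'o) \<Rightarrow> 'o \<times> ('i \<Rightarrow> 'm)" where
  "coprod C I X = (SOME p. is_coproduct C I X (fst p) (snd p))"

definition copair :: "('o, 'm) cat \<Rightarrow> 'i set \<Rightarrow> ('i \<Rightarrow> 'o) \<Rightarrow> 'o \<Rightarrow> ('i \<Rightarrow> 'm) \<Rightarrow> 'm" where
  "copair C I X d g = (THE h. h \<in> hom C (fst (coprod C I X)) d \<and>
     (\<forall>i\<in>I. h \<cdot>\<^bsub>C\<^esub> snd (coprod C I X) i = g i))"


section \<open>Enriched graphs\<close>

record ('a, 'o) vgraph =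
  verts :: "'a set"
  edge :: "'a \<times> 'a \<Rightarrow> 'o"

record ('a, 'o, 'm) vmap =
  vsrc :: "('a, 'o) vgraph"
  vtgt :: "('a, 'o) vgraph"
  vfun :: "'a \<Rightarrow> 'a"
  vmor :: "'a \<times> 'a \<Rightarrow> 'm"

abbreviation vpairs :: "('a, 'o) vgraph \<Rightarrow> ('a \<times> 'a) set" where
  "vpairs X \<equiv> verts X \<times> verts X"

definition vgraphs :: "('a set \<Rightarrow> bool) \<Rightarrow> ('o, 'm) cat \<Rightarrow> ('a, 'o) vgraph set" where
  "vgraphs small V = {X. small (verts X) \<and> edge X \<in> vpairs X \<rightarrow>\<^sub>E Ob V}"

definition GV :: "('a set \<Rightarrow> bool) \<Rightarrow> ('o, 'm) cat \<Rightarrow> (('a, 'o) vgraph, ('a, 'o, 'm) vmap) cat" where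
  "GV small V =
    \<lparr>Ob = vgraphs small V,
     Ar = {f. vsrc f \<in> vgraphs small V \<and> vtgt f \<in> vgraphs small V \<and>
       vfun f \<in> verts (vsrc f) \<rightarrow>\<^sub>E verts (vtgt f) \<and>
       vmor f \<in> (\<Pi>\<^sub>E p\<in>vpairs (vsrc f).
         hom V (edge (vsrc f) p) (edge (vtgt f) (map_prod (vfun f) (vfun f) p)))},
     Dom = vsrc,
     Cod = vtgt,
     Id = (\<lambda>X. \<lparr>vsrc = X, vtgt = X, vfun = (\<lambda>a\<in>verts X. a),
       vmor = (\<lambda>p\<in>vpairs X. Id V (edge X p))\<rparr>),
     Comp = (\<lambda>g f. \<lparr>vsrc = vsrc f, vtgt = vtgt g,
       vfun = (\<lambda>a\<in>verts (vsrc f). vfun g (vfun f a)),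
       vmor = (\<lambda>p\<in>vpairs (vsrc f). vmor g (map_prod (vfun f) (vfun f) p) \<cdot>\<^bsub>V\<^esub> vmor f p)\<rparr>)\<rparr>"

definition G_obj :: "('o, 'm, 'p, 'n, 'z) func_scheme \<Rightarrow> ('a, 'o) vgraph \<Rightarrow> ('a, 'p) vgraph" where
  "G_obj F X = \<lparr>verts = verts X, edge = (\<lambda>p\<in>vpairs X. fobj F (edge X p))\<rparr>"

definition G_func :: "('o, 'm, 'p, 'n, 'z) func_scheme
    \<Rightarrow> (('a, 'o) vgraph, ('a, 'o, 'm) vmap, ('a, 'p) vgraph, ('a, 'p, 'n) vmap) func" where
  "G_func F = \<lparr>fobj = G_obj F,
     farr = (\<lambda>f. \<lparr>vsrc = G_obj F (vsrc f), vtgt = G_obj F (vtgt f), vfun = vfun f,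
       vmor = (\<lambda>p\<in>vpairs (vsrc f). farr F (vmor f p))\<rparr>)\<rparr>"

definition G_trans :: "('o, 'm, 'p, 'n, 'y) func_scheme \<Rightarrow> ('o, 'm, 'p, 'n, 'z) func_scheme
    \<Rightarrow> ('o \<Rightarrow> 'n) \<Rightarrow> ('a, 'o) vgraph \<Rightarrow> ('a, 'p, 'n) vmap" where
  "G_trans F G t X = \<lparr>vsrc = G_obj F X, vtgt = G_obj G X, vfun = (\<lambda>a\<in>verts X. a),
     vmor = (\<lambda>p\<in>vpairs X. t (edge X p))\<rparr>"

definition G_monad :: "('o, 'm) monad_struct
    \<Rightarrow> (('a, 'o) vgraph, ('a, 'o, 'm) vmap) monad_struct" where
  "G_monad T = \<lparr>fobj = fobj (G_func T), farr = farr (G_func T),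
     m_unit = G_trans (id_func :: ('o, 'm, 'o, 'm) func) T (m_unit T),
     m_mult = G_trans (T \<circ>\<^sub>F T) T (m_mult T)\<rparr>"

text \<open>A sequence of vertices \<open>x\<^sub>0, \<dots>, x\<^sub>n\<close> is a nonempty list of length \<open>n + 1\<close>;
  \<open>walk_edges\<close> yields the sequence of the \<open>n\<close> objects \<open>X(x\<^sub>i\<^sub>-\<^sub>1, x\<^sub>i)\<close>, which is
  empty for \<open>n = 0\<close>.\<close>

definition walks :: "('a, 'o) vgraph \<Rightarrow> 'a list set" where
  "walks X = {xs. xs \<noteq> [] \<and> set xs \<subseteq> verts X}"

definition walks_between :: "('a, 'o) vgraph \<Rightarrow> 'a \<times> 'a \<Rightarrow> 'a list set" where
  "walks_between X p = {xs \<in> walks X. (hd xs, last xs) = p}"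

definition steps :: "'a list \<Rightarrow> ('a \<times> 'a) list" where
  "steps xs = zip xs (tl xs)"

definition walk_edges :: "('a, 'o) vgraph \<Rightarrow> 'a list \<Rightarrow> 'o list" where
  "walk_edges X xs = map (edge X) (steps xs)"

text \<open>A doubly nested composable sequence: a walk \<open>xs\<close>, and for each of its steps a walk between
  the two ends of that step. Joining identifies the end of each of these walks with the start of
  the next one.\<close>

definition nested_walk :: "('a, 'o) vgraph \<Rightarrow> 'a list \<Rightarrow> 'a list list \<Rightarrow> bool" where
  "nested_walk X xs yss \<longleftrightarrow> xs \<in> walks X \<and> list_all2 (\<lambda>ys p. ys \<in> walks_between X p) yss (steps xs)"

definition join_walk :: "'a list \<Rightarrow> 'a list list \<Rightarrow> 'a list" where
  "join_walk xs yss = hd xs # concat (map tl yss)"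


section \<open>\<open>E\<close>-categories\<close>

definition ecats :: "('a set \<Rightarrow> bool) \<Rightarrow> ('o, 'm) cat \<Rightarrow> ('o, 'm) multitensor_struct
    \<Rightarrow> (('a, 'o) vgraph \<times> ('a list \<Rightarrow> 'm)) set" where
  "ecats small V E = {(X, \<kappa>). X \<in> vgraphs small V \<and>
    \<kappa> \<in> (\<Pi>\<^sub>E xs\<in>walks X. hom V (fobj E (walk_edges X xs)) (edge X (hd xs, last xs))) \<and>
    (\<forall>a\<in>verts X. \<forall>b\<in>verts X.
       \<kappa> [a, b] \<cdot>\<^bsub>V\<^esub> mt_unit E (edge X (a, b)) = Id V (edge X (a, b))) \<and>
    (\<forall>xs yss. nested_walk X xs yss \<longrightarrow>
       \<kappa> (join_walk xs yss) \<cdot>\<^bsub>V\<^esub> mt_subst E (map (walk_edges X) yss)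
       = \<kappa> xs \<cdot>\<^bsub>V\<^esub> farr E (map \<kappa> yss))}"

definition ECat :: "('a set \<Rightarrow> bool) \<Rightarrow> ('o, 'm) cat \<Rightarrow> ('o, 'm) multitensor_struct
    \<Rightarrow> (('a, 'o) vgraph \<times> ('a list \<Rightarrow> 'm),
        (('a, 'o) vgraph \<times> ('a list \<Rightarrow> 'm)) \<times> (('a, 'o) vgraph \<times> ('a list \<Rightarrow> 'm)) \<times> ('a, 'o, 'm) vmap) cat"
  where
  "ECat small V E = struct_cat (GV small V) (ecats small V E) fst
    (\<lambda>(X, \<kappa>) (Y, \<kappa>') f. \<forall>xs\<in>walks X.
       vmor f (hd xs, last xs) \<cdot>\<^bsub>V\<^esub> \<kappa> xs
       = \<kappa>' (map (vfun f) xs) \<cdot>\<^bsub>V\<^esub> farr E (map (vmor f) (steps xs)))"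

definition ecat_forget :: "(('a, 'o) vgraph \<times> ('a list \<Rightarrow> 'm),
    (('a, 'o) vgraph \<times> ('a list \<Rightarrow> 'm)) \<times> (('a, 'o) vgraph \<times> ('a list \<Rightarrow> 'm)) \<times> ('a, 'o, 'm) vmap,
    ('a, 'o) vgraph, ('a, 'o, 'm) vmap) func" where
  "ecat_forget = forget_func fst"

definition liftings :: "('a set \<Rightarrow> bool) \<Rightarrow> ('o, 'm) cat \<Rightarrow> ('o, 'm) multitensor_struct
    \<Rightarrow> (('a, 'o) vgraph, ('a, 'o, 'm) vmap) monad_struct
    \<Rightarrow> (('a, 'o) vgraph \<times> ('a list \<Rightarrow> 'm),
        (('a, 'o) vgraph \<times> ('a list \<Rightarrow> 'm)) \<times> (('a, 'o) vgraph \<times> ('a list \<Rightarrow> 'm)) \<times> ('a, 'o, 'm) vmap)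
       monad_struct set" where
  "liftings small V E S = {S'.
    monad (ECat small V E) S' \<and>
    fobj S' \<in> extensional (Ob (ECat small V E)) \<and>
    farr S' \<in> extensional (Ar (ECat small V E)) \<and>
    m_unit S' \<in> extensional (Ob (ECat small V E)) \<and>
    m_mult S' \<in> extensional (Ob (ECat small V E)) \<and>
    func_eq (ECat small V E) (S \<circ>\<^sub>F ecat_forget) (ecat_forget \<circ>\<^sub>F S') \<and>
    (\<forall>A\<in>Ob (ECat small V E). m_unit S (fobj ecat_forget A) = farr ecat_forget (m_unit S' A)) \<and>
    (\<forall>A\<in>Ob (ECat small V E). m_mult S (fobj ecat_forget A) = farr ecat_forget (m_mult S' A))}"

text \<open>The passage from \<open>\<tau>\<close> to a lifting: \<open>T' (X, \<kappa>)\<close> is \<open>\<G>T X\<close> with the structure maps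
  \<open>E\<^sub>i T X(x\<^sub>i\<^sub>-\<^sub>1, x\<^sub>i) \<rightarrow> T E\<^sub>i X(x\<^sub>i\<^sub>-\<^sub>1, x\<^sub>i) \<rightarrow> T X(x\<^sub>0, x\<^sub>n)\<close>.\<close>

definition lifting_obj :: "('o, 'm) cat \<Rightarrow> ('o, 'm) monad_struct \<Rightarrow> ('o list \<Rightarrow> 'm)
    \<Rightarrow> ('a, 'o) vgraph \<times> ('a list \<Rightarrow> 'm) \<Rightarrow> ('a, 'o) vgraph \<times> ('a list \<Rightarrow> 'm)" where
  "lifting_obj V T \<tau> = (\<lambda>(X, \<kappa>). (G_obj T X,
     (\<lambda>xs\<in>walks X. farr T (\<kappa> xs) \<cdot>\<^bsub>V\<^esub> \<tau> (walk_edges X xs))))"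

definition lifting_of :: "('a set \<Rightarrow> bool) \<Rightarrow> ('o, 'm) cat \<Rightarrow> ('o, 'm) multitensor_struct
    \<Rightarrow> ('o, 'm) monad_struct \<Rightarrow> ('o list \<Rightarrow> 'm)
    \<Rightarrow> (('a, 'o) vgraph \<times> ('a list \<Rightarrow> 'm),
        (('a, 'o) vgraph \<times> ('a list \<Rightarrow> 'm)) \<times> (('a, 'o) vgraph \<times> ('a list \<Rightarrow> 'm)) \<times> ('a, 'o, 'm) vmap)
       monad_struct" where
  "lifting_of small V E T \<tau> = (let L = lifting_obj V T \<tau> in
    \<lparr>fobj = (\<lambda>A\<in>Ob (ECat small V E). L A),
     farr = (\<lambda>(A, B, f)\<in>Ar (ECat small V E). (L A, L B, farr (G_func T) f)),
     m_unit = (\<lambda>A\<in>Ob (ECat small V E). (A, L A, m_unit (G_monad T) (fst A))),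
     m_mult = (\<lambda>A\<in>Ob (ECat small V E). (L (L A), L A, m_mult (G_monad T) (fst A)))\<rparr>)"


section \<open>The monad \<open>\<Gamma>E\<close>\<close>

definition Gamma_coprod :: "('o, 'm) cat \<Rightarrow> ('o, 'm) multitensor_struct \<Rightarrow> ('a, 'o) vgraph
    \<Rightarrow> 'a \<times> 'a \<Rightarrow> 'o \<times> ('a list \<Rightarrow> 'm)" where
  "Gamma_coprod V E X p = coprod V (walks_between X p) (\<lambda>xs. fobj E (walk_edges X xs))"

definition Gamma_obj :: "('o, 'm) cat \<Rightarrow> ('o, 'm) multitensor_struct \<Rightarrow> ('a, 'o) vgraph
    \<Rightarrow> ('a, 'o) vgraph" where
  "Gamma_obj V E X = \<lparr>verts = verts X, edge = (\<lambda>p\<in>vpairs X. fst (Gamma_coprod V E X p))\<rparr>"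

definition Gamma_in :: "('o, 'm) cat \<Rightarrow> ('o, 'm) multitensor_struct \<Rightarrow> ('a, 'o) vgraph
    \<Rightarrow> 'a list \<Rightarrow> 'm" where
  "Gamma_in V E X xs = snd (Gamma_coprod V E X (hd xs, last xs)) xs"

definition Gamma_copair :: "('o, 'm) cat \<Rightarrow> ('o, 'm) multitensor_struct \<Rightarrow> ('a, 'o) vgraph
    \<Rightarrow> 'a \<times> 'a \<Rightarrow> 'o \<Rightarrow> ('a list \<Rightarrow> 'm) \<Rightarrow> 'm" where
  "Gamma_copair V E X p = copair V (walks_between X p) (\<lambda>xs. fobj E (walk_edges X xs))"

definition Gamma_arr :: "('o, 'm) cat \<Rightarrow> ('o, 'm) multitensor_struct \<Rightarrow> ('a, 'o, 'm) vmap
    \<Rightarrow> ('a, 'o, 'm) vmap" where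
  "Gamma_arr V E f = \<lparr>vsrc = Gamma_obj V E (vsrc f), vtgt = Gamma_obj V E (vtgt f), vfun = vfun f,
     vmor = (\<lambda>p\<in>vpairs (vsrc f). Gamma_copair V E (vsrc f) p
       (edge (Gamma_obj V E (vtgt f)) (map_prod (vfun f) (vfun f) p))
       (\<lambda>xs. Gamma_in V E (vtgt f) (map (vfun f) xs) \<cdot>\<^bsub>V\<^esub> farr E (map (vmor f) (steps xs))))\<rparr>"

definition Gamma_unit :: "('o, 'm) cat \<Rightarrow> ('o, 'm) multitensor_struct \<Rightarrow> ('a, 'o) vgraph
    \<Rightarrow> ('a, 'o, 'm) vmap" where
  "Gamma_unit V E X = \<lparr>vsrc = X, vtgt = Gamma_obj V E X, vfun = (\<lambda>a\<in>verts X. a),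
     vmor = (\<lambda>(a, b)\<in>vpairs X. Gamma_in V E X [a, b] \<cdot>\<^bsub>V\<^esub> mt_unit E (edge X (a, b)))\<rparr>"

text \<open>By distributivity \<open>(\<Gamma>E)\<^sup>2 X (a, b)\<close> is the coproduct of the \<open>E\<^sub>i E\<^sub>j X(x\<^sub>i\<^sub>j\<^sub>-\<^sub>1, x\<^sub>i\<^sub>j)\<close> over the
  nested walks from \<open>a\<close> to \<open>b\<close>, with the injections \<open>in \<circ> E\<^sub>i(in)\<close>.\<close>

definition Gamma_mult :: "('o, 'm) cat \<Rightarrow> ('o, 'm) multitensor_struct \<Rightarrow> ('a, 'o) vgraph
    \<Rightarrow> ('a, 'o, 'm) vmap" where
  "Gamma_mult V E X = \<lparr>vsrc = Gamma_obj V E (Gamma_obj V E X), vtgt = Gamma_obj V E X,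
     vfun = (\<lambda>a\<in>verts X. a),
     vmor = (\<lambda>p\<in>vpairs X. THE h.
       h \<in> hom V (edge (Gamma_obj V E (Gamma_obj V E X)) p) (edge (Gamma_obj V E X) p) \<and>
       (\<forall>xs yss. nested_walk X xs yss \<and> (hd xs, last xs) = p \<longrightarrow>
          h \<cdot>\<^bsub>V\<^esub> Gamma_in V E (Gamma_obj V E X) xs \<cdot>\<^bsub>V\<^esub> farr E (map (Gamma_in V E X) yss)
          = Gamma_in V E X (join_walk xs yss) \<cdot>\<^bsub>V\<^esub> mt_subst E (map (walk_edges X) yss)))\<rparr>"

definition Gamma :: "('o, 'm) cat \<Rightarrow> ('o, 'm) multitensor_struct
    \<Rightarrow> (('a, 'o) vgraph, ('a, 'o, 'm) vmap) monad_struct" where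
  "Gamma V E = \<lparr>fobj = Gamma_obj V E, farr = Gamma_arr V E,
     m_unit = Gamma_unit V E, m_mult = Gamma_mult V E\<rparr>"

definition dist_law_data :: "('a set \<Rightarrow> bool) \<Rightarrow> ('o, 'm) cat \<Rightarrow> ('o, 'm) multitensor_struct
    \<Rightarrow> ('o, 'm) monad_struct \<Rightarrow> (('a, 'o) vgraph \<Rightarrow> ('a, 'o, 'm) vmap) set" where
  "dist_law_data small V E T = {l \<in> extensional (Ob (GV small V)).
    distributive_law (GV small V) (G_monad T) (Gamma V E) l \<and>
    (\<forall>X\<in>Ob (GV small V). \<forall>a\<in>verts X. vfun (l X) a = a)}"

text \<open>The passage from \<open>\<tau>\<close> to \<open>\<lambda>\<close>: on the summand of a walk from \<open>a\<close> to \<open>b\<close>,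
  \<open>E\<^sub>i T X(x\<^sub>i\<^sub>-\<^sub>1, x\<^sub>i) \<rightarrow> T E\<^sub>i X(x\<^sub>i\<^sub>-\<^sub>1, x\<^sub>i) \<rightarrow> T (\<Gamma>E X (a, b))\<close>.\<close>

definition dist_law_of :: "('a set \<Rightarrow> bool) \<Rightarrow> ('o, 'm) cat \<Rightarrow> ('o, 'm) multitensor_struct
    \<Rightarrow> ('o, 'm) monad_struct \<Rightarrow> ('o list \<Rightarrow> 'm) \<Rightarrow> ('a, 'o) vgraph \<Rightarrow> ('a, 'o, 'm) vmap" where
  "dist_law_of small V E T \<tau> = (\<lambda>X\<in>Ob (GV small V).
    \<lparr>vsrc = Gamma_obj V E (G_obj T X), vtgt = G_obj T (Gamma_obj V E X),
     vfun = (\<lambda>a\<in>verts X. a),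
     vmor = (\<lambda>p\<in>vpairs X. Gamma_copair V E (G_obj T X) p (edge (G_obj T (Gamma_obj V E X)) p)
       (\<lambda>xs. farr T (Gamma_in V E X xs) \<cdot>\<^bsub>V\<^esub> \<tau> (walk_edges X xs)))\<rparr>)"

end

theory Submission
  imports Defs
begin

text \<open>
  The substitutions \<open>\<sigma>'\<close> and the maps \<open>\<tau>\<close> determine each other because \<open>\<sigma>'\<close>, precomposed with the units
  of \<open>T\<close> and \<open>E\<close>, returns \<open>\<tau>\<close>, while the unit conditions on \<open>\<sigma>'\<close> split it into
  \<open>T\<sigma> \<circ> \<mu> \<circ> T\<tau>\<close>. A distributive law is a family of maps indexed by all graphs; it is recovered from
  its values at one linear graph for each sequence \<open>(X\<^sub>1, \<dots>, X\<^sub>n)\<close>, with vertices \<open>0, \<dots>, n\<close>, the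
  \<open>X\<^sub>i\<close> as the homs from \<open>i - 1\<close> to \<open>i\<close> and the initial object as the other homs. By distributivity \<open>E\<close> of
  any sequence containing an initial object is initial, so that \<open>\<Gamma>E\<close> of the linear graph has the single
  hom \<open>E\<^sub>i X\<^sub>i\<close> from \<open>0\<close> to \<open>n\<close>. A sequence of arrows of \<open>V\<close> extends to a graph map out of the linear graph,
  and naturality along these maps reduces every equation to the linear case. For a lifting, the free
  \<open>E\<close>-category on the linear graph plays the same role.
\<close>

section \<open>Calculus in categories\<close>

text \<open>Two facts shape the constructions: the unary tensor \<open>E0 [X]\<close> need not be X,
  and T need not preserve the initial object. Because of the first, neighbouring vertices of the
  free E-category on a linear graph have the homs \<open>E0 [X]\<close>, and units u have to be
  inserted before a structure map there can be read as a map out of a tensor of the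
  \<open>T0 X\<close>. Because of the second, T destroys the sparseness of a linear graph; so on the
  source of a distributive law only the summand of the full path is used, while on the target T is
  applied after the coproduct has collapsed to one tensor. Among the conditions on \<sigma>', the
  identity condition does the decisive work: it makes T u split, so that \<mu> is itself a value of
  \<sigma>' composed with u. From there \<sigma>' is seen to be determined by its restriction along
  \<eta>. All vertices live in one fixed type. Hence the vertices 0, ..., n are transported along an
  embedding of the natural numbers, and walks, which index the coproducts of \<Gamma>E, are coded by
  vertices.\<close>

lemma hom_iff: "f \<in> hom C a b \<longleftrightarrow> f \<in> Ar C \<and> Dom C f = a \<and> Cod C f = b"
  by (auto simp: hom_def)

context category
begin

abbreviation cmp (infixr "\<bullet>" 55) where "g \<bullet> f \<equiv> Comp C g f"

lemma comp_typed [simp]: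
  assumes "f \<in> Ar C" "g \<in> Ar C" "Cod C f = Dom C g"
  shows "g \<bullet> f \<in> Ar C" "Dom C (g \<bullet> f) = Dom C f" "Cod C (g \<bullet> f) = Cod C g"
  using comp_hom[of f "Dom C f" "Dom C g" g "Cod C g"] assms by (auto simp: hom_iff)

lemma id_typed [simp]:
  assumes "a \<in> Ob C"
  shows "Id C a \<in> Ar C" "Dom C (Id C a) = a" "Cod C (Id C a) = a"
  using id_hom[OF assms] by (auto simp: hom_iff)

lemma comp_id [simp]:
  "f \<in> Ar C \<Longrightarrow> Cod C f = a \<Longrightarrow> Id C a \<bullet> f = f"
  "f \<in> Ar C \<Longrightarrow> Dom C f = a \<Longrightarrow> f \<bullet> Id C a = f"
  using comp_id_left comp_id_right by (auto simp: hom_iff)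

lemma assoc [simp]:
  assumes "f \<in> Ar C" "g \<in> Ar C" "h \<in> Ar C" "Cod C f = Dom C g" "Cod C g = Dom C h"
  shows "(h \<bullet> g) \<bullet> f = h \<bullet> (g \<bullet> f)"
  using comp_assoc[of f "Dom C f" "Dom C g" g "Dom C h" h "Cod C h"] assms by (auto simp: hom_iff)

text \<open>The simp rule \<open>assoc\<close> nests composites to the right, so a law about two
  adjacent arrows no longer matches when a further arrow stands to their right. Passing a law
  through this rule gives the form that rewrites inside such a composite.\<close>

lemma reassoc:
  assumes "g \<bullet> f = k" "f \<in> Ar C" "g \<in> Ar C" "Cod C f = Dom C g" "e \<in> Ar C" "Cod C e = Dom C f"
  shows "g \<bullet> (f \<bullet> e) = k \<bullet> e"
  using assms by auto

lemma ar_ob [simp]: "f \<in> Ar C \<Longrightarrow> Dom C f \<in> Ob C" "f \<in> Ar C \<Longrightarrow> Cod C f \<in> Ob C"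
  using dom_ob cod_ob by auto

end

lemma seq_cat_simps [simp]:
  "Ob (seq_cat V) = lists (Ob V)" "Ar (seq_cat V) = lists (Ar V)"
  "Dom (seq_cat V) = map (Dom V)" "Cod (seq_cat V) = map (Cod V)"
  "Id (seq_cat V) = map (Id V)" "Comp (seq_cat V) = map2 (Comp V)"
  by (auto simp: seq_cat_def)

lemma func_simps [simp]:
  "fobj id_func = (\<lambda>a. a)" "farr id_func = (\<lambda>a. a)"
  "fobj (G \<circ>\<^sub>F F) = fobj G \<circ> fobj F" "farr (G \<circ>\<^sub>F F) = farr G \<circ> farr F"
  "fobj (seq_func F) = map (fobj F)" "farr (seq_func F) = map (farr F)"
  "fobj concat_func = concat" "farr concat_func = concat"
  "fobj singleton_func = (\<lambda>X. [X])" "farr singleton_func = (\<lambda>X. [X])"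
  by (auto simp: id_func_def comp_func_def seq_func_def concat_func_def singleton_func_def)

text \<open>Composition of sequences is \<open>map2\<close>, which truncates to the shorter list.
  Between fixed sequences of objects the lengths are forced, so the truncation never takes
  effect.\<close>

lemma seq_hom_iff: "f \<in> hom (seq_cat V) a b \<longleftrightarrow>
    length f = length a \<and> length b = length a \<and> (\<forall>i<length a. f ! i \<in> hom V (a ! i) (b ! i))"
  by (fastforce simp: hom_iff in_lists_conv_set in_set_conv_nth intro!: nth_equalityI)

lemma category_seq_cat:
  assumes "category V"
  shows "category (seq_cat V)"
proof -
  interpret category V by fact
  show ?thesis
  proof
    fix f g h a b c d
    assume "f \<in> hom (seq_cat V) a b" "g \<in> hom (seq_cat V) b c" "h \<in> hom (seq_cat V) c d"
    then show "Comp (seq_cat V) (Comp (seq_cat V) h g) f = Comp (seq_cat V) h (Comp (seq_cat V) g f)"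
      unfolding seq_hom_iff by (auto intro!: nth_equalityI comp_assoc)
  qed (auto simp: seq_hom_iff in_set_conv_nth intro!: nth_equalityI comp_hom comp_id_left comp_id_right
      simp: id_hom, auto simp: hom_iff)
qed

lemma cat_functor_comp:
  assumes "cat_functor A B F" "cat_functor B C G"
  shows "cat_functor A C (G \<circ>\<^sub>F F)"
proof -
  interpret F: cat_functor A B F by fact
  interpret G: cat_functor B C G by fact
  show ?thesis
    by unfold_locales (auto simp: F.fobj_ob G.fobj_ob F.farr_id G.farr_id intro!: F.farr_hom G.farr_hom,
      metis F.farr_comp F.farr_hom G.farr_comp)
qed

lemma cat_functor_seq_func:
  assumes "cat_functor A B F"
  shows "cat_functor (seq_cat A) (seq_cat B) (seq_func F)"
proof -
  interpret F: cat_functor A B F by fact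
  interpret A: category "seq_cat A" by (rule category_seq_cat[OF F.A.category_axioms])
  interpret B: category "seq_cat B" by (rule category_seq_cat[OF F.B.category_axioms])
  show ?thesis
  proof
    fix f g a b c assume "f \<in> hom (seq_cat A) a b" "g \<in> hom (seq_cat A) b c"
    then show "farr (seq_func F) (Comp (seq_cat A) g f)
        = Comp (seq_cat B) (farr (seq_func F) g) (farr (seq_func F) f)"
      unfolding seq_hom_iff by (auto intro!: nth_equalityI F.farr_comp)
  qed (auto simp: seq_hom_iff F.fobj_ob F.farr_id intro!: F.farr_hom)
qed

lemma cat_functor_id:
  assumes "category A"
  shows "cat_functor A A id_func"
proof -
  interpret category A by fact
  show ?thesis by unfold_locales auto
qed

lemma cat_functor_singleton:
  assumes "category A"
  shows "cat_functor A (seq_cat A) singleton_func"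
proof -
  interpret category A by fact
  interpret S: category "seq_cat A" by (rule category_seq_cat[OF assms])
  show ?thesis by unfold_locales (auto simp: hom_iff)
qed

text \<open>Blockwise equal lengths keep the two concatenations in step; this is the functoriality
  of concatenation.\<close>

lemma map2_concat:
  "list_all2 (\<lambda>xs ys. length xs = length ys) xss yss \<Longrightarrow>
    map2 f (concat xss) (concat yss) = concat (map2 (map2 f) xss yss)"
  by (induction rule: list_all2_induct) auto

lemma cat_functor_concat:
  assumes "category A"
  shows "cat_functor (seq_cat (seq_cat A)) (seq_cat A) concat_func"
proof -
  interpret category A by fact
  interpret S: category "seq_cat A" by (rule category_seq_cat[OF assms])
  interpret SS: category "seq_cat (seq_cat A)" by (rule category_seq_cat[OF S.category_axioms])
  show ?thesis
  proof
    fix f g a b c assume fg: "f \<in> hom (seq_cat (seq_cat A)) a b" "g \<in> hom (seq_cat (seq_cat A)) b c"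
    then have "list_all2 (\<lambda>xs ys. length xs = length ys) g f"
      by (auto simp: seq_hom_iff list_all2_conv_all_nth)
    then show "farr concat_func (Comp (seq_cat (seq_cat A)) g f)
        = Comp (seq_cat A) (farr concat_func g) (farr concat_func f)"
      by (simp add: map2_concat)
  qed (force simp: hom_iff map_concat in_lists_conv_set)+
qed

locale seq_functor = cat_functor "seq_cat A" B F + A0: category A
  for A :: "('o, 'm) cat" and B :: "('p, 'n) cat" and F :: "('o list, 'm list, 'p, 'n, 'z) func_scheme"
begin

lemma ob [simp]: "\<forall>X\<in>set Xs. X \<in> Ob A \<Longrightarrow> fobj F Xs \<in> Ob B"
  using fobj_ob by (auto simp: in_lists_conv_set)

lemma arr [simp]:
  assumes "\<forall>f\<in>set fs. f \<in> Ar A"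
  shows "farr F fs \<in> Ar B" "Dom B (farr F fs) = fobj F (map (Dom A) fs)"
    "Cod B (farr F fs) = fobj F (map (Cod A) fs)"
  using farr_hom[of fs "map (Dom A) fs" "map (Cod A) fs"] assms by (auto simp: hom_iff in_lists_conv_set)

lemma arr_id [simp]: "\<forall>X\<in>set Xs. X \<in> Ob A \<Longrightarrow> farr F (map (Id A) Xs) = Id B (fobj F Xs)"
  using farr_id[of Xs] by (auto simp: in_lists_conv_set)

text \<open>Both sequences are images of one index list, so their lengths agree by construction. In
  this form functoriality of E applies to families indexed by the steps or the pieces of a
  walk.\<close>

lemma arr_comp:
  assumes "\<And>i. i \<in> set Is \<Longrightarrow> f i \<in> Ar A \<and> g i \<in> Ar A \<and> Cod A (f i) = Dom A (g i)"
  shows "farr F (map (\<lambda>i. Comp A (g i) (f i)) Is) = Comp B (farr F (map g Is)) (farr F (map f Is))"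
proof -
  have "Comp (seq_cat A) (map g Is) (map f Is) = map (\<lambda>i. Comp A (g i) (f i)) Is"
    by (auto intro!: nth_equalityI)
  then show ?thesis
    using farr_comp[of "map f Is" "map (Dom A o f) Is" "map (Cod A o f) Is" "map g Is" "map (Cod A o g) Is"] assms
    by (auto simp: hom_iff in_lists_conv_set)
qed

lemma arr_comp2:
  assumes "length gs = length fs"
    and "\<And>i. i < length fs \<Longrightarrow> fs ! i \<in> Ar A \<and> gs ! i \<in> Ar A \<and> Cod A (fs ! i) = Dom A (gs ! i)"
  shows "Comp B (farr F gs) (farr F fs) = farr F (map2 (Comp A) gs fs)"
proof -
  have "fs \<in> hom (seq_cat A) (map (Dom A) fs) (map (Cod A) fs)"
    "gs \<in> hom (seq_cat A) (map (Cod A) fs) (map (Cod A) gs)"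
    unfolding seq_hom_iff using assms by (simp_all add: hom_iff)
  from farr_comp[OF this] show ?thesis by simp
qed

end

locale ctx_functor = cat_functor
begin

lemma ob [simp]: "X \<in> Ob A \<Longrightarrow> fobj F X \<in> Ob B"
  using fobj_ob by auto

lemma arr [simp]:
  assumes "f \<in> Ar A"
  shows "farr F f \<in> Ar B" "Dom B (farr F f) = fobj F (Dom A f)"
    "Cod B (farr F f) = fobj F (Cod A f)"
  using farr_hom[of f "Dom A f" "Cod A f"] assms by (auto simp: hom_iff)

lemma arr_id [simp]: "X \<in> Ob A \<Longrightarrow> farr F (Id A X) = Id B (fobj F X)"
  using farr_id[of X] by auto

lemma arr_comp:
  assumes "f \<in> Ar A" "g \<in> Ar A" "Cod A f = Dom A g"
  shows "farr F (Comp A g f) = Comp B (farr F g) (farr F f)"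
  using farr_comp[of f "Dom A f" "Cod A f" g "Cod A g"] assms by (auto simp: hom_iff)

end

context monad
begin

abbreviation "T0 \<equiv> fobj T"
abbreviation "T1 \<equiv> farr T"
abbreviation "\<eta> \<equiv> m_unit T"
abbreviation "\<mu> \<equiv> m_mult T"

sublocale unit: nat_trans C C id_func T \<eta> by (rule unit_nat)
sublocale mult: nat_trans C C "T \<circ>\<^sub>F T" T \<mu> by (rule mult_nat)
sublocale T: ctx_functor C C T by unfold_locales

lemma unit_typed [simp]:
  assumes "X \<in> Ob C"
  shows "\<eta> X \<in> Ar C" "Dom C (\<eta> X) = X" "Cod C (\<eta> X) = T0 X"
  using unit.component[OF assms] by (auto simp: hom_iff)

lemma mult_typed [simp]:
  assumes "X \<in> Ob C"
  shows "\<mu> X \<in> Ar C" "Dom C (\<mu> X) = T0 (T0 X)" "Cod C (\<mu> X) = T0 X"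
  using mult.component[OF assms] by (auto simp: hom_iff)

lemma unit_natural: "f \<in> Ar C \<Longrightarrow> Cod C f = b \<Longrightarrow> \<eta> b \<bullet> f = T1 f \<bullet> \<eta> (Dom C f)"
  using unit.natural[of f "Dom C f" b] by (auto simp: hom_iff)

lemma mult_natural: "f \<in> Ar C \<Longrightarrow> Cod C f = b \<Longrightarrow> \<mu> b \<bullet> T1 (T1 f) = T1 f \<bullet> \<mu> (Dom C f)"
  using mult.natural[of f "Dom C f" b] by (auto simp: hom_iff)

lemma unit_natural_rev: "f \<in> Ar C \<Longrightarrow> Dom C f = a \<Longrightarrow> T1 f \<bullet> \<eta> a = \<eta> (Cod C f) \<bullet> f"
  using unit_natural[of f "Cod C f"] by simp

lemma mult_natural_rev: "f \<in> Ar C \<Longrightarrow> Dom C f = a \<Longrightarrow> T1 f \<bullet> \<mu> a = \<mu> (Cod C f) \<bullet> T1 (T1 f)"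
  using mult_natural[of f "Cod C f"] by simp

lemma mult_assoc_rev: "a \<in> Ob C \<Longrightarrow> \<mu> a \<bullet> T1 (\<mu> a) = \<mu> a \<bullet> \<mu> (T0 a)"
  using mult_assoc by simp

lemmas mult_assoc_rev' = mult_assoc_rev[THEN reassoc]
lemmas unit_natural_rev' = unit_natural_rev[THEN reassoc]
lemmas mult_natural_rev' = mult_natural_rev[THEN reassoc]
lemmas unit_natural' = unit_natural[THEN reassoc]
lemmas mult_natural' = mult_natural[THEN reassoc]
lemmas unit_left' = unit_left[THEN reassoc]
lemmas unit_right' = unit_right[THEN reassoc]

end

context multitensor
begin

abbreviation vcomp (infixr "\<bullet>" 55) where "g \<bullet> f \<equiv> Comp V g f"
abbreviation "E0 \<equiv> fobj E"
abbreviation "E1 \<equiv> farr E"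
abbreviation "u \<equiv> mt_unit E"
abbreviation "\<sigma> \<equiv> mt_subst E"

sublocale E: seq_functor V V E by (intro seq_functor.intro functor_E category_axioms)
sublocale mtu: nat_trans V V id_func "E \<circ>\<^sub>F singleton_func" u by (rule unit_nat)
sublocale mts: nat_trans "seq_cat (seq_cat V)" V "E \<circ>\<^sub>F seq_func E" "E \<circ>\<^sub>F concat_func" \<sigma>
  by (rule subst_nat)

lemma mtu_typed [simp]:
  assumes "X \<in> Ob V"
  shows "u X \<in> Ar V" "Dom V (u X) = X" "Cod V (u X) = E0 [X]"
  using mtu.component[of X] assms by (auto simp: hom_iff)

lemma mts_typed [simp]:
  assumes "\<forall>Xs\<in>set Xss. \<forall>X\<in>set Xs. X \<in> Ob V"
  shows "\<sigma> Xss \<in> Ar V" "Dom V (\<sigma> Xss) = E0 (map E0 Xss)" "Cod V (\<sigma> Xss) = E0 (concat Xss)"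
  using mts.component[of Xss] assms by (auto simp: hom_iff in_lists_conv_set)

lemma mtu_natural: "f \<in> Ar V \<Longrightarrow> Cod V f = b \<Longrightarrow> u b \<bullet> f = E1 [f] \<bullet> u (Dom V f)"
  using mtu.natural[of f "Dom V f" b] by (auto simp: hom_iff)

lemma mts_natural:
  assumes "\<forall>fs\<in>set fss. \<forall>f\<in>set fs. f \<in> Ar V"
  shows "\<sigma> (map (map (Cod V)) fss) \<bullet> E1 (map E1 fss) = E1 (concat fss) \<bullet> \<sigma> (map (map (Dom V)) fss)"
  using mts.natural[of fss "map (map (Dom V)) fss" "map (map (Cod V)) fss"] assms
  by (auto simp: hom_iff in_lists_conv_set)

lemma mts_natural_map:
  assumes "\<And>Is i. Is \<in> set Iss \<Longrightarrow> i \<in> set Is \<Longrightarrow> f i \<in> Ar V \<and> Dom V (f i) = a i \<and> Cod V (f i) = b i"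
  shows "\<sigma> (map (map b) Iss) \<bullet> E1 (map (\<lambda>Is. E1 (map f Is)) Iss)
    = E1 (map f (concat Iss)) \<bullet> \<sigma> (map (map a) Iss)"
proof -
  have ab: "map (map b) Iss = map (map (Cod V)) (map (map f) Iss)"
    "map (map a) Iss = map (map (Dom V)) (map (map f) Iss)"
    using assms by auto
  show ?thesis unfolding ab
    using mts_natural[of "map (map f) Iss"] assms by (simp add: map_concat o_def)
qed

lemma subst_unit_outer: "\<forall>X\<in>set Xs. X \<in> Ob V \<Longrightarrow> \<sigma> [Xs] \<bullet> u (E0 Xs) = Id V (E0 Xs)"
  using unit_outer by (auto simp: in_lists_conv_set)

lemma subst_unit_inner: "\<forall>X\<in>set Xs. X \<in> Ob V \<Longrightarrow> \<sigma> (map (\<lambda>X. [X]) Xs) \<bullet> E1 (map u Xs) = Id V (E0 Xs)"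
  using unit_inner by (auto simp: in_lists_conv_set)

lemma subst_assoc_map:
  assumes "\<forall>Xss\<in>set Xsss. \<forall>Xs\<in>set Xss. \<forall>X\<in>set Xs. X \<in> Ob V"
  shows "\<sigma> (concat Xsss) \<bullet> \<sigma> (map (map E0) Xsss) = \<sigma> (map concat Xsss) \<bullet> E1 (map \<sigma> Xsss)"
  using subst_assoc[of Xsss] assms by (auto simp: in_lists_conv_set)

end

text \<open>\<open>map_cong\<close> lets the simplifier use membership in the list when it rewrites
  under \<open>map\<close>, so typing facts that are known for the members only are enough.\<close>

declare map_cong [cong] comp_def [simp] map_concat [simp] in_lists_conv_set [simp]

section \<open>Monoidal monads and composite multitensors\<close>

locale tensor_monad = multitensor V E + T: monad V T
  for V :: "('o, 'm) cat" and E :: "('o, 'm) multitensor_struct" and T :: "('o, 'm) monad_struct"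
begin

abbreviation "T0 \<equiv> fobj T"
abbreviation "T1 \<equiv> farr T"
abbreviation "\<eta> \<equiv> m_unit T"
abbreviation "\<mu> \<equiv> m_mult T"

abbreviation "composite m \<equiv> composite_struct V E T m"

lemma composite_simps [simp]:
  "fobj (composite m) = (\<lambda>Xs. T0 (E0 Xs))" "farr (composite m) = (\<lambda>fs. T1 (E1 fs))"
  "mt_unit (composite m) = (\<lambda>X. \<eta> (E0 [X]) \<bullet> u X)" "mt_subst (composite m) = m"
  by (auto simp: composite_struct_def)

lemma unary_simps [simp]:
  "fobj (unary_monad M) = (\<lambda>X. fobj M [X])" "farr (unary_monad M) = (\<lambda>f. farr M [f])"
  "m_unit (unary_monad M) = mt_unit M" "m_mult (unary_monad M) = (\<lambda>X. mt_subst M [[X]])"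
  by (auto simp: unary_monad_def)

lemma composite_functor: "cat_functor (seq_cat V) V (composite m)"
proof -
  have "cat_functor (seq_cat V) V (T \<circ>\<^sub>F E)"
    by (rule cat_functor_comp) (rule functor_E T.unit.G.cat_functor_axioms)+
  then show ?thesis
    by (simp add: cat_functor_def cat_functor_axioms_def)
qed

text \<open>Together with \<open>reassoc\<close> this turns a law of V into a rewrite rule for its
  image under T; \<open>E_lift\<close> serves the same purpose for a family of laws under E.\<close>

lemma T_lift:
  assumes "g \<bullet> f = k" "f \<in> Ar V" "g \<in> Ar V" "Cod V f = Dom V g"
  shows "T1 g \<bullet> T1 f = T1 k"
  using assms T.T.arr_comp by metis

lemma E_lift:
  assumes "\<And>i. i \<in> set Is \<Longrightarrow> g i \<bullet> f i = k i"
    and "\<And>i. i \<in> set Is \<Longrightarrow> f i \<in> Ar V \<and> g i \<in> Ar V \<and> Cod V (f i) = Dom V (g i)"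
  shows "E1 (map g Is) \<bullet> E1 (map f Is) = E1 (map k Is)"
  using E.arr_comp[of Is f g] assms by simp

end

section \<open>From \<tau> to \<sigma>': the composite multitensor\<close>

locale monoidal_monad = tensor_monad +
  fixes \<tau>
  assumes tau: "\<tau> \<in> monoidal_monad_data V E T"
begin

lemma tau_typed [simp]:
  assumes "\<forall>X\<in>set Xs. X \<in> Ob V"
  shows "\<tau> Xs \<in> Ar V" "Dom V (\<tau> Xs) = E0 (map T0 Xs)" "Cod V (\<tau> Xs) = T0 (E0 Xs)"
proof -
  have "nat_trans (seq_cat V) V (E \<circ>\<^sub>F seq_func T) (T \<circ>\<^sub>F E) \<tau>"
    using tau by (simp add: monoidal_monad_data_def)
  from nat_trans.component[OF this, of Xs] assms
  show "\<tau> Xs \<in> Ar V" "Dom V (\<tau> Xs) = E0 (map T0 Xs)" "Cod V (\<tau> Xs) = T0 (E0 Xs)"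
    by (auto simp: hom_iff in_lists_conv_set)
qed

lemma tau_natural:
  assumes "\<And>i. i \<in> set Is \<Longrightarrow> f i \<in> Ar V \<and> Dom V (f i) = a i \<and> Cod V (f i) = b i"
  shows "\<tau> (map b Is) \<bullet> E1 (map (\<lambda>i. T1 (f i)) Is) = T1 (E1 (map f Is)) \<bullet> \<tau> (map a Is)"
proof -
  have "nat_trans (seq_cat V) V (E \<circ>\<^sub>F seq_func T) (T \<circ>\<^sub>F E) \<tau>"
    using tau by (simp add: monoidal_monad_data_def)
  from nat_trans.natural[OF this, of "map f Is" "map a Is" "map b Is"] assms
  show ?thesis by (simp add: hom_iff in_lists_conv_set o_def)
qed

lemma tau_unit: "X \<in> Ob V \<Longrightarrow> \<tau> [X] \<bullet> u (T0 X) = T1 (u X)"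
  using tau by (simp add: monoidal_monad_data_def)

lemma tau_subst: "\<forall>Xs\<in>set Xss. \<forall>X\<in>set Xs. X \<in> Ob V \<Longrightarrow>
    \<tau> (concat Xss) \<bullet> \<sigma> (map (map T0) Xss) = T1 (\<sigma> Xss) \<bullet> \<tau> (map E0 Xss) \<bullet> E1 (map \<tau> Xss)"
  using tau by (simp add: monoidal_monad_data_def in_lists_conv_set)

lemma tau_eta: "\<forall>X\<in>set Xs. X \<in> Ob V \<Longrightarrow> \<tau> Xs \<bullet> E1 (map \<eta> Xs) = \<eta> (E0 Xs)"
  using tau by (simp add: monoidal_monad_data_def in_lists_conv_set)

lemma tau_mu: "\<forall>X\<in>set Xs. X \<in> Ob V \<Longrightarrow>
    \<tau> Xs \<bullet> E1 (map \<mu> Xs) = \<mu> (E0 Xs) \<bullet> T1 (\<tau> Xs) \<bullet> \<tau> (map T0 Xs)"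
  using tau by (simp add: monoidal_monad_data_def in_lists_conv_set)

definition m where "m = subst_of V E T \<tau>"

lemma m_eq: "\<forall>Xs\<in>set Xss. \<forall>X\<in>set Xs. X \<in> Ob V \<Longrightarrow>
    m Xss = T1 (\<sigma> Xss) \<bullet> \<mu> (E0 (map E0 Xss)) \<bullet> T1 (\<tau> (map E0 Xss))"
  by (simp add: m_def subst_of_def in_lists_conv_set)

lemma m_typed [simp]:
  assumes "\<forall>Xs\<in>set Xss. \<forall>X\<in>set Xs. X \<in> Ob V"
  shows "m Xss \<in> Ar V" "Dom V (m Xss) = T0 (E0 (map (\<lambda>Xs. T0 (E0 Xs)) Xss))"
    "Cod V (m Xss) = T0 (E0 (concat Xss))"
  using assms by (simp_all add: m_eq)

text \<open>The three factors \<tau>, \<mu> and \<sigma> are natural one after the other.\<close>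

lemma m_natural:
  assumes "\<And>Is i. Is \<in> set Iss \<Longrightarrow> i \<in> set Is \<Longrightarrow> f i \<in> Ar V \<and> Dom V (f i) = a i \<and> Cod V (f i) = b i"
  shows "m (map (map b) Iss) \<bullet> T1 (E1 (map (\<lambda>Is. T1 (E1 (map f Is))) Iss))
    = T1 (E1 (map f (concat Iss))) \<bullet> m (map (map a) Iss)"
proof -
  have ab: "\<forall>Is\<in>set Iss. \<forall>i\<in>set Is. a i \<in> Ob V \<and> b i \<in> Ob V"
    using assms by (metis ar_ob)
  note [simp] = ab assms
  have t: "\<tau> (map (\<lambda>Is. E0 (map b Is)) Iss) \<bullet> E1 (map (\<lambda>Is. T1 (E1 (map f Is))) Iss)
    = T1 (E1 (map (\<lambda>Is. E1 (map f Is)) Iss)) \<bullet> \<tau> (map (\<lambda>Is. E0 (map a Is)) Iss)"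
    by (rule tau_natural) simp
  have s: "\<sigma> (map (map b) Iss) \<bullet> E1 (map (\<lambda>Is. E1 (map f Is)) Iss)
    = E1 (map f (concat Iss)) \<bullet> \<sigma> (map (map a) Iss)"
    by (rule mts_natural_map) simp
  have [simp]: "Dom V (E1 (concat (map (map f) Iss))) = E0 (concat (map (map a) Iss))" by (simp, simp)
  show ?thesis
    using t[THEN T_lift] s[THEN T_lift, THEN reassoc]
    by (simp add: m_eq T.T.arr_comp T.mult_natural')
qed

text \<open>Naturality moves \<eta> past \<tau>, where it cancels against \<mu>; what is left is
  \<tau> after u, which is T u, and this cancels against T \<sigma>.\<close>

lemma m_unit_outer:
  assumes [simp]: "\<forall>X\<in>set Xs. X \<in> Ob V"
  shows "m [Xs] \<bullet> \<eta> (E0 [T0 (E0 Xs)]) \<bullet> u (T0 (E0 Xs)) = Id V (T0 (E0 Xs))"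
  using subst_unit_outer[of Xs, THEN T_lift]
  by (simp add: m_eq T.unit_natural_rev' T.unit_left' tau_unit)

text \<open>The cancellations happen layer by layer: \<tau> turns \<open>E1\<close> of \<eta> into
  \<eta>, \<mu> cancels T of that, and \<sigma> cancels \<open>E1\<close> of u.\<close>

lemma m_unit_inner:
  assumes [simp]: "\<forall>X\<in>set Xs. X \<in> Ob V"
  shows "m (map (\<lambda>X. [X]) Xs) \<bullet> T1 (E1 (map (\<lambda>X. \<eta> (E0 [X]) \<bullet> u X) Xs)) = Id V (T0 (E0 Xs))"
  using subst_unit_inner[of Xs, THEN T_lift] tau_eta[of "map (\<lambda>X. E0 [X]) Xs", THEN T_lift, THEN reassoc]
  by (simp add: m_eq T.T.arr_comp E.arr_comp T.unit_right')

text \<open>Both sides are brought to one normal form: first all \<tau>, then two \<mu>, then two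
  layers of \<sigma>. The left side needs the \<sigma>-law of \<tau> and naturality of \<tau> along
  itself (1, 2), the right side naturality of \<tau> along \<sigma> and its \<mu>-law (3, 4).
  Associativity of \<sigma> and of \<mu> identifies what remains.\<close>

lemma m_assoc:
  assumes [simp]: "\<forall>Xss\<in>set A. \<forall>Xs\<in>set Xss. \<forall>X\<in>set Xs. X \<in> Ob V"
  shows "m (concat A) \<bullet> m (map (map (\<lambda>Xs. T0 (E0 Xs))) A) = m (map concat A) \<bullet> T1 (E1 (map m A))"
proof -
  \<comment> \<open>\<open>B\<close> is \<open>A\<close> with the innermost tensors formed, and
    \<open>C\<close> is the block of \<tau> common to both sides, which moves every inner T to the
    front.\<close>
  define B where "B = map (map E0) A"
  define C where "C = T1 (T1 (\<tau> (map E0 B))) \<bullet> T1 (\<tau> (map (\<lambda>Xs. T0 (E0 Xs)) B)) \<bullet> T1 (E1 (map (\<lambda>Xs. T1 (\<tau> Xs)) B))"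
  have [simp]: "\<forall>Xs\<in>set B. \<forall>X\<in>set Xs. X \<in> Ob V"
    by (simp add: B_def)
  have 1: "\<tau> (map E0 (concat A)) \<bullet> \<sigma> (map (map (\<lambda>Xs. T0 (E0 Xs))) A)
      = T1 (\<sigma> B) \<bullet> \<tau> (map E0 B) \<bullet> E1 (map \<tau> B)"
    using tau_subst[of B] by (simp add: B_def)
  have 2: "T1 (E1 (map \<tau> B)) \<bullet> \<tau> (map (\<lambda>Xs. E0 (map T0 Xs)) B)
      = \<tau> (map (\<lambda>Xs. T0 (E0 Xs)) B) \<bullet> E1 (map (\<lambda>Xs. T1 (\<tau> Xs)) B)"
    by (rule tau_natural[symmetric]) simp
  have 3: "\<tau> (map (\<lambda>Xss. E0 (concat Xss)) A) \<bullet> E1 (map (\<lambda>Xss. T1 (\<sigma> Xss)) A)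
      = T1 (E1 (map \<sigma> A)) \<bullet> \<tau> (map E0 B)"
    using tau_natural[of A \<sigma> "\<lambda>Xss. E0 (map E0 Xss)" "\<lambda>Xss. E0 (concat Xss)"] by (simp add: B_def)
  have 4: "\<tau> (map E0 B) \<bullet> E1 (map (\<lambda>Xs. \<mu> (E0 Xs)) B)
      = \<mu> (E0 (map E0 B)) \<bullet> T1 (\<tau> (map E0 B)) \<bullet> \<tau> (map (\<lambda>Xs. T0 (E0 Xs)) B)"
    using tau_mu[of "map E0 B"] by simp
  have 5: "m (map (map (\<lambda>Xs. T0 (E0 Xs))) A) = T1 (\<sigma> (map (map (\<lambda>Xs. T0 (E0 Xs))) A)) \<bullet>
      \<mu> (E0 (map (\<lambda>Xs. E0 (map T0 Xs)) B)) \<bullet> T1 (\<tau> (map (\<lambda>Xs. E0 (map T0 Xs)) B))"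
    by (simp add: m_eq B_def)
  have 6: "m (concat A) = T1 (\<sigma> (concat A)) \<bullet> \<mu> (E0 (concat B)) \<bullet> T1 (\<tau> (concat B))"
    by (simp add: m_eq B_def)
  have 7: "m (map concat A) = T1 (\<sigma> (map concat A)) \<bullet> \<mu> (E0 (map (\<lambda>Xss. E0 (concat Xss)) A)) \<bullet>
     T1 (\<tau> (map (\<lambda>Xss. E0 (concat Xss)) A))"
    by (simp add: m_eq B_def)
  have 8: "E1 (map m A) = E1 (map (\<lambda>Xss. T1 (\<sigma> Xss)) A) \<bullet> E1 (map (\<lambda>Xs. \<mu> (E0 Xs)) B)
      \<bullet> E1 (map (\<lambda>Xs. T1 (\<tau> Xs)) B)"
    by (simp add: m_eq B_def E.arr_comp)
  have 9: "\<sigma> (concat A) \<bullet> \<sigma> B = \<sigma> (map concat A) \<bullet> E1 (map \<sigma> A)"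
    using subst_assoc_map[of A] by (simp add: B_def)
  note [simp] = B_def T.T.arr_comp
  have 2: "T1 (E1 (map \<tau> B)) \<bullet> \<mu> (E0 (map (\<lambda>Xs. E0 (map T0 Xs)) B)) \<bullet> T1 (\<tau> (map (\<lambda>Xs. E0 (map T0 Xs)) B))
      = \<mu> (E0 (map (\<lambda>Xs. T0 (E0 Xs)) B)) \<bullet> T1 (\<tau> (map (\<lambda>Xs. T0 (E0 Xs)) B)) \<bullet> T1 (E1 (map (\<lambda>Xs. T1 (\<tau> Xs)) B))"
    using 2[THEN T_lift] by (simp add: T.mult_natural_rev')
  have "m (concat A) \<bullet> m (map (map (\<lambda>Xs. T0 (E0 Xs))) A)
    = T1 (\<sigma> (map concat A)) \<bullet> T1 (E1 (map \<sigma> A)) \<bullet> \<mu> (E0 (map E0 B)) \<bullet> \<mu> (T0 (E0 (map E0 B))) \<bullet> C"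
    unfolding 5 6 C_def
    using 1[THEN T_lift, THEN reassoc] 2 9[THEN T_lift, THEN reassoc]
    by (simp add: T.mult_natural')
  also have "\<dots> = m (map concat A) \<bullet> T1 (E1 (map m A))"
    unfolding 7 8 C_def
    using 3[THEN T_lift, THEN reassoc] 4[THEN T_lift, THEN reassoc]
    by (simp add: T.mult_natural' T.mult_assoc_rev')
  finally show ?thesis .
qed

lemma subst_of_composite: "m \<in> composite_data V E T"
proof -
  have ext: "m \<in> extensional (lists (lists (Ob V)))"
    by (simp add: m_def subst_of_def)
  interpret M: cat_functor "seq_cat V" V "composite m" by (rule composite_functor)
  have nu: "nat_trans V V id_func (composite m \<circ>\<^sub>F singleton_func) (mt_unit (composite m))"
    by (intro nat_trans.intro cat_functor_id category_axioms
        cat_functor_comp[OF cat_functor_singleton[OF category_axioms] composite_functor] nat_trans_axioms.intro)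
      (auto simp: hom_iff T.T.arr_comp mtu_natural T.unit_natural')
  have nm: "nat_trans (seq_cat (seq_cat V)) V (composite m \<circ>\<^sub>F seq_func (composite m))
      (composite m \<circ>\<^sub>F concat_func) (mt_subst (composite m))"
  proof (intro nat_trans.intro nat_trans_axioms.intro
        cat_functor_comp[OF cat_functor_seq_func[OF composite_functor] composite_functor]
        cat_functor_comp[OF cat_functor_concat[OF category_axioms] composite_functor])
    fix f a b assume "f \<in> hom (seq_cat (seq_cat V)) a b"
    then show "mt_subst (composite m) b \<bullet> farr (composite m \<circ>\<^sub>F seq_func (composite m)) f
       = farr (composite m \<circ>\<^sub>F concat_func) f \<bullet> mt_subst (composite m) a"
      using m_natural[of f "\<lambda>x. x" "Dom V" "Cod V"] by (auto simp: hom_iff)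
  qed (auto simp: hom_iff)
  have mt: "multitensor V (composite m)"
    by (intro multitensor.intro multitensor_axioms.intro category_axioms composite_functor nu nm)
      (auto simp: m_unit_outer m_unit_inner m_assoc)
  have e: "nat_trans (seq_cat V) V E (composite m) (\<lambda>Xs. \<eta> (E0 Xs))"
    by (intro nat_trans.intro nat_trans_axioms.intro functor_E composite_functor)
      (auto simp: hom_iff T.unit_natural)
  have t: "nat_trans V V T (unary_monad (composite m)) (\<lambda>X. T1 (u X))"
  proof -
    have "cat_functor V V (composite m \<circ>\<^sub>F singleton_func)"
      by (rule cat_functor_comp[OF cat_functor_singleton[OF category_axioms] composite_functor])
    then have "cat_functor V V (unary_monad (composite m))"
      by (simp add: cat_functor_def cat_functor_axioms_def)
    then show ?thesis
      by (intro nat_trans.intro nat_trans_axioms.intro T.unit.G.cat_functor_axioms)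
        (auto simp: hom_iff mtu_natural T.T.arr_comp[symmetric])
  qed
  \<comment> \<open>The next three facts are the square of \<eta>E with the substitutions, the
    multiplication square of T u, and the identity condition. The first rests on \<tau> absorbing
    \<eta>, the other two on \<tau> after u being T u.\<close>
  have 1: "m Xss \<bullet> \<eta> (E0 (map (\<lambda>Xs. T0 (E0 Xs)) Xss)) \<bullet> E1 (map (\<lambda>Xs. \<eta> (E0 Xs)) Xss) = \<eta> (E0 (concat Xss)) \<bullet> \<sigma> Xss"
    if [simp]: "\<forall>Xs\<in>set Xss. \<forall>X\<in>set Xs. X \<in> Ob V" for Xss
    using tau_eta[of "map E0 Xss", THEN T_lift, THEN reassoc]
    by (simp add: m_eq T.unit_natural T.unit_right')
  have 2: "m [[X]] \<bullet> T1 (u (T0 (E0 [X]))) \<bullet> T1 (T1 (u X)) = T1 (u X) \<bullet> \<mu> X"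
    if [simp]: "X \<in> Ob V" for X
    using tau_unit[of "E0 [X]", THEN T_lift, THEN reassoc] subst_unit_outer[of "[X]", THEN T_lift, THEN reassoc]
    by (simp add: m_eq T.mult_natural T.mult_natural')
  have 3: "m [Xs] \<bullet> T1 (u (T0 (E0 Xs))) \<bullet> T1 (\<eta> (E0 Xs)) = Id V (T0 (E0 Xs))"
    if [simp]: "\<forall>X\<in>set Xs. X \<in> Ob V" for Xs
    using tau_unit[of "E0 Xs", THEN T_lift, THEN reassoc] subst_unit_outer[of "Xs", THEN T_lift]
    by (simp add: m_eq T.mult_natural' T.unit_right)
  show ?thesis
    unfolding composite_data_def Let_def multitensor_map_def monad_map_def
    using ext mt e t 1 2 3 by (simp add: T.unit_natural_rev)
qed

end

lemma (in multitensor) E1_single: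
  "f \<in> Ar V \<Longrightarrow> g \<in> Ar V \<Longrightarrow> Cod V f = Dom V g \<Longrightarrow> E1 [g \<bullet> f] = E1 [g] \<bullet> E1 [f]"
  using E.arr_comp[of "[()]" "\<lambda>_. f" "\<lambda>_. g"] by simp

lemma (in multitensor) mtu_natural_rev:
  "f \<in> Ar V \<Longrightarrow> Dom V f = a \<Longrightarrow> E1 [f] \<bullet> u a = u (Cod V f) \<bullet> f"
  using mtu_natural[of f "Cod V f"] by simp

lemma (in multitensor) E1_single_id [simp]: "X \<in> Ob V \<Longrightarrow> E1 [Id V X] = Id V (E0 [X])"
  using E.arr_id[of "[X]"] by simp

section \<open>From \<sigma>' back to \<tau>\<close>

locale composite_mult = tensor_monad +
  fixes m
  assumes mem: "m \<in> composite_data V E T"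
begin

lemma composite_multitensor: "multitensor V (composite m)"
  using mem by (simp add: composite_data_def Let_def)

lemmas M = composite_multitensor

lemma m_typed [simp]:
  assumes "\<forall>Xs\<in>set Xss. \<forall>X\<in>set Xs. X \<in> Ob V"
  shows "m Xss \<in> Ar V" "Dom V (m Xss) = T0 (E0 (map (\<lambda>Xs. T0 (E0 Xs)) Xss))"
    "Cod V (m Xss) = T0 (E0 (concat Xss))"
  using multitensor.mts_typed[OF M, of Xss] assms by auto

lemma m_natural:
  assumes "\<And>Is i. Is \<in> set Iss \<Longrightarrow> i \<in> set Is \<Longrightarrow> f i \<in> Ar V \<and> Dom V (f i) = a i \<and> Cod V (f i) = b i"
  shows "m (map (map b) Iss) \<bullet> T1 (E1 (map (\<lambda>Is. T1 (E1 (map f Is))) Iss))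
    = T1 (E1 (map f (concat Iss))) \<bullet> m (map (map a) Iss)"
  using multitensor.mts_natural_map[OF M, of Iss f a b] assms by simp

lemma m_natural_single:
  assumes "\<And>i. i \<in> set Is \<Longrightarrow> f i \<in> Ar V \<and> Dom V (f i) = a i \<and> Cod V (f i) = b i"
  shows "m (map (\<lambda>i. [b i]) Is) \<bullet> T1 (E1 (map (\<lambda>i. T1 (E1 [f i])) Is))
    = T1 (E1 (map f Is)) \<bullet> m (map (\<lambda>i. [a i]) Is)"
proof -
  have "m (map (map b) (map (\<lambda>i. [i]) Is)) \<bullet> T1 (E1 (map (\<lambda>Is. T1 (E1 (map f Is))) (map (\<lambda>i. [i]) Is)))
    = T1 (E1 (map f (concat (map (\<lambda>i. [i]) Is)))) \<bullet> m (map (map a) (map (\<lambda>i. [i]) Is))"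
    by (rule m_natural) (use assms in auto)
  then show ?thesis by simp
qed

lemma m_assoc:
  assumes "\<forall>Xss\<in>set A. \<forall>Xs\<in>set Xss. \<forall>X\<in>set Xs. X \<in> Ob V"
  shows "m (concat A) \<bullet> m (map (map (\<lambda>Xs. T0 (E0 Xs))) A) = m (map concat A) \<bullet> T1 (E1 (map m A))"
  using multitensor.subst_assoc_map[OF M, of A] assms by simp

lemma m_eta:
  assumes "\<forall>Xs\<in>set Xss. \<forall>X\<in>set Xs. X \<in> Ob V"
  shows "m Xss \<bullet> \<eta> (E0 (map (\<lambda>Xs. T0 (E0 Xs)) Xss)) \<bullet> E1 (map (\<lambda>Xs. \<eta> (E0 Xs)) Xss)
    = \<eta> (E0 (concat Xss)) \<bullet> \<sigma> Xss"
  using mem assms by (simp add: composite_data_def Let_def multitensor_map_def)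

lemma m_mult:
  assumes "X \<in> Ob V"
  shows "m [[X]] \<bullet> T1 (u (T0 (E0 [X]))) \<bullet> T1 (T1 (u X)) = T1 (u X) \<bullet> \<mu> X"
  using mem assms by (simp add: composite_data_def Let_def monad_map_def)

lemma m_id:
  assumes "\<forall>X\<in>set Xs. X \<in> Ob V"
  shows "m [Xs] \<bullet> T1 (u (T0 (E0 Xs))) \<bullet> T1 (\<eta> (E0 Xs)) = Id V (T0 (E0 Xs))"
  using mem assms by (simp add: composite_data_def Let_def)

text \<open>The monad map condition gives \<mu> only with T u after it. By the identity condition
  \<open>T1 (u (E0 Xs))\<close> has the left inverse
  \<open>m [Xs] \<bullet> T1 (E1 [\<eta> (E0 Xs)])\<close> (fact 1) and can be cancelled;
  associativity of m and fact 1 under E then simplify the result.\<close>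

lemma mu_eq:
  assumes [simp]: "\<forall>X\<in>set Xs. X \<in> Ob V"
  shows "m [Xs] \<bullet> T1 (u (T0 (E0 Xs))) = \<mu> (E0 Xs)"
proof -
  have 1: "m [Xs] \<bullet> T1 (E1 [\<eta> (E0 Xs)]) \<bullet> T1 (u (E0 Xs)) = Id V (T0 (E0 Xs))"
    using m_id[of Xs] mtu_natural[of "\<eta> (E0 Xs)" "T0 (E0 Xs)", THEN T_lift] by (simp add: T.T.arr_comp)
  have 2: "m [[T0 (E0 Xs)]] \<bullet> T1 (E1 [T1 (E1 [\<eta> (E0 Xs)])]) = T1 (E1 [\<eta> (E0 Xs)]) \<bullet> m [[E0 Xs]]"
    using m_natural[of "[[E0 Xs]]" \<eta> "\<lambda>X. X" T0] by simp
  have 3: "m [Xs] \<bullet> m [[T0 (E0 Xs)]] = m [Xs] \<bullet> T1 (E1 [m [Xs]])"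
    using m_assoc[of "[[Xs]]"] by simp
  have 4: "E1 [m [Xs]] \<bullet> E1 [T1 (E1 [\<eta> (E0 Xs)])] \<bullet> E1 [T1 (u (E0 Xs))] = Id V (E0 [T0 (E0 Xs)])"
    using arg_cong[OF 1, of "\<lambda>f. E1 [f]"] by (simp add: E1_single)
  have 5: "T1 (u (T0 (E0 [E0 Xs]))) \<bullet> T1 (T1 (u (E0 Xs))) = T1 (E1 [T1 (u (E0 Xs))]) \<bullet> T1 (u (T0 (E0 Xs)))"
    using mtu_natural[of "T1 (u (E0 Xs))" "T0 (E0 [E0 Xs])", THEN T_lift] by (simp add: T.T.arr_comp)
  have "\<mu> (E0 Xs) = m [Xs] \<bullet> T1 (E1 [\<eta> (E0 Xs)]) \<bullet> T1 (u (E0 Xs)) \<bullet> \<mu> (E0 Xs)"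
    using 1[THEN reassoc, of "\<mu> (E0 Xs)"] by simp
  also have "\<dots> = m [Xs] \<bullet> T1 (E1 [\<eta> (E0 Xs)]) \<bullet> m [[E0 Xs]] \<bullet> T1 (E1 [T1 (u (E0 Xs))]) \<bullet> T1 (u (T0 (E0 Xs)))"
    using m_mult[of "E0 Xs"] 5 by simp
  also have "\<dots> = m [Xs] \<bullet> T1 (E1 [m [Xs]]) \<bullet> T1 (E1 [T1 (E1 [\<eta> (E0 Xs)])]) \<bullet> T1 (E1 [T1 (u (E0 Xs))]) \<bullet> T1 (u (T0 (E0 Xs)))"
    using 2[symmetric, THEN reassoc] 3[THEN reassoc] by simp
  also have "\<dots> = m [Xs] \<bullet> T1 (u (T0 (E0 Xs)))"
    using 4[THEN T_lift, THEN reassoc] by (simp add: T.T.arr_comp)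
  finally show ?thesis by simp
qed

text \<open>Every substitution is the extension, to a map of free T-algebras, of its restriction
  along \<eta>. By \<open>mu_eq\<close> the multiplication is itself a substitution, so this follows
  from associativity of m and the identity condition.\<close>

lemma m_absorb:
  assumes [simp]: "\<forall>Xs\<in>set Xss. \<forall>X\<in>set Xs. X \<in> Ob V"
  shows "\<mu> (E0 (concat Xss)) \<bullet> T1 (m Xss) \<bullet> T1 (\<eta> (E0 (map (\<lambda>Xs. T0 (E0 Xs)) Xss))) = m Xss"
proof -
  have 1: "u (T0 (E0 (concat Xss))) \<bullet> m Xss = E1 [m Xss] \<bullet> u (T0 (E0 (map (\<lambda>Xs. T0 (E0 Xs)) Xss)))"
    by (simp add: mtu_natural)
  have 2: "m [concat Xss] \<bullet> T1 (E1 [m Xss]) = m Xss \<bullet> m [map (\<lambda>Xs. T0 (E0 Xs)) Xss]"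
    using m_assoc[of "[Xss]"] by simp
  show ?thesis
    using 1[THEN T_lift, THEN reassoc] 2[THEN reassoc] m_id[of "map (\<lambda>Xs. T0 (E0 Xs)) Xss"]
    by (simp add: mu_eq[symmetric] T.T.arr_comp)
qed

text \<open>The condition that \<eta>E is a multitensor map is this equation restricted along
  \<eta>; \<open>m_absorb\<close> removes the restriction.\<close>

lemma sigma_eq:
  assumes [simp]: "\<forall>Xs\<in>set Xss. \<forall>X\<in>set Xs. X \<in> Ob V"
  shows "m Xss \<bullet> T1 (E1 (map (\<lambda>Xs. \<eta> (E0 Xs)) Xss)) = T1 (\<sigma> Xss)"
proof -
  have "T1 (\<sigma> Xss) = \<mu> (E0 (concat Xss)) \<bullet> T1 (\<eta> (E0 (concat Xss))) \<bullet> T1 (\<sigma> Xss)"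
    by (simp add: T.unit_right')
  also have "\<dots> = \<mu> (E0 (concat Xss)) \<bullet> T1 (m Xss) \<bullet> T1 (\<eta> (E0 (map (\<lambda>Xs. T0 (E0 Xs)) Xss)))
      \<bullet> T1 (E1 (map (\<lambda>Xs. \<eta> (E0 Xs)) Xss))"
    using arg_cong[OF m_eta[of Xss], of T1] by (simp add: T.T.arr_comp)
  also have "\<dots> = (\<mu> (E0 (concat Xss)) \<bullet> T1 (m Xss) \<bullet> T1 (\<eta> (E0 (map (\<lambda>Xs. T0 (E0 Xs)) Xss))))
      \<bullet> T1 (E1 (map (\<lambda>Xs. \<eta> (E0 Xs)) Xss))"
    by simp
  also have "\<dots> = m Xss \<bullet> T1 (E1 (map (\<lambda>Xs. \<eta> (E0 Xs)) Xss))"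
    by (simp only: m_absorb[OF assms])
  finally show ?thesis by simp
qed

text \<open>A substitution starts from T of a tensor of objects of the form
  \<open>T0 (E0 Xs)\<close>. Here u supplies a unary tensor in each entry, and \<eta> the outer
  T.\<close>

definition tau where
  "tau Xs = m (map (\<lambda>X. [X]) Xs) \<bullet> T1 (E1 (map (\<lambda>X. T1 (u X)) Xs)) \<bullet> \<eta> (E0 (map T0 Xs))"

lemma tau_typed [simp]:
  assumes [simp]: "\<forall>X\<in>set Xs. X \<in> Ob V"
  shows "tau Xs \<in> Ar V" "Dom V (tau Xs) = E0 (map T0 Xs)" "Cod V (tau Xs) = T0 (E0 Xs)"
  by (simp_all add: tau_def)

text \<open>An instance of \<open>m_absorb\<close>: extending \<open>tau\<close> to free T-algebras
  just removes the \<eta> from its definition.\<close>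

lemma mu_tau:
  assumes [simp]: "\<forall>X\<in>set Xs. X \<in> Ob V"
  shows "\<mu> (E0 Xs) \<bullet> T1 (tau Xs) = m (map (\<lambda>X. [X]) Xs) \<bullet> T1 (E1 (map (\<lambda>X. T1 (u X)) Xs))"
proof -
  have 1: "T1 (E1 (map (\<lambda>X. T1 (u X)) Xs)) \<bullet> \<eta> (E0 (map T0 Xs))
     = \<eta> (E0 (map (\<lambda>X. T0 (E0 [X])) Xs)) \<bullet> E1 (map (\<lambda>X. T1 (u X)) Xs)"
    by (simp add: T.unit_natural_rev)
  have 2: "\<mu> (E0 Xs) \<bullet> T1 (m (map (\<lambda>X. [X]) Xs)) \<bullet> T1 (\<eta> (E0 (map (\<lambda>X. T0 (E0 [X])) Xs))) = m (map (\<lambda>X. [X]) Xs)"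
    using m_absorb[of "map (\<lambda>X. [X]) Xs"] by simp
  have "\<mu> (E0 Xs) \<bullet> T1 (tau Xs) = (\<mu> (E0 Xs) \<bullet> T1 (m (map (\<lambda>X. [X]) Xs)) \<bullet> T1 (\<eta> (E0 (map (\<lambda>X. T0 (E0 [X])) Xs))))
     \<bullet> T1 (E1 (map (\<lambda>X. T1 (u X)) Xs))"
    using 1[THEN T_lift] by (simp add: tau_def T.T.arr_comp)
  then show ?thesis by (simp only: 2)
qed

text \<open>\<open>sigma_eq\<close> turns T \<sigma> into a substitution, so that associativity of m
  merges it with the one in \<open>tau\<close>. In each entry there remains \<open>m [Xs]\<close>
  after \<eta> and u, which is the identity by \<open>sigma_eq\<close> and the unit law of
  \<sigma>.\<close>

lemma sigma_tau:
  assumes [simp]: "\<forall>Xs\<in>set Xss. \<forall>X\<in>set Xs. X \<in> Ob V"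
  shows "T1 (\<sigma> Xss) \<bullet> tau (map E0 Xss) = m Xss \<bullet> \<eta> (E0 (map (\<lambda>Xs. T0 (E0 Xs)) Xss))"
proof -
  have 1: "T1 (E1 (map (\<lambda>Xs. \<eta> (E0 Xs)) Xss)) \<bullet> m (map (\<lambda>Xs. [E0 Xs]) Xss)
     = m (map (\<lambda>Xs. [T0 (E0 Xs)]) Xss) \<bullet> T1 (E1 (map (\<lambda>Xs. T1 (E1 [\<eta> (E0 Xs)])) Xss))"
    using m_natural_single[of Xss "\<lambda>Xs. \<eta> (E0 Xs)" E0 "\<lambda>Xs. T0 (E0 Xs)"] by simp
  have 2: "m Xss \<bullet> m (map (\<lambda>Xs. [T0 (E0 Xs)]) Xss) = m Xss \<bullet> T1 (E1 (map (\<lambda>Xs. m [Xs]) Xss))"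
    using m_assoc[of "map (\<lambda>Xs. [Xs]) Xss"] by simp
  have 3: "E1 (map (\<lambda>Xs. m [Xs]) Xss) \<bullet> E1 (map (\<lambda>Xs. T1 (E1 [\<eta> (E0 Xs)])) Xss)
      \<bullet> E1 (map (\<lambda>Xs. T1 (u (E0 Xs))) Xss) = Id V (E0 (map (\<lambda>Xs. T0 (E0 Xs)) Xss))"
  proof -
    have "m [Xs] \<bullet> T1 (E1 [\<eta> (E0 Xs)]) \<bullet> T1 (u (E0 Xs)) = Id V (T0 (E0 Xs))" if "Xs \<in> set Xss" for Xs
      using sigma_eq[of "[Xs]", THEN reassoc] subst_unit_outer[of Xs, THEN T_lift] that by simp
    then have "E1 (map (\<lambda>Xs. m [Xs] \<bullet> T1 (E1 [\<eta> (E0 Xs)]) \<bullet> T1 (u (E0 Xs))) Xss) = E1 (map (Id V) (map (\<lambda>Xs. T0 (E0 Xs)) Xss))"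
      by simp
    also have "\<dots> = Id V (E0 (map (\<lambda>Xs. T0 (E0 Xs)) Xss))"
      by (rule E.arr_id) simp
    finally show ?thesis
      by (simp add: E.arr_comp)
  qed
  show ?thesis
    using 1[THEN reassoc] 2[THEN reassoc] 3[THEN T_lift, THEN reassoc]
    by (simp add: tau_def sigma_eq[symmetric] T.T.arr_comp)
qed

text \<open>Moving T \<sigma> past \<mu> brings it next to \<open>tau\<close>; then
  \<open>sigma_tau\<close> and \<open>m_absorb\<close> apply. Away from sequences of objects both
  sides are undefined by extensionality.\<close>

lemma subst_of_tau: "subst_of V E T (restrict tau (lists (Ob V))) = m"
proof
  fix Xss
  show "subst_of V E T (restrict tau (lists (Ob V))) Xss = m Xss"
  proof (cases "Xss \<in> lists (lists (Ob V))")
    case True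
    then have [simp]: "\<forall>Xs\<in>set Xss. \<forall>X\<in>set Xs. X \<in> Ob V" by auto
    have "subst_of V E T (restrict tau (lists (Ob V))) Xss
        = \<mu> (E0 (concat Xss)) \<bullet> T1 (T1 (\<sigma> Xss)) \<bullet> T1 (tau (map E0 Xss))"
      by (simp add: subst_of_def T.mult_natural')
    also have "\<dots> = m Xss"
      using sigma_tau[of Xss, THEN T_lift] m_absorb[of Xss] by (simp add: T.T.arr_comp)
    finally show ?thesis .
  next
    case False
    then show ?thesis
      using mem by (auto simp: subst_of_def composite_data_def extensional_def restrict_def simp del: in_lists_conv_set)
  qed
qed

lemma tau_natural:
  assumes "\<And>i. i \<in> set Is \<Longrightarrow> f i \<in> Ar V \<and> Dom V (f i) = a i \<and> Cod V (f i) = b i"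
  shows "tau (map b Is) \<bullet> E1 (map (\<lambda>i. T1 (f i)) Is) = T1 (E1 (map f Is)) \<bullet> tau (map a Is)"
proof -
  note [simp] = assms
  have [simp]: "i \<in> set Is \<Longrightarrow> a i \<in> Ob V" "i \<in> set Is \<Longrightarrow> b i \<in> Ob V" for i
    using assms by (metis ar_ob)+
  have "E1 (map (\<lambda>i. T1 (u (b i))) Is) \<bullet> E1 (map (\<lambda>i. T1 (f i)) Is) = E1 (map (\<lambda>i. T1 (E1 [f i]) \<bullet> T1 (u (a i))) Is)"
    by (rule E_lift) (simp_all add: mtu_natural T.T.arr_comp[symmetric])
  moreover have "m (map (\<lambda>i. [b i]) Is) \<bullet> T1 (E1 (map (\<lambda>i. T1 (E1 [f i])) Is))
    = T1 (E1 (map f Is)) \<bullet> m (map (\<lambda>i. [a i]) Is)"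
    by (rule m_natural_single) simp
  note this[THEN reassoc] calculation[THEN T_lift, THEN reassoc]
  then show ?thesis
    by (simp add: tau_def E.arr_comp T.T.arr_comp T.unit_natural)
qed

text \<open>This is the multiplication square of T u, precomposed with \<eta> so that \<mu>
  cancels.\<close>

lemma tau_unit:
  assumes [simp]: "X \<in> Ob V"
  shows "tau [X] \<bullet> u (T0 X) = T1 (u X)"
proof -
  have "T1 (E1 [T1 (u X)]) \<bullet> T1 (u (T0 X)) = T1 (u (T0 (E0 [X]))) \<bullet> T1 (T1 (u X))"
    by (simp add: T.T.arr_comp[symmetric] mtu_natural)
  from this[THEN reassoc] m_mult[of X, THEN reassoc] show ?thesis
    by (simp add: tau_def T.unit_natural T.unit_left)
qed

text \<open>With each entry made a one-element sequence, the multitensor map condition for \<eta>E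
  leaves \<sigma> after u, which is the identity.\<close>

lemma tau_eta:
  assumes [simp]: "\<forall>X\<in>set Xs. X \<in> Ob V"
  shows "tau Xs \<bullet> E1 (map \<eta> Xs) = \<eta> (E0 Xs)"
proof -
  have "E1 (map (\<lambda>X. T1 (u X)) Xs) \<bullet> E1 (map \<eta> Xs) = E1 (map (\<lambda>X. \<eta> (E0 [X]) \<bullet> u X) Xs)"
    by (rule E_lift) (simp_all add: T.unit_natural)
  then show ?thesis
    using m_eta[of "map (\<lambda>X. [X]) Xs", THEN reassoc, of "E1 (map u Xs)"] subst_unit_inner[of Xs]
    by (simp add: tau_def T.unit_natural_rev' E.arr_comp)
qed

text \<open>The two \<tau> on the right give two substitutions over one-element sequences.
  Associativity of m moves the inner one under E, where the multiplication square of T u turns it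
  into \<mu>.\<close>

lemma tau_mu:
  assumes [simp]: "\<forall>X\<in>set Xs. X \<in> Ob V"
  shows "tau Xs \<bullet> E1 (map \<mu> Xs) = \<mu> (E0 Xs) \<bullet> T1 (tau Xs) \<bullet> tau (map T0 Xs)"
proof -
  have 1: "E1 (map (\<lambda>X. T1 (u X)) Xs) \<bullet> E1 (map \<mu> Xs)
     = E1 (map (\<lambda>X. m [[X]] \<bullet> T1 (u (T0 (E0 [X]))) \<bullet> T1 (T1 (u X))) Xs)"
    by (rule E_lift) (simp_all add: m_mult)
  have 2: "m (map (\<lambda>X. [X]) Xs) \<bullet> m (map (\<lambda>X. [T0 (E0 [X])]) Xs) = m (map (\<lambda>X. [X]) Xs) \<bullet> T1 (E1 (map (\<lambda>X. m [[X]]) Xs))"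
    using m_assoc[of "map (\<lambda>X. [[X]]) Xs"] by simp
  have 3: "T1 (E1 (map (\<lambda>X. T1 (u X)) Xs)) \<bullet> m (map (\<lambda>X. [T0 X]) Xs)
      = m (map (\<lambda>X. [T0 (E0 [X])]) Xs) \<bullet> T1 (E1 (map (\<lambda>X. T1 (E1 [T1 (u X)])) Xs))"
    by (rule m_natural_single[symmetric]) simp
  have 4: "E1 (map (\<lambda>X. T1 (E1 [T1 (u X)])) Xs) \<bullet> E1 (map (\<lambda>X. T1 (u (T0 X))) Xs)
     = E1 (map (\<lambda>X. T1 (u (T0 (E0 [X]))) \<bullet> T1 (T1 (u X))) Xs)"
    by (rule E_lift) (simp_all add: T.T.arr_comp[symmetric] mtu_natural)
  have "\<mu> (E0 Xs) \<bullet> T1 (tau Xs) \<bullet> tau (map T0 Xs)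
     = m (map (\<lambda>X. [X]) Xs) \<bullet> T1 (E1 (map (\<lambda>X. T1 (u X)) Xs)) \<bullet> tau (map T0 Xs)"
    using mu_tau[of Xs, THEN reassoc, of "tau (map T0 Xs)"] by simp
  also have "\<dots> = m (map (\<lambda>X. [X]) Xs) \<bullet> m (map (\<lambda>X. [T0 (E0 [X])]) Xs) \<bullet>
      T1 (E1 (map (\<lambda>X. T1 (u (T0 (E0 [X]))) \<bullet> T1 (T1 (u X))) Xs)) \<bullet> \<eta> (E0 (map (\<lambda>X. T0 (T0 X)) Xs))"
    using 3[THEN reassoc] 4[THEN T_lift, THEN reassoc] by (simp add: tau_def)
  also have "\<dots> = tau Xs \<bullet> E1 (map \<mu> Xs)"
    using 2[THEN reassoc] 1[THEN T_lift, THEN reassoc]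
    by (simp add: tau_def T.unit_natural E.arr_comp T.T.arr_comp)
  finally show ?thesis by simp
qed

text \<open>Associativity of m is applied to \<open>Xss\<close> with every entry made a one-element
  sequence. One of the resulting substitutions is preceded by \<eta> on both levels, so the
  multitensor map condition turns it back into \<sigma>.\<close>

lemma tau_subst:
  assumes [simp]: "\<forall>Xs\<in>set Xss. \<forall>X\<in>set Xs. X \<in> Ob V"
  shows "tau (concat Xss) \<bullet> \<sigma> (map (map T0) Xss) = T1 (\<sigma> Xss) \<bullet> tau (map E0 Xss) \<bullet> E1 (map tau Xss)"
proof -
  have 1: "m (map (\<lambda>X. [X]) (concat Xss)) \<bullet> m (map (map (\<lambda>X. T0 (E0 [X]))) Xss)
      = m Xss \<bullet> T1 (E1 (map (\<lambda>Xs. m (map (\<lambda>X. [X]) Xs)) Xss))"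
    using m_assoc[of "map (map (\<lambda>X. [X])) Xss"] by simp
  have 2: "E1 (map tau Xss) = E1 (map (\<lambda>Xs. m (map (\<lambda>X. [X]) Xs)) Xss)
     \<bullet> E1 (map (\<lambda>Xs. \<eta> (E0 (map (\<lambda>X. T0 (E0 [X])) Xs))) Xss) \<bullet> E1 (map (\<lambda>Xs. E1 (map (\<lambda>X. T1 (u X)) Xs)) Xss)"
    by (simp add: tau_def E.arr_comp T.unit_natural_rev)
  have 3: "m (map (map (\<lambda>X. T0 (E0 [X]))) Xss) \<bullet> \<eta> (E0 (map (\<lambda>Xs. T0 (E0 (map (\<lambda>X. T0 (E0 [X])) Xs))) Xss))
     \<bullet> E1 (map (\<lambda>Xs. \<eta> (E0 (map (\<lambda>X. T0 (E0 [X])) Xs))) Xss)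
     = \<eta> (E0 (map (\<lambda>X. T0 (E0 [X])) (concat Xss))) \<bullet> \<sigma> (map (map (\<lambda>X. T0 (E0 [X]))) Xss)"
    using m_eta[of "map (map (\<lambda>X. T0 (E0 [X]))) Xss"] by simp
  have 4: "\<sigma> (map (map (\<lambda>X. T0 (E0 [X]))) Xss) \<bullet> E1 (map (\<lambda>Xs. E1 (map (\<lambda>X. T1 (u X)) Xs)) Xss)
     = E1 (map (\<lambda>X. T1 (u X)) (concat Xss)) \<bullet> \<sigma> (map (map T0) Xss)"
    using mts_natural_map[of Xss "\<lambda>X. T1 (u X)" T0 "\<lambda>X. T0 (E0 [X])"] by simp
  have 5: "\<eta> (E0 (map (\<lambda>Xs. T0 (E0 Xs)) Xss)) \<bullet> E1 (map (\<lambda>Xs. m (map (\<lambda>X. [X]) Xs)) Xss)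
     = T1 (E1 (map (\<lambda>Xs. m (map (\<lambda>X. [X]) Xs)) Xss)) \<bullet> \<eta> (E0 (map (\<lambda>Xs. T0 (E0 (map (\<lambda>X. T0 (E0 [X])) Xs))) Xss))"
    by (simp add: T.unit_natural)
  \<comment> \<open>Naming the concatenation keeps the simp rule \<open>map_concat\<close> from
    pushing \<open>map\<close> inside it.\<close>
  define Y where "Y = concat Xss"
  have [simp]: "\<forall>X\<in>set Y. X \<in> Ob V" by (auto simp: Y_def)
  have "Cod V (\<sigma> (map (map T0) Xss)) = E0 (map T0 Y)" "\<sigma> (map (map T0) Xss) \<in> Ar V" by (simp_all add: Y_def)
  then have 6: "tau Y \<bullet> \<sigma> (map (map T0) Xss) = m (map (\<lambda>X. [X]) Y) \<bullet> \<eta> (E0 (map (\<lambda>X. T0 (E0 [X])) Y))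
     \<bullet> E1 (map (\<lambda>X. T1 (u X)) Y) \<bullet> \<sigma> (map (map T0) Xss)"
    by (simp add: tau_def T.unit_natural_rev' del: mts_typed)
  have "T1 (\<sigma> Xss) \<bullet> tau (map E0 Xss) \<bullet> E1 (map tau Xss)
     = m Xss \<bullet> \<eta> (E0 (map (\<lambda>Xs. T0 (E0 Xs)) Xss)) \<bullet> E1 (map tau Xss)"
    using sigma_tau[of Xss, THEN reassoc, of "E1 (map tau Xss)"] by simp
  also have "\<dots> = m (map (\<lambda>X. [X]) (concat Xss)) \<bullet> m (map (map (\<lambda>X. T0 (E0 [X]))) Xss)
    \<bullet> \<eta> (E0 (map (\<lambda>Xs. T0 (E0 (map (\<lambda>X. T0 (E0 [X])) Xs))) Xss))
     \<bullet> E1 (map (\<lambda>Xs. \<eta> (E0 (map (\<lambda>X. T0 (E0 [X])) Xs))) Xss) \<bullet> E1 (map (\<lambda>Xs. E1 (map (\<lambda>X. T1 (u X)) Xs)) Xss)"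
    unfolding 2 using 1[THEN reassoc] 5[THEN reassoc] by simp
  also have "\<dots> = tau (concat Xss) \<bullet> \<sigma> (map (map T0) Xss)"
    using 3[THEN reassoc, of "E1 (map (\<lambda>Xs. E1 (map (\<lambda>X. T1 (u X)) Xs)) Xss)"] 4
    6 unfolding Y_def by simp
  finally show ?thesis by simp
qed

lemma tau_monoidal: "restrict tau (lists (Ob V)) \<in> monoidal_monad_data V E T"
proof -
  have "nat_trans (seq_cat V) V (E \<circ>\<^sub>F seq_func T) (T \<circ>\<^sub>F E) (restrict tau (lists (Ob V)))"
  proof (intro nat_trans.intro nat_trans_axioms.intro
        cat_functor_comp[OF cat_functor_seq_func[OF T.unit.G.cat_functor_axioms] functor_E]
        cat_functor_comp[OF functor_E T.unit.G.cat_functor_axioms])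
    fix f a b assume "f \<in> hom (seq_cat V) a b"
    then show "restrict tau (lists (Ob V)) b \<bullet> farr (E \<circ>\<^sub>F seq_func T) f
       = farr (T \<circ>\<^sub>F E) f \<bullet> restrict tau (lists (Ob V)) a"
      using tau_natural[of f "\<lambda>x. x" "Dom V" "Cod V"] by (auto simp: hom_iff)
  qed (auto simp: hom_iff)
  then show ?thesis
    by (simp add: monoidal_monad_data_def tau_unit tau_subst tau_eta tau_mu)
qed

end

text \<open>Naturality of \<tau> along u brings u next to \<sigma>, where it cancels, while \<eta>
  passes \<tau> and cancels against \<mu>. This makes \<open>subst_of\<close> injective.\<close>

lemma (in monoidal_monad) tau_eq:
  assumes [simp]: "\<forall>X\<in>set Xs. X \<in> Ob V"
  shows "\<tau> Xs = m (map (\<lambda>X. [X]) Xs) \<bullet> T1 (E1 (map (\<lambda>X. T1 (u X)) Xs)) \<bullet> \<eta> (E0 (map T0 Xs))"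
proof -
  have 1: "\<tau> (map (\<lambda>X. E0 [X]) Xs) \<bullet> E1 (map (\<lambda>X. T1 (u X)) Xs) = T1 (E1 (map u Xs)) \<bullet> \<tau> Xs"
    using tau_natural[of Xs u "\<lambda>X. X" "\<lambda>X. E0 [X]"] by simp
  have 2: "T1 (\<tau> Xs) \<bullet> \<eta> (E0 (map T0 Xs)) = \<eta> (T0 (E0 Xs)) \<bullet> \<tau> Xs"
    by (simp add: T.unit_natural_rev)
  show ?thesis
    using 1[THEN T_lift, THEN reassoc] 2 subst_unit_inner[of Xs, THEN T_lift, THEN reassoc]
    by (simp add: m_eq T.T.arr_comp T.mult_natural' T.unit_left')
qed

section \<open>The bijection between \<tau> and \<sigma>'\<close>

context tensor_monad
begin

lemma monoidalI: "\<tau> \<in> monoidal_monad_data V E T \<Longrightarrow> monoidal_monad V E T \<tau>"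
  by (intro monoidal_monad.intro tensor_monad_axioms monoidal_monad_axioms.intro)

lemma monoidal_eqI:
  assumes "\<tau> \<in> monoidal_monad_data V E T" "\<tau>' \<in> monoidal_monad_data V E T"
    and "\<And>Xs. \<forall>X\<in>set Xs. X \<in> Ob V \<Longrightarrow> \<tau> Xs = \<tau>' Xs"
  shows "\<tau> = \<tau>'"
  using assms by (intro extensionalityI[of _ "lists (Ob V)"]) (auto simp: monoidal_monad_data_def)

theorem bij_subst_of: "bij_betw (subst_of V E T) (monoidal_monad_data V E T) (composite_data V E T)"
proof (rule bij_betw_imageI)
  show "inj_on (subst_of V E T) (monoidal_monad_data V E T)"
  proof (rule inj_onI)
    fix \<tau> \<tau>' assume d: "\<tau> \<in> monoidal_monad_data V E T" "\<tau>' \<in> monoidal_monad_data V E T"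
      and eq: "subst_of V E T \<tau> = subst_of V E T \<tau>'"
    show "\<tau> = \<tau>'"
      using monoidal_monad.tau_eq[OF monoidalI[OF d(1)]] monoidal_monad.tau_eq[OF monoidalI[OF d(2)]] eq
      by (intro monoidal_eqI[OF d])
        (simp add: monoidal_monad.m_def[OF monoidalI[OF d(1)]] monoidal_monad.m_def[OF monoidalI[OF d(2)]])
  qed
  show "subst_of V E T ` monoidal_monad_data V E T = composite_data V E T"
  proof (intro subset_antisym subsetI)
    fix m assume "m \<in> composite_data V E T"
    then interpret composite_mult V E T m
      by (intro composite_mult.intro tensor_monad_axioms composite_mult_axioms.intro)
    show "m \<in> subst_of V E T ` monoidal_monad_data V E T"
      using tau_monoidal subst_of_tau by (metis imageI)
  next
    fix m assume "m \<in> subst_of V E T ` monoidal_monad_data V E T"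
    then show "m \<in> composite_data V E T"
      using monoidal_monad.subst_of_composite[OF monoidalI] monoidal_monad.m_def[OF monoidalI] by auto
  qed
qed

end

section \<open>Graphs and walks\<close>

lemma vmap_eqI:
  assumes "f \<in> Ar (GV small V)" "g \<in> Ar (GV small V)" "vsrc f = vsrc g" "vtgt f = vtgt g"
    and "\<And>a. a \<in> verts (vsrc f) \<Longrightarrow> vfun f a = vfun g a"
    and "\<And>a b. a \<in> verts (vsrc f) \<Longrightarrow> b \<in> verts (vsrc f) \<Longrightarrow> vmor f (a, b) = vmor g (a, b)"
  shows "f = g"
proof (rule vmap.equality)
  show "vfun f = vfun g"
    using assms by (intro PiE_ext[of _ "verts (vsrc f)" "\<lambda>_. verts (vtgt f)"]) (auto simp: GV_def)
  show "vmor f = vmor g"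
    by (rule extensionalityI[of _ "vpairs (vsrc f)"]) (use assms in \<open>auto simp: GV_def PiE_def\<close>)
qed (use assms in auto)

lemma GV_simps [simp]:
  "Ob (GV small V) = vgraphs small V" "Dom (GV small V) = vsrc" "Cod (GV small V) = vtgt"
  "vsrc (Id (GV small V) X) = X" "vtgt (Id (GV small V) X) = X"
  "vfun (Id (GV small V) X) = (\<lambda>a\<in>verts X. a)"
  "vmor (Id (GV small V) X) = (\<lambda>p\<in>vpairs X. Id V (edge X p))"
  "vsrc (Comp (GV small V) g f) = vsrc f" "vtgt (Comp (GV small V) g f) = vtgt g"
  "vfun (Comp (GV small V) g f) = (\<lambda>a\<in>verts (vsrc f). vfun g (vfun f a))"
  "vmor (Comp (GV small V) g f) = (\<lambda>p\<in>vpairs (vsrc f). Comp V (vmor g (map_prod (vfun f) (vfun f) p)) (vmor f p))"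
  by (auto simp: GV_def)

lemma vgraphs_edge [simp]: "X \<in> vgraphs small V \<Longrightarrow> a \<in> verts X \<Longrightarrow> b \<in> verts X \<Longrightarrow> edge X (a, b) \<in> Ob V"
  by (auto simp: vgraphs_def)

lemma GV_arD:
  assumes "f \<in> Ar (GV small V)"
  shows "vsrc f \<in> vgraphs small V" "vtgt f \<in> vgraphs small V"
    "a \<in> verts (vsrc f) \<Longrightarrow> vfun f a \<in> verts (vtgt f)"
    "a \<in> verts (vsrc f) \<Longrightarrow> b \<in> verts (vsrc f) \<Longrightarrow> vmor f (a, b) \<in> Ar V"
    "a \<in> verts (vsrc f) \<Longrightarrow> b \<in> verts (vsrc f) \<Longrightarrow> Dom V (vmor f (a, b)) = edge (vsrc f) (a, b)"
    "a \<in> verts (vsrc f) \<Longrightarrow> b \<in> verts (vsrc f) \<Longrightarrow> Cod V (vmor f (a, b)) = edge (vtgt f) (vfun f a, vfun f b)"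
    "vfun f \<in> extensional (verts (vsrc f))" "vmor f \<in> extensional (vpairs (vsrc f))"
  using assms by (auto simp: GV_def hom_iff PiE_def Pi_def split_paired_all)

lemma GV_arI:
  assumes "vsrc f \<in> vgraphs small V" "vtgt f \<in> vgraphs small V"
    "vfun f \<in> extensional (verts (vsrc f))" "vmor f \<in> extensional (vpairs (vsrc f))"
    "\<And>a. a \<in> verts (vsrc f) \<Longrightarrow> vfun f a \<in> verts (vtgt f)"
    "\<And>a b. a \<in> verts (vsrc f) \<Longrightarrow> b \<in> verts (vsrc f) \<Longrightarrow>
       vmor f (a, b) \<in> hom V (edge (vsrc f) (a, b)) (edge (vtgt f) (vfun f a, vfun f b))"
  shows "f \<in> Ar (GV small V)"
  using assms by (auto simp: GV_def PiE_def Pi_def)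

lemma category_GV:
  assumes "category V"
  shows "category (GV small V)"
proof -
  interpret category V by fact
  note [simp] = GV_arD
  show ?thesis
  proof
    fix a assume "a \<in> Ob (GV small V)"
    then show "Id (GV small V) a \<in> hom (GV small V) a a"
      by (auto simp: hom_iff intro!: GV_arI)
  next
    fix f g a b c assume "f \<in> hom (GV small V) a b" "g \<in> hom (GV small V) b c"
    then show "Comp (GV small V) g f \<in> hom (GV small V) a c"
      by (auto simp: hom_iff intro!: GV_arI)
  next
    fix f a b assume f: "f \<in> hom (GV small V) a b"
    then have 1: "Comp (GV small V) (Id (GV small V) b) f \<in> Ar (GV small V)"
      "Comp (GV small V) f (Id (GV small V) a) \<in> Ar (GV small V)"
      by (auto simp: hom_iff intro!: GV_arI)
    show "Comp (GV small V) (Id (GV small V) b) f = f" "Comp (GV small V) f (Id (GV small V) a) = f"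
      by (rule vmap_eqI; use 1 f in \<open>auto simp: hom_iff\<close>)+
  next
    fix f g h a b c d
    assume fgh: "f \<in> hom (GV small V) a b" "g \<in> hom (GV small V) b c" "h \<in> hom (GV small V) c d"
    then have 1: "Comp (GV small V) (Comp (GV small V) h g) f \<in> Ar (GV small V)"
      "Comp (GV small V) h (Comp (GV small V) g f) \<in> Ar (GV small V)"
      by (auto simp: hom_iff intro!: GV_arI)
    show "Comp (GV small V) (Comp (GV small V) h g) f = Comp (GV small V) h (Comp (GV small V) g f)"
      by (rule vmap_eqI; use 1 fgh in \<open>auto simp: hom_iff\<close>)+
  qed (auto simp: hom_iff)
qed

lemma G_simps [simp]:
  "verts (G_obj F X) = verts X" "edge (G_obj F X) = (\<lambda>p\<in>vpairs X. fobj F (edge X p))"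
  "fobj (G_func F) = G_obj F"
  "vsrc (farr (G_func F) f) = G_obj F (vsrc f)" "vtgt (farr (G_func F) f) = G_obj F (vtgt f)"
  "vfun (farr (G_func F) f) = vfun f" "vmor (farr (G_func F) f) = (\<lambda>p\<in>vpairs (vsrc f). farr F (vmor f p))"
  "vsrc (G_trans F G t X) = G_obj F X" "vtgt (G_trans F G t X) = G_obj G X"
  "vfun (G_trans F G t X) = (\<lambda>a\<in>verts X. a)" "vmor (G_trans F G t X) = (\<lambda>p\<in>vpairs X. t (edge X p))"
  "fobj (G_monad T) = G_obj T" "farr (G_monad T) = farr (G_func T)"
  "m_unit (G_monad T) = G_trans (id_func :: ('o, 'm, 'o, 'm) func) T (m_unit T)"
  "m_mult (G_monad T) = G_trans (T \<circ>\<^sub>F T) T (m_mult T)"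
  by (auto simp: G_obj_def G_func_def G_trans_def G_monad_def)

lemma G_obj_vgraphs: "cat_functor A B F \<Longrightarrow> X \<in> vgraphs small A \<Longrightarrow> G_obj F X \<in> vgraphs small B"
  by (auto simp: vgraphs_def cat_functor.fobj_ob)

lemma G_obj_eqI:
  assumes "verts X = verts Y" "\<And>a b. a \<in> verts X \<Longrightarrow> b \<in> verts X \<Longrightarrow> edge X (a, b) = edge Y (a, b)"
    "edge X \<in> extensional (vpairs X)" "edge Y \<in> extensional (vpairs Y)"
  shows "X = Y"
  using assms by (intro vgraph.equality extensionalityI[of _ "vpairs X"]) auto

lemma vgraphs_extensional: "X \<in> vgraphs small V \<Longrightarrow> edge X \<in> extensional (vpairs X)"
  by (auto simp: vgraphs_def PiE_def)

text \<open>The unit of \<open>G_monad T\<close> at X starts from \<open>G_obj id_func X\<close>;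
  since the homs of a V-graph form an extensional function, this graph is X itself.\<close>

lemma G_obj_id [simp]: "edge X \<in> extensional (vpairs X) \<Longrightarrow> G_obj id_func X = X"
  by (rule G_obj_eqI) auto

lemma G_obj_comp [simp]: "G_obj (G \<circ>\<^sub>F F) X = G_obj G (G_obj F X)"
  by (rule G_obj_eqI) auto

lemma cat_functor_G:
  assumes "cat_functor A B F"
  shows "cat_functor (GV small A) (GV small B) (G_func F)"
proof -
  interpret cat_functor A B F by fact
  interpret F: ctx_functor A B F by unfold_locales
  interpret GA: category "GV small A" by (rule category_GV[OF A.category_axioms])
  interpret GB: category "GV small B" by (rule category_GV[OF B.category_axioms])
  note [simp] = GV_arD G_obj_vgraphs[OF assms]
  have ar: "farr (G_func F) f \<in> Ar (GV small B)" if "f \<in> Ar (GV small A)" for f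
    using that by (intro GV_arI) (auto simp: hom_iff)
  show ?thesis
  proof
    fix f a b assume "f \<in> hom (GV small A) a b"
    then show "farr (G_func F) f \<in> hom (GV small B) (fobj (G_func F) a) (fobj (G_func F) b)"
      using ar by (auto simp: hom_iff)
  next
    fix a assume a: "a \<in> Ob (GV small A)"
    then show "farr (G_func F) (Id (GV small A) a) = Id (GV small B) (fobj (G_func F) a)"
      by (intro vmap_eqI[where small = small and V = B] ar GA.id_typed GB.id_typed) auto
  next
    fix f g a b c assume "f \<in> hom (GV small A) a b" "g \<in> hom (GV small A) b c"
    then show "farr (G_func F) (Comp (GV small A) g f) = Comp (GV small B) (farr (G_func F) g) (farr (G_func F) f)"
      by (intro vmap_eqI[where small = small and V = B] ar GA.comp_typed GB.comp_typed) (auto simp: hom_iff F.arr_comp)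
  qed auto
qed

lemma monad_G:
  assumes "monad V T"
  shows "monad (GV small V) (G_monad T)"
proof -
  interpret monad V T by fact
  interpret GV: category "GV small V" by (rule category_GV[OF category_axioms])
  interpret G: cat_functor "GV small V" "GV small V" "G_func T"
    by (rule cat_functor_G[OF unit.G.cat_functor_axioms])
  interpret G: ctx_functor "GV small V" "GV small V" "G_func T" by unfold_locales
  have GT: "cat_functor (GV small V) (GV small V) (G_monad T)"
    using G.cat_functor_axioms by (simp add: cat_functor_def cat_functor_axioms_def)
  note [simp] = GV_arD G_obj_vgraphs[OF unit.G.cat_functor_axioms] G_obj_vgraphs[OF cat_functor_id[OF category_axioms]]
  have u: "m_unit (G_monad T) X \<in> Ar (GV small V)" if "X \<in> vgraphs small V" for X
    using that by (intro GV_arI) (auto simp: hom_iff)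
  have m: "m_mult (G_monad T) X \<in> Ar (GV small V)" if "X \<in> vgraphs small V" for X
    using that by (intro GV_arI) (auto simp: hom_iff)
  note um = u[simplified] m[simplified]
  note I = vmap_eqI[where small = small and V = V] GV.comp_typed G.arr um GV.id_typed
  show ?thesis
  proof (intro monad.intro monad_axioms.intro nat_trans.intro nat_trans_axioms.intro GV.category_axioms
      cat_functor_id GT cat_functor_comp[OF GT GT])
    fix X assume "X \<in> Ob (GV small V)"
    then have X [simp]: "X \<in> vgraphs small V" "edge X \<in> extensional (vpairs X)"
      by (auto dest: vgraphs_extensional)
    note [simp] = vgraphs_edge[OF X(1)]
    show "m_unit (G_monad T) X \<in> hom (GV small V) (fobj id_func X) (fobj (G_monad T) X)"
      "m_mult (G_monad T) X \<in> hom (GV small V) (fobj (G_monad T \<circ>\<^sub>F G_monad T) X) (fobj (G_monad T) X)"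
      by (auto simp: hom_iff um)
    show "GV.cmp (m_mult (G_monad T) X) (m_unit (G_monad T) (fobj (G_monad T) X)) = Id (GV small V) (fobj (G_monad T) X)"
      by (simp, intro I) (auto simp: um unit_left)
    show "GV.cmp (m_mult (G_monad T) X) (farr (G_monad T) (m_unit (G_monad T) X)) = Id (GV small V) (fobj (G_monad T) X)"
      by (simp, intro I) (auto simp: um unit_right)
    show "GV.cmp (m_mult (G_monad T) X) (m_mult (G_monad T) (fobj (G_monad T) X))
        = GV.cmp (m_mult (G_monad T) X) (farr (G_monad T) (m_mult (G_monad T) X))"
      by (simp, intro I) (auto simp: um mult_assoc)
  next
    fix f X Y assume "f \<in> hom (GV small V) X Y"
    then have f [simp]: "f \<in> Ar (GV small V)" "vsrc f = X" "vtgt f = Y" "X \<in> vgraphs small V" "Y \<in> vgraphs small V"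
      by (auto simp: hom_iff)
    note [simp] = vgraphs_extensional[OF f(4)] vgraphs_extensional[OF f(5)] vgraphs_edge[OF f(4)] vgraphs_edge[OF f(5)]
    note f' = GV_arD(3-6)[OF f(1), unfolded f(2,3)]
    show "GV.cmp (m_unit (G_monad T) Y) (farr id_func f) = GV.cmp (farr (G_monad T) f) (m_unit (G_monad T) X)"
      by (simp, intro I) (auto simp: um f' unit_natural)
    show "GV.cmp (m_mult (G_monad T) Y) (farr (G_monad T \<circ>\<^sub>F G_monad T) f) = GV.cmp (farr (G_monad T) f) (m_mult (G_monad T) X)"
      by (simp, intro I) (auto simp: um f' mult_natural)
  qed
qed

lemma walks_simps:
  "xs \<in> walks X \<longleftrightarrow> xs \<noteq> [] \<and> (\<forall>x\<in>set xs. x \<in> verts X)"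
  "xs \<in> walks_between X p \<longleftrightarrow> xs \<noteq> [] \<and> (\<forall>x\<in>set xs. x \<in> verts X) \<and> (hd xs, last xs) = p"
  by (auto simp: walks_def walks_between_def)

lemma steps_simps [simp]: "steps [] = []" "steps [a] = []" "steps (a # b # xs) = (a, b) # steps (b # xs)"
  by (auto simp: steps_def)

lemma length_steps: "length (steps xs) = length xs - 1"
  by (simp add: steps_def)

lemma steps_map: "steps (map f xs) = map (map_prod f f) (steps xs)"
  by (simp add: steps_def map_tl[symmetric] zip_map_map map_prod_def)

lemma steps_set: "p \<in> set (steps xs) \<Longrightarrow> fst p \<in> set xs \<and> snd p \<in> set xs"
  unfolding steps_def by (metis in_set_zipE list.set_sel(2) list.sel(2) prod.collapse)

text \<open>The last vertex of \<open>ys\<close> is repeated in front of \<open>zs\<close>, because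
  the step across the junction lies in neither list.\<close>

lemma steps_append: "ys \<noteq> [] \<Longrightarrow> steps (ys @ zs) = steps ys @ steps (last ys # zs)"
  by (induction ys rule: induct_list012) auto

lemma walk_edges_simps [simp]: "walk_edges X [a] = []" "walk_edges X (a # b # xs) = edge X (a, b) # walk_edges X (b # xs)"
  by (auto simp: walk_edges_def)

lemma steps_walk: "xs \<in> walks X \<Longrightarrow> (a, b) \<in> set (steps xs) \<Longrightarrow> a \<in> verts X \<and> b \<in> verts X"
  using steps_set[of "(a, b)" xs] by (auto simp: walks_simps)

lemma walk_edges_ob:
  assumes "X \<in> vgraphs small V" "xs \<in> walks X"
  shows "\<forall>A\<in>set (walk_edges X xs). A \<in> Ob V"
  using steps_walk[OF assms(2)] assms(1) by (auto simp: walk_edges_def)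

lemma walk_ends: "xs \<in> walks X \<Longrightarrow> hd xs \<in> verts X" "xs \<in> walks X \<Longrightarrow> last xs \<in> verts X"
  by (auto simp: walks_simps)

lemma walks_G_obj [simp]: "walks (G_obj F X) = walks X" "walks_between (G_obj F X) p = walks_between X p"
  by (auto simp: walks_simps)

lemma nested_walk_G_obj [simp]: "nested_walk (G_obj F X) = nested_walk X"
  by (auto simp: nested_walk_def fun_eq_iff)

lemma walk_edges_G_obj: "xs \<in> walks X \<Longrightarrow> walk_edges (G_obj F X) xs = map (fobj F) (walk_edges X xs)"
  using steps_walk[of xs X] by (auto simp: walk_edges_def)

lemma walks_map: "f \<in> Ar (GV small V) \<Longrightarrow> xs \<in> walks (vsrc f) \<Longrightarrow> map (vfun f) xs \<in> walks (vtgt f)"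
  by (auto simp: walks_simps GV_arD)

lemma walk_map_ends: "xs \<in> walks X \<Longrightarrow> hd (map f xs) = f (hd xs)" "xs \<in> walks X \<Longrightarrow> last (map f xs) = f (last xs)"
  by (auto simp: walks_simps hd_map last_map)

lemma walk_edges_map:
  assumes "f \<in> Ar (GV small V)" "xs \<in> walks (vsrc f)"
  shows "map (\<lambda>p. Dom V (vmor f p)) (steps xs) = walk_edges (vsrc f) xs"
    "map (\<lambda>p. Cod V (vmor f p)) (steps xs) = walk_edges (vtgt f) (map (vfun f) xs)"
    "\<forall>p\<in>set (steps xs). vmor f p \<in> Ar V"
  using steps_walk[OF assms(2)] assms(1) by (auto simp: walk_edges_def steps_map GV_arD)

lemma nested_walk_induct [consumes 1, case_names single step]:
  assumes "nested_walk X xs yss"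
    and "\<And>a. a \<in> verts X \<Longrightarrow> P [a] []"
    and "\<And>a b xs ys yss. ys \<in> walks_between X (a, b) \<Longrightarrow> a \<in> verts X \<Longrightarrow> nested_walk X (b # xs) yss \<Longrightarrow> P (b # xs) yss
      \<Longrightarrow> P (a # b # xs) (ys # yss)"
  shows "P xs yss"
  using assms(1)
proof (induction xs arbitrary: yss rule: induct_list012)
  case (3 a b xs)
  then obtain ys yss' where "yss = ys # yss'" "ys \<in> walks_between X (a, b)" "nested_walk X (b # xs) yss'" "a \<in> verts X"
    by (auto simp: nested_walk_def list_all2_Cons2 walks_simps)
  then show ?case using 3 assms(3) by blast
qed (auto simp: nested_walk_def walks_simps intro: assms(2))

text \<open>The vertex b both ends \<open>ys\<close> and heads the joined remainder;
  \<open>tl\<close> drops the second copy.\<close>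

lemma join_walk_Cons: "ys \<in> walks_between X (a, b) \<Longrightarrow> join_walk (a # b # xs) (ys # yss) = ys @ tl (join_walk (b # xs) yss)"
  by (cases ys) (auto simp: join_walk_def walks_simps)

text \<open>Neighbouring inner walks share a vertex but no step, so their steps are simply
  concatenated. This matches the edges of the joined walk with the target of \<sigma>.\<close>

lemma join_walk_props:
  assumes "nested_walk X xs yss"
  shows "join_walk xs yss \<in> walks X \<and> hd (join_walk xs yss) = hd xs \<and> last (join_walk xs yss) = last xs \<and>
    steps (join_walk xs yss) = concat (map steps yss)"
  using assms
proof (induction rule: nested_walk_induct)
  case (step a b xs ys yss)
  obtain zs where zs: "join_walk (b # xs) yss = b # zs"
    by (simp add: join_walk_def)
  show ?case
    using step zs by (auto simp: join_walk_Cons[OF step(1)] steps_append walks_simps split: if_splits)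
qed (auto simp: join_walk_def walks_simps)

text \<open>These are the typing facts for the associativity law of an E-category: by the last one,
  \<open>E1 (map \<kappa> yss)\<close> ends where \<kappa> of the outer walk starts.\<close>

lemma nested_walkD:
  assumes "nested_walk X xs yss"
  shows "xs \<in> walks X" "\<And>ys. ys \<in> set yss \<Longrightarrow> ys \<in> walks X" "join_walk xs yss \<in> walks X"
    "hd (join_walk xs yss) = hd xs" "last (join_walk xs yss) = last xs"
    "walk_edges X (join_walk xs yss) = concat (map (walk_edges X) yss)"
    "map (\<lambda>ys. (hd ys, last ys)) yss = steps xs"
    "map (\<lambda>ys. edge X (hd ys, last ys)) yss = walk_edges X xs"
proof -
  show "xs \<in> walks X" using assms by (simp add: nested_walk_def)
  show "ys \<in> walks X" if "ys \<in> set yss" for ys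
    using assms that by (auto simp: nested_walk_def list_all2_conv_all_nth walks_between_def in_set_conv_nth)
  show s: "map (\<lambda>ys. (hd ys, last ys)) yss = steps xs"
    using assms by (intro nth_equalityI) (auto simp: nested_walk_def list_all2_conv_all_nth walks_between_def)
  have "map (\<lambda>ys. edge X (hd ys, last ys)) yss = map (edge X) (map (\<lambda>ys. (hd ys, last ys)) yss)"
    by simp
  then show "map (\<lambda>ys. edge X (hd ys, last ys)) yss = walk_edges X xs"
    by (simp only: s walk_edges_def)
  show "walk_edges X (join_walk xs yss) = concat (map (walk_edges X) yss)"
    using join_walk_props[OF assms] by (simp add: walk_edges_def)
qed (use join_walk_props[OF assms] in auto)

lemma walk_map_restrict_id: "xs \<in> walks X \<Longrightarrow> map (\<lambda>a\<in>verts X. a) xs = xs"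
  by (auto simp: walks_simps intro: map_idI)

lemma steps_map_restrict: "xs \<in> walks X \<Longrightarrow> map (\<lambda>p\<in>vpairs X. h (edge X p)) (steps xs) = map h (walk_edges X xs)"
  using steps_walk[of xs X] by (auto simp: walk_edges_def)

lemma steps_restrict: "xs \<in> walks X \<Longrightarrow> map (restrict h (vpairs X)) (steps xs) = map h (steps xs)"
  using steps_walk[of xs X] by auto

section \<open>Categories of structured objects\<close>

lemma struct_cat_simps [simp]:
  "Ob (struct_cat C S U P) = S"
  "(s, t, f) \<in> Ar (struct_cat C S U P) \<longleftrightarrow> s \<in> S \<and> t \<in> S \<and> f \<in> hom C (U s) (U t) \<and> P s t f"
  "Dom (struct_cat C S U P) = (\<lambda>(s, t, f). s)"
  "Cod (struct_cat C S U P) = (\<lambda>(s, t, f). t)"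
  "Id (struct_cat C S U P) = (\<lambda>s. (s, s, Id C (U s)))"
  "Comp (struct_cat C S U P) = (\<lambda>(s', t', g) (s, t, f). (s, t', Comp C g f))"
  by (auto simp: struct_cat_def)

lemma category_struct_cat:
  assumes "category C"
    and U: "\<And>s. s \<in> S \<Longrightarrow> U s \<in> Ob C"
    and id: "\<And>s. s \<in> S \<Longrightarrow> P s s (Id C (U s))"
    and comp: "\<And>r s t f g. r \<in> S \<Longrightarrow> s \<in> S \<Longrightarrow> t \<in> S \<Longrightarrow> f \<in> hom C (U r) (U s) \<Longrightarrow> g \<in> hom C (U s) (U t) \<Longrightarrow>
      P r s f \<Longrightarrow> P s t g \<Longrightarrow> P r t (Comp C g f)"
  shows "category (struct_cat C S U P)"
proof -
  interpret category C by fact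
  show ?thesis
  proof
    fix f g a b c
    assume "f \<in> hom (struct_cat C S U P) a b" "g \<in> hom (struct_cat C S U P) b c"
    then show "Comp (struct_cat C S U P) g f \<in> hom (struct_cat C S U P) a c"
      by (cases f; cases g) (auto simp: hom_iff[of _ "struct_cat C S U P"] intro: comp comp_hom)
  qed (auto simp: hom_iff[of _ "struct_cat C S U P"] U id id_hom comp_id_left comp_id_right intro: comp_assoc)
qed

text \<open>The monad equations are equations between underlying arrows, so they are inherited from
  T. Once P is closed under identities and composition, it remains to supply that T, its unit and
  its multiplication respect P.\<close>

lemma struct_monad:
  assumes "monad C T"
    and U: "\<And>s. s \<in> S \<Longrightarrow> U s \<in> Ob C"
    and id: "\<And>s. s \<in> S \<Longrightarrow> P s s (Id C (U s))"
    and comp: "\<And>r s t f g. r \<in> S \<Longrightarrow> s \<in> S \<Longrightarrow> t \<in> S \<Longrightarrow> f \<in> hom C (U r) (U s) \<Longrightarrow> g \<in> hom C (U s) (U t) \<Longrightarrow>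
      P r s f \<Longrightarrow> P s t g \<Longrightarrow> P r t (Comp C g f)"
    and L: "\<And>s. s \<in> S \<Longrightarrow> L s \<in> S" "\<And>s. s \<in> S \<Longrightarrow> U (L s) = fobj T (U s)"
    and P: "\<And>s t f. s \<in> S \<Longrightarrow> t \<in> S \<Longrightarrow> f \<in> hom C (U s) (U t) \<Longrightarrow> P s t f \<Longrightarrow> P (L s) (L t) (farr T f)"
      "\<And>s. s \<in> S \<Longrightarrow> P s (L s) (m_unit T (U s))" "\<And>s. s \<in> S \<Longrightarrow> P (L (L s)) (L s) (m_mult T (U s))"
  shows "monad (struct_cat C S U P) \<lparr>fobj = restrict L S,
    farr = (\<lambda>(s, t, f)\<in>Ar (struct_cat C S U P). (L s, L t, farr T f)),
    m_unit = (\<lambda>s\<in>S. (s, L s, m_unit T (U s))), m_mult = (\<lambda>s\<in>S. (L (L s), L s, m_mult T (U s)))\<rparr>"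
    (is "monad ?D ?M")
proof -
  interpret T: monad C T by fact
  interpret D: category ?D by (rule category_struct_cat[OF T.category_axioms]) (use U id comp in auto)
  note [simp] = U L P id
  have F: "cat_functor ?D ?D ?M"
    by unfold_locales (auto simp: hom_iff T.T.arr_comp dest: comp[unfolded hom_iff])
  show ?thesis
    by (intro monad.intro monad_axioms.intro nat_trans.intro nat_trans_axioms.intro D.category_axioms
      cat_functor_id F cat_functor_comp[OF F F])
      (auto simp: hom_iff T.unit_natural T.mult_natural T.unit_left T.unit_right T.mult_assoc)
qed

section \<open>The category of \<open>E\<close>-categories\<close>

text \<open>The predicate of \<open>ECat\<close> without pattern matching on its first two
  arguments, so that \<open>ECat\<close> becomes a \<open>struct_cat\<close> over a named
  predicate.\<close>

definition efun :: "('o, 'm) cat \<Rightarrow> ('o, 'm) multitensor_struct \<Rightarrow> ('a, 'o) vgraph \<times> ('a list \<Rightarrow> 'm)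
    \<Rightarrow> ('a, 'o) vgraph \<times> ('a list \<Rightarrow> 'm) \<Rightarrow> ('a, 'o, 'm) vmap \<Rightarrow> bool" where
  "efun V E A B f \<longleftrightarrow> (\<forall>xs\<in>walks (fst A). Comp V (vmor f (hd xs, last xs)) (snd A xs)
     = Comp V (snd B (map (vfun f) xs)) (farr E (map (vmor f) (steps xs))))"

lemma ECat_eq: "ECat small V E = struct_cat (GV small V) (ecats small V E) fst (efun V E)"
  unfolding ECat_def efun_def[abs_def] by (rule arg_cong[where f = "struct_cat _ _ _"]) (auto simp: fun_eq_iff)

context multitensor
begin

lemma ecatsD:
  assumes "(X, \<kappa>) \<in> ecats small V E"
  shows "X \<in> vgraphs small V" "\<kappa> \<in> extensional (walks X)"
    "\<And>xs. xs \<in> walks X \<Longrightarrow> \<kappa> xs \<in> Ar V"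
    "\<And>xs. xs \<in> walks X \<Longrightarrow> Dom V (\<kappa> xs) = E0 (walk_edges X xs)"
    "\<And>xs. xs \<in> walks X \<Longrightarrow> Cod V (\<kappa> xs) = edge X (hd xs, last xs)"
    "\<And>a b. a \<in> verts X \<Longrightarrow> b \<in> verts X \<Longrightarrow> \<kappa> [a, b] \<bullet> u (edge X (a, b)) = Id V (edge X (a, b))"
    "\<And>xs yss. nested_walk X xs yss \<Longrightarrow> \<kappa> (join_walk xs yss) \<bullet> \<sigma> (map (walk_edges X) yss) = \<kappa> xs \<bullet> E1 (map \<kappa> yss)"
  using assms by (auto simp: ecats_def hom_iff PiE_def Pi_def)

lemma ecatsI:
  assumes "X \<in> vgraphs small V" "\<kappa> \<in> extensional (walks X)"
    "\<And>xs. xs \<in> walks X \<Longrightarrow> \<kappa> xs \<in> Ar V"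
    "\<And>xs. xs \<in> walks X \<Longrightarrow> Dom V (\<kappa> xs) = E0 (walk_edges X xs)"
    "\<And>xs. xs \<in> walks X \<Longrightarrow> Cod V (\<kappa> xs) = edge X (hd xs, last xs)"
    "\<And>a b. a \<in> verts X \<Longrightarrow> b \<in> verts X \<Longrightarrow> \<kappa> [a, b] \<bullet> u (edge X (a, b)) = Id V (edge X (a, b))"
    "\<And>xs yss. nested_walk X xs yss \<Longrightarrow> \<kappa> (join_walk xs yss) \<bullet> \<sigma> (map (walk_edges X) yss) = \<kappa> xs \<bullet> E1 (map \<kappa> yss)"
  shows "(X, \<kappa>) \<in> ecats small V E"
  using assms by (auto simp: ecats_def hom_iff PiE_def Pi_def)

lemma E1_graph_map:
  assumes "f \<in> Ar (GV small V)" "xs \<in> walks (vsrc f)"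
  shows "E1 (map (vmor f) (steps xs)) \<in> Ar V"
    "Dom V (E1 (map (vmor f) (steps xs))) = E0 (walk_edges (vsrc f) xs)"
    "Cod V (E1 (map (vmor f) (steps xs))) = E0 (walk_edges (vtgt f) (map (vfun f) xs))"
  using walk_edges_map[OF assms] by auto

lemma ecats_vgraphs: "A \<in> ecats small V E \<Longrightarrow> fst A \<in> vgraphs small V"
  by (auto simp: ecats_def)

lemma efun_id:
  assumes A: "A \<in> ecats small V E"
  shows "efun V E A A (Id (GV small V) (fst A))"
proof -
  obtain X \<kappa> where [simp]: "A = (X, \<kappa>)" by (cases A)
  note D = ecatsD[OF A[simplified]]
  show ?thesis
    unfolding efun_def
  proof
    fix xs assume xs: "xs \<in> walks (fst A)"
    have "map (\<lambda>a\<in>verts X. a) xs = xs"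
      using xs by (auto simp: walks_simps intro: map_idI)
    moreover have "map (\<lambda>p\<in>vpairs X. Id V (edge X p)) (steps xs) = map (Id V) (walk_edges X xs)"
      using steps_walk[of xs X] xs by (auto simp: walk_edges_def)
    ultimately show "vmor (Id (GV small V) (fst A)) (hd xs, last xs) \<bullet> snd A xs
        = snd A (map (vfun (Id (GV small V) (fst A))) xs) \<bullet> E1 (map (vmor (Id (GV small V) (fst A))) (steps xs))"
      using xs D walk_edges_ob[OF D(1), of xs] by (simp add: walk_ends)
  qed
qed

text \<open>The two E-functor squares are pasted. They fit because the steps of the image walk are
  the images of the steps, so that \<open>E1\<close> of the composite splits.\<close>

lemma efun_comp:
  assumes A: "A \<in> ecats small V E" and B: "B \<in> ecats small V E" and C: "C \<in> ecats small V E"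
    and f: "f \<in> hom (GV small V) (fst A) (fst B)" and g: "g \<in> hom (GV small V) (fst B) (fst C)"
    and ef: "efun V E A B f" and eg: "efun V E B C g"
  shows "efun V E A C (Comp (GV small V) g f)"
proof -
  obtain X \<kappa> Y \<kappa>' Z \<kappa>'' where [simp]: "A = (X, \<kappa>)" "B = (Y, \<kappa>')" "C = (Z, \<kappa>'')"
    by (cases A; cases B; cases C)
  note D = ecatsD[OF A[simplified]] ecatsD[OF B[simplified]] ecatsD[OF C[simplified]]
  have f' [simp]: "f \<in> Ar (GV small V)" "vsrc f = X" "vtgt f = Y"
    and g' [simp]: "g \<in> Ar (GV small V)" "vsrc g = Y" "vtgt g = Z"
    using f g by (auto simp: hom_iff)
  show ?thesis
    unfolding efun_def
  proof
    fix xs assume xs': "xs \<in> walks (fst A)"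
    then have xs: "xs \<in> walks X" by simp
    then have ys: "map (vfun f) xs \<in> walks Y"
      using walks_map[OF f'(1)] by simp
    note e = walk_map_ends[OF xs] walk_ends[OF xs] walk_ends[OF ys]
    have 1: "vmor g (vfun f (hd xs), vfun f (last xs)) \<bullet> \<kappa>' (map (vfun f) xs)
        = \<kappa>'' (map (vfun g) (map (vfun f) xs)) \<bullet> E1 (map (vmor g) (map (map_prod (vfun f) (vfun f)) (steps xs)))"
      using eg ys unfolding efun_def steps_map[symmetric] by (auto simp: e simp del: map_map)
    have 2: "vmor f (hd xs, last xs) \<bullet> \<kappa> xs = \<kappa>' (map (vfun f) xs) \<bullet> E1 (map (vmor f) (steps xs))"
      using ef xs unfolding efun_def by simp
    have 3: "E1 (map (\<lambda>p\<in>vpairs X. vmor g (map_prod (vfun f) (vfun f) p) \<bullet> vmor f p) (steps xs))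
        = E1 (map (vmor g) (map (map_prod (vfun f) (vfun f)) (steps xs))) \<bullet> E1 (map (vmor f) (steps xs))"
    proof -
      have "E1 (map (\<lambda>p\<in>vpairs X. vmor g (map_prod (vfun f) (vfun f) p) \<bullet> vmor f p) (steps xs))
        = E1 (map (\<lambda>p. vmor g (map_prod (vfun f) (vfun f) p) \<bullet> vmor f p) (steps xs))"
        using steps_walk[OF xs] by (intro arg_cong[where f = E1]) auto
      also have "\<dots> = E1 (map (\<lambda>p. vmor g (map_prod (vfun f) (vfun f) p)) (steps xs)) \<bullet> E1 (map (vmor f) (steps xs))"
        by (rule E.arr_comp)
          (use steps_walk[OF xs] GV_arD(3-6)[OF f'(1)] GV_arD(3-6)[OF g'(1)] in auto)
      finally show ?thesis by simp
    qed
    have 4: "map (\<lambda>a\<in>verts X. vfun g (vfun f a)) xs = map (vfun g) (map (vfun f) xs)"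
      using xs by (auto simp: walks_simps)
    have T: "E1 (map (vmor f) (steps xs)) \<in> Ar V" "Cod V (E1 (map (vmor f) (steps xs))) = E0 (walk_edges Y (map (vfun f) xs))"
        "Dom V (E1 (map (vmor f) (steps xs))) = E0 (walk_edges X xs)"
      using E1_graph_map[OF f'(1)] xs by auto
    have T': "E1 (map (vmor g) (map (map_prod (vfun f) (vfun f)) (steps xs))) \<in> Ar V"
        "Dom V (E1 (map (vmor g) (map (map_prod (vfun f) (vfun f)) (steps xs)))) = E0 (walk_edges Y (map (vfun f) xs))"
        "Cod V (E1 (map (vmor g) (map (map_prod (vfun f) (vfun f)) (steps xs)))) = E0 (walk_edges Z (map (vfun g) (map (vfun f) xs)))"
      using E1_graph_map[OF g'(1), of "map (vfun f) xs"] ys by (simp_all only: steps_map g')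
    have zs: "map (vfun g) (map (vfun f) xs) \<in> walks Z"
      using walks_map[OF g'(1), unfolded g'(2,3), OF ys] .
    have k: "\<kappa>' (map (vfun f) xs) \<in> Ar V" "Dom V (\<kappa>' (map (vfun f) xs)) = E0 (walk_edges Y (map (vfun f) xs))"
      "Cod V (\<kappa>' (map (vfun f) xs)) = edge Y (vfun f (hd xs), vfun f (last xs))"
      using D(10-12)[OF ys] by (simp_all add: e)
    have k': "\<kappa> xs \<in> Ar V" "Cod V (\<kappa> xs) = edge X (hd xs, last xs)"
      using D(3,5)[OF xs] by simp_all
    have k'': "\<kappa>'' (map (vfun g) (map (vfun f) xs)) \<in> Ar V" "Dom V (\<kappa>'' (map (vfun g) (map (vfun f) xs))) = E0 (walk_edges Z (map (vfun g) (map (vfun f) xs)))"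
      using D(17,18)[OF zs] by simp_all
    have v: "vmor f (hd xs, last xs) \<in> Ar V" "Dom V (vmor f (hd xs, last xs)) = edge X (hd xs, last xs)"
       "Cod V (vmor f (hd xs, last xs)) = edge Y (vfun f (hd xs), vfun f (last xs))"
       "vmor g (vfun f (hd xs), vfun f (last xs)) \<in> Ar V"
       "Dom V (vmor g (vfun f (hd xs), vfun f (last xs))) = edge Y (vfun f (hd xs), vfun f (last xs))"
      using GV_arD(3-6)[OF f'(1)] GV_arD(3-6)[OF g'(1)] e by simp_all
    have "vmor (Comp (GV small V) g f) (hd xs, last xs) \<bullet> snd A xs = (vmor g (vfun f (hd xs), vfun f (last xs)) \<bullet> vmor f (hd xs, last xs)) \<bullet> \<kappa> xs"
      using e by simp
    also have "\<dots> = (vmor g (vfun f (hd xs), vfun f (last xs)) \<bullet> \<kappa>' (map (vfun f) xs)) \<bullet> E1 (map (vmor f) (steps xs))"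
      by (simp only: assoc v k k' T 2)
    also have "\<dots> = \<kappa>'' (map (vfun g) (map (vfun f) xs)) \<bullet> E1 (map (vmor g) (map (map_prod (vfun f) (vfun f)) (steps xs))) \<bullet> E1 (map (vmor f) (steps xs))"
      by (simp only: 1 assoc T T' k'')
    finally show "vmor (Comp (GV small V) g f) (hd xs, last xs) \<bullet> snd A xs
      = snd C (map (vfun (Comp (GV small V) g f)) xs) \<bullet> E1 (map (vmor (Comp (GV small V) g f)) (steps xs))"
      using 3 4 by (simp del: map_map)
  qed
qed

lemma category_ECat: "category (ECat small V E)"
  unfolding ECat_eq
  by (rule category_struct_cat[OF category_GV[OF category_axioms]])
    (auto intro: efun_id efun_comp simp: ecats_vgraphs)

end

section \<open>The lifted monad on E-categories\<close>

context monoidal_monad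
begin

lemma lifting_obj_eq: "lifting_obj V T \<tau> A =
    (G_obj T (fst A), (\<lambda>xs\<in>walks (fst A). T1 (snd A xs) \<bullet> \<tau> (walk_edges (fst A) xs)))"
  by (simp add: lifting_obj_def split: prod.split)

lemma tau_walk_typed:
  assumes "X \<in> vgraphs small V" "xs \<in> walks X"
  shows "\<tau> (walk_edges X xs) \<in> Ar V" "Dom V (\<tau> (walk_edges X xs)) = E0 (map T0 (walk_edges X xs))"
    "Cod V (\<tau> (walk_edges X xs)) = T0 (E0 (walk_edges X xs))"
  using walk_edges_ob[OF assms] by simp_all

text \<open>The unit law comes from \<tau> after u being T u. For associativity, the \<sigma>-law of
  \<tau> splits off T \<sigma>, T of the associativity of \<kappa> replaces it by T of the tensored
  \<kappa>, and naturality of \<tau> carries these to the inner walks.\<close>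

lemma lifting_obj_ecats:
  assumes A: "A \<in> ecats small V E"
  shows "lifting_obj V T \<tau> A \<in> ecats small V E"
proof -
  obtain X \<kappa> where [simp]: "A = (X, \<kappa>)" by (cases A)
  note D = ecatsD[OF A[simplified]]
  note t = tau_walk_typed[OF D(1)]
  show ?thesis
    unfolding lifting_obj_eq
  proof (rule ecatsI)
    show "G_obj T (fst A) \<in> vgraphs small V"
      using D(1) G_obj_vgraphs[OF T.unit.G.cat_functor_axioms] by simp
  next
    fix xs assume "xs \<in> walks (G_obj T (fst A))"
    then have xs: "xs \<in> walks X" by simp
    let ?k = "\<lambda>xs\<in>walks (fst A). T1 (snd A xs) \<bullet> \<tau> (walk_edges (fst A) xs)"
    show "?k xs \<in> Ar V" "Dom V (?k xs) = E0 (walk_edges (G_obj T (fst A)) xs)"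
      "Cod V (?k xs) = edge (G_obj T (fst A)) (hd xs, last xs)"
      using xs D t walk_ends[OF xs] by (simp_all add: walk_edges_G_obj)
  next
    fix a b assume "a \<in> verts (G_obj T (fst A))" "b \<in> verts (G_obj T (fst A))"
    then have ab: "a \<in> verts X" "b \<in> verts X" by simp_all
    then have w: "[a, b] \<in> walks X" by (simp add: walks_simps)
    have "T1 (\<kappa> [a, b]) \<bullet> \<tau> [edge X (a, b)] \<bullet> u (T0 (edge X (a, b))) = Id V (T0 (edge X (a, b)))"
      using D(3,4,5)[OF w] D(6)[OF ab, THEN T_lift] ab vgraphs_edge[OF D(1) ab] by (simp add: tau_unit)
    then show "(\<lambda>xs\<in>walks (fst A). T1 (snd A xs) \<bullet> \<tau> (walk_edges (fst A) xs)) [a, b] \<bullet> u (edge (G_obj T (fst A)) (a, b))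
       = Id V (edge (G_obj T (fst A)) (a, b))"
      using w ab D(3,4,5)[OF w] vgraphs_edge[OF D(1) ab] by simp
  next
    fix xs yss assume "nested_walk (G_obj T (fst A)) xs yss"
    then have n: "nested_walk X xs yss" by simp
    note N = nested_walkD[OF n]
    have N9 [simp]: "map (\<lambda>ys. T0 (edge X (hd ys, last ys))) yss = map T0 (walk_edges X xs)"
      unfolding N(8)[symmetric] by simp
    note [simp] = N(8)
    note [simp] = N(1-6) D(3-5) t D(3-5)[OF N(1)] D(3-5)[OF N(2)] D(3-5)[OF N(3)] t[OF N(1)] t[OF N(2)] t[OF N(3), unfolded N(6)]
    have e [simp]: "\<forall>ys\<in>set yss. \<forall>B\<in>set (walk_edges X ys). B \<in> Ob V"
      using walk_edges_ob[OF D(1) N(2)] by blast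
    have 1: "T1 (\<kappa> (join_walk xs yss)) \<bullet> T1 (\<sigma> (map (walk_edges X) yss)) = T1 (\<kappa> xs) \<bullet> T1 (E1 (map \<kappa> yss))"
      using arg_cong[OF D(7)[OF n], of T1] by (simp add: T.T.arr_comp)
    have 2: "\<tau> (walk_edges X xs) \<bullet> E1 (map (\<lambda>ys. T1 (\<kappa> ys)) yss) = T1 (E1 (map \<kappa> yss)) \<bullet> \<tau> (map (\<lambda>ys. E0 (walk_edges X ys)) yss)"
      using tau_natural[of yss \<kappa> "\<lambda>ys. E0 (walk_edges X ys)" "\<lambda>ys. edge X (hd ys, last ys)"] by simp
    have 3: "\<tau> (concat (map (walk_edges X) yss)) \<bullet> \<sigma> (map (map T0) (map (walk_edges X) yss))
       = T1 (\<sigma> (map (walk_edges X) yss)) \<bullet> \<tau> (map E0 (map (walk_edges X) yss)) \<bullet> E1 (map \<tau> (map (walk_edges X) yss))"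
      by (rule tau_subst) simp
    have 4: "E1 (map (\<lambda>xs\<in>walks X. T1 (\<kappa> xs) \<bullet> \<tau> (walk_edges X xs)) yss)
        = E1 (map (\<lambda>ys. T1 (\<kappa> ys)) yss) \<bullet> E1 (map (\<lambda>ys. \<tau> (walk_edges X ys)) yss)"
      by (subst E.arr_comp[symmetric]) (auto intro!: arg_cong[where f = E1])
    have 5: "map (walk_edges (G_obj T X)) yss = map (map T0) (map (walk_edges X) yss)"
      by (simp add: walk_edges_G_obj)
    have "(T1 (\<kappa> (join_walk xs yss)) \<bullet> \<tau> (concat (map (walk_edges X) yss))) \<bullet> \<sigma> (map (map T0) (map (walk_edges X) yss))
      = T1 (\<kappa> (join_walk xs yss)) \<bullet> T1 (\<sigma> (map (walk_edges X) yss)) \<bullet> \<tau> (map E0 (map (walk_edges X) yss)) \<bullet> E1 (map \<tau> (map (walk_edges X) yss))"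
      using 3 by simp
    also have "\<dots> = T1 (\<kappa> xs) \<bullet> \<tau> (walk_edges X xs) \<bullet> E1 (map (\<lambda>ys. T1 (\<kappa> ys)) yss) \<bullet> E1 (map (\<lambda>ys. \<tau> (walk_edges X ys)) yss)"
      using 1[THEN reassoc] 2[THEN reassoc] by simp
    finally have "(T1 (\<kappa> (join_walk xs yss)) \<bullet> \<tau> (concat (map (walk_edges X) yss))) \<bullet> \<sigma> (map (walk_edges (G_obj T X)) yss)
        = (T1 (\<kappa> xs) \<bullet> \<tau> (walk_edges X xs)) \<bullet> E1 (map (\<lambda>xs\<in>walks X. T1 (\<kappa> xs) \<bullet> \<tau> (walk_edges X xs)) yss)"
      unfolding 4 5 by simp
    then show "(\<lambda>xs\<in>walks (fst A). T1 (snd A xs) \<bullet> \<tau> (walk_edges (fst A) xs)) (join_walk xs yss)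
         \<bullet> \<sigma> (map (walk_edges (G_obj T (fst A))) yss)
       = (\<lambda>xs\<in>walks (fst A). T1 (snd A xs) \<bullet> \<tau> (walk_edges (fst A) xs)) xs
         \<bullet> E1 (map (\<lambda>xs\<in>walks (fst A). T1 (snd A xs) \<bullet> \<tau> (walk_edges (fst A) xs)) yss)"
      by (simp cong del: map_cong)
  qed auto
qed

text \<open>T of the E-functor square of f, pasted with naturality of \<tau> along the homs of
  f.\<close>

lemma lifting_efun:
  assumes A: "A \<in> ecats small V E" and B: "B \<in> ecats small V E"
    and f: "f \<in> hom (GV small V) (fst A) (fst B)" and ef: "efun V E A B f"
  shows "efun V E (lifting_obj V T \<tau> A) (lifting_obj V T \<tau> B) (farr (G_func T) f)"
proof -
  obtain X \<kappa> Y \<kappa>' where [simp]: "A = (X, \<kappa>)" "B = (Y, \<kappa>')" by (cases A; cases B)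
  note D = ecatsD[OF A[simplified]] and D' = ecatsD[OF B[simplified]]
  have f' [simp]: "f \<in> Ar (GV small V)" "vsrc f = X" "vtgt f = Y"
    using f by (auto simp: hom_iff)
  note F = GV_arD(3-6)[OF f'(1), unfolded f'(2,3)]
  show ?thesis
    unfolding efun_def lifting_obj_eq
  proof
    fix xs assume "xs \<in> walks (fst (G_obj T (fst A), \<lambda>xs\<in>walks (fst A). T1 (snd A xs) \<bullet> \<tau> (walk_edges (fst A) xs)))"
    then have xs: "xs \<in> walks X" by simp
    have ys: "map (vfun f) xs \<in> walks Y"
      using walks_map[OF f'(1)] xs by simp
    have 1: "vmor f (hd xs, last xs) \<bullet> \<kappa> xs = \<kappa>' (map (vfun f) xs) \<bullet> E1 (map (vmor f) (steps xs))"
      using ef xs by (simp add: efun_def)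
    note W = walk_edges_map[OF f'(1), unfolded f'(2,3), OF xs]
    have 2: "\<tau> (walk_edges Y (map (vfun f) xs)) \<bullet> E1 (map (\<lambda>p. T1 (vmor f p)) (steps xs))
        = T1 (E1 (map (vmor f) (steps xs))) \<bullet> \<tau> (walk_edges X xs)"
      unfolding W(1,2)[symmetric] by (rule tau_natural) (use W(3) in auto)
    have 3: "map (\<lambda>p\<in>vpairs X. T1 (vmor f p)) (steps xs) = map (\<lambda>p. T1 (vmor f p)) (steps xs)"
      using steps_walk[OF xs] by auto
    have m: "map (\<lambda>p. T0 (Dom V (vmor f p))) (steps xs) = map T0 (walk_edges X xs)"
      "map (\<lambda>p. T0 (Cod V (vmor f p))) (steps xs) = map T0 (walk_edges Y (map (vfun f) xs))"
      unfolding W(1,2)[symmetric] by simp_all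
    note [simp] = D(3-5)[OF xs] D'(3-5)[OF ys] tau_walk_typed[OF D(1) xs] tau_walk_typed[OF D'(1) ys] F walk_ends[OF xs]
      W m walk_map_ends[OF xs]
    have T: "E1 (map (\<lambda>p. T1 (vmor f p)) (steps xs)) \<in> Ar V"
      "Cod V (E1 (map (\<lambda>p. T1 (vmor f p)) (steps xs))) = E0 (map T0 (walk_edges Y (map (vfun f) xs)))"
      "E1 (map (vmor f) (steps xs)) \<in> Ar V" "Cod V (E1 (map (vmor f) (steps xs))) = E0 (walk_edges Y (map (vfun f) xs))"
      "Dom V (E1 (map (vmor f) (steps xs))) = E0 (walk_edges X xs)"
      by simp_all
    show "vmor (farr (G_func T) f) (hd xs, last xs) \<bullet> snd (G_obj T (fst A), \<lambda>xs\<in>walks (fst A). T1 (snd A xs) \<bullet> \<tau> (walk_edges (fst A) xs)) xs =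
       snd (G_obj T (fst B), \<lambda>xs\<in>walks (fst B). T1 (snd B xs) \<bullet> \<tau> (walk_edges (fst B) xs)) (map (vfun (farr (G_func T) f)) xs) \<bullet>
       E1 (map (vmor (farr (G_func T) f)) (steps xs))"
      using xs ys 2 1[THEN T_lift, THEN reassoc] by (simp add: 3 T T.T.arr_comp cong del: map_cong)
  qed
qed

text \<open>The square is naturality of \<eta> along \<kappa> together with
  \<open>tau_eta\<close>.\<close>

lemma unit_efun:
  assumes A: "A \<in> ecats small V E"
  shows "efun V E A (lifting_obj V T \<tau> A) (m_unit (G_monad T) (fst A))"
proof -
  obtain X \<kappa> where [simp]: "A = (X, \<kappa>)" by (cases A)
  note D = ecatsD[OF A[simplified]]
  have "\<eta> (edge X (hd xs, last xs)) \<bullet> \<kappa> xs = (T1 (\<kappa> xs) \<bullet> \<tau> (walk_edges X xs)) \<bullet> E1 (map \<eta> (walk_edges X xs))"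
    if xs: "xs \<in> walks X" for xs
    using D(3-5)[OF xs] tau_walk_typed[OF D(1) xs] walk_edges_ob[OF D(1) xs]
    by (simp add: tau_eta T.unit_natural)
  then show ?thesis
    unfolding efun_def lifting_obj_eq
    by (simp add: walk_map_restrict_id steps_map_restrict walk_ends cong del: map_cong)
qed

text \<open>As for the unit, with naturality of \<mu> and \<open>tau_mu\<close>.\<close>

lemma mult_efun:
  assumes A: "A \<in> ecats small V E"
  shows "efun V E (lifting_obj V T \<tau> (lifting_obj V T \<tau> A)) (lifting_obj V T \<tau> A) (m_mult (G_monad T) (fst A))"
proof -
  obtain X \<kappa> where [simp]: "A = (X, \<kappa>)" by (cases A)
  note D = ecatsD[OF A[simplified]]
  have "\<mu> (edge X (hd xs, last xs)) \<bullet> T1 (T1 (\<kappa> xs) \<bullet> \<tau> (walk_edges X xs)) \<bullet> \<tau> (map T0 (walk_edges X xs))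
      = (T1 (\<kappa> xs) \<bullet> \<tau> (walk_edges X xs)) \<bullet> E1 (map \<mu> (walk_edges X xs))"
    if xs: "xs \<in> walks X" for xs
    using D(3-5)[OF xs] tau_walk_typed[OF D(1) xs] walk_edges_ob[OF D(1) xs] vgraphs_edge[OF D(1)] walk_ends[OF xs]
    by (simp add: tau_mu T.mult_natural' T.T.arr_comp)
  then show ?thesis
    unfolding efun_def lifting_obj_eq
    by (simp add: walk_map_restrict_id steps_map_restrict walk_ends walk_edges_G_obj cong del: map_cong)
qed

lemma lifting_in_liftings: "lifting_of small V E T \<tau> \<in> liftings small V E (G_monad T)"
proof -
  interpret GV: category "GV small V" by (rule category_GV[OF category_axioms])
  have "monad (ECat small V E) (lifting_of small V E T \<tau>)"
  proof -
    have "monad (struct_cat (GV small V) (ecats small V E) fst (efun V E)) \<lparr>fobj = restrict (lifting_obj V T \<tau>) (ecats small V E),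
      farr = (\<lambda>(s, t, f)\<in>Ar (struct_cat (GV small V) (ecats small V E) fst (efun V E)).
        (lifting_obj V T \<tau> s, lifting_obj V T \<tau> t, farr (G_monad T) f)),
      m_unit = (\<lambda>s\<in>ecats small V E. (s, lifting_obj V T \<tau> s, m_unit (G_monad T) (fst s))),
      m_mult = (\<lambda>s\<in>ecats small V E. (lifting_obj V T \<tau> (lifting_obj V T \<tau> s), lifting_obj V T \<tau> s, m_mult (G_monad T) (fst s)))\<rparr>"
    proof (rule struct_monad[OF monad_G[OF T.monad_axioms]])
      show "fst (lifting_obj V T \<tau> A) = fobj (G_monad T) (fst A)" for A
        by (simp add: lifting_obj_eq)
      show "efun V E (lifting_obj V T \<tau> A) (lifting_obj V T \<tau> B) (farr (G_monad T) f)"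
        if "A \<in> ecats small V E" "B \<in> ecats small V E" "f \<in> hom (GV small V) (fst A) (fst B)" "efun V E A B f" for A B f
        using lifting_efun[OF that] by simp
    qed (auto simp: ecats_vgraphs efun_id lifting_obj_ecats intro: unit_efun mult_efun efun_comp simp del: G_simps)
    then show ?thesis
      by (simp add: lifting_of_def ECat_eq Let_def)
  qed
  then show ?thesis
    unfolding liftings_def
    by (auto simp: lifting_of_def Let_def func_eq_def ecat_forget_def forget_func_def ECat_eq lifting_obj_eq)
qed

end

section \<open>Algebras of the lifted monad\<close>

text \<open>Arrows on both sides are underlying arrows of C subject to a predicate, so a bijection
  of structured objects over C under which the predicates agree is already an isomorphism of
  categories. The second category is structured twice: in the application it consists of algebras on
  E-categories on graphs.\<close>

lemma struct_iso:
  fixes C :: "('o, 'm) cat" and S :: "'s set"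
  assumes D1: "category (struct_cat C S1 U1 P1)" and D2: "category (struct_cat (struct_cat C S U P) S2 U2 P2)"
    and K: "\<And>s. s \<in> S1 \<Longrightarrow> K s \<in> S2" and G: "\<And>a. a \<in> S2 \<Longrightarrow> G a \<in> S1"
    and GK: "\<And>s. s \<in> S1 \<Longrightarrow> G (K s) = s" and KG: "\<And>a. a \<in> S2 \<Longrightarrow> K (G a) = a"
    and U: "\<And>s. s \<in> S1 \<Longrightarrow> U2 (K s) \<in> S" "\<And>s. s \<in> S1 \<Longrightarrow> U (U2 (K s)) = U1 s"
    and P: "\<And>s t f. s \<in> S1 \<Longrightarrow> t \<in> S1 \<Longrightarrow> f \<in> hom C (U1 s) (U1 t) \<Longrightarrow>
      P1 s t f \<longleftrightarrow> P (U2 (K s)) (U2 (K t)) f \<and> P2 (K s) (K t) (U2 (K s), U2 (K t), f)"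
  shows "\<exists>F. cat_iso (struct_cat C S1 U1 P1) (struct_cat (struct_cat C S U P) S2 U2 P2) F \<and>
    func_eq (struct_cat C S1 U1 P1) (forget_func U \<circ>\<^sub>F forget_func U2 \<circ>\<^sub>F F) (forget_func U1)"
    (is "\<exists>F. cat_iso ?D1 ?D2 F \<and> _")
proof -
  interpret D1: category ?D1 by fact
  interpret D2: category ?D2 by fact
  define F where "F = \<lparr>fobj = K, farr = (\<lambda>(s, t, f :: 'm). (K s, K t, (U2 (K s), U2 (K t), f)))\<rparr>"
  define G' where "G' = \<lparr>fobj = G, farr = (\<lambda>(a, b, (_ :: 's, _ :: 's, f :: 'm)). (G a, G b, f))\<rparr>"
  have UG: "U2 a \<in> S" "U1 (G a) = U (U2 a)" if "a \<in> S2" for a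
    using U[OF G[OF that]] KG[OF that] by auto
  have "cat_functor ?D1 ?D2 F"
    by unfold_locales (auto simp: F_def hom_iff[of _ ?D1] hom_iff[of _ ?D2] hom_iff[of _ "struct_cat C S U P"] K U P)
  moreover have "cat_functor ?D2 ?D1 G'"
    by unfold_locales
      (auto simp: G'_def hom_iff[of _ ?D1] hom_iff[of _ ?D2] hom_iff[of _ "struct_cat C S U P"] G UG KG P)
  moreover have "func_eq ?D1 (G' \<circ>\<^sub>F F) id_func" "func_eq ?D2 (F \<circ>\<^sub>F G') id_func"
    by (auto simp: func_eq_def F_def G'_def GK KG hom_iff[of _ "struct_cat C S U P"])
  moreover have "func_eq ?D1 (forget_func U \<circ>\<^sub>F forget_func U2 \<circ>\<^sub>F F) (forget_func U1)"
    by (auto simp: func_eq_def F_def forget_func_def U)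
  ultimately show ?thesis
    unfolding cat_iso_def by blast
qed

lemma category_alg_cat:
  assumes "monad C T"
  shows "category (alg_cat C T)"
proof -
  interpret monad C T by fact
  show ?thesis
    unfolding alg_cat_def
  proof (rule category_struct_cat[OF category_axioms])
    show "fst s \<in> Ob C" if "s \<in> monad_algebras C T" for s
      using that by (auto simp: monad_algebras_def)
    show "(case s of (A, x) \<Rightarrow> \<lambda>(B, y) f. f \<bullet> x = y \<bullet> T1 f) s (Id C (fst s))" if "s \<in> monad_algebras C T" for s
      using that by (auto simp: monad_algebras_def hom_iff)
  next
    fix r s t f g
    assume rst: "r \<in> monad_algebras C T" "s \<in> monad_algebras C T" "t \<in> monad_algebras C T"
      and fg: "f \<in> hom C (fst r) (fst s)" "g \<in> hom C (fst s) (fst t)"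
      and e: "(case r of (A, x) \<Rightarrow> \<lambda>(B, y) f. f \<bullet> x = y \<bullet> T1 f) s f"
         "(case s of (A, x) \<Rightarrow> \<lambda>(B, y) f. f \<bullet> x = y \<bullet> T1 f) t g"
    obtain A x B y D z where [simp]: "r = (A, x)" "s = (B, y)" "t = (D, z)"
      by (cases r; cases s; cases t)
    have [simp]: "x \<in> Ar C" "Dom C x = T0 A" "Cod C x = A" "y \<in> Ar C" "Dom C y = T0 B" "Cod C y = B"
      "z \<in> Ar C" "Dom C z = T0 D" "Cod C z = D"
      using rst by (auto simp: monad_algebras_def hom_iff)
    have [simp]: "f \<in> Ar C" "Dom C f = A" "Cod C f = B" "g \<in> Ar C" "Dom C g = B" "Cod C g = D"
      using fg by (auto simp: hom_iff)
    have 1: "f \<bullet> x = y \<bullet> T1 f" "g \<bullet> y = z \<bullet> T1 g"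
      using e by auto
    show "(case r of (A, x) \<Rightarrow> \<lambda>(B, y) f. f \<bullet> x = y \<bullet> T1 f) t (g \<bullet> f)"
      using 1(1) 1(2)[THEN reassoc] by (simp add: T.arr_comp)
  qed
qed

context monoidal_monad
begin

text \<open>Makes the laws of \<sigma>' available for the substitution built from \<tau>.\<close>

sublocale C: composite_mult V E T m
  by (intro composite_mult.intro tensor_monad_axioms composite_mult_axioms.intro subst_of_composite)

lemma C_tau [simp]: "\<forall>X\<in>set Xs. X \<in> Ob V \<Longrightarrow> C.tau Xs = \<tau> Xs"
  by (simp add: C.tau_def tau_eq)

end

text \<open>One of the two trivial nestings of a walk; the other, in
  \<open>nested_walk_steps\<close>, has a one-step walk over each step. Associativity along them
  relates a structure map to the structure maps of one-step walks.\<close>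

lemma nested_walk_single:
  assumes "xs \<in> walks X"
  shows "nested_walk X [hd xs, last xs] [xs]" "join_walk [hd xs, last xs] [xs] = xs"
  using assms by (auto simp: nested_walk_def walks_simps join_walk_def)

lemma nested_walk_steps:
  assumes "xs \<in> walks X"
  shows "nested_walk X xs (map (\<lambda>p. [fst p, snd p]) (steps xs))"
    "join_walk xs (map (\<lambda>p. [fst p, snd p]) (steps xs)) = xs"
proof -
  show "nested_walk X xs (map (\<lambda>p. [fst p, snd p]) (steps xs))"
    using assms steps_walk[OF assms, of "fst (steps xs ! i)" "snd (steps xs ! i)" for i]
    by (auto simp: nested_walk_def list_all2_conv_all_nth walks_simps(2))
  have "map snd (steps xs) = tl xs"
    by (simp add: steps_def map_snd_zip_take)
  then show "join_walk xs (map (\<lambda>p. [fst p, snd p]) (steps xs)) = xs"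
    using assms by (simp add: join_walk_def walks_simps)
qed

section \<open>From TE-categories to algebras of the lifted monad\<close>

locale composite_category = monoidal_monad V E T \<tau>
  for V :: "('o, 'm) cat" and E and T and \<tau> +
  fixes small :: "'a set \<Rightarrow> bool" and X :: "('a, 'o) vgraph" and k :: "'a list \<Rightarrow> 'm"
  assumes cat: "(X, k) \<in> ecats small V (composite m)"
begin

lemmas k_raw = multitensor.ecatsD[OF C.composite_multitensor cat, simplified]

lemma X_ob [simp]: "X \<in> vgraphs small V"
  by (rule k_raw)

lemma edge_ob [simp]: "a \<in> verts X \<Longrightarrow> b \<in> verts X \<Longrightarrow> edge X (a, b) \<in> Ob V"
  using vgraphs_edge[OF X_ob] .

lemma edges_ob: "xs \<in> walks X \<Longrightarrow> \<forall>A\<in>set (walk_edges X xs). A \<in> Ob V"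
  by (rule walk_edges_ob[OF X_ob])

lemma tensor_ob [simp]: "xs \<in> walks X \<Longrightarrow> E0 (walk_edges X xs) \<in> Ob V"
  using edges_ob by simp

lemma pair_walk [simp]: "[a, b] \<in> walks X \<longleftrightarrow> a \<in> verts X \<and> b \<in> verts X"
  by (simp add: walks_simps)

lemma k_typed [simp]:
  assumes "xs \<in> walks X"
  shows "k xs \<in> Ar V" "Dom V (k xs) = T0 (E0 (walk_edges X xs))" "Cod V (k xs) = edge X (hd xs, last xs)"
  using k_raw assms by auto

lemma k_unit: "a \<in> verts X \<Longrightarrow> b \<in> verts X \<Longrightarrow> k [a, b] \<bullet> \<eta> (E0 [edge X (a, b)]) \<bullet> u (edge X (a, b)) = Id V (edge X (a, b))"
  using k_raw(6) by simp

lemma k_assoc: "nested_walk X xs yss \<Longrightarrow>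
    k (join_walk xs yss) \<bullet> m (map (walk_edges X) yss) = k xs \<bullet> T1 (E1 (map k yss))"
  by (rule k_raw)

lemma k_single:
  assumes "xs \<in> walks X"
  shows "k [hd xs, last xs] \<bullet> T1 (E1 [k xs]) = k xs \<bullet> m [walk_edges X xs]"
  using k_assoc[OF nested_walk_single(1)[OF assms]] nested_walk_single(2)[OF assms] by simp

lemma k_steps:
  assumes "xs \<in> walks X"
  shows "k xs \<bullet> m (map (\<lambda>A. [A]) (walk_edges X xs)) = k xs \<bullet> T1 (E1 (map (\<lambda>p. k [fst p, snd p]) (steps xs)))"
  using k_assoc[OF nested_walk_steps(1)[OF assms]] nested_walk_steps(2)[OF assms]
  by (simp add: walk_edges_def[of X xs])

text \<open>The one-step structure maps make each hom an algebra of the unary monad; restricting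
  along the monad map T u gives this T-action.\<close>

definition "act p = k [fst p, snd p] \<bullet> T1 (u (edge X p))"

lemma act_typed [simp]:
  assumes [simp]: "a \<in> verts X" "b \<in> verts X"
  shows "act (a, b) \<in> Ar V" "Dom V (act (a, b)) = T0 (edge X (a, b))" "Cod V (act (a, b)) = edge X (a, b)"
  by (simp_all add: act_def)

text \<open>Naturality of u and associativity along the nesting with one inner walk turn the left
  side into k after a composite that is the identity by the identity condition on \<sigma>'. Thus k
  is the T-action after T of the underlying E-structure.\<close>

lemma act_k:
  assumes [simp]: "xs \<in> walks X"
  shows "act (hd xs, last xs) \<bullet> T1 (k xs) \<bullet> T1 (\<eta> (E0 (walk_edges X xs))) = k xs"
proof -
  note [simp] = walk_ends[OF assms] edges_ob[OF assms]
  have 1: "T1 (u (edge X (hd xs, last xs))) \<bullet> T1 (k xs) = T1 (E1 [k xs]) \<bullet> T1 (u (T0 (E0 (walk_edges X xs))))"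
    by (simp add: T.T.arr_comp[symmetric] mtu_natural)
  show ?thesis
    using 1[THEN reassoc] k_single[OF assms, THEN reassoc] C.m_id[of "walk_edges X xs"]
    by (simp add: act_def)
qed

text \<open>Associativity along the nesting by single steps absorbs the one-step structure maps of
  the actions into a substitution; with its units, this substitution is the formula for
  \<tau>.\<close>

lemma k_act:
  assumes [simp]: "xs \<in> walks X"
  shows "k xs \<bullet> \<eta> (E0 (walk_edges X xs)) \<bullet> E1 (map act (steps xs)) = k xs \<bullet> \<tau> (walk_edges X xs)"
proof -
  note w = steps_walk[OF assms] and [simp] = edges_ob[OF assms]
  have [simp]: "p \<in> set (steps xs) \<Longrightarrow> fst p \<in> verts X" "p \<in> set (steps xs) \<Longrightarrow> snd p \<in> verts X"
     "p \<in> set (steps xs) \<Longrightarrow> edge X p \<in> Ob V" for p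
    using w[of "fst p" "snd p"] edge_ob[of "fst p" "snd p"] by auto
  have 1: "E1 (map act (steps xs)) = E1 (map (\<lambda>p. k [fst p, snd p]) (steps xs)) \<bullet> E1 (map (\<lambda>p. T1 (u (edge X p))) (steps xs))"
    unfolding act_def[abs_def] by (rule E.arr_comp) simp
  have 2: "\<eta> (E0 (walk_edges X xs)) \<bullet> E1 (map (\<lambda>p. k [fst p, snd p]) (steps xs))
      = T1 (E1 (map (\<lambda>p. k [fst p, snd p]) (steps xs))) \<bullet> \<eta> (E0 (map (\<lambda>p. T0 (E0 [edge X p])) (steps xs)))"
    by (simp add: T.unit_natural walk_edges_def)
  have 3: "\<eta> (E0 (map (\<lambda>p. T0 (E0 [edge X p])) (steps xs))) \<bullet> E1 (map (\<lambda>p. T1 (u (edge X p))) (steps xs))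
      = T1 (E1 (map (\<lambda>X. T1 (u X)) (walk_edges X xs))) \<bullet> \<eta> (E0 (map T0 (walk_edges X xs)))"
    by (simp add: T.unit_natural walk_edges_def)
  have "k xs \<bullet> \<eta> (E0 (walk_edges X xs)) \<bullet> E1 (map act (steps xs))
     = k xs \<bullet> T1 (E1 (map (\<lambda>p. k [fst p, snd p]) (steps xs))) \<bullet> T1 (E1 (map (\<lambda>X. T1 (u X)) (walk_edges X xs))) \<bullet> \<eta> (E0 (map T0 (walk_edges X xs)))"
    unfolding 1 using 2[THEN reassoc] 3 by (simp add: walk_edges_def)
  also have "\<dots> = k xs \<bullet> C.tau (walk_edges X xs)"
    using k_steps[OF assms, symmetric, THEN reassoc] by (simp add: C.tau_def walk_edges_def)
  finally show ?thesis by simp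
qed

lemma act_unit:
  assumes [simp]: "a \<in> verts X" "b \<in> verts X"
  shows "act (a, b) \<bullet> \<eta> (edge X (a, b)) = Id V (edge X (a, b))"
  using k_unit[of a b] by (simp add: act_def T.unit_natural_rev)

text \<open>The multiplication square of the monad map T u, combined with naturality of u and
  associativity of k.\<close>

lemma act_mult:
  assumes [simp]: "a \<in> verts X" "b \<in> verts X"
  shows "act (a, b) \<bullet> \<mu> (edge X (a, b)) = act (a, b) \<bullet> T1 (act (a, b))"
proof -
  have 1: "T1 (u (edge X (a, b))) \<bullet> T1 (k [a, b]) = T1 (E1 [k [a, b]]) \<bullet> T1 (u (T0 (E0 [edge X (a, b)])))"
    by (simp add: T.T.arr_comp[symmetric] mtu_natural)
  show ?thesis
    using 1[THEN reassoc] k_single[of "[a, b]", THEN reassoc] C.m_mult[of "edge X (a, b)"]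
    by (simp add: act_def T.T.arr_comp)
qed

text \<open>The restriction of the TE-structure along the multitensor map \<eta>E.\<close>

definition base where "base = (\<lambda>xs\<in>walks X. k xs \<bullet> \<eta> (E0 (walk_edges X xs)))"

lemma base_ecats: "(X, base) \<in> ecats small V E"
proof (rule ecatsI)
  fix a b assume "a \<in> verts X" "b \<in> verts X"
  then show "base [a, b] \<bullet> u (edge X (a, b)) = Id V (edge X (a, b))"
    using k_unit by (simp add: base_def)
next
  fix xs yss assume n: "nested_walk X xs yss"
  note N = nested_walkD[OF n]
  note [simp] = N(1-6) N(8)
  have e [simp]: "\<forall>ys\<in>set yss. \<forall>B\<in>set (walk_edges X ys). B \<in> Ob V"
    using edges_ob[OF N(2)] by blast
  have e' [simp]: "\<forall>B\<in>set (walk_edges X xs). B \<in> Ob V"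
    by (rule edges_ob[OF N(1)])
  have 1: "\<eta> (E0 (concat (map (walk_edges X) yss))) \<bullet> \<sigma> (map (walk_edges X) yss)
      = m (map (walk_edges X) yss) \<bullet> \<eta> (E0 (map (\<lambda>ys. T0 (E0 (walk_edges X ys))) yss)) \<bullet> E1 (map (\<lambda>ys. \<eta> (E0 (walk_edges X ys))) yss)"
    using C.m_eta[of "map (walk_edges X) yss"] by simp
  have 2: "T1 (E1 (map k yss)) \<bullet> \<eta> (E0 (map (\<lambda>ys. T0 (E0 (walk_edges X ys))) yss)) = \<eta> (E0 (walk_edges X xs)) \<bullet> E1 (map k yss)"
    by (simp add: T.unit_natural_rev)
  have 3: "E1 (map base yss) = E1 (map k yss) \<bullet> E1 (map (\<lambda>ys. \<eta> (E0 (walk_edges X ys))) yss)"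
    by (subst E.arr_comp[symmetric]) (auto simp: base_def intro!: arg_cong[where f = E1])
  have "(k (join_walk xs yss) \<bullet> \<eta> (E0 (concat (map (walk_edges X) yss)))) \<bullet> \<sigma> (map (walk_edges X) yss)
    = k (join_walk xs yss) \<bullet> m (map (walk_edges X) yss) \<bullet> \<eta> (E0 (map (\<lambda>ys. T0 (E0 (walk_edges X ys))) yss)) \<bullet> E1 (map (\<lambda>ys. \<eta> (E0 (walk_edges X ys))) yss)"
    using 1 by simp
  also have "\<dots> = k xs \<bullet> \<eta> (E0 (walk_edges X xs)) \<bullet> E1 (map base yss)"
    unfolding 3 using k_assoc[OF n, THEN reassoc] 2[THEN reassoc] by simp
  finally have "(k (join_walk xs yss) \<bullet> \<eta> (E0 (concat (map (walk_edges X) yss)))) \<bullet> \<sigma> (map (walk_edges X) yss)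
    = (k xs \<bullet> \<eta> (E0 (walk_edges X xs))) \<bullet> E1 (map base yss)"
    unfolding 3 by simp
  moreover have "base (join_walk xs yss) = k (join_walk xs yss) \<bullet> \<eta> (E0 (concat (map (walk_edges X) yss)))"
    "base xs = k xs \<bullet> \<eta> (E0 (walk_edges X xs))"
    by (simp_all add: base_def)
  ultimately show "base (join_walk xs yss) \<bullet> \<sigma> (map (walk_edges X) yss) = base xs \<bullet> E1 (map base yss)"
    by simp
qed (auto simp: base_def)

definition action :: "('a, 'o, 'm) vmap" where
  "action = \<lparr>vsrc = G_obj T X, vtgt = X, vfun = (\<lambda>a\<in>verts X. a), vmor = (\<lambda>p\<in>vpairs X. act p)\<rparr>"

lemma action_simps [simp]: "vsrc action = G_obj T X" "vtgt action = X" "vfun action = (\<lambda>a\<in>verts X. a)"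
  "vmor action = (\<lambda>p\<in>vpairs X. act p)"
  by (simp_all add: action_def)

lemma GT_ob [simp]: "G_obj T X \<in> vgraphs small V"
  by (rule G_obj_vgraphs[OF T.unit.G.cat_functor_axioms X_ob])

lemma action_ar [simp]: "action \<in> Ar (GV small V)"
  by (rule GV_arI) (auto simp: hom_iff)

text \<open>Both sides equal k after \<tau>: the left by \<open>act_k\<close>, the right by
  \<open>k_act\<close>.\<close>

lemma action_efun: "efun V E (lifting_obj V T \<tau> (X, base)) (X, base) action"
proof -
  have "act (hd xs, last xs) \<bullet> T1 (k xs \<bullet> \<eta> (E0 (walk_edges X xs))) \<bullet> \<tau> (walk_edges X xs)
     = (k xs \<bullet> \<eta> (E0 (walk_edges X xs))) \<bullet> E1 (map act (steps xs))" if [simp]: "xs \<in> walks X" for xs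
  proof -
    note [simp] = walk_ends[OF that] edges_ob[OF that]
    have [simp]: "p \<in> set (steps xs) \<Longrightarrow> act p \<in> Ar V \<and> Cod V (act p) = edge X p" for p
      using steps_walk[OF that, of "fst p" "snd p"] act_typed[of "fst p" "snd p"] by simp
    have "E1 (map act (steps xs)) \<in> Ar V" "Cod V (E1 (map act (steps xs))) = E0 (walk_edges X xs)"
      by (simp_all add: walk_edges_def)
    then show ?thesis
      using act_k[OF that, THEN reassoc] k_act[OF that] by (simp add: T.T.arr_comp)
  qed
  then show ?thesis
    unfolding efun_def lifting_obj_eq
    by (simp add: steps_restrict walk_map_restrict_id walk_ends base_def cong del: map_cong)
qed

end

context monoidal_monad
begin

lemma lifting_of_simps:
  "A \<in> ecats small V E \<Longrightarrow> fobj (lifting_of small V E T \<tau>) A = lifting_obj V T \<tau> A"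
  "(A, B, f) \<in> Ar (ECat small V E) \<Longrightarrow>
     farr (lifting_of small V E T \<tau>) (A, B, f) = (lifting_obj V T \<tau> A, lifting_obj V T \<tau> B, farr (G_func T) f)"
  "A \<in> ecats small V E \<Longrightarrow> m_unit (lifting_of small V E T \<tau>) A = (A, lifting_obj V T \<tau> A, m_unit (G_monad T) (fst A))"
  "A \<in> ecats small V E \<Longrightarrow> m_mult (lifting_of small V E T \<tau>) A
     = (lifting_obj V T \<tau> (lifting_obj V T \<tau> A), lifting_obj V T \<tau> A, m_mult (G_monad T) (fst A))"
  by (simp_all add: lifting_of_def Let_def ECat_eq del: G_simps)

text \<open>Arrows of \<open>ECat\<close> carry their source and target, so in an algebra s and t
  are determined. What remains is an algebra structure v for T on graphs that is also an
  E-functor.\<close>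

lemma algebra_iff:
  "(A, (s, t, v)) \<in> monad_algebras (ECat small V E) (lifting_of small V E T \<tau>) \<longleftrightarrow>
    A \<in> ecats small V E \<and> s = lifting_obj V T \<tau> A \<and> t = A \<and>
    v \<in> Ar (GV small V) \<and> vsrc v = G_obj T (fst A) \<and> vtgt v = fst A \<and> efun V E s A v \<and>
    Comp (GV small V) v (m_unit (G_monad T) (fst A)) = Id (GV small V) (fst A) \<and>
    Comp (GV small V) v (m_mult (G_monad T) (fst A)) = Comp (GV small V) v (farr (G_func T) v)"
proof (cases "A \<in> ecats small V E \<and> s = lifting_obj V T \<tau> A \<and> t = A \<and> v \<in> Ar (GV small V) \<and>
    vsrc v = G_obj T (fst A) \<and> vtgt v = fst A \<and> efun V E s A v")
  case True
  then have "lifting_obj V T \<tau> A \<in> ecats small V E"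
    using lifting_obj_ecats by blast
  moreover have "fst (lifting_obj V T \<tau> A) = G_obj T (fst A)"
    by (simp add: lifting_obj_eq)
  ultimately have "(s, t, v) \<in> Ar (ECat small V E)"
    using True by (auto simp: ECat_eq hom_iff)
  with True show ?thesis
    by (auto simp: monad_algebras_def lifting_of_simps hom_iff ECat_eq lifting_obj_eq simp del: G_simps(12-))
next
  case False
  then show ?thesis
    by (auto simp: monad_algebras_def lifting_of_simps hom_iff ECat_eq lifting_obj_eq)
qed

end

section \<open>From algebras of the lifted monad to TE-categories\<close>

locale lifted_algebra = monoidal_monad V E T \<tau>
  for V :: "('o, 'm) cat" and E and T and \<tau> +
  fixes small :: "'a set \<Rightarrow> bool" and X :: "('a, 'o) vgraph" and \<kappa> :: "'a list \<Rightarrow> 'm" and s t v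
  assumes alg: "((X, \<kappa>), (s, t, v)) \<in> monad_algebras (ECat small V E) (lifting_of small V E T \<tau>)"
begin

lemmas alg_raw = alg[unfolded algebra_iff, simplified]

lemma cat: "(X, \<kappa>) \<in> ecats small V E"
  using alg_raw by simp

lemmas k_raw = ecatsD[OF cat]

lemma X_ob [simp]: "X \<in> vgraphs small V"
  by (rule k_raw)

lemma edge_ob [simp]: "a \<in> verts X \<Longrightarrow> b \<in> verts X \<Longrightarrow> edge X (a, b) \<in> Ob V"
  using vgraphs_edge[OF X_ob] .

lemma edges_ob: "xs \<in> walks X \<Longrightarrow> \<forall>A\<in>set (walk_edges X xs). A \<in> Ob V"
  by (rule walk_edges_ob[OF X_ob])

lemma tensor_ob [simp]: "xs \<in> walks X \<Longrightarrow> E0 (walk_edges X xs) \<in> Ob V"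
  using edges_ob by simp

lemma k_typed [simp]:
  assumes "xs \<in> walks X"
  shows "\<kappa> xs \<in> Ar V" "Dom V (\<kappa> xs) = E0 (walk_edges X xs)" "Cod V (\<kappa> xs) = edge X (hd xs, last xs)"
  using k_raw assms by auto

lemma pair_walk [simp]: "[a, b] \<in> walks X \<longleftrightarrow> a \<in> verts X \<and> b \<in> verts X"
  by (simp add: walks_simps)

lemma v_ar: "v \<in> Ar (GV small V)" "vsrc v = G_obj T X" "vtgt v = X"
  using alg_raw by auto

text \<open>The unit of the graph monad fixes the vertices, so the unit law of the algebra forces v
  to fix them too. This is what makes the homs of v into actions on the homs of X.\<close>

lemma v_fun [simp]: "a \<in> verts X \<Longrightarrow> vfun v a = a"
proof -
  assume a: "a \<in> verts X"
  have "vfun (Comp (GV small V) v (m_unit (G_monad T) X)) a = vfun (Id (GV small V) X) a"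
    using alg_raw by simp
  then show ?thesis
    using a by simp
qed

abbreviation "act \<equiv> vmor v"

lemma act_typed [simp]:
  assumes [simp]: "a \<in> verts X" "b \<in> verts X"
  shows "act (a, b) \<in> Ar V" "Dom V (act (a, b)) = T0 (edge X (a, b))" "Cod V (act (a, b)) = edge X (a, b)"
  using GV_arD(4-6)[OF v_ar(1), unfolded v_ar(2,3), of a b] by simp_all

lemma act_unit:
  assumes [simp]: "a \<in> verts X" "b \<in> verts X"
  shows "act (a, b) \<bullet> \<eta> (edge X (a, b)) = Id V (edge X (a, b))"
proof -
  have "vmor (Comp (GV small V) v (m_unit (G_monad T) X)) (a, b) = vmor (Id (GV small V) X) (a, b)"
    using alg_raw by simp
  then show ?thesis
    using k_raw(1) by (simp add: vgraphs_extensional)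
qed

lemma act_mult:
  assumes [simp]: "a \<in> verts X" "b \<in> verts X"
  shows "act (a, b) \<bullet> \<mu> (edge X (a, b)) = act (a, b) \<bullet> T1 (act (a, b))"
proof -
  have "vmor (Comp (GV small V) v (m_mult (G_monad T) X)) (a, b) = vmor (Comp (GV small V) v (farr (G_func T) v)) (a, b)"
    using alg_raw by simp
  then show ?thesis
    by (simp add: v_ar)
qed

lemma walk_map_v: "xs \<in> walks X \<Longrightarrow> map (vfun v) xs = xs"
  by (rule map_idI) (auto simp: walks_simps)

lemma act_efun:
  assumes [simp]: "xs \<in> walks X"
  shows "act (hd xs, last xs) \<bullet> T1 (\<kappa> xs) \<bullet> \<tau> (walk_edges X xs) = \<kappa> xs \<bullet> E1 (map act (steps xs))"
proof -
  have "s = lifting_obj V T \<tau> (X, \<kappa>)" "efun V E s (X, \<kappa>) v"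
    using alg_raw by blast+
  then have "efun V E (lifting_obj V T \<tau> (X, \<kappa>)) (X, \<kappa>) v"
    by simp
  then show ?thesis
    unfolding efun_def lifting_obj_eq using assms by (auto simp: walk_map_v)
qed

text \<open>The form is dictated by \<open>act_k\<close>, which factors the structure maps of a
  TE-category in this way.\<close>

definition comp_cat where "comp_cat = (\<lambda>xs\<in>walks X. act (hd xs, last xs) \<bullet> T1 (\<kappa> xs))"

text \<open>In the associativity law, T of the law for \<kappa> removes \<sigma>, associativity of
  the action replaces \<mu> by a second action, and T of the E-functor square of the action (fact 4)
  moves that action to the edges of the outer walk.\<close>

lemma comp_cat_ecats: "(X, comp_cat) \<in> ecats small V (composite m)"
proof (rule multitensor.ecatsI[OF C.composite_multitensor])
  fix xs assume "xs \<in> walks X"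
  then show "comp_cat xs \<in> Ar V" "Dom V (comp_cat xs) = fobj (composite m) (walk_edges X xs)"
    "Cod V (comp_cat xs) = edge X (hd xs, last xs)"
    by (simp_all add: comp_cat_def walk_ends)
next
  fix a b assume ab [simp]: "a \<in> verts X" "b \<in> verts X"
  show "Comp V (comp_cat [a, b]) (mt_unit (composite m) (edge X (a, b))) = Id V (edge X (a, b))"
    using k_raw(6)[OF ab] act_unit[OF ab] act_unit[OF ab, THEN reassoc]
    by (simp add: comp_cat_def T.unit_natural_rev')
next
  fix xs yss assume n: "nested_walk X xs yss"
  note N = nested_walkD[OF n]
  have N9 [simp]: "map (\<lambda>ys. T0 (edge X (hd ys, last ys))) yss = map T0 (walk_edges X xs)"
    unfolding N(8)[symmetric] by simp
  note [simp] = N(1-6) N(8) walk_ends[OF N(1)] walk_ends[OF N(2)] walk_ends[OF N(3)]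
  have e [simp]: "\<forall>ys\<in>set yss. \<forall>B\<in>set (walk_edges X ys). B \<in> Ob V"
    using edges_ob[OF N(2)] by blast
  have e' [simp]: "\<forall>B\<in>set (walk_edges X xs). B \<in> Ob V"
    by (rule edges_ob[OF N(1)])
  have s [simp]: "p \<in> set (steps xs) \<Longrightarrow> act p \<in> Ar V \<and> Dom V (act p) = T0 (edge X p) \<and> Cod V (act p) = edge X p" for p
    using steps_walk[OF N(1), of "fst p" "snd p"] act_typed[of "fst p" "snd p"] by simp
  have s2 [simp]: "E1 (map act (steps xs)) \<in> Ar V" "Cod V (E1 (map act (steps xs))) = E0 (walk_edges X xs)"
     "Dom V (E1 (map act (steps xs))) = E0 (map T0 (walk_edges X xs))"
    by (simp_all add: walk_edges_def)
  have 1: "T1 (\<kappa> (join_walk xs yss)) \<bullet> T1 (\<sigma> (map (walk_edges X) yss)) = T1 (\<kappa> xs) \<bullet> T1 (E1 (map \<kappa> yss))"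
    using arg_cong[OF k_raw(7)[OF n], of T1] by (simp add: T.T.arr_comp)
  have 2: "T1 (T1 (E1 (map \<kappa> yss))) \<bullet> T1 (\<tau> (map (\<lambda>ys. E0 (walk_edges X ys)) yss))
      = T1 (\<tau> (walk_edges X xs)) \<bullet> T1 (E1 (map (\<lambda>ys. T1 (\<kappa> ys)) yss))"
    using tau_natural[of yss \<kappa> "\<lambda>ys. E0 (walk_edges X ys)" "\<lambda>ys. edge X (hd ys, last ys)", THEN T_lift]
    by (simp add: T.T.arr_comp)
  have 3: "E1 (map act (steps xs)) \<bullet> E1 (map (\<lambda>ys. T1 (\<kappa> ys)) yss) = E1 (map comp_cat yss)"
  proof -
    have "map act (steps xs) = map (\<lambda>ys. act (hd ys, last ys)) yss"
      unfolding N(7)[symmetric] by simp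
    moreover have "E1 (map comp_cat yss) = E1 (map (\<lambda>ys. act (hd ys, last ys) \<bullet> T1 (\<kappa> ys)) yss)"
      by (auto simp: comp_cat_def intro!: arg_cong[where f = E1])
    ultimately show ?thesis
      by (simp add: E.arr_comp)
  qed
  have 4: "act (hd xs, last xs) \<bullet> T1 (act (hd xs, last xs)) \<bullet> T1 (T1 (\<kappa> xs)) \<bullet> T1 (\<tau> (walk_edges X xs))
     = act (hd xs, last xs) \<bullet> T1 (\<kappa> xs) \<bullet> T1 (E1 (map act (steps xs)))"
    using arg_cong[OF act_efun[OF N(1)], of T1] by (simp add: T.T.arr_comp)
  have "(act (hd xs, last xs) \<bullet> T1 (\<kappa> (join_walk xs yss))) \<bullet> m (map (walk_edges X) yss)
    = act (hd xs, last xs) \<bullet> T1 (\<kappa> xs) \<bullet> T1 (E1 (map \<kappa> yss)) \<bullet> \<mu> (E0 (map (\<lambda>ys. E0 (walk_edges X ys)) yss)) \<bullet> T1 (\<tau> (map (\<lambda>ys. E0 (walk_edges X ys)) yss))"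
    using 1[THEN reassoc] by (simp add: m_eq)
  also have "\<dots> = act (hd xs, last xs) \<bullet> \<mu> (edge X (hd xs, last xs)) \<bullet> T1 (T1 (\<kappa> xs)) \<bullet> T1 (\<tau> (walk_edges X xs)) \<bullet> T1 (E1 (map (\<lambda>ys. T1 (\<kappa> ys)) yss))"
    using 2 by (simp add: T.mult_natural_rev')
  also have "\<dots> = (act (hd xs, last xs) \<bullet> T1 (act (hd xs, last xs)) \<bullet> T1 (T1 (\<kappa> xs)) \<bullet> T1 (\<tau> (walk_edges X xs))) \<bullet> T1 (E1 (map (\<lambda>ys. T1 (\<kappa> ys)) yss))"
    using act_mult[of "hd xs" "last xs", THEN reassoc] by simp
  also have "\<dots> = (act (hd xs, last xs) \<bullet> T1 (\<kappa> xs)) \<bullet> T1 (E1 (map comp_cat yss))"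
    unfolding 4 3[symmetric] by (simp add: T.T.arr_comp)
  finally have "(act (hd xs, last xs) \<bullet> T1 (\<kappa> (join_walk xs yss))) \<bullet> m (map (walk_edges X) yss)
    = (act (hd xs, last xs) \<bullet> T1 (\<kappa> xs)) \<bullet> T1 (E1 (map comp_cat yss))" .
  moreover have "comp_cat (join_walk xs yss) = act (hd xs, last xs) \<bullet> T1 (\<kappa> (join_walk xs yss))"
    "comp_cat xs = act (hd xs, last xs) \<bullet> T1 (\<kappa> xs)"
    by (simp_all add: comp_cat_def)
  ultimately show "Comp V (comp_cat (join_walk xs yss)) (mt_subst (composite m) (map (walk_edges X) yss))
      = Comp V (comp_cat xs) (farr (composite m) (map comp_cat yss))"
    by simp
qed (auto simp: comp_cat_def)

end

context composite_category
begin

lemma algebra: "((X, base), (lifting_obj V T \<tau> (X, base), (X, base), action))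
    \<in> monad_algebras (ECat small V E) (lifting_of small V E T \<tau>)"
proof -
  interpret GV: category "GV small V" by (rule category_GV[OF category_axioms])
  interpret G: monad "GV small V" "G_monad T" by (rule monad_G[OF T.monad_axioms])
  have [simp]: "edge X \<in> extensional (vpairs X)"
    by (rule vgraphs_extensional[OF X_ob])
  note [simp] = G.unit_typed[simplified] G.mult_typed[simplified]
  have 1: "Comp (GV small V) action (m_unit (G_monad T) X) = Id (GV small V) X"
    by (rule vmap_eqI[where small = small and V = V]) (auto simp: act_unit)
  have ta: "farr (G_func T) action \<in> Ar (GV small V)"
    using G.T.arr(1)[OF action_ar] by simp
  have 2: "Comp (GV small V) action (m_mult (G_monad T) X) = Comp (GV small V) action (farr (G_func T) action)"
    by (rule vmap_eqI[where small = small and V = V]) (auto simp: act_mult ta)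
  show ?thesis
    unfolding algebra_iff using base_ecats action_efun 1 2 by simp
qed

end

context composite_category
begin

interpretation L: lifted_algebra V E T \<tau> small X base "lifting_obj V T \<tau> (X, base)" "(X, base)" action
  by (intro lifted_algebra.intro monoidal_monad_axioms lifted_algebra_axioms.intro algebra)

lemma comp_cat_action: "L.comp_cat = k"
proof (rule extensionalityI[of _ "walks X"])
  show "k \<in> extensional (walks X)" by (rule k_raw)
  show "L.comp_cat xs = k xs" if xs: "xs \<in> walks X" for xs
  proof -
    have "L.comp_cat xs = act (hd xs, last xs) \<bullet> T1 (base xs)"
      using xs by (simp add: L.comp_cat_def walk_ends)
    then show ?thesis
      using act_k[OF xs] xs by (simp add: base_def walk_ends T.T.arr_comp)
  qed
qed (simp add: L.comp_cat_def)

end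

context lifted_algebra
begin

lemma composite_category: "composite_category V E T \<tau> small X comp_cat"
  by (intro composite_category.intro monoidal_monad_axioms composite_category_axioms.intro comp_cat_ecats)

interpretation K: composite_category V E T \<tau> small X comp_cat
  by (rule composite_category)

text \<open>By naturality \<eta> meets the action, and the unit law of the action cancels
  both.\<close>

lemma base_comp_cat: "composite_category.base V E T X comp_cat = \<kappa>"
proof (rule extensionalityI[of _ "walks X"])
  show "\<kappa> \<in> extensional (walks X)" by (rule k_raw)
  show "K.base xs = \<kappa> xs" if xs: "xs \<in> walks X" for xs
  proof -
    have "K.base xs = comp_cat xs \<bullet> \<eta> (E0 (walk_edges X xs))"
      using xs by (simp add: K.base_def)
    then show ?thesis
      using xs walk_ends[OF xs] act_unit[of "hd xs" "last xs", THEN reassoc]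
      by (simp add: comp_cat_def T.unit_natural_rev)
  qed
qed (simp add: K.base_def)

text \<open>The unit law of \<kappa> cancels the u in the definition of the action.\<close>

lemma action_comp_cat: "composite_category.action V E T X comp_cat = v"
proof (rule vmap_eqI[where small = small and V = V])
  fix a b assume "a \<in> verts (vsrc K.action)" "b \<in> verts (vsrc K.action)"
  then have ab [simp]: "a \<in> verts X" "b \<in> verts X" by simp_all
  show "vmor K.action (a, b) = vmor v (a, b)"
  proof -
    have "vmor K.action (a, b) = comp_cat [a, b] \<bullet> T1 (u (edge X (a, b)))"
      by (simp add: K.act_def)
    then show ?thesis
      using k_raw(6)[OF ab, THEN T_lift] by (simp add: comp_cat_def)
  qed
qed (auto simp: v_ar)

end

section \<open>The isomorphism of categories over graphs\<close>

context monoidal_monad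
begin

definition algebra_of where
  "algebra_of = (\<lambda>(X, k). let A = (X, composite_category.base V E T X k)
     in (A, (lifting_obj V T \<tau> A, A, composite_category.action V E T X k)))"

definition composite_of where
  "composite_of = (\<lambda>((X, \<kappa>), (s, t, v)). (X, lifted_algebra.comp_cat V T X \<kappa> v))"

lemma composite_categoryI: "(X, k) \<in> ecats small V (composite m) \<Longrightarrow> composite_category V E T \<tau> small X k"
  by (intro composite_category.intro monoidal_monad_axioms composite_category_axioms.intro)

lemma lifted_algebraI:
  "((X, \<kappa>), (s, t, v)) \<in> monad_algebras (ECat small V E) (lifting_of small V E T \<tau>) \<Longrightarrow>
    lifted_algebra V E T \<tau> small X \<kappa> s t v"
  by (intro lifted_algebra.intro monoidal_monad_axioms lifted_algebra_axioms.intro)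

text \<open>From left to right one restricts along \<eta>E and along T u. From right to left,
  \<open>act_k\<close> factors k as the action after T of the base structure, so the square for k is
  the square of the action pasted with T of the square of the base.\<close>

lemma efun_composite_iff:
  assumes A: "(X, k) \<in> ecats small V (composite m)" and B: "(Y, k') \<in> ecats small V (composite m)"
    and f: "f \<in> hom (GV small V) X Y"
  shows "efun V (composite m) (X, k) (Y, k') f \<longleftrightarrow>
    efun V E (X, composite_category.base V E T X k) (Y, composite_category.base V E T Y k') f \<and>
    Comp (GV small V) f (composite_category.action V E T X k)
      = Comp (GV small V) (composite_category.action V E T Y k') (farr (G_func T) f)"
proof -
  interpret X: composite_category V E T \<tau> small X k by (rule composite_categoryI[OF A])
  interpret Y: composite_category V E T \<tau> small Y k' by (rule composite_categoryI[OF B])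
  interpret GV: category "GV small V" by (rule category_GV[OF category_axioms])
  interpret G: monad "GV small V" "G_monad T" by (rule monad_G[OF T.monad_axioms])
  have f' [simp]: "f \<in> Ar (GV small V)" "vsrc f = X" "vtgt f = Y"
    using f by (auto simp: hom_iff)
  have tf [simp]: "farr (G_func T) f \<in> Ar (GV small V)"
    using G.T.arr(1)[OF f'(1)] by simp
  note F [simp] = GV_arD(3-6)[OF f'(1), unfolded f'(2,3)]
  have act_iff: "Comp (GV small V) f X.action = Comp (GV small V) Y.action (farr (G_func T) f) \<longleftrightarrow>
    (\<forall>a\<in>verts X. \<forall>b\<in>verts X. vmor f (a, b) \<bullet> X.act (a, b) = Y.act (vfun f a, vfun f b) \<bullet> T1 (vmor f (a, b)))"
    (is "?L = ?R \<longleftrightarrow> ?P")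
  proof
    assume eq: "?L = ?R"
    show ?P
    proof (intro ballI)
      fix a b assume "a \<in> verts X" "b \<in> verts X"
      then show "vmor f (a, b) \<bullet> X.act (a, b) = Y.act (vfun f a, vfun f b) \<bullet> T1 (vmor f (a, b))"
        using arg_cong[OF eq, of "\<lambda>g. vmor g (a, b)"] by simp
    qed
  next
    assume ?P
    then show "?L = ?R"
      by (intro vmap_eqI[where small = small and V = V]) auto
  qed
  have E: "vmor f (hd xs, last xs) \<in> Ar V" "Dom V (vmor f (hd xs, last xs)) = edge X (hd xs, last xs)"
    "Cod V (vmor f (hd xs, last xs)) = edge Y (vfun f (hd xs), vfun f (last xs))"
    "map (vfun f) xs \<in> walks Y"
    "E1 (map (vmor f) (steps xs)) \<in> Ar V" "Cod V (E1 (map (vmor f) (steps xs))) = E0 (walk_edges Y (map (vfun f) xs))"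
    "Dom V (E1 (map (vmor f) (steps xs))) = E0 (walk_edges X xs)" if xs: "xs \<in> walks X" for xs
    using walk_ends[OF xs] walks_map[OF f'(1)] E1_graph_map[OF f'(1)] xs by simp_all
  show ?thesis
    unfolding act_iff
  proof (intro iffI conjI)
    assume e: "efun V (composite m) (X, k) (Y, k') f"
    then have e': "vmor f (hd xs, last xs) \<bullet> k xs = k' (map (vfun f) xs) \<bullet> T1 (E1 (map (vmor f) (steps xs)))"
      if "xs \<in> walks X" for xs
      using that by (simp add: efun_def)
    show "efun V E (X, X.base) (Y, Y.base) f"
      unfolding efun_def
    proof
      fix xs assume "xs \<in> walks (fst (X, X.base))"
      then have xs: "xs \<in> walks X" by simp
      note [simp] = E[OF xs]
      have "vmor f (hd xs, last xs) \<bullet> k xs \<bullet> \<eta> (E0 (walk_edges X xs))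
          = (k' (map (vfun f) xs) \<bullet> \<eta> (E0 (walk_edges Y (map (vfun f) xs)))) \<bullet> E1 (map (vmor f) (steps xs))"
        using e'[OF xs, THEN reassoc] xs by (simp add: T.unit_natural walk_map_ends[OF xs] cong del: map_cong)
      then show "vmor f (hd xs, last xs) \<bullet> snd (X, X.base) xs = snd (Y, Y.base) (map (vfun f) xs) \<bullet> E1 (map (vmor f) (steps xs))"
        using xs by (simp add: X.base_def Y.base_def cong del: map_cong)
    qed
    show "\<forall>a\<in>verts X. \<forall>b\<in>verts X. vmor f (a, b) \<bullet> X.act (a, b) = Y.act (vfun f a, vfun f b) \<bullet> T1 (vmor f (a, b))"
    proof (intro ballI)
      fix a b assume ab [simp]: "a \<in> verts X" "b \<in> verts X"
      have "T1 (E1 [vmor f (a, b)]) \<bullet> T1 (u (edge X (a, b))) = T1 (u (edge Y (vfun f a, vfun f b))) \<bullet> T1 (vmor f (a, b))"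
        by (simp add: T.T.arr_comp[symmetric] mtu_natural)
      then show "vmor f (a, b) \<bullet> X.act (a, b) = Y.act (vfun f a, vfun f b) \<bullet> T1 (vmor f (a, b))"
        using e'[of "[a, b]", THEN reassoc] by (simp add: X.act_def Y.act_def)
    qed
  next
    assume "efun V E (X, X.base) (Y, Y.base) f \<and>
      (\<forall>a\<in>verts X. \<forall>b\<in>verts X. vmor f (a, b) \<bullet> X.act (a, b) = Y.act (vfun f a, vfun f b) \<bullet> T1 (vmor f (a, b)))"
    then have e: "efun V E (X, X.base) (Y, Y.base) f"
      and a: "\<And>a b. a \<in> verts X \<Longrightarrow> b \<in> verts X \<Longrightarrow> vmor f (a, b) \<bullet> X.act (a, b) = Y.act (vfun f a, vfun f b) \<bullet> T1 (vmor f (a, b))"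
      by auto
    show "efun V (composite m) (X, k) (Y, k') f"
      unfolding efun_def
    proof
      fix xs assume "xs \<in> walks (fst (X, k))"
      then have xs: "xs \<in> walks X" by simp
      note [simp] = E[OF xs] walk_ends[OF xs] walk_map_ends[OF xs]
      have 1: "vmor f (hd xs, last xs) \<bullet> k xs \<bullet> \<eta> (E0 (walk_edges X xs))
          = k' (map (vfun f) xs) \<bullet> \<eta> (E0 (walk_edges Y (map (vfun f) xs))) \<bullet> E1 (map (vmor f) (steps xs))"
        using e xs by (simp add: efun_def X.base_def Y.base_def cong del: map_cong)
      have 2: "Y.act (vfun f (hd xs), vfun f (last xs)) \<bullet> T1 (k' (map (vfun f) xs)) \<bullet> T1 (\<eta> (E0 (walk_edges Y (map (vfun f) xs))))
        = k' (map (vfun f) xs)"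
        using Y.act_k[OF E(4)[OF xs]] by simp
      have "vmor f (hd xs, last xs) \<bullet> k xs
        = (vmor f (hd xs, last xs) \<bullet> X.act (hd xs, last xs)) \<bullet> T1 (k xs) \<bullet> T1 (\<eta> (E0 (walk_edges X xs)))"
        using X.act_k[OF xs] xs by simp
      also have "\<dots> = Y.act (vfun f (hd xs), vfun f (last xs)) \<bullet> T1 (vmor f (hd xs, last xs) \<bullet> k xs \<bullet> \<eta> (E0 (walk_edges X xs)))"
        using a[of "hd xs" "last xs"] xs by (simp add: T.T.arr_comp)
      also have "\<dots> = (Y.act (vfun f (hd xs), vfun f (last xs)) \<bullet> T1 (k' (map (vfun f) xs)) \<bullet> T1 (\<eta> (E0 (walk_edges Y (map (vfun f) xs)))))
          \<bullet> T1 (E1 (map (vmor f) (steps xs)))"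
        unfolding 1 using xs by (simp add: T.T.arr_comp cong del: map_cong)
      finally show "vmor f (hd xs, last xs) \<bullet> snd (X, k) xs = snd (Y, k') (map (vfun f) xs) \<bullet> farr (composite m) (map (vmor f) (steps xs))"
        unfolding 2 by simp
    qed
  qed
qed

theorem algebra_iso:
  "\<exists>K. cat_iso (ECat small V (composite m)) (alg_cat (ECat small V E) (lifting_of small V E T \<tau>)) K \<and>
    func_eq (ECat small V (composite m)) (ecat_forget \<circ>\<^sub>F alg_forget \<circ>\<^sub>F K) ecat_forget"
proof -
  have mon: "monad (ECat small V E) (lifting_of small V E T \<tau>)"
    using lifting_in_liftings by (auto simp: liftings_def)
  let ?A = "monad_algebras (ECat small V E) (lifting_of small V E T \<tau>)"
  show ?thesis
    unfolding ECat_eq[of small V "composite m"] alg_cat_def ecat_forget_def alg_forget_def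
    unfolding ECat_eq[of small V E]
  proof (rule struct_iso[where K = algebra_of and G = composite_of])
    show "category (struct_cat (GV small V) (ecats small V (composite m)) fst (efun V (composite m)))"
      using multitensor.category_ECat[OF C.composite_multitensor] by (simp add: ECat_eq)
    show "category (struct_cat (struct_cat (GV small V) (ecats small V E) fst (efun V E))
       (monad_algebras (struct_cat (GV small V) (ecats small V E) fst (efun V E)) (lifting_of small V E T \<tau>)) fst
       (\<lambda>(A, x) (B, y) f. Comp (struct_cat (GV small V) (ecats small V E) fst (efun V E)) f x =
          Comp (struct_cat (GV small V) (ecats small V E) fst (efun V E)) y (farr (lifting_of small V E T \<tau>) f)))"
      using category_alg_cat[OF mon] by (simp only: alg_cat_def ECat_eq)
  next
    fix A assume A: "A \<in> ecats small V (composite m)"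
    show "algebra_of A \<in> monad_algebras (struct_cat (GV small V) (ecats small V E) fst (efun V E)) (lifting_of small V E T \<tau>)"
      using composite_category.algebra[OF composite_categoryI] A
      by (auto simp: algebra_of_def Let_def ECat_eq split: prod.split)
    show "composite_of (algebra_of A) = A"
      using composite_category.comp_cat_action[OF composite_categoryI] A
      by (auto simp: algebra_of_def composite_of_def Let_def split: prod.split)
    show "fst (algebra_of A) \<in> ecats small V E"
      using composite_category.base_ecats[OF composite_categoryI] A
      by (auto simp: algebra_of_def Let_def split: prod.split)
    show "fst (fst (algebra_of A)) = fst A"
      by (simp add: algebra_of_def Let_def split: prod.split)
  next
    fix a assume "a \<in> monad_algebras (struct_cat (GV small V) (ecats small V E) fst (efun V E)) (lifting_of small V E T \<tau>)"
    then have a: "a \<in> ?A" by (simp add: ECat_eq)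
    obtain X \<kappa> s t v where a_eq: "a = ((X, \<kappa>), (s, t, v))"
      by (metis prod.collapse)
    interpret lifted_algebra V E T \<tau> small X \<kappa> s t v
      using a a_eq by (intro lifted_algebraI) simp
    show "composite_of a \<in> ecats small V (composite m)"
      using comp_cat_ecats by (simp add: composite_of_def a_eq)
    show "algebra_of (composite_of a) = a"
      using alg_raw by (auto simp: composite_of_def algebra_of_def Let_def a_eq base_comp_cat action_comp_cat)
  next
    fix A B f
    assume A: "A \<in> ecats small V (composite m)" and B: "B \<in> ecats small V (composite m)"
      and f: "f \<in> hom (GV small V) (fst A) (fst B)"
    obtain X k Y k' where eq: "A = (X, k)" "B = (Y, k')"
      by (cases A; cases B)
    have b: "(X, composite_category.base V E T X k) \<in> ecats small V E" "(Y, composite_category.base V E T Y k') \<in> ecats small V E"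
      using composite_category.base_ecats[OF composite_categoryI] A B eq by auto
    have ar: "((X, composite_category.base V E T X k), (Y, composite_category.base V E T Y k'), f) \<in> Ar (ECat small V E)"
       if "efun V E (X, composite_category.base V E T X k) (Y, composite_category.base V E T Y k') f"
      using that b f eq by (simp add: ECat_eq)
    have "efun V (composite m) A B f \<longleftrightarrow>
      efun V E (X, composite_category.base V E T X k) (Y, composite_category.base V E T Y k') f \<and>
      Comp (GV small V) f (composite_category.action V E T X k)
        = Comp (GV small V) (composite_category.action V E T Y k') (farr (G_func T) f)"
      using efun_composite_iff A B f unfolding eq by simp
    then show "efun V (composite m) A B f \<longleftrightarrow> efun V E (fst (algebra_of A)) (fst (algebra_of B)) f \<and>
       (case algebra_of A of (A, x) \<Rightarrow> \<lambda>(B, y) f. Comp (struct_cat (GV small V) (ecats small V E) fst (efun V E)) f x =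
          Comp (struct_cat (GV small V) (ecats small V E) fst (efun V E)) y (farr (lifting_of small V E T \<tau>) f))
        (algebra_of B) (fst (algebra_of A), fst (algebra_of B), f)"
      using lifting_of_simps(2)[OF ar] by (auto simp: algebra_of_def Let_def eq)
  qed
qed

end

section \<open>Initial objects and path categories\<close>

locale enriched = tensor_monad V E T
  for V :: "('o, 'm) cat" and E and T +
  fixes small :: "'a set \<Rightarrow> bool"
  assumes universe: "small_universe small" and coproducts: "has_coproducts small V"
    and dist: "distributive small V E"
begin

lemma small_image: "small A \<Longrightarrow> B \<subseteq> f ` A \<Longrightarrow> small B"
  using universe unfolding small_universe_def by blast

lemma ex_small_infinite: "\<exists>A. small A \<and> infinite A"
  using universe by (simp add: small_universe_def)

text \<open>An infinite small set has subsets of every finite size, and small sets are closed under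
  images and subsets.\<close>

lemma small_finite: "finite A \<Longrightarrow> small A"
proof -
  assume A: "finite A"
  obtain B where B: "small B" "infinite B" using ex_small_infinite by blast
  show "small A"
  proof (cases "A = {}")
    case True
    then show ?thesis using small_image[OF B(1)] by blast
  next
    case False
    obtain C where C: "C \<subseteq> B" "finite C" "card C = card A"
      using B(2) infinite_arbitrarily_large by metis
    then obtain f where "bij_betw f C A"
      using A finite_same_card_bij by blast
    then have "A \<subseteq> f ` B"
      using C(1) by (auto simp: bij_betw_def)
    then show ?thesis using small_image[OF B(1)] by blast
  qed
qed

definition initial where "initial z \<longleftrightarrow> z \<in> Ob V \<and> (\<forall>d\<in>Ob V. \<exists>!h. h \<in> hom V z d)"

text \<open>In this form existence of coproducts and distributivity apply to initial objects,
  through the empty index set.\<close>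

lemma initial_iff: "initial z \<longleftrightarrow> is_coproduct V {} X z \<iota>"
  by (auto simp: initial_def is_coproduct_def)

definition "zero = (SOME z. initial z)"

lemma initial_zero: "initial zero"
proof -
  have "\<exists>z. initial z"
    using coproducts[unfolded has_coproducts_def, rule_format, of "{}" undefined] small_finite[of "{}"]
    by (auto simp: initial_iff[symmetric])
  then show ?thesis
    unfolding zero_def by (rule someI_ex)
qed

lemma zero_ob [simp]: "zero \<in> Ob V"
  using initial_zero by (simp add: initial_def)

definition "ini z d = (THE h. h \<in> hom V z d)"

lemma ini_hom: "initial z \<Longrightarrow> d \<in> Ob V \<Longrightarrow> ini z d \<in> hom V z d"
  unfolding ini_def by (rule theI') (auto simp: initial_def)

lemma ini_typed:
  assumes "initial z" "d \<in> Ob V"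
  shows "ini z d \<in> Ar V" "Dom V (ini z d) = z" "Cod V (ini z d) = d"
  using ini_hom[OF assms] by (auto simp: hom_iff)

lemma initial_eq:
  assumes "initial z" "f \<in> Ar V" "g \<in> Ar V" "Dom V f = z" "Dom V g = z" "Cod V f = Cod V g"
  shows "f = g"
  using assms unfolding initial_def by (metis ar_ob(2) hom_iff)

text \<open>Distributivity in the position of z, for the empty family.\<close>

lemma tensor_initial:
  assumes "z \<in> set Xs" "initial z" "\<forall>X\<in>set Xs. X \<in> Ob V"
  shows "initial (E0 Xs)"
proof -
  obtain Ys Zs where Xs: "Xs = Ys @ [z] @ Zs"
    using split_list[OF assms(1)] by auto
  then have Y: "Ys \<in> lists (Ob V)" "Zs \<in> lists (Ob V)"
    using assms(3) by auto
  have 1: "is_coproduct V ({} :: 'a set) (\<lambda>_. z) z (\<lambda>_. Id V z)"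
    using assms(2) by (simp only: initial_iff[symmetric])
  have "is_coproduct V ({} :: 'a set) (\<lambda>_. E0 (Ys @ [z] @ Zs)) (E0 (Ys @ [z] @ Zs))
      (\<lambda>_. E1 (map (Id V) Ys @ [Id V z] @ map (Id V) Zs))"
    using dist[unfolded distributive_def, rule_format, OF Y, of "{}" "\<lambda>_. z" z "\<lambda>_. Id V z"] 1 small_finite[of "{}"]
    by simp
  then show ?thesis
    unfolding Xs initial_iff[symmetric] .
qed

text \<open>Vertices have to be taken from the type of vertices of all graphs. An embedding of the
  natural numbers exists because some small set is infinite.\<close>

definition vx :: "nat \<Rightarrow> 'a" where "vx = (SOME v. inj v)"

lemma inj_vx: "inj vx"
proof -
  obtain A where "infinite (A :: 'a set)" using ex_small_infinite by blast
  then have "\<exists>v :: nat \<Rightarrow> 'a. inj v" using infinite_countable_subset by blast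
  then show ?thesis unfolding vx_def by (rule someI_ex)
qed

lemma vx_eq [simp]: "vx i = vx j \<longleftrightarrow> i = j"
  using inj_vx by (auto dest: injD)

definition "ix = inv vx"

lemma ix_vx [simp]: "ix (vx i) = i"
  by (simp add: ix_def inj_vx)

definition path :: "nat \<Rightarrow> 'a list" where "path n = map vx [0..<Suc n]"

text \<open>Entry i of \<open>Xs\<close>, counted from 0, lies between the vertices i and i + 1; so
  this is the part of the sequence between two vertices.\<close>

definition slice :: "'b list \<Rightarrow> 'a \<times> 'a \<Rightarrow> 'b list" where
  "slice Xs p = take (ix (snd p) - ix (fst p)) (drop (ix (fst p)) Xs)"

text \<open>The order is weak: a step from a vertex to itself is allowed, has an empty slice, and
  stands for a nullary tensor.\<close>

definition ascending :: "'a list \<Rightarrow> bool" where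
  "ascending ws \<longleftrightarrow> (\<forall>p\<in>set (steps ws). ix (fst p) \<le> ix (snd p))"

lemma slice_append: "ix a \<le> ix b \<Longrightarrow> ix b \<le> ix c \<Longrightarrow> slice Xs (a, b) @ slice Xs (b, c) = slice Xs (a, c)"
  using take_add[of "ix b - ix a" "ix c - ix b" "drop (ix a) Xs"] by (simp add: slice_def)

text \<open>The slices between consecutive vertices telescope.\<close>

lemma ascending_props:
  assumes "ws \<noteq> []" "ascending ws"
  shows "ix (hd ws) \<le> ix (last ws) \<and> concat (map (slice Xs) (steps ws)) = slice Xs (hd ws, last ws)"
  using assms
proof (induction ws rule: induct_list012)
  case (3 a b ws)
  then have "ascending (b # ws)" "ix a \<le> ix b" by (auto simp: ascending_def)
  with 3 show ?case using slice_append[of a b "last (b # ws)" Xs] by auto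
qed (auto simp: slice_def)

lemma ascending_ends: "ws \<noteq> [] \<Longrightarrow> ascending ws \<Longrightarrow> ix (hd ws) \<le> ix (last ws)"
  using ascending_props by blast

lemma concat_slices: "ws \<noteq> [] \<Longrightarrow> ascending ws \<Longrightarrow> concat (map (slice Xs) (steps ws)) = slice Xs (hd ws, last ws)"
  using ascending_props by blast

lemma slice_ob: "\<forall>X\<in>set Xs. P X \<Longrightarrow> \<forall>X\<in>set (slice Xs p). P X"
  unfolding slice_def by (meson in_set_dropD in_set_takeD)

lemma map_slice: "map f (slice Xs p) = slice (map f Xs) p"
  by (simp add: slice_def take_map drop_map)

lemma steps_path: "steps (path n) = map (\<lambda>i. (vx i, vx (Suc i))) [0..<n]"
  unfolding path_def steps_map by (intro nth_equalityI) (auto simp: steps_def nth_tl simp del: upt_Suc)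

lemma path_props [simp]: "hd (path n) = vx 0" "last (path n) = vx n" "path n \<noteq> []" "length (path n) = Suc n"
  by (simp_all add: path_def hd_map last_map del: upt_Suc)

lemma ascending_path: "ascending (path n)"
  by (auto simp: ascending_def steps_path)

lemma slices_path: "n = length Xs \<Longrightarrow> map (slice Xs) (steps (path n)) = map (\<lambda>X. [X]) Xs"
  by (intro nth_equalityI) (auto simp: steps_path slice_def take_Suc_conv_app_nth hd_drop_conv_nth take_Suc)

text \<open>
  The free \<open>E\<close>-category on the linear graph with edges \<open>X\<^sub>1, \<dots>, X\<^sub>n\<close>: its hom from \<open>i\<close> to \<open>j\<close> is
  \<open>E (X\<^sub>i\<^sub>+\<^sub>1, \<dots>, X\<^sub>j)\<close> if \<open>i \<le> j\<close>, and initial otherwise.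
\<close>

definition pathG :: "'o list \<Rightarrow> ('a, 'o) vgraph" where
  "pathG Xs = \<lparr>verts = vx ` {..length Xs}, edge = (\<lambda>p\<in>vx ` {..length Xs} \<times> vx ` {..length Xs}.
     if ix (fst p) \<le> ix (snd p) then E0 (slice Xs p) else zero)\<rparr>"

text \<open>On ascending walks this is the structure of a free E-category. A walk with a descending
  step has an initial source, which leaves no choice.\<close>

definition pathK :: "'o list \<Rightarrow> 'a list \<Rightarrow> 'm" where
  "pathK Xs = (\<lambda>ws\<in>walks (pathG Xs). if ascending ws then \<sigma> (map (slice Xs) (steps ws))
     else ini (E0 (walk_edges (pathG Xs) ws)) (edge (pathG Xs) (hd ws, last ws)))"

lemma pathG_verts: "verts (pathG Xs) = vx ` {..length Xs}"
  by (simp add: pathG_def)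

lemma pathG_edge: "a \<in> verts (pathG Xs) \<Longrightarrow> b \<in> verts (pathG Xs) \<Longrightarrow>
    edge (pathG Xs) (a, b) = (if ix a \<le> ix b then E0 (slice Xs (a, b)) else zero)"
  by (simp add: pathG_def)

lemma path_walk: "n = length Xs \<Longrightarrow> path n \<in> walks (pathG Xs)"
  by (auto simp: walks_simps path_def pathG_verts simp del: upt_Suc)

context
  fixes Xs :: "'o list"
  assumes Xs [simp]: "\<forall>X\<in>set Xs. X \<in> Ob V"
begin

lemma slices_ob [simp]: "\<forall>X\<in>set (slice Xs p). X \<in> Ob V"
  using slice_ob[OF Xs] .

lemma pathG_vgraph: "pathG Xs \<in> vgraphs small V"
  unfolding vgraphs_def by (auto simp: pathG_def intro!: small_finite)

lemma ascending_edges: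
  assumes "ws \<in> walks (pathG Xs)" "ascending ws"
  shows "walk_edges (pathG Xs) ws = map E0 (map (slice Xs) (steps ws))"
  using assms steps_walk[OF assms(1)] by (auto simp: walk_edges_def ascending_def pathG_edge)

text \<open>A descending step contributes \<open>zero\<close> to the sequence that is
  tensored.\<close>

lemma not_ascending_initial:
  assumes "ws \<in> walks (pathG Xs)" "\<not> ascending ws"
  shows "initial (E0 (walk_edges (pathG Xs) ws))"
proof (rule tensor_initial[OF _ initial_zero walk_edges_ob[OF pathG_vgraph assms(1)]])
  obtain a b where ab: "(a, b) \<in> set (steps ws)" "\<not> ix a \<le> ix b"
    using assms(2) by (auto simp: ascending_def)
  then have "edge (pathG Xs) (a, b) = zero"
    using steps_walk[OF assms(1) ab(1)] by (simp add: pathG_edge)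
  then show "zero \<in> set (walk_edges (pathG Xs) ws)"
    using ab(1) by (force simp: walk_edges_def)
qed

lemma pathK_typed:
  assumes ws: "ws \<in> walks (pathG Xs)"
  shows "pathK Xs ws \<in> Ar V" "Dom V (pathK Xs ws) = E0 (walk_edges (pathG Xs) ws)"
    "Cod V (pathK Xs ws) = edge (pathG Xs) (hd ws, last ws)"
proof -
  have ne: "ws \<noteq> []" using ws by (simp add: walks_simps)
  have "edge (pathG Xs) (hd ws, last ws) \<in> Ob V"
    using walk_ends[OF ws] pathG_vgraph by simp
  then show "pathK Xs ws \<in> Ar V" "Dom V (pathK Xs ws) = E0 (walk_edges (pathG Xs) ws)"
    "Cod V (pathK Xs ws) = edge (pathG Xs) (hd ws, last ws)"
    using ws ini_typed[OF not_ascending_initial[OF ws]] ascending_edges[OF ws] walk_ends[OF ws]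
      concat_slices[OF ne, of Xs] ascending_ends[OF ne]
    by (auto simp: pathK_def pathG_edge)
qed

lemma pathK_ascending: "ws \<in> walks (pathG Xs) \<Longrightarrow> ascending ws \<Longrightarrow> pathK Xs ws = \<sigma> (map (slice Xs) (steps ws))"
  by (simp add: pathK_def)

text \<open>If every inner walk ascends, so do the outer and the joined walk, and the law is
  associativity of \<sigma>. Otherwise the common source of both sides is initial.\<close>

lemma path_ecat: "(pathG Xs, pathK Xs) \<in> ecats small V E"
proof (rule ecatsI)
  fix a b assume ab: "a \<in> verts (pathG Xs)" "b \<in> verts (pathG Xs)"
  then have w: "[a, b] \<in> walks (pathG Xs)" by (simp add: walks_simps)
  have o: "edge (pathG Xs) (a, b) \<in> Ob V"
    using pathG_vgraph ab by simp
  show "pathK Xs [a, b] \<bullet> u (edge (pathG Xs) (a, b)) = Id V (edge (pathG Xs) (a, b))"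
  proof (cases "ix a \<le> ix b")
    case True
    then show ?thesis
      using w ab subst_unit_outer[of "slice Xs (a, b)"] by (simp add: pathK_ascending ascending_def pathG_edge)
  next
    case False
    then have "edge (pathG Xs) (a, b) = zero" using ab by (simp add: pathG_edge)
    then show ?thesis
      using initial_zero pathK_typed[OF w] o by (intro initial_eq[of zero]) auto
  qed
next
  fix xs yss assume n: "nested_walk (pathG Xs) xs yss"
  note N = nested_walkD[OF n]
  note P = pathK_typed[OF N(3)] pathK_typed[OF N(1)] pathK_typed[OF N(2)]
  have e: "\<forall>ys\<in>set yss. \<forall>X\<in>set (walk_edges (pathG Xs) ys). X \<in> Ob V"
    using walk_edges_ob[OF pathG_vgraph] N(2) by blast
  show "pathK Xs (join_walk xs yss) \<bullet> \<sigma> (map (walk_edges (pathG Xs)) yss) = pathK Xs xs \<bullet> E1 (map (pathK Xs) yss)"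
  proof (cases "\<forall>ys\<in>set yss. ascending ys")
    case True
    define A where "A = map (\<lambda>ys. map (slice Xs) (steps ys)) yss"
    have ne: "ys \<in> set yss \<Longrightarrow> ys \<noteq> []" for ys using N(2) by (auto simp: walks_simps)
    have x: "ascending xs"
      unfolding ascending_def N(7)[symmetric] using True ascending_ends ne by auto
    have sj: "steps (join_walk xs yss) = concat (map steps yss)"
      using join_walk_props[OF n] by simp
    have j: "ascending (join_walk xs yss)"
      unfolding ascending_def sj using True by (auto simp: ascending_def)
    have 1: "pathK Xs (join_walk xs yss) = \<sigma> (concat A)"
      using N(3) j by (simp add: pathK_ascending sj A_def)
    have 2: "map (walk_edges (pathG Xs)) yss = map (map E0) A"
      using N(2) True by (simp add: A_def ascending_edges del: map_map) simp
    have 3: "map (slice Xs) (steps xs) = map concat A"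
      unfolding N(7)[symmetric] A_def using True ne by (simp add: concat_slices)
    have 4: "map (pathK Xs) yss = map \<sigma> A"
      unfolding A_def using True N(2) by (simp add: pathK_ascending)
    show ?thesis
      unfolding 1 2 4 pathK_ascending[OF N(1) x] 3
      by (rule subst_assoc_map) (auto simp: A_def)
  next
    case False
    then obtain ys where ys: "ys \<in> set yss" "\<not> ascending ys" by auto
    have "initial (E0 (map E0 (map (walk_edges (pathG Xs)) yss)))"
      by (rule tensor_initial[of "E0 (walk_edges (pathG Xs) ys)"])
        (use ys N(2) e in \<open>auto intro: not_ascending_initial\<close>)
    then show ?thesis
      using P e N by (intro initial_eq[of "E0 (map E0 (map (walk_edges (pathG Xs)) yss))"]) auto
  qed
qed (auto simp: pathK_typed pathG_vgraph, simp add: pathK_def)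

text \<open>The homs between neighbours are the unary tensors \<open>E0 [X]\<close> and not the X
  themselves; this is where the units u in the later formulas come from.\<close>

lemma path_edges: "n = length Xs \<Longrightarrow> walk_edges (pathG Xs) (path n) = map (\<lambda>X. E0 [X]) Xs"
  using ascending_edges[OF path_walk ascending_path, of n] slices_path[of n Xs] by (simp del: map_map) simp

lemma pathK_path: "n = length Xs \<Longrightarrow> pathK Xs (path n) = \<sigma> (map (\<lambda>X. [X]) Xs)"
  using pathK_ascending[OF path_walk ascending_path, of n] slices_path[of n Xs] by simp

end

text \<open>A walk has one vertex more than it has steps, hence the \<open>Suc\<close> that
  \<open>slice\<close> lacks.\<close>

definition wslice :: "'b list \<Rightarrow> 'a \<times> 'a \<Rightarrow> 'b list" where
  "wslice xs p = take (Suc (ix (snd p) - ix (fst p))) (drop (ix (fst p)) xs)"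

lemma steps_drop: "steps (drop i xs) = drop i (steps xs)"
  by (simp add: steps_def drop_zip tl_drop)

lemma steps_take: "steps (take (Suc k) xs) = take k (steps xs)"
proof (induction xs arbitrary: k rule: induct_list012)
  case (3 a b xs)
  show ?case using 3(2)[of "k - 1"] by (cases k) auto
qed auto

lemma steps_wslice: "steps (wslice xs p) = slice (steps xs) p"
  by (simp add: wslice_def slice_def steps_take steps_drop)

lemma walk_edges_wslice: "walk_edges X (wslice xs p) = slice (walk_edges X xs) p"
  by (simp add: walk_edges_def steps_wslice map_slice)

lemma wslice_props:
  assumes "xs \<in> walks X" "ix a \<le> ix b" "ix b < length xs"
  shows "wslice xs (a, b) \<in> walks X" "hd (wslice xs (a, b)) = xs ! ix a" "last (wslice xs (a, b)) = xs ! ix b"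
    "walk_edges X (wslice xs (a, b)) = slice (walk_edges X xs) (a, b)"
proof -
  have "wslice xs (a, b) \<noteq> []" using assms by (simp add: wslice_def)
  then show "wslice xs (a, b) \<in> walks X"
    using assms(1) unfolding wslice_def walks_simps by (meson in_set_dropD in_set_takeD)
  show "hd (wslice xs (a, b)) = xs ! ix a" "last (wslice xs (a, b)) = xs ! ix b"
    using assms by (auto simp: wslice_def hd_drop_conv_nth last_conv_nth min_def intro!: arg_cong[where f = "nth xs"])
  show "walk_edges X (wslice xs (a, b)) = slice (walk_edges X xs) (a, b)"
    by (rule walk_edges_wslice)
qed

lemma wslice_append:
  assumes "ix a \<le> ix b" "ix b \<le> ix c"
  shows "wslice xs (a, b) @ tl (wslice xs (b, c)) = wslice xs (a, c)"
proof -
  have "tl (wslice xs (b, c)) = take (ix c - ix b) (drop (Suc (ix b - ix a)) (drop (ix a) xs))"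
    using assms by (simp add: wslice_def tl_take tl_drop drop_Suc[symmetric])
  then show ?thesis
    using take_add[of "Suc (ix b - ix a)" "ix c - ix b" "drop (ix a) xs"] assms by (simp add: wslice_def)
qed

text \<open>An ascending walk of indices cuts \<open>xs\<close> at the corresponding vertices; a
  repeated index gives an inner walk with a single vertex. Associativity in X thereby becomes
  available along every ascending walk of the path category.\<close>

lemma nested_wslice:
  assumes "ws \<noteq> []" "ascending ws" "\<forall>a\<in>set ws. ix a < length xs" "xs \<in> walks X"
  shows "nested_walk X (map (\<lambda>a. xs ! ix a) ws) (map (wslice xs) (steps ws)) \<and>
    join_walk (map (\<lambda>a. xs ! ix a) ws) (map (wslice xs) (steps ws)) = wslice xs (hd ws, last ws)"
  using assms
proof (induction ws rule: induct_list012)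
  case (2 a)
  then show ?case
    by (auto simp: nested_walk_def walks_simps join_walk_def wslice_def take_Suc hd_drop_conv_nth)
next
  case (3 a b ws)
  let ?f = "\<lambda>a. xs ! ix a"
  have asc: "ascending (b # ws)" and ab: "ix a \<le> ix b" using 3 by (auto simp: ascending_def)
  have l: "ix b \<le> ix (last (b # ws))" using ascending_ends[OF _ asc] by simp
  have IH: "nested_walk X (map ?f (b # ws)) (map (wslice xs) (steps (b # ws)))"
    "join_walk (map ?f (b # ws)) (map (wslice xs) (steps (b # ws))) = wslice xs (b, last (b # ws))"
    using 3 asc by auto
  have w: "wslice xs (a, b) \<in> walks_between X (?f a, ?f b)"
    using wslice_props[OF 3(6) ab] 3(5) by (simp add: walks_between_def)
  have "?f a \<in> verts X" using 3(5,6) by (simp add: walks_simps)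
  then have "nested_walk X (map ?f (a # b # ws)) (map (wslice xs) (steps (a # b # ws)))"
    using IH(1) w by (simp add: nested_walk_def walks_simps(1))
  moreover have "join_walk (map ?f (a # b # ws)) (map (wslice xs) (steps (a # b # ws)))
      = wslice xs (a, b) @ tl (wslice xs (b, last (b # ws)))"
    using join_walk_Cons[OF w, of "map ?f ws" "map (wslice xs) (steps (b # ws))"] IH(2) by simp
  ultimately show ?case
    using wslice_append[OF ab l, of xs] by simp
qed auto

text \<open>The extension that freeness of the path category demands, for a walk \<open>xs\<close>
  in the E-category A and arrows \<open>gs\<close> into the homs along it.\<close>

definition ext :: "'o list \<Rightarrow> ('a, 'o) vgraph \<times> ('a list \<Rightarrow> 'm) \<Rightarrow> 'a list \<Rightarrow> 'm list \<Rightarrow> ('a, 'o, 'm) vmap" where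
  "ext Xs A xs gs = \<lparr>vsrc = pathG Xs, vtgt = fst A, vfun = (\<lambda>a\<in>verts (pathG Xs). xs ! ix a),
     vmor = (\<lambda>p\<in>vpairs (pathG Xs). if ix (fst p) \<le> ix (snd p) then snd A (wslice xs p) \<bullet> E1 (slice gs p)
       else ini zero (edge (fst A) (xs ! ix (fst p), xs ! ix (snd p))))\<rparr>"

context
  fixes X \<kappa> xs Xs gs
  assumes cat: "(X, \<kappa>) \<in> ecats small V E" and xs: "xs \<in> walks X"
    and gs: "\<forall>g\<in>set gs. g \<in> Ar V" "map (Dom V) gs = Xs" "map (Cod V) gs = walk_edges X xs"
begin

lemma ext_Xs: "\<forall>X\<in>set Xs. X \<in> Ob V"
  using gs by auto

lemma ext_length: "length Xs = length gs" "length xs = Suc (length gs)"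
proof -
  show "length Xs = length gs" using gs(2) by auto
  have "length (walk_edges X xs) = length gs" using gs(3) by (metis length_map)
  then show "length xs = Suc (length gs)"
    using xs by (cases xs) (auto simp: walk_edges_def length_steps walks_simps)
qed

lemma ext_vert: "a \<in> verts (pathG Xs) \<Longrightarrow> ix a < length xs \<and> xs ! ix a \<in> verts X"
  using xs ext_length by (auto simp: pathG_verts walks_simps)

lemma slice_gs:
  "\<forall>g\<in>set (slice gs p). g \<in> Ar V" "map (Dom V) (slice gs p) = slice Xs p"
  "map (Cod V) (slice gs p) = slice (walk_edges X xs) p"
  using gs slice_ob[OF gs(1)] by (simp_all add: map_slice)

lemma E1_slice_gs: "E1 (slice gs p) \<in> Ar V" "Dom V (E1 (slice gs p)) = E0 (slice Xs p)"
  "Cod V (E1 (slice gs p)) = E0 (slice (walk_edges X xs) p)"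
  using slice_gs[of p] by simp_all

lemmas k = ecatsD[OF cat]

lemma ext_vmor: "a \<in> verts (pathG Xs) \<Longrightarrow> b \<in> verts (pathG Xs) \<Longrightarrow> ix a \<le> ix b \<Longrightarrow>
    vmor (ext Xs (X, \<kappa>) xs gs) (a, b) = \<kappa> (wslice xs (a, b)) \<bullet> E1 (slice gs (a, b))"
  by (simp add: ext_def)

lemma ext_ar: "ext Xs (X, \<kappa>) xs gs \<in> Ar (GV small V)"
proof (rule GV_arI)
  fix a b assume "a \<in> verts (vsrc (ext Xs (X, \<kappa>) xs gs))" "b \<in> verts (vsrc (ext Xs (X, \<kappa>) xs gs))"
  then have ab: "a \<in> verts (pathG Xs)" "b \<in> verts (pathG Xs)" by (simp_all add: ext_def)
  note v = ext_vert[OF ab(1)] ext_vert[OF ab(2)]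
  have o: "edge X (xs ! ix a, xs ! ix b) \<in> Ob V"
    using v k(1) by simp
  show "vmor (ext Xs (X, \<kappa>) xs gs) (a, b) \<in> hom V (edge (vsrc (ext Xs (X, \<kappa>) xs gs)) (a, b))
     (edge (vtgt (ext Xs (X, \<kappa>) xs gs)) (vfun (ext Xs (X, \<kappa>) xs gs) a, vfun (ext Xs (X, \<kappa>) xs gs) b))"
  proof (cases "ix a \<le> ix b")
    case True
    then show ?thesis
      using ab v wslice_props[OF xs True] k(3-5)[OF wslice_props(1)[OF xs True]] E1_slice_gs[of "(a, b)"]
      by (simp add: ext_def hom_iff pathG_edge)
  next
    case False
    then show ?thesis
      using ab ini_hom[OF initial_zero o] by (simp add: ext_def pathG_edge)
  qed
qed (use k(1) pathG_vgraph[OF ext_Xs] ext_vert in \<open>auto simp: ext_def\<close>)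

text \<open>On ascending walks the square is associativity of \<kappa> along the nesting of
  \<open>nested_wslice\<close>, combined with naturality of \<sigma> along \<open>gs\<close>. On
  other walks the source is initial.\<close>

lemma ext_efun: "efun V E (pathG Xs, pathK Xs) (X, \<kappa>) (ext Xs (X, \<kappa>) xs gs)"
  unfolding efun_def
proof
  let ?f = "ext Xs (X, \<kappa>) xs gs"
  fix ws assume "ws \<in> walks (fst (pathG Xs, pathK Xs))"
  then have ws: "ws \<in> walks (pathG Xs)" by simp
  note F = ext_ar
  have src: "vsrc ?f = pathG Xs" "vtgt ?f = X" by (simp_all add: ext_def)
  have ws': "map (vfun ?f) ws \<in> walks X"
    using walks_map[OF F, unfolded src] ws by simp
  note K = pathK_typed[OF ext_Xs ws]
  note E = E1_graph_map[OF F, unfolded src, OF ws]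
  note M = GV_arD(4-6)[OF F, unfolded src, OF walk_ends[OF ws]]
  have K': "\<kappa> (map (vfun ?f) ws) \<in> Ar V" "Dom V (\<kappa> (map (vfun ?f) ws)) = E0 (walk_edges X (map (vfun ?f) ws))"
    "Cod V (\<kappa> (map (vfun ?f) ws)) = edge X (vfun ?f (hd ws), vfun ?f (last ws))"
    using k(3-5)[OF ws'] walk_map_ends[OF ws, of "vfun ?f"] by simp_all
  show "vmor ?f (hd ws, last ws) \<bullet> snd (pathG Xs, pathK Xs) ws = snd (X, \<kappa>) (map (vfun ?f) ws) \<bullet> E1 (map (vmor ?f) (steps ws))"
  proof (cases "ascending ws")
    case False
    show ?thesis
      by (rule initial_eq[OF not_ascending_initial[OF ext_Xs ws False]]) (simp_all only: snd_conv comp_typed K E M K')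
  next
    case True
    have ne: "ws \<noteq> []" using ws by (simp add: walks_simps)
    have lt: "\<forall>a\<in>set ws. ix a < length xs" using ws ext_vert by (auto simp: walks_simps)
    have fw: "map (vfun ?f) ws = map (\<lambda>a. xs ! ix a) ws"
      using ws by (auto simp: ext_def walks_simps)
    note N = nested_wslice[OF ne True lt xs]
    note n = N[THEN conjunct1] and j = N[THEN conjunct2]
    note nd = nested_walkD[OF n]
    let ?p = "(hd ws, last ws)"
    have st: "a \<in> verts (pathG Xs) \<and> b \<in> verts (pathG Xs) \<and> ix a \<le> ix b" if "(a, b) \<in> set (steps ws)" for a b
      using steps_walk[OF ws that] True that by (auto simp: ascending_def)
    have 1: "map (vmor ?f) (steps ws) = map (\<lambda>p. \<kappa> (wslice xs p) \<bullet> E1 (slice gs p)) (steps ws)"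
      using st ext_vmor by auto
    have we: "map (walk_edges X) (map (wslice xs) (steps ws)) = map (slice (walk_edges X xs)) (steps ws)"
      by (simp add: walk_edges_def steps_wslice map_slice)
    have wk: "wslice xs p \<in> walks X" if "p \<in> set (steps ws)" for p
      using nd(2) that by auto
    have 2: "E1 (map (\<lambda>p. \<kappa> (wslice xs p) \<bullet> E1 (slice gs p)) (steps ws))
       = E1 (map (\<lambda>p. \<kappa> (wslice xs p)) (steps ws)) \<bullet> E1 (map (\<lambda>p. E1 (slice gs p)) (steps ws))"
    proof (rule E.arr_comp)
      fix p assume p: "p \<in> set (steps ws)"
      show "E1 (slice gs p) \<in> Ar V \<and> \<kappa> (wslice xs p) \<in> Ar V \<and> Cod V (E1 (slice gs p)) = Dom V (\<kappa> (wslice xs p))"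
        using k(3,4)[OF wk[OF p]] E1_slice_gs[of p] by (simp add: walk_edges_wslice)
    qed
    have 3: "\<sigma> (map (slice (walk_edges X xs)) (steps ws)) \<bullet> E1 (map (\<lambda>p. E1 (slice gs p)) (steps ws))
        = E1 (slice gs ?p) \<bullet> \<sigma> (map (slice Xs) (steps ws))"
    proof -
      have "map (map (Cod V)) (map (slice gs) (steps ws)) = map (slice (walk_edges X xs)) (steps ws)"
        "map (map (Dom V)) (map (slice gs) (steps ws)) = map (slice Xs) (steps ws)"
        "concat (map (slice gs) (steps ws)) = slice gs ?p"
        "map E1 (map (slice gs) (steps ws)) = map (\<lambda>p. E1 (slice gs p)) (steps ws)"
        using slice_gs concat_slices[OF ne True] by simp_all
      then show ?thesis
        using mts_natural[of "map (slice gs) (steps ws)"] slice_gs(1) by (simp del: map_map)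
    qed
    have 4: "\<kappa> (wslice xs ?p) \<bullet> \<sigma> (map (slice (walk_edges X xs)) (steps ws))
        = \<kappa> (map (\<lambda>a. xs ! ix a) ws) \<bullet> E1 (map (\<lambda>p. \<kappa> (wslice xs p)) (steps ws))"
      using k(7)[OF n] unfolding j we by simp
    have e: "\<forall>Xs\<in>set (map (slice (walk_edges X xs)) (steps ws)). \<forall>X\<in>set Xs. X \<in> Ob V"
      using slice_ob[OF walk_edges_ob[OF k(1) xs]] by auto
    have e': "\<forall>Xs\<in>set (map (slice Xs) (steps ws)). \<forall>X\<in>set Xs. X \<in> Ob V"
      using slice_ob[OF ext_Xs] by auto
    have p: "hd ws \<in> verts (pathG Xs)" "last ws \<in> verts (pathG Xs)" "ix (hd ws) \<le> ix (last ws)"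
      using walk_ends[OF ws] ascending_ends[OF ne True] by auto
    have wp: "wslice xs ?p \<in> walks X" using nd(3) j by simp
    have T1: "\<kappa> (wslice xs ?p) \<in> Ar V" "Dom V (\<kappa> (wslice xs ?p)) = E0 (slice (walk_edges X xs) ?p)"
      using k(3,4)[OF wp] by (simp_all add: walk_edges_wslice)
    have T2: "E1 (map (\<lambda>p. E1 (slice gs p)) (steps ws)) \<in> Ar V"
        "Cod V (E1 (map (\<lambda>p. E1 (slice gs p)) (steps ws))) = E0 (map E0 (map (slice (walk_edges X xs)) (steps ws)))"
      using E1_slice_gs by simp_all
    have T3: "E1 (map (\<lambda>p. \<kappa> (wslice xs p)) (steps ws)) \<in> Ar V"
        "Dom V (E1 (map (\<lambda>p. \<kappa> (wslice xs p)) (steps ws))) = E0 (map E0 (map (slice (walk_edges X xs)) (steps ws)))"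
        "Cod V (E1 (map (\<lambda>p. \<kappa> (wslice xs p)) (steps ws))) = E0 (walk_edges X (map (\<lambda>a. xs ! ix a) ws))"
    proof -
      have "map (\<lambda>p. Cod V (\<kappa> (wslice xs p))) (steps ws) = walk_edges X (map (\<lambda>a. xs ! ix a) ws)"
        unfolding nd(8)[symmetric] using k(5)[OF wk] by simp
      then show "E1 (map (\<lambda>p. \<kappa> (wslice xs p)) (steps ws)) \<in> Ar V"
        "Dom V (E1 (map (\<lambda>p. \<kappa> (wslice xs p)) (steps ws))) = E0 (map E0 (map (slice (walk_edges X xs)) (steps ws)))"
        "Cod V (E1 (map (\<lambda>p. \<kappa> (wslice xs p)) (steps ws))) = E0 (walk_edges X (map (\<lambda>a. xs ! ix a) ws))"
        using k(3,4)[OF wk] by (simp_all add: walk_edges_wslice)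
    qed
    have S: "\<sigma> (map (slice (walk_edges X xs)) (steps ws)) \<in> Ar V"
      "Dom V (\<sigma> (map (slice (walk_edges X xs)) (steps ws))) = E0 (map E0 (map (slice (walk_edges X xs)) (steps ws)))"
      "Cod V (\<sigma> (map (slice (walk_edges X xs)) (steps ws))) = E0 (slice (walk_edges X xs) ?p)"
      using mts_typed[OF e] concat_slices[OF ne True, of "walk_edges X xs"] by simp_all
    have S': "\<sigma> (map (slice Xs) (steps ws)) \<in> Ar V"
      "Cod V (\<sigma> (map (slice Xs) (steps ws))) = E0 (slice Xs ?p)"
      using mts_typed[OF e'] concat_slices[OF ne True, of "Xs"] by simp_all
    have "vmor ?f ?p \<bullet> pathK Xs ws = (\<kappa> (wslice xs ?p) \<bullet> E1 (slice gs ?p)) \<bullet> \<sigma> (map (slice Xs) (steps ws))"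
      using ext_vmor[OF p] pathK_ascending[OF ext_Xs ws True] by simp
    also have "\<dots> = (\<kappa> (wslice xs ?p) \<bullet> \<sigma> (map (slice (walk_edges X xs)) (steps ws))) \<bullet> E1 (map (\<lambda>p. E1 (slice gs p)) (steps ws))"
      by (simp only: assoc T1 E1_slice_gs S' S T2 3)
    also have "\<dots> = \<kappa> (map (\<lambda>a. xs ! ix a) ws) \<bullet> E1 (map (vmor ?f) (steps ws))"
      using K'[unfolded fw] unfolding 4 1 2 by (simp only: assoc T2 T3)
    finally show ?thesis
      unfolding fw by simp
  qed
qed

end

end

text \<open>Consecutive pieces share one vertex: a piece with n steps takes n + 1 vertices, while
  only n are dropped before the next piece.\<close>

lemma split_walk:
  "xs \<in> walks X \<Longrightarrow> length xs = Suc (sum_list ns) \<Longrightarrow>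
    \<exists>ws yss. nested_walk X ws yss \<and> join_walk ws yss = xs \<and> map length yss = map Suc ns"
proof (induction ns arbitrary: xs)
  case Nil
  then obtain a where "xs = [a]" by (auto simp: length_Suc_conv)
  with Nil have "nested_walk X [a] [] \<and> join_walk [a] [] = xs \<and> map length [] = map Suc []"
    by (auto simp: nested_walk_def walks_simps join_walk_def)
  then show ?case by blast
next
  case (Cons n ns)
  define ys where "ys = take (Suc n) xs"
  have ne: "drop n xs \<noteq> []" using Cons by simp
  have "drop n xs \<in> walks X"
    using Cons(2) ne unfolding walks_simps by (meson in_set_dropD)
  then obtain ws yss where IH: "nested_walk X ws yss" "join_walk ws yss = drop n xs" "map length yss = map Suc ns"
    using Cons.IH[of "drop n xs"] Cons(3) by auto
  obtain b ws' where ws: "ws = b # ws'"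
    using nested_walkD(1)[OF IH(1)] by (cases ws) (auto simp: walks_simps)
  have b: "b = xs ! n"
    using nested_walkD(4)[OF IH(1)] IH(2) Cons(3) by (simp add: ws hd_drop_conv_nth)
  have ys: "ys \<in> walks_between X (hd xs, b)"
  proof -
    have "length ys = Suc n" using Cons(3) by (simp add: ys_def)
    then have "ys \<noteq> []" "last ys = ys ! n" using last_conv_nth[of ys] by (metis length_0_conv nat.distinct(1), metis diff_Suc_1 length_0_conv nat.distinct(1))
    then show ?thesis
      using Cons(2) unfolding walks_simps by (auto simp: ys_def b dest: in_set_takeD)
  qed
  have "nested_walk X (hd xs # ws) (ys # yss)"
    using IH(1) ys walk_ends[OF Cons(2)] by (simp add: nested_walk_def ws walks_simps(1))
  moreover have "join_walk (hd xs # ws) (ys # yss) = ys @ tl (drop n xs)"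
    using join_walk_Cons[OF ys, of ws' yss] IH(2) by (simp add: ws)
  then have "join_walk (hd xs # ws) (ys # yss) = xs"
    by (metis append_take_drop_id drop_Suc tl_drop ys_def)
  moreover have "map length (ys # yss) = map Suc (n # ns)"
    using IH(3) Cons(3) by (simp add: ys_def)
  ultimately show ?case by blast
qed

lemma concat_lengths_eq: "map length xss = map length yss \<Longrightarrow> concat xss = concat yss \<Longrightarrow> xss = yss"
proof (induction xss arbitrary: yss)
  case (Cons xs xss)
  obtain ys yss' where yss: "yss = ys # yss'" using Cons(2) by (cases yss) simp_all
  have "length xs = length ys" "map length xss = map length yss'" using Cons(2) yss by simp_all
  moreover from this Cons(3) yss have "xs = ys" "concat xss = concat yss'" by simp_all
  ultimately show ?case using Cons(1) yss by simp
qed simp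

context enriched
begin

text \<open>Cuts the full path at the block boundaries of \<open>Xss\<close>, so that associativity
  along the nested walk becomes a statement about an arbitrary doubly nested sequence. The pieces
  are identified by their lengths and their concatenation.\<close>

lemma split_path:
  assumes n: "n = length (concat Xss)"
  shows "\<exists>ws yss. nested_walk (pathG (concat Xss)) ws yss \<and> join_walk ws yss = path n \<and>
    ascending ws \<and> (\<forall>ys\<in>set yss. ascending ys) \<and> map (slice (concat Xss)) (steps ws) = Xss \<and>
    map (\<lambda>ys. map (slice (concat Xss)) (steps ys)) yss = map (map (\<lambda>X. [X])) Xss"
proof -
  let ?X = "concat Xss"
  have "length (path n) = Suc (sum_list (map length Xss))"
    by (simp add: n length_concat)
  then obtain ws yss where N: "nested_walk (pathG ?X) ws yss" and j: "join_walk ws yss = path n"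
    and l: "map length yss = map Suc (map length Xss)"
    using split_walk[OF path_walk[OF n]] by metis
  note D = nested_walkD[OF N]
  have s: "concat (map steps yss) = steps (path n)"
    using join_walk_props[OF N] j by simp
  have a: "\<forall>ys\<in>set yss. ascending ys"
    using ascending_path[of n] unfolding ascending_def s[symmetric] by auto
  have ne: "ys \<in> set yss \<Longrightarrow> ys \<noteq> []" for ys using D(2) by (auto simp: walks_simps)
  have aw: "ascending ws"
    unfolding ascending_def D(7)[symmetric] using a ascending_ends ne by auto
  have sl: "map (\<lambda>ys. map (slice ?X) (steps ys)) yss = map (map (\<lambda>X. [X])) Xss"
  proof (rule concat_lengths_eq)
    have "concat (map (\<lambda>ys. map (slice ?X) (steps ys)) yss) = map (slice ?X) (concat (map steps yss))"
      by simp
    then show "concat (map (\<lambda>ys. map (slice ?X) (steps ys)) yss) = concat (map (map (\<lambda>X. [X])) Xss)"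
      unfolding s slices_path[OF n] by simp
    have "map length (map (\<lambda>ys. map (slice ?X) (steps ys)) yss) = map (\<lambda>ys. length ys - 1) yss"
      by (simp add: length_steps)
    also have "\<dots> = map (\<lambda>n. n - 1) (map length yss)" by (simp only: map_map comp_def)
    also have "\<dots> = map length (map (map (\<lambda>X. [X])) Xss)" unfolding l by (rule nth_equalityI) simp_all
    finally show "map length (map (\<lambda>ys. map (slice ?X) (steps ys)) yss) = map length (map (map (\<lambda>X. [X])) Xss)" .
  qed
  have "map (slice ?X) (steps ws) = map concat (map (\<lambda>ys. map (slice ?X) (steps ys)) yss)"
    unfolding D(7)[symmetric] using a ne by (simp add: concat_slices)
  also have "\<dots> = Xss"
    unfolding sl by (rule nth_equalityI) simp_all
  finally show ?thesis
    using N j aw a sl by blast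
qed

end

section \<open>Liftings\<close>

locale lifting = enriched V E T small
  for V :: "('o, 'm) cat" and E and T and small :: "'a set \<Rightarrow> bool" +
  fixes S
  assumes S: "S \<in> liftings small V E (G_monad T)"
begin

lemma ECat_hom:
  assumes "h \<in> hom (ECat small V E) A B" "snd (snd h) = f"
  shows "h = (A, B, f)" "efun V E A B f"
proof -
  obtain a b c where h: "h = (a, b, c)" by (cases h)
  have "(a, b, c) \<in> Ar (ECat small V E)" "Dom (ECat small V E) (a, b, c) = A" "Cod (ECat small V E) (a, b, c) = B"
    using assms(1) unfolding h hom_iff by auto
  then show "h = (A, B, f)" "efun V E A B f"
    using assms(2) unfolding h ECat_eq by simp_all
qed

lemma S_props:
  "monad (ECat small V E) S" "func_eq (ECat small V E) (G_monad T \<circ>\<^sub>F ecat_forget) (ecat_forget \<circ>\<^sub>F S)"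
  "\<And>A. A \<in> Ob (ECat small V E) \<Longrightarrow> m_unit (G_monad T) (fobj ecat_forget A) = farr ecat_forget (m_unit S A)"
  "\<And>A. A \<in> Ob (ECat small V E) \<Longrightarrow> m_mult (G_monad T) (fobj ecat_forget A) = farr ecat_forget (m_mult S A)"
  "fobj S \<in> extensional (Ob (ECat small V E))" "farr S \<in> extensional (Ar (ECat small V E))"
  "m_unit S \<in> extensional (Ob (ECat small V E))" "m_mult S \<in> extensional (Ob (ECat small V E))"
  using S unfolding liftings_def by blast+

lemma ECat_ob: "Ob (ECat small V E) = ecats small V E"
  by (simp add: ECat_eq)

lemma ecat_forget_simps: "fobj ecat_forget A = fst A" "farr ecat_forget h = snd (snd h)"
  by (simp_all add: ecat_forget_def forget_func_def split: prod.split)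

lemmas S_monad = S_props(1)

lemma S_obj: "A \<in> ecats small V E \<Longrightarrow> fobj S A \<in> ecats small V E \<and> fst (fobj S A) = G_obj T (fst A)"
proof -
  assume A: "A \<in> ecats small V E"
  interpret S: monad "ECat small V E" S by (rule S_monad)
  have "fobj S A \<in> ecats small V E"
    using S.unit.G.fobj_ob[of A] A by (simp only: ECat_ob)
  moreover have "fst (fobj S A) = G_obj T (fst A)"
    using S_props(2) A by (simp add: func_eq_def ecat_forget_simps ECat_ob)
  ultimately show ?thesis by simp
qed

definition "kp A = snd (fobj S A)"

lemma S_obj_eq: "A \<in> ecats small V E \<Longrightarrow> fobj S A = (G_obj T (fst A), kp A)"
  using S_obj[of A] by (simp add: kp_def prod_eq_iff)

lemma kp_ecat: "A \<in> ecats small V E \<Longrightarrow> (G_obj T (fst A), kp A) \<in> ecats small V E"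
  using S_obj[of A] by (simp add: S_obj_eq)

text \<open>The underlying graph map is prescribed by the lifting condition. So S chooses only
  structure maps, and functoriality becomes an E-functor condition on them.\<close>

lemma S_arr:
  assumes f: "(A, B, f) \<in> Ar (ECat small V E)"
  shows "farr S (A, B, f) = (fobj S A, fobj S B, farr (G_func T) f)"
    "efun V E (fobj S A) (fobj S B) (farr (G_func T) f)"
proof -
  interpret S: monad "ECat small V E" S by (rule S_monad)
  have "farr S (A, B, f) \<in> hom (ECat small V E) (fobj S A) (fobj S B)"
    by (rule S.unit.G.farr_hom) (use f in \<open>simp add: hom_iff ECat_eq\<close>)
  moreover have "snd (snd (farr S (A, B, f))) = farr (G_func T) f"
  proof -
    have "farr (G_monad T \<circ>\<^sub>F ecat_forget) (A, B, f) = farr (ecat_forget \<circ>\<^sub>F S) (A, B, f)"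
      using S_props(2) f unfolding func_eq_def by blast
    then show ?thesis by (simp add: ecat_forget_simps)
  qed
  ultimately show "farr S (A, B, f) = (fobj S A, fobj S B, farr (G_func T) f)"
    "efun V E (fobj S A) (fobj S B) (farr (G_func T) f)"
    by (rule ECat_hom)+
qed

lemma S_unit:
  assumes A: "A \<in> ecats small V E"
  shows "m_unit S A = (A, fobj S A, m_unit (G_monad T) (fst A))" "efun V E A (fobj S A) (m_unit (G_monad T) (fst A))"
proof -
  interpret S: monad "ECat small V E" S by (rule S_monad)
  have "m_unit S A \<in> hom (ECat small V E) A (fobj S A)"
    using S.unit.component[of A] A by (simp add: ECat_ob)
  moreover have "snd (snd (m_unit S A)) = m_unit (G_monad T) (fst A)"
  proof -
    show ?thesis
      using S_props(3)[of A] A by (simp only: ECat_ob ecat_forget_simps)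
  qed
  ultimately show "m_unit S A = (A, fobj S A, m_unit (G_monad T) (fst A))" "efun V E A (fobj S A) (m_unit (G_monad T) (fst A))"
    by (rule ECat_hom)+
qed

lemma S_mult:
  assumes A: "A \<in> ecats small V E"
  shows "m_mult S A = (fobj S (fobj S A), fobj S A, m_mult (G_monad T) (fst A))"
    "efun V E (fobj S (fobj S A)) (fobj S A) (m_mult (G_monad T) (fst A))"
proof -
  interpret S: monad "ECat small V E" S by (rule S_monad)
  have "m_mult S A \<in> hom (ECat small V E) (fobj S (fobj S A)) (fobj S A)"
    using S.mult.component[of A] A by (simp add: ECat_ob)
  moreover have "snd (snd (m_mult S A)) = m_mult (G_monad T) (fst A)"
  proof -
    show ?thesis
      using S_props(4)[of A] A by (simp only: ECat_ob ecat_forget_simps)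
  qed
  ultimately show "m_mult S A = (fobj S (fobj S A), fobj S A, m_mult (G_monad T) (fst A))"
    "efun V E (fobj S (fobj S A)) (fobj S A) (m_mult (G_monad T) (fst A))"
    by (rule ECat_hom)+
qed

text \<open>The structure map of the lifted path category along the full path leads from the tensor
  of the \<open>T0 (E0 [X])\<close> to \<open>T0 (E0 Xs)\<close>; the units u correct the
  source.\<close>

definition tau where
  "tau Xs = kp (pathG Xs, pathK Xs) (path (length Xs)) \<bullet> E1 (map (\<lambda>X. T1 (u X)) Xs)"

context
  fixes Xs
  assumes Xs [simp]: "\<forall>X\<in>set Xs. X \<in> Ob V"
begin

lemma kpP: "kp (pathG Xs, pathK Xs) (path (length Xs)) \<in> Ar V"
  "Dom V (kp (pathG Xs, pathK Xs) (path (length Xs))) = E0 (map (\<lambda>X. T0 (E0 [X])) Xs)"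
  "Cod V (kp (pathG Xs, pathK Xs) (path (length Xs))) = T0 (E0 Xs)"
proof -
  note k = ecatsD[OF kp_ecat[OF path_ecat[OF Xs], simplified]]
  have w: "path (length Xs) \<in> walks (G_obj T (pathG Xs))" using path_walk by simp
  have v: "vx 0 \<in> verts (pathG Xs)" "vx (length Xs) \<in> verts (pathG Xs)" by (auto simp: pathG_verts)
  show "kp (pathG Xs, pathK Xs) (path (length Xs)) \<in> Ar V"
    "Dom V (kp (pathG Xs, pathK Xs) (path (length Xs))) = E0 (map (\<lambda>X. T0 (E0 [X])) Xs)"
    "Cod V (kp (pathG Xs, pathK Xs) (path (length Xs))) = T0 (E0 Xs)"
  proof -
    have "walk_edges (G_obj T (pathG Xs)) (path (length Xs)) = map (\<lambda>X. T0 (E0 [X])) Xs"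
      by (simp only: walk_edges_G_obj[OF path_walk] path_edges[OF Xs] map_map comp_def)
    moreover have "edge (G_obj T (pathG Xs)) (vx 0, vx (length Xs)) = T0 (E0 Xs)"
      using v by (simp add: pathG_edge slice_def)
    ultimately show "kp (pathG Xs, pathK Xs) (path (length Xs)) \<in> Ar V"
      "Dom V (kp (pathG Xs, pathK Xs) (path (length Xs))) = E0 (map (\<lambda>X. T0 (E0 [X])) Xs)"
      "Cod V (kp (pathG Xs, pathK Xs) (path (length Xs))) = T0 (E0 Xs)"
      using k(3-5)[OF w] by (simp_all only: path_props)
  qed
qed

lemma tau_typed: "tau Xs \<in> Ar V" "Dom V (tau Xs) = E0 (map T0 Xs)" "Cod V (tau Xs) = T0 (E0 Xs)"
  by (simp_all add: tau_def kpP)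

end

lemmas [simp] = tau_typed

text \<open>This is the lifting applied to the \<open>E\<close>-functor out of the path category that \<open>xs\<close> and \<open>gs\<close> determine.\<close>

lemma kp_ext:
  assumes cat: "(X, \<kappa>) \<in> ecats small V E" and xs: "xs \<in> walks X"
    and gs: "\<forall>g\<in>set gs. g \<in> Ar V" "map (Dom V) gs = Xs" "map (Cod V) gs = walk_edges X xs"
  shows "T1 (\<kappa> xs \<bullet> E1 gs) \<bullet> tau Xs = kp (X, \<kappa>) xs \<bullet> E1 (map T1 gs)"
proof -
  define n where "n = length gs"
  have n: "n = length Xs" "length xs = Suc n"
    using ext_length[OF cat xs gs] by (simp_all add: n_def)
  have Xs: "\<forall>X\<in>set Xs. X \<in> Ob V" by (rule ext_Xs[OF cat xs gs])
  let ?P = "(pathG Xs, pathK Xs)" and ?f = "ext Xs (X, \<kappa>) xs gs"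
  note k = ecatsD[OF cat]
  have src: "vsrc ?f = pathG Xs" "vtgt ?f = X" by (simp_all add: ext_def)
  have "(?P, (X, \<kappa>), ?f) \<in> Ar (ECat small V E)"
    using ext_ar[OF cat xs gs] ext_efun[OF cat xs gs] path_ecat[OF Xs] cat
    by (simp add: ECat_eq hom_iff src)
  note S_arr(2)[OF this]
  then have ef: "efun V E (G_obj T (pathG Xs), kp ?P) (G_obj T X, kp (X, \<kappa>)) (farr (G_func T) ?f)"
    using S_obj_eq[OF path_ecat[OF Xs]] S_obj_eq[OF cat] by simp
  have w: "path n \<in> walks (pathG Xs)" by (rule path_walk[OF n(1)])
  have v: "vx i \<in> verts (pathG Xs)" if "i \<le> n" for i using that by (simp add: pathG_verts n)
  have mp: "map (vfun ?f) (path n) = xs"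
    using v n(2) by (intro nth_equalityI) (auto simp: path_def ext_def simp del: upt_Suc)
  have ws: "wslice xs (vx 0, vx n) = xs" "slice gs (vx 0, vx n) = gs"
    using n by (simp_all add: wslice_def slice_def n_def)
  have e0: "vmor ?f (vx 0, vx n) = \<kappa> xs \<bullet> E1 gs"
    using ext_vmor[OF cat xs gs v v, of 0 n] ws by simp
  have si: "slice gs (vx i, vx (Suc i)) = [gs ! i]" "wslice xs (vx i, vx (Suc i)) = [xs ! i, xs ! Suc i]" if "i < n" for i
  proof -
    have 1: "drop i gs = gs ! i # drop (Suc i) gs" using that by (simp add: Cons_nth_drop_Suc n_def)
    have 2: "drop i xs = xs ! i # xs ! Suc i # drop (Suc (Suc i)) xs" using that n by (simp add: Cons_nth_drop_Suc)
    show "slice gs (vx i, vx (Suc i)) = [gs ! i]" "wslice xs (vx i, vx (Suc i)) = [xs ! i, xs ! Suc i]"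
      using that by (simp_all add: slice_def wslice_def 1 2)
  qed
  have ei: "vmor ?f (vx i, vx (Suc i)) = \<kappa> [xs ! i, xs ! Suc i] \<bullet> E1 [gs ! i]" if "i < n" for i
    using ext_vmor[OF cat xs gs v v, of i "Suc i"] si that by simp
  have gi: "gs ! i \<in> Ar V" "Dom V (gs ! i) = Xs ! i" "Cod V (gs ! i) = edge X (xs ! i, xs ! Suc i)"
    "xs ! i \<in> verts X" "xs ! Suc i \<in> verts X" if "i < n" for i
  proof -
    show "gs ! i \<in> Ar V" using gs(1) that by (simp add: n_def)
    show "Dom V (gs ! i) = Xs ! i" using that unfolding gs(2)[symmetric] by (simp add: n_def)
    have "Cod V (gs ! i) = walk_edges X xs ! i" using that unfolding gs(3)[symmetric] by (simp add: n_def)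
    then show "Cod V (gs ! i) = edge X (xs ! i, xs ! Suc i)"
      using that n by (simp add: walk_edges_def length_steps steps_def nth_tl)
    show "xs ! i \<in> verts X" "xs ! Suc i \<in> verts X" using xs that n by (simp_all add: walks_simps)
  qed
  \<comment> \<open>On a single edge the extension after u returns the arrow from which it was
    built, by the unit law of \<kappa>. This is how the units in \<open>tau\<close> are
    absorbed.\<close>
  have pw: "vmor ?f (vx i, vx (Suc i)) \<bullet> u (Xs ! i) = gs ! i" "vmor ?f (vx i, vx (Suc i)) \<in> Ar V"
      "Dom V (vmor ?f (vx i, vx (Suc i))) = E0 [Xs ! i]" if i: "i < n" for i
  proof -
    note [simp] = gi[OF i] k(3-6)
    have o [simp]: "edge X (xs ! i, xs ! Suc i) \<in> Ob V" "Xs ! i \<in> Ob V" using gi[OF i] k(1) ar_ob by (metis)+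
    have w2 [simp]: "[xs ! i, xs ! Suc i] \<in> walks X" by (simp add: walks_simps)
    show "vmor ?f (vx i, vx (Suc i)) \<bullet> u (Xs ! i) = gs ! i"
      using k(6)[OF gi(4,5)[OF i], THEN reassoc] by (simp add: ei[OF i] mtu_natural_rev)
    show "vmor ?f (vx i, vx (Suc i)) \<in> Ar V" "Dom V (vmor ?f (vx i, vx (Suc i))) = E0 [Xs ! i]"
      by (simp_all add: ei[OF i])
  qed
  have st: "map (vmor (farr (G_func T) ?f)) (steps (path n)) = map (\<lambda>i. T1 (vmor ?f (vx i, vx (Suc i)))) [0..<n]"
    using v by (simp add: steps_path src)
  have Xi: "Xs = map (\<lambda>i. Xs ! i) [0..<n]" "gs = map (\<lambda>i. gs ! i) [0..<n]"
    by (simp_all add: n(1) map_nth) (simp add: n(1)[symmetric] n_def map_nth)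
  have Xo: "Xs ! i \<in> Ob V" if "i < n" for i using Xs that n by simp
  have E: "E1 (map (vmor (farr (G_func T) ?f)) (steps (path n))) \<bullet> E1 (map (\<lambda>X. T1 (u X)) Xs) = E1 (map T1 gs)"
  proof -
    have "E1 (map (\<lambda>i. T1 (vmor ?f (vx i, vx (Suc i)))) [0..<n]) \<bullet> E1 (map (\<lambda>i. T1 (u (Xs ! i))) [0..<n])
      = E1 (map (\<lambda>i. T1 (gs ! i)) [0..<n])"
      by (rule E_lift) (use pw Xo in \<open>simp_all add: T.T.arr_comp[symmetric]\<close>)
    moreover have "map (\<lambda>i. T1 (u (Xs ! i))) [0..<n] = map (\<lambda>X. T1 (u X)) Xs" "map (\<lambda>i. T1 (gs ! i)) [0..<n] = map T1 gs"
      by (subst (2) Xi, simp)+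
    ultimately show ?thesis unfolding st by simp
  qed
  have "T1 (\<kappa> xs \<bullet> E1 gs) \<bullet> kp ?P (path n) = kp (X, \<kappa>) xs \<bullet> E1 (map (vmor (farr (G_func T) ?f)) (steps (path n)))"
  proof -
    have "path n \<in> walks (fst (G_obj T (pathG Xs), kp ?P))" using w by simp
    from ef[unfolded efun_def, rule_format, OF this] show ?thesis
      using v by (simp only: G_simps snd_conv path_props mp src) (simp add: e0)
  qed
  moreover have "kp (X, \<kappa>) xs \<in> Ar V" "Dom V (kp (X, \<kappa>) xs) = E0 (map T0 (walk_edges X xs))"
    using ecatsD(3,4)[OF kp_ecat[OF cat], of xs] xs walk_edges_G_obj[OF xs, of T] by simp_all
  moreover have "E1 (map (vmor (farr (G_func T) ?f)) (steps (path n))) \<in> Ar V"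
     "Cod V (E1 (map (vmor (farr (G_func T) ?f)) (steps (path n)))) = E0 (map T0 (walk_edges X xs))"
     "Dom V (E1 (map (vmor (farr (G_func T) ?f)) (steps (path n)))) = E0 (map (\<lambda>X. T0 (E0 [X])) Xs)"
  proof -
    have c: "Cod V (vmor ?f (vx i, vx (Suc i))) = edge X (xs ! i, xs ! Suc i)" if "i < n" for i
      using GV_arD(6)[OF ext_ar[OF cat xs gs], unfolded src, of "vx i" "vx (Suc i)"] v that by (simp add: ext_def)
    have we: "walk_edges X xs = map (\<lambda>i. edge X (xs ! i, xs ! Suc i)) [0..<n]"
      using n(2) by (intro nth_equalityI) (auto simp: walk_edges_def length_steps steps_def nth_tl)
    show "E1 (map (vmor (farr (G_func T) ?f)) (steps (path n))) \<in> Ar V"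
      unfolding st using pw by simp
    show "Cod V (E1 (map (vmor (farr (G_func T) ?f)) (steps (path n)))) = E0 (map T0 (walk_edges X xs))"
      unfolding st we by (subst E.arr(3)) (use pw c in \<open>auto intro!: arg_cong[where f = E0]\<close>)
    have "Dom V (E1 (map (vmor (farr (G_func T) ?f)) (steps (path n)))) = E0 (map (\<lambda>X. T0 (E0 [X])) (map (\<lambda>i. Xs ! i) [0..<n]))"
      unfolding st by (subst E.arr(2)) (use pw in \<open>auto intro!: arg_cong[where f = E0]\<close>)
    then show "Dom V (E1 (map (vmor (farr (G_func T) ?f)) (steps (path n)))) = E0 (map (\<lambda>X. T0 (E0 [X])) Xs)"
      by (simp only: Xi(1)[symmetric])
  qed
  moreover have "\<kappa> xs \<bullet> E1 gs \<in> Ar V" "Dom V (\<kappa> xs \<bullet> E1 gs) = E0 Xs"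
    using k(3,4)[OF xs] gs by simp_all
  ultimately show ?thesis
    using E Xs kpP[OF Xs] reassoc[of "T1 (\<kappa> xs \<bullet> E1 gs)" "kp ?P (path n)"]
    by (simp add: tau_def n(1)[symmetric])
qed

text \<open>\<open>kp_ext\<close> for the identities of the edges. Hence the structure maps of a
  lifting have the form prescribed by \<open>lifting_obj\<close> and are determined by
  \<open>tau\<close>.\<close>

lemma kp_eq:
  assumes cat: "(X, \<kappa>) \<in> ecats small V E" and xs: "xs \<in> walks X"
  shows "kp (X, \<kappa>) xs = T1 (\<kappa> xs) \<bullet> tau (walk_edges X xs)"
proof -
  note k = ecatsD[OF cat]
  note o = walk_edges_ob[OF k(1) xs]
  have "T1 (\<kappa> xs \<bullet> E1 (map (Id V) (walk_edges X xs))) \<bullet> tau (walk_edges X xs)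
     = kp (X, \<kappa>) xs \<bullet> E1 (map T1 (map (Id V) (walk_edges X xs)))"
    by (rule kp_ext[OF cat xs]) (use o in \<open>auto intro: map_idI\<close>)
  moreover have "E1 (map T1 (map (Id V) (walk_edges X xs))) = Id V (E0 (map T0 (walk_edges X xs)))"
  proof -
    have "map T1 (map (Id V) (walk_edges X xs)) = map (Id V) (map T0 (walk_edges X xs))"
      using o by simp
    then show ?thesis using o E.arr_id[of "map T0 (walk_edges X xs)"] by simp
  qed
  ultimately show ?thesis
    using o k(3,4)[OF xs] ecatsD(3,4)[OF kp_ecat[OF cat], of xs] xs walk_edges_G_obj[OF xs, of T] by simp
qed

text \<open>\<open>kp_ext\<close> with the path category of the codomains as target; its edges are
  unary tensors, so each f is followed by u.\<close>

lemma tau_natural: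
  assumes f: "\<And>i. i \<in> set Is \<Longrightarrow> f i \<in> Ar V \<and> Dom V (f i) = a i \<and> Cod V (f i) = b i"
  shows "tau (map b Is) \<bullet> E1 (map (\<lambda>i. T1 (f i)) Is) = T1 (E1 (map f Is)) \<bullet> tau (map a Is)"
proof -
  note [simp] = f
  have [simp]: "i \<in> set Is \<Longrightarrow> b i \<in> Ob V" "i \<in> set Is \<Longrightarrow> a i \<in> Ob V" for i
    using f by (metis ar_ob)+
  have b: "\<forall>X\<in>set (map b Is). X \<in> Ob V" by simp
  let ?gs = "map (\<lambda>i. u (b i) \<bullet> f i) Is" and ?n = "length (map b Is)"
  have "T1 (pathK (map b Is) (path ?n) \<bullet> E1 ?gs) \<bullet> tau (map a Is)
     = kp (pathG (map b Is), pathK (map b Is)) (path ?n) \<bullet> E1 (map T1 ?gs)"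
    by (rule kp_ext[OF path_ecat[OF b] path_walk[OF refl]]) (simp_all add: path_edges)
  moreover have "pathK (map b Is) (path ?n) \<bullet> E1 ?gs = E1 (map f Is)"
  proof -
    have "E1 ?gs = E1 (map u (map b Is)) \<bullet> E1 (map f Is)"
      using E.arr_comp[of Is f "\<lambda>i. u (b i)"] by simp
    then show ?thesis
      using subst_unit_inner[OF b, THEN reassoc, of "E1 (map f Is)"] by (simp add: pathK_path)
  qed
  moreover have "tau (map b Is) \<bullet> E1 (map (\<lambda>i. T1 (f i)) Is) = kp (pathG (map b Is), pathK (map b Is)) (path ?n) \<bullet> E1 (map T1 ?gs)"
    using kpP[OF b] by (simp add: tau_def T.T.arr_comp E.arr_comp)
  ultimately show ?thesis by simp
qed

text \<open>The unit law of the lifted path category on the edge from 0 to 1.\<close>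

lemma tau_unit:
  assumes X [simp]: "X \<in> Ob V"
  shows "tau [X] \<bullet> u (T0 X) = T1 (u X)"
proof -
  let ?P = "(pathG [X], pathK [X])"
  have v: "vx 0 \<in> verts (pathG [X])" "vx 1 \<in> verts (pathG [X])" by (simp_all add: pathG_verts)
  have p: "path (Suc 0) = [vx 0, vx 1]" by (simp add: path_def)
  have e: "edge (pathG [X]) (vx 0, vx 1) = E0 [X]" using v by (simp add: pathG_edge slice_def)
  have "kp ?P [vx 0, vx 1] \<bullet> u (T0 (E0 [X])) = Id V (T0 (E0 [X]))"
    using ecatsD(6)[OF kp_ecat[OF path_ecat], of "[X]" "vx 0" "vx 1"] v e by simp
  then show ?thesis
    using kpP[of "[X]"] reassoc[of "kp ?P [vx 0, vx 1]" "u (T0 (E0 [X]))" _ "T1 (u X)"]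
    by (simp add: tau_def p mtu_natural_rev)
qed

text \<open>The unit of the lifting is an E-functor out of the path category; its square at the full
  path, precomposed with the units u, gives this equation.\<close>

lemma tau_eta:
  assumes Xs [simp]: "\<forall>X\<in>set Xs. X \<in> Ob V"
  shows "tau Xs \<bullet> E1 (map \<eta> Xs) = \<eta> (E0 Xs)"
proof -
  let ?P = "(pathG Xs, pathK Xs)" and ?n = "length Xs"
  have w: "path ?n \<in> walks (pathG Xs)" by (simp add: path_walk)
  have v: "vx 0 \<in> verts (pathG Xs)" "vx ?n \<in> verts (pathG Xs)" by (simp_all add: pathG_verts)
  have e: "edge (pathG Xs) (vx 0, vx ?n) = E0 Xs" using v by (simp add: pathG_edge slice_def)
  have "efun V E ?P (G_obj T (pathG Xs), kp ?P) (G_trans (id_func :: ('o, 'm, 'o, 'm) func) T \<eta> (pathG Xs))"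
    using S_unit(2)[OF path_ecat[OF Xs]] S_obj_eq[OF path_ecat[OF Xs]] by simp
  then have "\<eta> (E0 Xs) \<bullet> \<sigma> (map (\<lambda>X. [X]) Xs) = kp ?P (path ?n) \<bullet> E1 (map \<eta> (map (\<lambda>X. E0 [X]) Xs))"
    using w v unfolding efun_def
    by (auto simp: walk_map_restrict_id steps_map_restrict e pathK_path path_edges simp del: map_map cong del: map_cong dest!: bspec[of _ _ "path ?n"])
  then have 1: "\<eta> (E0 Xs) \<bullet> \<sigma> (map (\<lambda>X. [X]) Xs) = kp ?P (path ?n) \<bullet> E1 (map (\<lambda>X. \<eta> (E0 [X])) Xs)"
    by simp
  have 2: "E1 (map (\<lambda>X. \<eta> (E0 [X])) Xs) \<bullet> E1 (map u Xs) = E1 (map (\<lambda>X. T1 (u X)) Xs) \<bullet> E1 (map \<eta> Xs)"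
  proof -
    have "E1 (map (\<lambda>X. \<eta> (E0 [X])) Xs) \<bullet> E1 (map u Xs) = E1 (map (\<lambda>X. T1 (u X) \<bullet> \<eta> X) Xs)"
      by (rule E_lift) (simp_all add: T.unit_natural)
    then show ?thesis by (simp add: E.arr_comp)
  qed
  have "tau Xs \<bullet> E1 (map \<eta> Xs) = (kp ?P (path ?n) \<bullet> E1 (map (\<lambda>X. \<eta> (E0 [X])) Xs)) \<bullet> E1 (map u Xs)"
    using 2 kpP[OF Xs] by (simp add: tau_def)
  also have "\<dots> = \<eta> (E0 Xs)"
    unfolding 1[symmetric] using subst_unit_inner[OF Xs] by simp
  finally show ?thesis .
qed

text \<open>As for \<eta>, with the multiplication of the lifting. The structure map of the twice
  lifted path category is expressed through \<open>tau\<close> by \<open>kp_eq\<close>.\<close>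

lemma tau_mu:
  assumes Xs [simp]: "\<forall>X\<in>set Xs. X \<in> Ob V"
  shows "tau Xs \<bullet> E1 (map \<mu> Xs) = \<mu> (E0 Xs) \<bullet> T1 (tau Xs) \<bullet> tau (map T0 Xs)"
proof -
  let ?P = "(pathG Xs, pathK Xs)" and ?n = "length Xs"
  have w: "path ?n \<in> walks (pathG Xs)" by (simp add: path_walk)
  have v: "vx 0 \<in> verts (pathG Xs)" "vx ?n \<in> verts (pathG Xs)" by (simp_all add: pathG_verts)
  have e: "edge (pathG Xs) (vx 0, vx ?n) = E0 Xs" using v by (simp add: pathG_edge slice_def)
  note cT = kp_ecat[OF path_ecat[OF Xs], simplified]
  have k2: "kp (G_obj T (pathG Xs), kp ?P) (path ?n) = T1 (kp ?P (path ?n)) \<bullet> tau (map (\<lambda>X. T0 (E0 [X])) Xs)"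
    using kp_eq[OF cT, of "path ?n"] w by (simp add: walk_edges_G_obj[OF w] path_edges)
  have "efun V E (G_obj T (G_obj T (pathG Xs)), kp (G_obj T (pathG Xs), kp ?P)) (G_obj T (pathG Xs), kp ?P)
      (G_trans (T \<circ>\<^sub>F T) T \<mu> (pathG Xs))"
    using S_mult(2)[OF path_ecat[OF Xs]] S_obj_eq[OF path_ecat[OF Xs]] S_obj_eq[OF cT] by simp
  then have "\<mu> (E0 Xs) \<bullet> kp (G_obj T (pathG Xs), kp ?P) (path ?n) = kp ?P (path ?n) \<bullet> E1 (map \<mu> (map (\<lambda>X. E0 [X]) Xs))"
    using w v unfolding efun_def
    by (auto simp: walk_map_restrict_id steps_map_restrict e path_edges simp del: map_map cong del: map_cong dest!: bspec[of _ _ "path ?n"])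
  then have 1: "\<mu> (E0 Xs) \<bullet> T1 (kp ?P (path ?n)) \<bullet> tau (map (\<lambda>X. T0 (E0 [X])) Xs) = kp ?P (path ?n) \<bullet> E1 (map (\<lambda>X. \<mu> (E0 [X])) Xs)"
    unfolding k2 by simp
  have 2: "E1 (map (\<lambda>X. \<mu> (E0 [X])) Xs) \<bullet> E1 (map (\<lambda>X. T1 (T1 (u X))) Xs) = E1 (map (\<lambda>X. T1 (u X)) Xs) \<bullet> E1 (map \<mu> Xs)"
  proof -
    have "E1 (map (\<lambda>X. \<mu> (E0 [X])) Xs) \<bullet> E1 (map (\<lambda>X. T1 (T1 (u X))) Xs) = E1 (map (\<lambda>X. T1 (u X) \<bullet> \<mu> X) Xs)"
      by (rule E_lift) (simp_all add: T.mult_natural)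
    then show ?thesis by (simp add: E.arr_comp)
  qed
  have 3: "tau (map (\<lambda>X. T0 (E0 [X])) Xs) \<bullet> E1 (map (\<lambda>X. T1 (T1 (u X))) Xs) = T1 (E1 (map (\<lambda>X. T1 (u X)) Xs)) \<bullet> tau (map T0 Xs)"
    by (rule tau_natural) simp
  have "tau Xs \<bullet> E1 (map \<mu> Xs) = (kp ?P (path ?n) \<bullet> E1 (map (\<lambda>X. \<mu> (E0 [X])) Xs)) \<bullet> E1 (map (\<lambda>X. T1 (T1 (u X))) Xs)"
    using 2 kpP[OF Xs] by (simp add: tau_def)
  also have "\<dots> = \<mu> (E0 Xs) \<bullet> T1 (tau Xs) \<bullet> tau (map T0 Xs)"
    unfolding 1[symmetric] using 3 kpP[OF Xs] by (simp add: tau_def[of Xs] T.T.arr_comp)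
  finally show ?thesis .
qed

text \<open>Associativity of the lifted path category along the nested walk of
  \<open>split_path\<close>. The structure maps of the outer and inner walks are rewritten by
  \<open>kp_eq\<close>, and the units u cancel against the inner \<sigma>.\<close>

lemma tau_subst:
  assumes Xss [simp]: "\<forall>Xs\<in>set Xss. \<forall>X\<in>set Xs. X \<in> Ob V"
  shows "tau (concat Xss) \<bullet> \<sigma> (map (map T0) Xss) = T1 (\<sigma> Xss) \<bullet> tau (map E0 Xss) \<bullet> E1 (map tau Xss)"
proof -
  define Y where "Y = concat Xss"
  have Y [simp]: "\<forall>X\<in>set Y. X \<in> Ob V" by (auto simp: Y_def)
  let ?P = "pathG Y" and ?n = "length Y"
  let ?A = "(pathG Y, pathK Y)"
  obtain ws yss where N: "nested_walk ?P ws yss" and j: "join_walk ws yss = path ?n"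
    and aw: "ascending ws" and ay: "\<forall>ys\<in>set yss. ascending ys" and sw: "map (slice Y) (steps ws) = Xss"
    and sy: "map (\<lambda>ys. map (slice Y) (steps ys)) yss = map (map (\<lambda>X. [X])) Xss"
    using split_path[OF refl, of Xss, folded Y_def] by (elim exE conjE)
  note D = nested_walkD[OF N]
  note cat = path_ecat[OF Y]
  have wy: "walk_edges ?P ys = map E0 (map (slice Y) (steps ys))" if "ys \<in> set yss" for ys
    using ascending_edges[OF Y D(2)[OF that]] ay that by blast
  have 1: "map (walk_edges (G_obj T ?P)) yss = map (map (\<lambda>X. T0 (E0 [X]))) Xss"
  proof -
    have "map (walk_edges (G_obj T ?P)) yss = map (\<lambda>Ys. map T0 (map E0 Ys)) (map (\<lambda>ys. map (slice Y) (steps ys)) yss)"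
      using wy D(2) by (simp add: walk_edges_G_obj)
    then show ?thesis unfolding sy by simp
  qed
  have 2: "map (kp ?A) yss = map (\<lambda>Xs. T1 (\<sigma> (map (\<lambda>X. [X]) Xs)) \<bullet> tau (map (\<lambda>X. E0 [X]) Xs)) Xss"
  proof -
    have "map (kp ?A) yss = map (\<lambda>Ys. T1 (\<sigma> Ys) \<bullet> tau (map E0 Ys)) (map (\<lambda>ys. map (slice Y) (steps ys)) yss)"
      using wy D(2) ay kp_eq[OF cat] pathK_ascending[OF Y] by simp
    then show ?thesis unfolding sy by simp
  qed
  have 3: "kp ?A ws = T1 (\<sigma> Xss) \<bullet> tau (map E0 Xss)"
    using kp_eq[OF cat D(1)] pathK_ascending[OF Y D(1) aw] ascending_edges[OF Y D(1) aw] unfolding sw by simp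
  have 4: "kp ?A (path ?n) \<bullet> \<sigma> (map (map (\<lambda>X. T0 (E0 [X]))) Xss)
     = (T1 (\<sigma> Xss) \<bullet> tau (map E0 Xss)) \<bullet> E1 (map (\<lambda>Xs. T1 (\<sigma> (map (\<lambda>X. [X]) Xs)) \<bullet> tau (map (\<lambda>X. E0 [X]) Xs)) Xss)"
    using ecatsD(7)[OF kp_ecat[OF cat], of ws yss] N unfolding fst_conv 1 2 3 j by simp
  have 5: "E1 (map (\<lambda>Xs. T1 (\<sigma> (map (\<lambda>X. [X]) Xs)) \<bullet> tau (map (\<lambda>X. E0 [X]) Xs)) Xss) \<bullet> E1 (map (\<lambda>Xs. E1 (map (\<lambda>X. T1 (u X)) Xs)) Xss)
     = E1 (map tau Xss)"
  proof (rule E_lift)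
    fix Xs assume "Xs \<in> set Xss"
    then have [simp]: "\<forall>X\<in>set Xs. X \<in> Ob V" using Xss by blast
    have "tau (map (\<lambda>X. E0 [X]) Xs) \<bullet> E1 (map (\<lambda>X. T1 (u X)) Xs) = T1 (E1 (map u Xs)) \<bullet> tau Xs"
      using tau_natural[of Xs u "\<lambda>X. X" "\<lambda>X. E0 [X]"] by simp
    then show "(T1 (\<sigma> (map (\<lambda>X. [X]) Xs)) \<bullet> tau (map (\<lambda>X. E0 [X]) Xs)) \<bullet> E1 (map (\<lambda>X. T1 (u X)) Xs) = tau Xs"
      using subst_unit_inner[of Xs, THEN T_lift, THEN reassoc] by simp
  qed simp
  have 6: "\<sigma> (map (map (\<lambda>X. T0 (E0 [X]))) Xss) \<bullet> E1 (map (\<lambda>Xs. E1 (map (\<lambda>X. T1 (u X)) Xs)) Xss)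
     = E1 (map (\<lambda>X. T1 (u X)) Y) \<bullet> \<sigma> (map (map T0) Xss)"
    unfolding Y_def by (rule mts_natural_map) simp
  have S: "Cod V (\<sigma> (map (map T0) Xss)) = E0 (map T0 Y)" "\<sigma> (map (map T0) Xss) \<in> Ar V"
    "Cod V (\<sigma> (map (map (\<lambda>X. T0 (E0 [X]))) Xss)) = E0 (map (\<lambda>X. T0 (E0 [X])) Y)"
    "\<sigma> (map (map (\<lambda>X. T0 (E0 [X]))) Xss) \<in> Ar V"
    "Dom V (\<sigma> (map (map (\<lambda>X. T0 (E0 [X]))) Xss)) = E0 (map (\<lambda>Xs. E0 (map (\<lambda>X. T0 (E0 [X])) Xs)) Xss)"
    by (simp_all add: Y_def)
  have "tau Y \<bullet> \<sigma> (map (map T0) Xss) = kp ?A (path ?n) \<bullet> E1 (map (\<lambda>X. T1 (u X)) Y) \<bullet> \<sigma> (map (map T0) Xss)"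
    using S kpP[OF Y] by (simp add: tau_def del: mts_typed)
  also have "\<dots> = (kp ?A (path ?n) \<bullet> \<sigma> (map (map (\<lambda>X. T0 (E0 [X]))) Xss)) \<bullet> E1 (map (\<lambda>Xs. E1 (map (\<lambda>X. T1 (u X)) Xs)) Xss)"
    unfolding 6[symmetric] using S kpP[OF Y] by (simp del: mts_typed)
  also have "\<dots> = T1 (\<sigma> Xss) \<bullet> tau (map E0 Xss) \<bullet> E1 (map tau Xss)"
    unfolding 4 using 5 by simp
  finally show ?thesis by (simp add: Y_def)
qed

lemma tau_monoidal: "restrict tau (lists (Ob V)) \<in> monoidal_monad_data V E T"
proof -
  have "nat_trans (seq_cat V) V (E \<circ>\<^sub>F seq_func T) (T \<circ>\<^sub>F E) (restrict tau (lists (Ob V)))"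
  proof (intro nat_trans.intro nat_trans_axioms.intro
        cat_functor_comp[OF cat_functor_seq_func[OF T.unit.G.cat_functor_axioms] functor_E]
        cat_functor_comp[OF functor_E T.unit.G.cat_functor_axioms])
    fix f a b assume "f \<in> hom (seq_cat V) a b"
    then show "restrict tau (lists (Ob V)) b \<bullet> farr (E \<circ>\<^sub>F seq_func T) f
       = farr (T \<circ>\<^sub>F E) f \<bullet> restrict tau (lists (Ob V)) a"
      using tau_natural[of f "\<lambda>x. x" "Dom V" "Cod V"] by (auto simp: hom_iff)
  qed (auto simp: hom_iff)
  then show ?thesis
    by (simp add: monoidal_monad_data_def tau_unit tau_subst tau_eta tau_mu)
qed

text \<open>On objects this is \<open>kp_eq\<close>; the values on arrows, the unit and the
  multiplication are then forced, since their underlying graph maps are prescribed.\<close>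

lemma lifting_of_tau: "lifting_of small V E T (restrict tau (lists (Ob V))) = S"
proof -
  let ?t = "restrict tau (lists (Ob V))"
  have L: "lifting_obj V T ?t A = fobj S A" if A: "A \<in> ecats small V E" for A
  proof -
    obtain X \<kappa> where A_eq: "A = (X, \<kappa>)" by (cases A)
    have cat: "(X, \<kappa>) \<in> ecats small V E" using A A_eq by simp
    have "(\<lambda>xs\<in>walks X. T1 (\<kappa> xs) \<bullet> ?t (walk_edges X xs)) = kp (X, \<kappa>)"
    proof (rule extensionalityI[of _ "walks X"])
      show "kp (X, \<kappa>) \<in> extensional (walks X)"
        using ecatsD(2)[OF kp_ecat[OF cat]] by simp
      show "(\<lambda>xs\<in>walks X. T1 (\<kappa> xs) \<bullet> ?t (walk_edges X xs)) xs = kp (X, \<kappa>) xs" if "xs \<in> walks X" for xs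
        using kp_eq[OF cat that] walk_edges_ob[OF ecatsD(1)[OF cat] that] that by simp
    qed simp
    then show ?thesis
      using S_obj_eq[OF cat] unfolding A_eq lifting_obj_def by simp
  qed
  show ?thesis
  proof (rule monad_struct.equality)
    show "fobj (lifting_of small V E T ?t) = fobj S"
      by (rule extensionalityI[OF _ S_props(5)]) (simp_all add: lifting_of_def Let_def ECat_ob L)
    show "m_unit (lifting_of small V E T ?t) = m_unit S"
      by (rule extensionalityI[OF _ S_props(7)]) (simp_all add: lifting_of_def Let_def ECat_ob L S_unit(1) del: G_simps)
    show "m_mult (lifting_of small V E T ?t) = m_mult S"
    proof (rule extensionalityI[OF _ S_props(8)])
      fix A assume A: "A \<in> Ob (ECat small V E)"
      then have "fobj S A \<in> ecats small V E" using S_obj[of A] by (simp add: ECat_ob)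
      with A show "m_mult (lifting_of small V E T ?t) A = m_mult S A"
        by (simp add: lifting_of_def Let_def ECat_ob L S_mult(1) del: G_simps)
    qed (simp add: lifting_of_def Let_def)
    show "farr (lifting_of small V E T ?t) = farr S"
    proof (rule extensionalityI[OF _ S_props(6)])
      fix h assume h: "h \<in> Ar (ECat small V E)"
      obtain A B f where h_eq: "h = (A, B, f)" by (cases h)
      have "A \<in> ecats small V E" "B \<in> ecats small V E" using h by (simp_all add: h_eq ECat_eq)
      then show "farr (lifting_of small V E T ?t) h = farr S h"
        using S_arr(1) h by (simp add: lifting_of_def Let_def h_eq L)
    qed (simp add: lifting_of_def Let_def)
  qed simp
qed

end

section \<open>The bijection with liftings\<close>

context enriched
begin

theorem bij_lifting_of: "bij_betw (lifting_of small V E T) (monoidal_monad_data V E T) (liftings small V E (G_monad T))"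
proof (rule bij_betw_imageI)
  show "inj_on (lifting_of small V E T) (monoidal_monad_data V E T)"
  proof (rule inj_onI)
    fix \<tau> \<tau>' assume d: "\<tau> \<in> monoidal_monad_data V E T" "\<tau>' \<in> monoidal_monad_data V E T"
      and eq: "lifting_of small V E T \<tau> = lifting_of small V E T \<tau>'"
    show "\<tau> = \<tau>'"
    proof (rule monoidal_eqI[OF d])
      fix Xs assume Xs [simp]: "\<forall>X\<in>set Xs. X \<in> Ob V"
      let ?P = "(pathG Xs, pathK Xs)"
      \<comment> \<open>The lifting of the path category returns \<tau>: along the full path its
        structure map is T \<sigma> after \<tau>, and by naturality of \<tau> the units u reach
        \<sigma> and cancel.\<close>
      have *: "\<tau> Xs = snd (fobj (lifting_of small V E T \<tau>) ?P) (path (length Xs)) \<bullet> E1 (map (\<lambda>X. T1 (u X)) Xs)"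
        if "\<tau> \<in> monoidal_monad_data V E T" for \<tau>
      proof -
        interpret M: monoidal_monad V E T \<tau> by (rule monoidalI[OF that])
        have "\<tau> (map (\<lambda>X. E0 [X]) Xs) \<bullet> E1 (map (\<lambda>X. T1 (u X)) Xs) = T1 (E1 (map u Xs)) \<bullet> \<tau> Xs"
          using M.tau_natural[of Xs u "\<lambda>X. X" "\<lambda>X. E0 [X]"] by simp
        then show ?thesis
          using subst_unit_inner[OF Xs, THEN T_lift, THEN reassoc]
          by (simp add: M.lifting_of_simps(1)[OF path_ecat[OF Xs]] M.lifting_obj_eq path_walk pathK_path path_edges)
      qed
      show "\<tau> Xs = \<tau>' Xs"
        using *[OF d(1)] *[OF d(2)] eq by simp
    qed
  qed
  show "lifting_of small V E T ` monoidal_monad_data V E T = liftings small V E (G_monad T)"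
  proof (intro subset_antisym subsetI)
    fix S :: "(('a, 'o) vgraph \<times> ('a list \<Rightarrow> 'm), (('a, 'o) vgraph \<times> ('a list \<Rightarrow> 'm)) \<times> (('a, 'o) vgraph \<times> ('a list \<Rightarrow> 'm)) \<times> ('a, 'o, 'm) vmap) monad_struct"
    assume "S \<in> liftings small V E (G_monad T)"
    then interpret lifting V E T small S
      by (intro lifting.intro enriched_axioms lifting_axioms.intro)
    show "S \<in> lifting_of small V E T ` monoidal_monad_data V E T"
      using tau_monoidal lifting_of_tau by (metis imageI)
  next
    fix S assume "S \<in> lifting_of small V E T ` monoidal_monad_data V E T"
    then show "S \<in> liftings small V E (G_monad T)"
      using monoidal_monad.lifting_in_liftings[OF monoidalI] by auto
  qed
qed

end

section \<open>Coproducts indexed by walks\<close>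

context category
begin

lemma coproductD:
  assumes "is_coproduct C I X c \<iota>"
  shows "c \<in> Ob C" "i \<in> I \<Longrightarrow> X i \<in> Ob C" "i \<in> I \<Longrightarrow> \<iota> i \<in> Ar C" "i \<in> I \<Longrightarrow> Dom C (\<iota> i) = X i" "i \<in> I \<Longrightarrow> Cod C (\<iota> i) = c"
  using assms by (auto simp: is_coproduct_def hom_iff)

lemma coproduct_epi:
  assumes "is_coproduct C I X c \<iota>" "f \<in> hom C c d" "g \<in> hom C c d" "\<And>i. i \<in> I \<Longrightarrow> f \<bullet> \<iota> i = g \<bullet> \<iota> i"
  shows "f = g"
proof -
  note D = coproductD[OF assms(1)]
  have d: "d \<in> Ob C" using assms(2) by (auto simp: hom_iff)
  have t: "f \<bullet> \<iota> i \<in> hom C (X i) d" if "i \<in> I" for i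
    using D that assms(2) by (simp add: hom_iff)
  have "\<forall>g. (\<forall>i\<in>I. g i \<in> hom C (X i) d) \<longrightarrow> (\<exists>!h. h \<in> hom C c d \<and> (\<forall>i\<in>I. h \<bullet> \<iota> i = g i))"
    using assms(1) d unfolding is_coproduct_def by blast
  from this[rule_format, of "\<lambda>i. f \<bullet> \<iota> i"] t
  have u: "\<exists>!h. h \<in> hom C c d \<and> (\<forall>i\<in>I. h \<bullet> \<iota> i = f \<bullet> \<iota> i)" by blast
  have "f \<in> hom C c d \<and> (\<forall>i\<in>I. f \<bullet> \<iota> i = f \<bullet> \<iota> i)" "g \<in> hom C c d \<and> (\<forall>i\<in>I. g \<bullet> \<iota> i = f \<bullet> \<iota> i)"
    using assms(2-4) by auto
  then show ?thesis by (rule the1_equality[OF u, symmetric, THEN trans, OF _ the1_equality[OF u]])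
qed

lemma coproduct_ex:
  assumes "is_coproduct C I X c \<iota>" "d \<in> Ob C" "\<And>i. i \<in> I \<Longrightarrow> g i \<in> hom C (X i) d"
  obtains h where "h \<in> hom C c d" "\<And>i. i \<in> I \<Longrightarrow> h \<bullet> \<iota> i = g i"
proof -
  have "\<forall>g. (\<forall>i\<in>I. g i \<in> hom C (X i) d) \<longrightarrow> (\<exists>!h. h \<in> hom C c d \<and> (\<forall>i\<in>I. h \<bullet> \<iota> i = g i))"
    using assms(1,2) unfolding is_coproduct_def by blast
  from this[rule_format, of g] assms(3) that show thesis by blast
qed

lemma coproductI:
  assumes "c \<in> Ob C" "\<And>i. i \<in> I \<Longrightarrow> X i \<in> Ob C" "\<And>i. i \<in> I \<Longrightarrow> \<iota> i \<in> hom C (X i) c"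
    and "\<And>d g. d \<in> Ob C \<Longrightarrow> (\<And>i. i \<in> I \<Longrightarrow> g i \<in> hom C (X i) d) \<Longrightarrow> \<exists>h\<in>hom C c d. \<forall>i\<in>I. h \<bullet> \<iota> i = g i"
    and "\<And>d f g. f \<in> hom C c d \<Longrightarrow> g \<in> hom C c d \<Longrightarrow> (\<And>i. i \<in> I \<Longrightarrow> f \<bullet> \<iota> i = g \<bullet> \<iota> i) \<Longrightarrow> f = g"
  shows "is_coproduct C I X c \<iota>"
  unfolding is_coproduct_def
proof (intro conjI ballI allI impI)
  fix d g assume d: "d \<in> Ob C" and g: "\<forall>i\<in>I. g i \<in> hom C (X i) d"
  then obtain h where "h \<in> hom C c d" "\<forall>i\<in>I. h \<bullet> \<iota> i = g i"
    using assms(4)[of d g] by blast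
  then show "\<exists>!h. h \<in> hom C c d \<and> (\<forall>i\<in>I. h \<bullet> \<iota> i = g i)"
    using assms(5) by (intro ex1I[of _ h]) auto
qed (use assms in auto)

lemma coproduct_reindex:
  assumes "is_coproduct C J X c \<iota>" "bij_betw e I J"
    and "\<And>i. i \<in> I \<Longrightarrow> X' i = X (e i)" "\<And>i. i \<in> I \<Longrightarrow> \<iota>' i = \<iota> (e i)"
  shows "is_coproduct C I X' c \<iota>'"
proof (rule coproductI)
  note D = coproductD[OF assms(1)]
  have e: "i \<in> I \<Longrightarrow> e i \<in> J" for i using assms(2) by (auto simp: bij_betw_def)
  show "c \<in> Ob C" "\<And>i. i \<in> I \<Longrightarrow> X' i \<in> Ob C" "\<And>i. i \<in> I \<Longrightarrow> \<iota>' i \<in> hom C (X' i) c"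
    using D e assms(3,4) by (auto simp: hom_iff)
  fix d
  show "\<exists>h\<in>hom C c d. \<forall>i\<in>I. h \<bullet> \<iota>' i = g i" if d: "d \<in> Ob C" and g: "\<And>i. i \<in> I \<Longrightarrow> g i \<in> hom C (X' i) d" for g
  proof -
    have inv: "the_inv_into I e j \<in> I" "e (the_inv_into I e j) = j" if "j \<in> J" for j
      using assms(2) that by (auto simp: bij_betw_def the_inv_into_into f_the_inv_into_f)
    have inv': "the_inv_into I e (e i) = i" if "i \<in> I" for i
      using assms(2) that by (auto simp: bij_betw_def the_inv_into_f_f)
    obtain h where "h \<in> hom C c d" "\<And>j. j \<in> J \<Longrightarrow> h \<bullet> \<iota> j = g (the_inv_into I e j)"
      using coproduct_ex[OF assms(1) d, of "\<lambda>j. g (the_inv_into I e j)"] g inv assms(3) by metis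
    then show ?thesis using e assms(4) inv' by (intro bexI[of _ h]) auto
  qed
  show "f = g" if "f \<in> hom C c d" "g \<in> hom C c d" "\<And>i. i \<in> I \<Longrightarrow> f \<bullet> \<iota>' i = g \<bullet> \<iota>' i" for f g
  proof (rule coproduct_epi[OF assms(1) that(1,2)])
    fix j assume "j \<in> J"
    then obtain i where "i \<in> I" "j = e i" using assms(2) by (auto simp: bij_betw_def)
    then show "f \<bullet> \<iota> j = g \<bullet> \<iota> j" using that(3)[of i] assms(4) by simp
  qed
qed

text \<open>Needed twice: to treat the variables one at a time in \<open>multi_distributive\<close>,
  and to combine outer with inner walks in the square of \<Gamma>E.\<close>

lemma coproduct_Sigma:
  assumes I: "is_coproduct C I A c \<iota>" and J: "\<And>i. i \<in> I \<Longrightarrow> is_coproduct C (J i) (B i) (A i) (\<kappa> i)"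
  shows "is_coproduct C (Sigma I J) (\<lambda>(i, j). B i j) c (\<lambda>(i, j). \<iota> i \<bullet> \<kappa> i j)"
proof (rule coproductI)
  note D = coproductD[OF I] and D' = coproductD[OF J]
  show "c \<in> Ob C" "\<And>p. p \<in> Sigma I J \<Longrightarrow> (\<lambda>(i, j). B i j) p \<in> Ob C"
    "\<And>p. p \<in> Sigma I J \<Longrightarrow> (\<lambda>(i, j). \<iota> i \<bullet> \<kappa> i j) p \<in> hom C ((\<lambda>(i, j). B i j) p) c"
    using D D' by (auto simp: hom_iff)
  fix d
  show "\<exists>h\<in>hom C c d. \<forall>p\<in>Sigma I J. h \<bullet> (\<lambda>(i, j). \<iota> i \<bullet> \<kappa> i j) p = g p"
    if d: "d \<in> Ob C" and gp: "\<And>p. p \<in> Sigma I J \<Longrightarrow> g p \<in> hom C ((\<lambda>(i, j). B i j) p) d" for g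
  proof -
    have "\<exists>h\<in>hom C (A i) d. \<forall>j\<in>J i. h \<bullet> \<kappa> i j = g (i, j)" if i: "i \<in> I" for i
      using coproduct_ex[OF J[OF i] d, of "\<lambda>j. g (i, j)"] gp i by (metis (no_types, lifting) SigmaI case_prod_conv)
    then obtain k where k: "\<And>i. i \<in> I \<Longrightarrow> k i \<in> hom C (A i) d" "\<And>i j. i \<in> I \<Longrightarrow> j \<in> J i \<Longrightarrow> k i \<bullet> \<kappa> i j = g (i, j)"
      by metis
    obtain h where h: "h \<in> hom C c d" "\<And>i. i \<in> I \<Longrightarrow> h \<bullet> \<iota> i = k i"
      using coproduct_ex[OF I d, of k] k(1) by blast
    have "h \<bullet> \<iota> i \<bullet> \<kappa> i j = g (i, j)" if "i \<in> I" "j \<in> J i" for i j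
      using h(2)[OF that(1), THEN reassoc, of "\<kappa> i j"] h(1) k(2)[OF that] D D' that by (simp add: hom_iff)
    then show ?thesis using h(1) by auto
  qed
  show "f = g" if f: "f \<in> hom C c d" and g: "g \<in> hom C c d"
    and eq: "\<And>p. p \<in> Sigma I J \<Longrightarrow> f \<bullet> (\<lambda>(i, j). \<iota> i \<bullet> \<kappa> i j) p = g \<bullet> (\<lambda>(i, j). \<iota> i \<bullet> \<kappa> i j) p" for f g
  proof (rule coproduct_epi[OF I f g])
    fix i assume i: "i \<in> I"
    show "f \<bullet> \<iota> i = g \<bullet> \<iota> i"
    proof (rule coproduct_epi[OF J[OF i], of _ d])
      show "f \<bullet> \<iota> i \<in> hom C (A i) d" "g \<bullet> \<iota> i \<in> hom C (A i) d"
        using f g D i by (auto simp: hom_iff)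
      show "(f \<bullet> \<iota> i) \<bullet> \<kappa> i j = (g \<bullet> \<iota> i) \<bullet> \<kappa> i j" if "j \<in> J i" for j
        using eq[of "(i, j)"] f g D D' i that by (simp add: hom_iff)
    qed
  qed
qed

lemma coproduct_single: "a \<in> Ob C \<Longrightarrow> is_coproduct C {i} (\<lambda>_. a) a (\<lambda>_. Id C a)"
  by (rule coproductI) (auto simp: hom_iff)

lemma coprod_is:
  assumes "is_coproduct C I X c \<iota>"
  shows "is_coproduct C I X (fst (coprod C I X)) (snd (coprod C I X))"
  unfolding coprod_def by (rule someI[of _ "(c, \<iota>)"]) (simp add: assms)

lemma copair_props:
  assumes "is_coproduct C I X c \<iota>" "d \<in> Ob C" "\<And>i. i \<in> I \<Longrightarrow> g i \<in> hom C (X i) d"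
  shows "copair C I X d g \<in> hom C (fst (coprod C I X)) d"
    "i \<in> I \<Longrightarrow> copair C I X d g \<bullet> snd (coprod C I X) i = g i"
proof -
  have "\<exists>!h. h \<in> hom C (fst (coprod C I X)) d \<and> (\<forall>i\<in>I. h \<bullet> snd (coprod C I X) i = g i)"
    using coprod_is[OF assms(1)] assms(2,3) unfolding is_coproduct_def by blast
  from theI'[OF this] show "copair C I X d g \<in> hom C (fst (coprod C I X)) d"
    "i \<in> I \<Longrightarrow> copair C I X d g \<bullet> snd (coprod C I X) i = g i"
    unfolding copair_def by blast+
qed

end

text \<open>Coproducts in V are indexed by sets of vertices, those of \<Gamma>E by walks. An
  infinite set absorbs its finite sequences because it is in bijection with its square, and iterated
  pairing codes sequences of a fixed length.\<close>

lemma list_encoding: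
  assumes W: "infinite (W :: 'a set)"
  shows "\<exists>e :: 'a list \<Rightarrow> 'a. inj_on e (lists W) \<and> e ` lists W \<subseteq> W"
proof -
  obtain p where p: "bij_betw p (W \<times> W) W"
    using card_of_Times_same_infinite[OF W] card_of_ordIso by blast
  then have pW: "x \<in> W \<Longrightarrow> y \<in> W \<Longrightarrow> p (x, y) \<in> W" and
    pinj: "x \<in> W \<Longrightarrow> y \<in> W \<Longrightarrow> x' \<in> W \<Longrightarrow> y' \<in> W \<Longrightarrow> p (x, y) = p (x', y') \<Longrightarrow> x = x' \<and> y = y'" for x y x' y'
    by (auto simp: bij_betw_def inj_on_def)
  obtain v :: "nat \<Rightarrow> 'a" where v: "inj v" "range v \<subseteq> W"
    using infinite_countable_subset[OF W] by blast
  define f where "f xs = foldr (\<lambda>x y. p (x, y)) xs (v 0)" for xs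
  have fW: "xs \<in> lists W \<Longrightarrow> f xs \<in> W" for xs
    unfolding f_def using v(2) pW by (induction xs) auto
  have finj: "xs \<in> lists W \<Longrightarrow> ys \<in> lists W \<Longrightarrow> length xs = length ys \<Longrightarrow> f xs = f ys \<Longrightarrow> xs = ys" for xs ys
  proof (induction xs arbitrary: ys)
    case (Cons x xs)
    then obtain y zs where ys: "ys = y # zs" by (cases ys) auto
    have "p (x, f xs) = p (y, f zs)" using Cons.prems(4) by (simp add: f_def ys)
    then have "x = y \<and> f xs = f zs" using Cons.prems fW ys by (intro pinj) auto
    then show ?case using Cons ys by auto
  qed auto
  \<comment> \<open>Iterated pairing is injective only among sequences of one length, so the length
    is coded as well.\<close>
  let ?e = "\<lambda>xs. p (v (length xs), f xs)"
  have "inj_on ?e (lists W)"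
  proof (rule inj_onI)
    fix xs ys assume xy: "xs \<in> lists W" "ys \<in> lists W" and eq: "?e xs = ?e ys"
    then have "v (length xs) = v (length ys) \<and> f xs = f ys"
      using v(2) fW by (intro pinj) auto
    then show "xs = ys" using finj xy v(1) by (auto dest: injD)
  qed
  moreover have "?e ` lists W \<subseteq> W" using pW v(2) fW by blast
  ultimately show ?thesis by blast
qed

context enriched
begin

lemma small_UN: "small I \<Longrightarrow> (\<And>i. i \<in> I \<Longrightarrow> small (F i)) \<Longrightarrow> small (\<Union>i\<in>I. F i)"
  using universe unfolding small_universe_def by blast

lemma walks_encoding:
  assumes "small A"
  obtains e :: "'a list \<Rightarrow> 'a" where "inj_on e (lists A)" "small (e ` lists A)"
proof -
  obtain B where B: "small B" "infinite B" using ex_small_infinite by blast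
  have sm: "small (A \<union> B)"
  proof -
    \<comment> \<open>Smallness is closed under small unions, so the binary union is written as a
      union over two vertices. Adding the infinite set B is what makes \<open>list_encoding\<close>
      applicable.\<close>
    have "small (\<Union>i\<in>{vx 0, vx 1}. if i = vx 0 then A else B)"
      by (rule small_UN) (auto simp: small_finite assms B(1))
    then show ?thesis by (simp add: Un_commute)
  qed
  obtain e :: "'a list \<Rightarrow> 'a" where e: "inj_on e (lists (A \<union> B))" "e ` lists (A \<union> B) \<subseteq> A \<union> B"
    using list_encoding[of "A \<union> B"] B(2) by auto
  have "lists A \<subseteq> lists (A \<union> B)" by auto
  then have "inj_on e (lists A)" "e ` lists A \<subseteq> A \<union> B"
    using inj_on_subset[OF e(1)] e(2) by blast+
  then have "inj_on e (lists A)" "e ` lists A \<subseteq> (\<lambda>x. x) ` (A \<union> B)"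
    by simp_all
  then show ?thesis
    using that small_image[OF sm] by blast
qed

lemma walks_between_encoding:
  assumes "X \<in> vgraphs small V"
  obtains e :: "'a list \<Rightarrow> 'a" where "bij_betw e (walks_between X p) (e ` walks_between X p)" "small (e ` walks_between X p)"
proof -
  have "small (verts X)" using assms by (simp add: vgraphs_def)
  then obtain e :: "'a list \<Rightarrow> 'a" where e: "inj_on e (lists (verts X))" "small (e ` lists (verts X))"
    using walks_encoding by blast
  have s: "walks_between X p \<subseteq> lists (verts X)" by (auto simp: walks_simps)
  have "e ` walks_between X p \<subseteq> (\<lambda>x. x) ` (e ` lists (verts X))" using s by auto
  from small_image[OF e(2) this] show ?thesis
    using that[of e] inj_on_subset[OF e(1) s] by (auto simp: bij_betw_def)
qed

text \<open>The coproduct over the codes of the walks exists by assumption and is carried back along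
  the coding; \<open>walk_distributive\<close> does the same for distributivity.\<close>

lemma walk_coproduct_ex:
  assumes X: "X \<in> vgraphs small V" and F: "\<And>xs. xs \<in> walks_between X p \<Longrightarrow> F xs \<in> Ob V"
  shows "\<exists>c \<iota>. is_coproduct V (walks_between X p) F c \<iota>"
proof -
  obtain e :: "'a list \<Rightarrow> 'a" where e: "bij_betw e (walks_between X p) (e ` walks_between X p)" "small (e ` walks_between X p)"
    using walks_between_encoding[OF X] by blast
  have inv: "the_inv_into (walks_between X p) e (e xs) = xs" if "xs \<in> walks_between X p" for xs
    using e(1) that by (auto simp: bij_betw_def the_inv_into_f_f)
  obtain c \<iota> where "is_coproduct V (e ` walks_between X p) (\<lambda>a. F (the_inv_into (walks_between X p) e a)) c \<iota>"
    using coproducts[unfolded has_coproducts_def, rule_format, of "e ` walks_between X p" "\<lambda>a. F (the_inv_into (walks_between X p) e a)"] e(2) F inv by auto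
  from coproduct_reindex[OF this e(1), of F "\<lambda>xs. \<iota> (e xs)"] show ?thesis
    using inv by auto
qed

lemma walk_distributive:
  assumes X: "X \<in> vgraphs small V" and c: "is_coproduct V (walks_between X p) F c \<iota>"
    and Y: "\<forall>A\<in>set Ys. A \<in> Ob V" "\<forall>A\<in>set Zs. A \<in> Ob V"
  shows "is_coproduct V (walks_between X p) (\<lambda>xs. E0 (Ys @ [F xs] @ Zs)) (E0 (Ys @ [c] @ Zs))
    (\<lambda>xs. E1 (map (Id V) Ys @ [\<iota> xs] @ map (Id V) Zs))"
proof -
  let ?W = "walks_between X p"
  obtain e :: "'a list \<Rightarrow> 'a" where e: "bij_betw e ?W (e ` ?W)" "small (e ` ?W)"
    using walks_between_encoding[OF X] by blast
  let ?i = "the_inv_into ?W e"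
  have inv: "?i (e xs) = xs" if "xs \<in> ?W" for xs
    using e(1) that by (auto simp: bij_betw_def the_inv_into_f_f)
  have inv2: "bij_betw ?i (e ` ?W) ?W"
    by (rule bij_betw_the_inv_into[OF e(1)])
  have "is_coproduct V (e ` ?W) (\<lambda>a. F (?i a)) c (\<lambda>a. \<iota> (?i a))"
    by (rule coproduct_reindex[OF c inv2]) auto
  then have "is_coproduct V (e ` ?W) (\<lambda>a. E0 (Ys @ [F (?i a)] @ Zs)) (E0 (Ys @ [c] @ Zs))
    (\<lambda>a. E1 (map (Id V) Ys @ [\<iota> (?i a)] @ map (Id V) Zs))"
    using dist[unfolded distributive_def, rule_format, of Ys Zs "e ` ?W" "\<lambda>a. F (?i a)" c "\<lambda>a. \<iota> (?i a)"] e(2) Y by auto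
  from coproduct_reindex[OF this e(1)] show ?thesis using inv by simp
qed

text \<open>The prefix \<open>Ys\<close> of fixed objects makes the induction work: the first
  coproduct is expanded by distributivity in one variable, the chosen summand joins the prefix, and
  \<open>coproduct_Sigma\<close> combines this with the remaining variables.\<close>

lemma multi_distributive:
  assumes X: "X \<in> vgraphs small V" and Y: "\<forall>A\<in>set Ys. A \<in> Ob V"
    and c: "\<And>p. p \<in> set ps \<Longrightarrow> is_coproduct V (walks_between X p) F (c p) \<iota>"
  shows "is_coproduct V {yss. list_all2 (\<lambda>ys p. ys \<in> walks_between X p) yss ps} (\<lambda>yss. E0 (Ys @ map F yss))
    (E0 (Ys @ map c ps)) (\<lambda>yss. E1 (map (Id V) Ys @ map \<iota> yss))"
  using Y c
proof (induction ps arbitrary: Ys)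
  case Nil
  have "{yss. list_all2 (\<lambda>ys p. ys \<in> walks_between X p) yss []} = {[]}" by auto
  then show ?case
    using coproduct_single[of "E0 Ys" "[]"] Nil(1) by (auto intro: coproduct_reindex[where e = id])
next
  case (Cons p ps)
  have cp: "is_coproduct V (walks_between X p) F (c p) \<iota>" using Cons(3) by simp
  note D = coproductD[OF cp]
  have cs: "\<forall>A\<in>set (map c ps). A \<in> Ob V" using Cons(3) coproductD(1) by fastforce
  let ?L = "\<lambda>ps. {yss. list_all2 (\<lambda>ys p. ys \<in> walks_between X p) yss ps}"
  have 1: "is_coproduct V (walks_between X p) (\<lambda>xs. E0 (Ys @ [F xs] @ map c ps)) (E0 (Ys @ [c p] @ map c ps))
    (\<lambda>xs. E1 (map (Id V) Ys @ [\<iota> xs] @ map (Id V) (map c ps)))"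
    by (rule walk_distributive[OF X cp Cons(2) cs])
  have 2: "is_coproduct V (?L ps) (\<lambda>yss. E0 ((Ys @ [F xs]) @ map F yss)) (E0 (Ys @ [F xs] @ map c ps))
      (\<lambda>yss. E1 (map (Id V) (Ys @ [F xs]) @ map \<iota> yss))" if "xs \<in> walks_between X p" for xs
    using Cons(1)[of "Ys @ [F xs]"] Cons(2,3) D that by simp
  note 3 = coproduct_Sigma[OF 1 2]
  have b: "bij_betw (\<lambda>yss. (hd yss, tl yss)) (?L (p # ps)) (Sigma (walks_between X p) (\<lambda>_. ?L ps))"
    by (rule bij_betw_byWitness[where f' = "\<lambda>(ys, yss). ys # yss"]) (auto simp: list_all2_Cons2)
  show ?case
  proof (rule coproduct_reindex[OF _ b])
    show "is_coproduct V (Sigma (walks_between X p) (\<lambda>_. ?L ps)) (\<lambda>(xs, yss). E0 ((Ys @ [F xs]) @ map F yss)) (E0 (Ys @ map c (p # ps)))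
      (\<lambda>(xs, yss). E1 (map (Id V) Ys @ [\<iota> xs] @ map (Id V) (map c ps)) \<bullet> E1 (map (Id V) (Ys @ [F xs]) @ map \<iota> yss))"
      using 3 by simp
    fix zss assume "zss \<in> ?L (p # ps)"
    then obtain xs yss where z: "zss = xs # yss" and xs: "xs \<in> walks_between X p" and yss: "yss \<in> ?L ps"
      by (auto simp: list_all2_Cons2)
    show "E0 (Ys @ map F zss) = (\<lambda>(xs, yss). E0 ((Ys @ [F xs]) @ map F yss)) (hd zss, tl zss)"
      by (simp add: z)
    have l: "length yss = length ps" using yss by (auto dest: list_all2_lengthD)
    have i: "\<iota> (yss ! k) \<in> Ar V" "Cod V (\<iota> (yss ! k)) = c (ps ! k)" "c (ps ! k) \<in> Ob V" if "k < length ps" for k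
      using yss that Cons(3) coproductD(3,5)[of "walks_between X (ps ! k)" F "c (ps ! k)" \<iota> "yss ! k"]
        coproductD(1)[of "walks_between X (ps ! k)" F "c (ps ! k)" \<iota>]
      by (auto simp: list_all2_conv_all_nth)
    have "E1 (map (Id V) Ys @ [\<iota> xs] @ map (Id V) (map c ps)) \<bullet> E1 (map (Id V) (Ys @ [F xs]) @ map \<iota> yss)
      = E1 (map2 (Comp V) (map (Id V) Ys @ [\<iota> xs] @ map (Id V) (map c ps)) (map (Id V) (Ys @ [F xs]) @ map \<iota> yss))"
    proof (rule E.arr_comp2)
      show "length (map (Id V) Ys @ [\<iota> xs] @ map (Id V) (map c ps)) = length (map (Id V) (Ys @ [F xs]) @ map \<iota> yss)"
        using l by simp
    qed (use i l D xs Cons(2) in \<open>auto simp: nth_append nth_Cons split: nat.split\<close>)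
    also have "map2 (Comp V) (map (Id V) Ys @ [\<iota> xs] @ map (Id V) (map c ps)) (map (Id V) (Ys @ [F xs]) @ map \<iota> yss)
      = map (Id V) Ys @ map \<iota> zss"
      using i l D xs Cons(2)
      by (intro nth_equalityI) (auto simp: z nth_append nth_Cons split: nat.split)
    finally show "E1 (map (Id V) Ys @ map \<iota> zss) = (\<lambda>(xs, yss). E1 (map (Id V) Ys @ [\<iota> xs] @ map (Id V) (map c ps))
       \<bullet> E1 (map (Id V) (Ys @ [F xs]) @ map \<iota> yss)) (hd zss, tl zss)"
      by (simp add: z)
  qed
qed

end

section \<open>The functor \<open>\<Gamma>E\<close>\<close>

context enriched
begin

abbreviation "\<Gamma>0 \<equiv> Gamma_obj V E"
abbreviation "inn \<equiv> Gamma_in V E"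

lemma Gamma_verts [simp]: "verts (\<Gamma>0 X) = verts X"
  by (simp add: Gamma_obj_def)

lemma walks_Gamma [simp]: "walks (\<Gamma>0 X) = walks X" "walks_between (\<Gamma>0 X) p = walks_between X p"
  by (auto simp: walks_simps)

lemma Gamma_coprod_is:
  assumes X: "X \<in> vgraphs small V"
  shows "is_coproduct V (walks_between X p) (\<lambda>xs. E0 (walk_edges X xs)) (fst (Gamma_coprod V E X p)) (snd (Gamma_coprod V E X p))"
proof -
  have t: "E0 (walk_edges X xs) \<in> Ob V" if "xs \<in> walks_between X p" for xs
    using walk_edges_ob[OF X, of xs] that by (simp add: walks_between_def)
  obtain c \<iota> where "is_coproduct V (walks_between X p) (\<lambda>xs. E0 (walk_edges X xs)) c \<iota>"
    using walk_coproduct_ex[OF X, of p "\<lambda>xs. E0 (walk_edges X xs)"] t by blast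
  from coprod_is[OF this] show ?thesis
    by (simp add: Gamma_coprod_def)
qed

lemma Gamma_coproduct:
  assumes X: "X \<in> vgraphs small V" and ab: "a \<in> verts X" "b \<in> verts X"
  shows "is_coproduct V (walks_between X (a, b)) (\<lambda>xs. E0 (walk_edges X xs)) (edge (\<Gamma>0 X) (a, b)) (inn X)"
proof (rule coproduct_reindex[where e = id])
  show "is_coproduct V (walks_between X (a, b)) (\<lambda>xs. E0 (walk_edges X xs)) (edge (\<Gamma>0 X) (a, b)) (snd (Gamma_coprod V E X (a, b)))"
    using Gamma_coprod_is[OF X, of "(a, b)"] ab by (simp add: Gamma_obj_def)
qed (auto simp: Gamma_in_def walks_between_def)

lemma Gamma_vgraph [simp]: "X \<in> vgraphs small V \<Longrightarrow> \<Gamma>0 X \<in> vgraphs small V"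
  using coproductD(1)[OF Gamma_coprod_is] by (auto simp: vgraphs_def Gamma_obj_def)

lemma inn_typed:
  assumes X: "X \<in> vgraphs small V" and xs: "xs \<in> walks X"
  shows "inn X xs \<in> Ar V" "Dom V (inn X xs) = E0 (walk_edges X xs)" "Cod V (inn X xs) = edge (\<Gamma>0 X) (hd xs, last xs)"
  using coproductD(3-5)[OF Gamma_coproduct[OF X walk_ends[OF xs]], of xs] xs by (simp_all add: walks_between_def)

lemma inn_epi:
  assumes X: "X \<in> vgraphs small V" and ab: "a \<in> verts X" "b \<in> verts X"
    and "f \<in> hom V (edge (\<Gamma>0 X) (a, b)) d" "g \<in> hom V (edge (\<Gamma>0 X) (a, b)) d"
    and "\<And>xs. xs \<in> walks X \<Longrightarrow> hd xs = a \<Longrightarrow> last xs = b \<Longrightarrow> f \<bullet> inn X xs = g \<bullet> inn X xs"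
  shows "f = g"
  by (rule coproduct_epi[OF Gamma_coproduct[OF X ab] assms(4,5)]) (auto simp: walks_between_def assms(6))

lemma Gamma_copair_props:
  assumes X: "X \<in> vgraphs small V" and ab: "a \<in> verts X" "b \<in> verts X" and d: "d \<in> Ob V"
    and g: "\<And>xs. xs \<in> walks X \<Longrightarrow> hd xs = a \<Longrightarrow> last xs = b \<Longrightarrow> g xs \<in> hom V (E0 (walk_edges X xs)) d"
  shows "Gamma_copair V E X (a, b) d g \<in> hom V (edge (\<Gamma>0 X) (a, b)) d"
    "\<And>xs. xs \<in> walks X \<Longrightarrow> hd xs = a \<Longrightarrow> last xs = b \<Longrightarrow> Gamma_copair V E X (a, b) d g \<bullet> inn X xs = g xs"
proof -
  have g': "g xs \<in> hom V (E0 (walk_edges X xs)) d" if "xs \<in> walks_between X (a, b)" for xs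
    using g that by (simp add: walks_between_def)
  note P = copair_props[OF Gamma_coprod_is[OF X, of "(a, b)"] d g']
  show "Gamma_copair V E X (a, b) d g \<in> hom V (edge (\<Gamma>0 X) (a, b)) d"
    using P(1) ab by (simp add: Gamma_copair_def Gamma_obj_def Gamma_coprod_def)
  show "Gamma_copair V E X (a, b) d g \<bullet> inn X xs = g xs" if "xs \<in> walks X" "hd xs = a" "last xs = b" for xs
    using P(2)[where i = xs] that by (simp add: Gamma_copair_def Gamma_in_def Gamma_coprod_def walks_between_def)
qed

lemma Gamma_arr_simps [simp]:
  "vsrc (Gamma_arr V E f) = \<Gamma>0 (vsrc f)" "vtgt (Gamma_arr V E f) = \<Gamma>0 (vtgt f)" "vfun (Gamma_arr V E f) = vfun f"
  by (simp_all add: Gamma_arr_def)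

lemma Gamma_arr_hom:
  assumes f: "f \<in> Ar (GV small V)" and ab: "a \<in> verts (vsrc f)" "b \<in> verts (vsrc f)"
  shows "vmor (Gamma_arr V E f) (a, b) \<in> hom V (edge (\<Gamma>0 (vsrc f)) (a, b)) (edge (\<Gamma>0 (vtgt f)) (vfun f a, vfun f b))"
    "\<And>xs. xs \<in> walks (vsrc f) \<Longrightarrow> hd xs = a \<Longrightarrow> last xs = b \<Longrightarrow> vmor (Gamma_arr V E f) (a, b) \<bullet> inn (vsrc f) xs
      = inn (vtgt f) (map (vfun f) xs) \<bullet> E1 (map (vmor f) (steps xs))"
proof -
  note F = GV_arD[OF f]
  have d: "edge (\<Gamma>0 (vtgt f)) (vfun f a, vfun f b) \<in> Ob V"
    by (rule vgraphs_edge[OF Gamma_vgraph[OF F(2)]]) (simp_all add: F ab)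
  have g: "inn (vtgt f) (map (vfun f) xs) \<bullet> E1 (map (vmor f) (steps xs))
      \<in> hom V (E0 (walk_edges (vsrc f) xs)) (edge (\<Gamma>0 (vtgt f)) (vfun f a, vfun f b))"
    if "xs \<in> walks (vsrc f)" "hd xs = a" "last xs = b" for xs
    using inn_typed[OF F(2) walks_map[OF f that(1)]] E1_graph_map[OF f that(1)] walk_map_ends[OF that(1), of "vfun f"] that
    by (simp add: hom_iff)
  have e: "vmor (Gamma_arr V E f) (a, b) = Gamma_copair V E (vsrc f) (a, b) (edge (\<Gamma>0 (vtgt f)) (vfun f a, vfun f b))
      (\<lambda>xs. inn (vtgt f) (map (vfun f) xs) \<bullet> E1 (map (vmor f) (steps xs)))"
    using ab by (simp add: Gamma_arr_def)
  show "vmor (Gamma_arr V E f) (a, b) \<in> hom V (edge (\<Gamma>0 (vsrc f)) (a, b)) (edge (\<Gamma>0 (vtgt f)) (vfun f a, vfun f b))"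
    unfolding e by (rule Gamma_copair_props(1)[OF F(1) ab d g])
  show "vmor (Gamma_arr V E f) (a, b) \<bullet> inn (vsrc f) xs = inn (vtgt f) (map (vfun f) xs) \<bullet> E1 (map (vmor f) (steps xs))"
    if "xs \<in> walks (vsrc f)" "hd xs = a" "last xs = b" for xs
    unfolding e by (rule Gamma_copair_props(2)[OF F(1) ab d g that])
qed

lemma Gamma_arr_in:
  assumes "f \<in> Ar (GV small V)" "xs \<in> walks (vsrc f)"
  shows "vmor (Gamma_arr V E f) (hd xs, last xs) \<bullet> inn (vsrc f) xs = inn (vtgt f) (map (vfun f) xs) \<bullet> E1 (map (vmor f) (steps xs))"
  using Gamma_arr_hom(2)[OF assms(1) walk_ends[OF assms(2)] assms(2) refl refl] .

lemma Gamma_arr_ar: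
  assumes f: "f \<in> Ar (GV small V)"
  shows "Gamma_arr V E f \<in> Ar (GV small V)"
proof (rule GV_arI)
  note F = GV_arD[OF f]
  show "vsrc (Gamma_arr V E f) \<in> vgraphs small V" "vtgt (Gamma_arr V E f) \<in> vgraphs small V"
    using F by simp_all
  show "vfun (Gamma_arr V E f) \<in> extensional (verts (vsrc (Gamma_arr V E f)))"
    using F by simp
  show "vmor (Gamma_arr V E f) \<in> extensional (vpairs (vsrc (Gamma_arr V E f)))"
    by (simp add: Gamma_arr_def)
  fix a b assume "a \<in> verts (vsrc (Gamma_arr V E f))" "b \<in> verts (vsrc (Gamma_arr V E f))"
  then show "vfun (Gamma_arr V E f) a \<in> verts (vtgt (Gamma_arr V E f))"
    "vmor (Gamma_arr V E f) (a, b) \<in> hom V (edge (vsrc (Gamma_arr V E f)) (a, b))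
      (edge (vtgt (Gamma_arr V E f)) (vfun (Gamma_arr V E f) a, vfun (Gamma_arr V E f) b))"
    using Gamma_arr_hom(1)[OF f] F by simp_all
qed

lemma Gamma_arr_typed:
  assumes f: "f \<in> Ar (GV small V)" and xs: "xs \<in> walks (vsrc f)"
  shows "vmor (Gamma_arr V E f) (hd xs, last xs) \<in> Ar V"
    "Dom V (vmor (Gamma_arr V E f) (hd xs, last xs)) = edge (\<Gamma>0 (vsrc f)) (hd xs, last xs)"
    "Cod V (vmor (Gamma_arr V E f) (hd xs, last xs)) = edge (\<Gamma>0 (vtgt f)) (vfun f (hd xs), vfun f (last xs))"
  using Gamma_arr_hom(1)[OF f walk_ends[OF xs]] by (simp_all add: hom_iff)

lemma Gamma_simps [simp]:
  "fobj (Gamma V E) = \<Gamma>0" "farr (Gamma V E) = Gamma_arr V E" "m_unit (Gamma V E) = Gamma_unit V E"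
  "m_mult (Gamma V E) = Gamma_mult V E"
  by (simp_all add: Gamma_def)

lemma cat_functor_Gamma: "cat_functor (GV small V) (GV small V) (Gamma V E)"
proof -
  interpret GV: category "GV small V" by (rule category_GV[OF category_axioms])
  show ?thesis
  proof
    fix f X Y assume "f \<in> hom (GV small V) X Y"
    then show "farr (Gamma V E) f \<in> hom (GV small V) (fobj (Gamma V E) X) (fobj (Gamma V E) Y)"
      using Gamma_arr_ar by (auto simp: hom_iff)
  next
    fix X assume "X \<in> Ob (GV small V)"
    then have X: "X \<in> vgraphs small V" by simp
    let ?I = "Id (GV small V) X"
    have I: "?I \<in> Ar (GV small V)" "vsrc ?I = X" "vtgt ?I = X" using GV.id_typed[of X] X by simp_all
    have "Gamma_arr V E ?I = Id (GV small V) (\<Gamma>0 X)"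
    proof (rule vmap_eqI[where small = small and V = V])
      fix a b assume "a \<in> verts (vsrc (Gamma_arr V E ?I))" "b \<in> verts (vsrc (Gamma_arr V E ?I))"
      then have ab: "a \<in> verts X" "b \<in> verts X" by simp_all
      have o: "edge (\<Gamma>0 X) (a, b) \<in> Ob V" using vgraphs_edge[OF Gamma_vgraph[OF X]] ab by simp
      have "vmor (Gamma_arr V E ?I) (a, b) = Id V (edge (\<Gamma>0 X) (a, b))"
      proof (rule inn_epi[OF X ab])
        show "vmor (Gamma_arr V E ?I) (a, b) \<in> hom V (edge (\<Gamma>0 X) (a, b)) (edge (\<Gamma>0 X) (a, b))"
          using Gamma_arr_hom(1)[OF I(1), of a b] ab by simp
        show "Id V (edge (\<Gamma>0 X) (a, b)) \<in> hom V (edge (\<Gamma>0 X) (a, b)) (edge (\<Gamma>0 X) (a, b))"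
          using o by (simp add: hom_iff)
        fix xs assume xs: "xs \<in> walks X" "hd xs = a" "last xs = b"
        have "E1 (map (\<lambda>p\<in>vpairs X. Id V (edge X p)) (steps xs)) = Id V (E0 (walk_edges X xs))"
          using walk_edges_ob[OF X xs(1)] by (simp add: steps_map_restrict[OF xs(1), of "Id V"] cong del: map_cong)
        then show "vmor (Gamma_arr V E ?I) (a, b) \<bullet> inn X xs = Id V (edge (\<Gamma>0 X) (a, b)) \<bullet> inn X xs"
          using Gamma_arr_in[OF I(1), of xs] inn_typed[OF X xs(1)] xs
          by (simp add: walk_map_restrict_id cong del: map_cong)
      qed
      then show "vmor (Gamma_arr V E ?I) (a, b) = vmor (Id (GV small V) (\<Gamma>0 X)) (a, b)"
        using ab by simp
    qed (use X Gamma_arr_ar[OF I(1)] GV.id_typed[of "\<Gamma>0 X"] in simp_all)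
    then show "farr (Gamma V E) (Id (GV small V) X) = Id (GV small V) (fobj (Gamma V E) X)" by simp
  next
    fix f g X Y Z assume "f \<in> hom (GV small V) X Y" "g \<in> hom (GV small V) Y Z"
    then have f: "f \<in> Ar (GV small V)" "vsrc f = X" "vtgt f = Y" and g: "g \<in> Ar (GV small V)" "vsrc g = Y" "vtgt g = Z"
      by (auto simp: hom_iff)
    let ?h = "Comp (GV small V) g f"
    have h: "?h \<in> Ar (GV small V)" using GV.comp_typed(1)[OF f(1) g(1)] f g by simp
    note F = GV_arD[OF f(1), unfolded f] and G = GV_arD[OF g(1), unfolded g]
    have gc: "Comp (GV small V) (Gamma_arr V E g) (Gamma_arr V E f) \<in> Ar (GV small V)"
      using GV.comp_typed(1)[OF Gamma_arr_ar[OF f(1)] Gamma_arr_ar[OF g(1)]] f g by simp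
    have "Gamma_arr V E ?h = Comp (GV small V) (Gamma_arr V E g) (Gamma_arr V E f)"
    proof (rule vmap_eqI[OF Gamma_arr_ar[OF h] gc])
      fix a b assume "a \<in> verts (vsrc (Gamma_arr V E ?h))" "b \<in> verts (vsrc (Gamma_arr V E ?h))"
      then have ab: "a \<in> verts X" "b \<in> verts X" using f by simp_all
      have "vmor (Gamma_arr V E ?h) (a, b) = vmor (Gamma_arr V E g) (vfun f a, vfun f b) \<bullet> vmor (Gamma_arr V E f) (a, b)"
      proof (rule inn_epi[OF F(1) ab])
        show "vmor (Gamma_arr V E ?h) (a, b) \<in> hom V (edge (\<Gamma>0 X) (a, b)) (edge (\<Gamma>0 Z) (vfun g (vfun f a), vfun g (vfun f b)))"
          using Gamma_arr_hom(1)[OF h, of a b] ab by (simp add: f g)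
        show "vmor (Gamma_arr V E g) (vfun f a, vfun f b) \<bullet> vmor (Gamma_arr V E f) (a, b)
            \<in> hom V (edge (\<Gamma>0 X) (a, b)) (edge (\<Gamma>0 Z) (vfun g (vfun f a), vfun g (vfun f b)))"
          using Gamma_arr_hom(1)[OF f(1), of a b] Gamma_arr_hom(1)[OF g(1), of "vfun f a" "vfun f b"] ab F(3)
          by (simp add: f g hom_iff)
        fix xs assume xs: "xs \<in> walks X" "hd xs = a" "last xs = b"
        have ys: "map (vfun f) xs \<in> walks Y" using walks_map[OF f(1)] xs f by simp
        note e = walk_map_ends[OF xs(1), of "vfun f"]
        have 1: "vmor (Gamma_arr V E f) (a, b) \<bullet> inn X xs = inn Y (map (vfun f) xs) \<bullet> E1 (map (vmor f) (steps xs))"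
          using Gamma_arr_in[OF f(1), unfolded f, OF xs(1)] xs by simp
        have 2: "vmor (Gamma_arr V E g) (vfun f a, vfun f b) \<bullet> inn Y (map (vfun f) xs)
            = inn Z (map (\<lambda>x. vfun g (vfun f x)) xs) \<bullet> E1 (map (vmor g) (steps (map (vfun f) xs)))"
          using Gamma_arr_in[OF g(1), unfolded g, OF ys] xs e by simp
        have 3: "vmor (Gamma_arr V E ?h) (a, b) \<bullet> inn X xs = inn Z (map (\<lambda>x. vfun g (vfun f x)) xs) \<bullet> E1 (map (vmor ?h) (steps xs))"
        proof -
          have m: "map (vfun ?h) xs = map (\<lambda>x. vfun g (vfun f x)) xs"
            using xs(1) by (auto simp: walks_simps f)
          show ?thesis
            using Gamma_arr_in[OF h, of xs] xs unfolding m by (simp add: f g cong del: map_cong)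
        qed
        have 4: "E1 (map (vmor ?h) (steps xs)) = E1 (map (vmor g) (steps (map (vfun f) xs))) \<bullet> E1 (map (vmor f) (steps xs))"
        proof -
          have "E1 (map (vmor ?h) (steps xs)) = E1 (map (\<lambda>p. vmor g (map_prod (vfun f) (vfun f) p) \<bullet> vmor f p) (steps xs))"
            using steps_walk[OF xs(1)] by (auto simp: f intro!: arg_cong[where f = E1])
          also have "\<dots> = E1 (map (\<lambda>p. vmor g (map_prod (vfun f) (vfun f) p)) (steps xs)) \<bullet> E1 (map (vmor f) (steps xs))"
            by (rule E.arr_comp) (use steps_walk[OF xs(1)] F G in auto)
          finally show ?thesis by (simp add: steps_map)
        qed
        note T = inn_typed[OF F(1) xs(1)] inn_typed[OF F(2) ys] inn_typed[OF G(2) walks_map[OF g(1), unfolded g, OF ys]]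
          E1_graph_map[OF f(1), unfolded f, OF xs(1)] E1_graph_map[OF g(1), unfolded g, OF ys]
        note T' = Gamma_arr_typed[OF f(1), unfolded f, OF xs(1)] Gamma_arr_typed[OF g(1), unfolded g, OF ys]
        have "(vmor (Gamma_arr V E g) (vfun f a, vfun f b) \<bullet> vmor (Gamma_arr V E f) (a, b)) \<bullet> inn X xs
          = (vmor (Gamma_arr V E g) (vfun f a, vfun f b) \<bullet> inn Y (map (vfun f) xs)) \<bullet> E1 (map (vmor f) (steps xs))"
          using 1 T T' xs e by simp
        also have "\<dots> = vmor (Gamma_arr V E ?h) (a, b) \<bullet> inn X xs"
          unfolding 2 3 4 using T by simp
        finally show "vmor (Gamma_arr V E ?h) (a, b) \<bullet> inn X xs
          = (vmor (Gamma_arr V E g) (vfun f a, vfun f b) \<bullet> vmor (Gamma_arr V E f) (a, b)) \<bullet> inn X xs" by simp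
      qed
      then show "vmor (Gamma_arr V E ?h) (a, b) = vmor (Comp (GV small V) (Gamma_arr V E g) (Gamma_arr V E f)) (a, b)"
        using ab by (simp add: f)
    qed (simp_all add: f)
    then show "farr (Gamma V E) (Comp (GV small V) g f) = Comp (GV small V) (farr (Gamma V E) g) (farr (Gamma V E) f)" by simp
  qed simp
qed

text \<open>\<open>multi_distributive\<close> decomposes each summand of the outer coproduct over
  the choices of inner walks. This supplies the universal property behind
  \<open>Gamma_mult\<close>.\<close>

lemma Gamma_double_coproduct:
  assumes X: "X \<in> vgraphs small V" and ab: "a \<in> verts X" "b \<in> verts X"
  shows "is_coproduct V (SIGMA xs : walks_between X (a, b). {yss. list_all2 (\<lambda>ys p. ys \<in> walks_between X p) yss (steps xs)})
    (\<lambda>(xs, yss). E0 (map E0 (map (walk_edges X) yss))) (edge (\<Gamma>0 (\<Gamma>0 X)) (a, b))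
    (\<lambda>(xs, yss). inn (\<Gamma>0 X) xs \<bullet> E1 (map (inn X) yss))"
proof -
  have 1: "is_coproduct V (walks_between X (a, b)) (\<lambda>xs. E0 (walk_edges (\<Gamma>0 X) xs)) (edge (\<Gamma>0 (\<Gamma>0 X)) (a, b)) (inn (\<Gamma>0 X))"
    using Gamma_coproduct[OF Gamma_vgraph[OF X], of a b] ab by simp
  have 2: "is_coproduct V {yss. list_all2 (\<lambda>ys p. ys \<in> walks_between X p) yss (steps xs)}
     (\<lambda>yss. E0 (map E0 (map (walk_edges X) yss))) (E0 (walk_edges (\<Gamma>0 X) xs)) (\<lambda>yss. E1 (map (inn X) yss))"
    if "xs \<in> walks_between X (a, b)" for xs
  proof -
    have xs: "xs \<in> walks X" using that by (simp add: walks_between_def)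
    have "is_coproduct V (walks_between X p) (\<lambda>ys. E0 (walk_edges X ys)) (edge (\<Gamma>0 X) p) (inn X)" if "p \<in> set (steps xs)" for p
      using Gamma_coproduct[OF X, of "fst p" "snd p"] steps_walk[OF xs, of "fst p" "snd p"] that by simp
    from multi_distributive[OF X _ this, of "[]"] show ?thesis
      by (simp add: walk_edges_def)
  qed
  show ?thesis by (rule coproduct_Sigma[OF 1 2])
qed

lemma nested_index: "(xs, yss) \<in> (SIGMA xs : walks_between X (a, b). {yss. list_all2 (\<lambda>ys p. ys \<in> walks_between X p) yss (steps xs)})
    \<longleftrightarrow> nested_walk X xs yss \<and> (hd xs, last xs) = (a, b)"
  by (auto simp: nested_walk_def walks_between_def)

lemma inn_nested_typed:
  assumes X: "X \<in> vgraphs small V" and n: "nested_walk X xs yss"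
  shows "E1 (map (inn X) yss) \<in> Ar V" "Dom V (E1 (map (inn X) yss)) = E0 (map E0 (map (walk_edges X) yss))"
    "Cod V (E1 (map (inn X) yss)) = E0 (walk_edges (\<Gamma>0 X) xs)"
proof -
  note N = nested_walkD[OF n] and I = inn_typed[OF X]
  have "map (\<lambda>ys. edge (\<Gamma>0 X) (hd ys, last ys)) yss = walk_edges (\<Gamma>0 X) xs"
    unfolding walk_edges_def N(7)[symmetric] by simp
  then show "E1 (map (inn X) yss) \<in> Ar V" "Dom V (E1 (map (inn X) yss)) = E0 (map E0 (map (walk_edges X) yss))"
    "Cod V (E1 (map (inn X) yss)) = E0 (walk_edges (\<Gamma>0 X) xs)"
    using I[OF N(2)] by simp_all
qed

lemma inn_double_epi:
  assumes X: "X \<in> vgraphs small V" and ab: "a \<in> verts X" "b \<in> verts X"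
    and f: "f \<in> hom V (edge (\<Gamma>0 (\<Gamma>0 X)) (a, b)) d" and g: "g \<in> hom V (edge (\<Gamma>0 (\<Gamma>0 X)) (a, b)) d"
    and eq: "\<And>xs yss. nested_walk X xs yss \<Longrightarrow> hd xs = a \<Longrightarrow> last xs = b \<Longrightarrow>
      f \<bullet> inn (\<Gamma>0 X) xs \<bullet> E1 (map (inn X) yss) = g \<bullet> inn (\<Gamma>0 X) xs \<bullet> E1 (map (inn X) yss)"
  shows "f = g"
  by (rule coproduct_epi[OF Gamma_double_coproduct[OF X ab] f g])
    (auto simp: eq nested_walk_def walks_between_def)

lemma Gamma_mult_simps [simp]:
  "vsrc (Gamma_mult V E X) = \<Gamma>0 (\<Gamma>0 X)" "vtgt (Gamma_mult V E X) = \<Gamma>0 X" "vfun (Gamma_mult V E X) = (\<lambda>a\<in>verts X. a)"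
  "vsrc (Gamma_unit V E X) = X" "vtgt (Gamma_unit V E X) = \<Gamma>0 X" "vfun (Gamma_unit V E X) = (\<lambda>a\<in>verts X. a)"
  "vmor (Gamma_unit V E X) = (\<lambda>(a, b)\<in>vpairs X. inn X [a, b] \<bullet> u (edge X (a, b)))"
  by (simp_all add: Gamma_mult_def Gamma_unit_def)

text \<open>Existence and uniqueness from \<open>Gamma_double_coproduct\<close> give the definite
  description in \<open>Gamma_mult\<close> its meaning.\<close>

lemma Gamma_mult_props:
  assumes X: "X \<in> vgraphs small V" and ab: "a \<in> verts X" "b \<in> verts X"
  shows "vmor (Gamma_mult V E X) (a, b) \<in> hom V (edge (\<Gamma>0 (\<Gamma>0 X)) (a, b)) (edge (\<Gamma>0 X) (a, b))"
    "\<And>xs yss. nested_walk X xs yss \<Longrightarrow> hd xs = a \<Longrightarrow> last xs = b \<Longrightarrow>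
      vmor (Gamma_mult V E X) (a, b) \<bullet> inn (\<Gamma>0 X) xs \<bullet> E1 (map (inn X) yss)
      = inn X (join_walk xs yss) \<bullet> \<sigma> (map (walk_edges X) yss)"
proof -
  let ?P = "\<lambda>h. h \<in> hom V (edge (\<Gamma>0 (\<Gamma>0 X)) (a, b)) (edge (\<Gamma>0 X) (a, b)) \<and>
       (\<forall>xs yss. nested_walk X xs yss \<and> (hd xs, last xs) = (a, b) \<longrightarrow>
          h \<bullet> inn (\<Gamma>0 X) xs \<bullet> E1 (map (inn X) yss) = inn X (join_walk xs yss) \<bullet> \<sigma> (map (walk_edges X) yss))"
  have t: "inn X (join_walk xs yss) \<bullet> \<sigma> (map (walk_edges X) yss) \<in> hom V (E0 (map E0 (map (walk_edges X) yss))) (edge (\<Gamma>0 X) (a, b))"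
    if "nested_walk X xs yss" "(hd xs, last xs) = (a, b)" for xs yss
  proof -
    note N = nested_walkD[OF that(1)]
    have "\<forall>Xs\<in>set (map (walk_edges X) yss). \<forall>A\<in>set Xs. A \<in> Ob V" using walk_edges_ob[OF X N(2)] by auto
    then show ?thesis
      using inn_typed[OF X N(3)] N that(2) by (simp add: hom_iff)
  qed
  have o: "edge (\<Gamma>0 X) (a, b) \<in> Ob V" using vgraphs_edge[OF Gamma_vgraph[OF X]] ab by simp
  have "\<exists>h. ?P h"
  proof -
    have gt: "(\<lambda>(xs, yss). inn X (join_walk xs yss) \<bullet> \<sigma> (map (walk_edges X) yss)) i
        \<in> hom V ((\<lambda>(xs, yss). E0 (map E0 (map (walk_edges X) yss))) i) (edge (\<Gamma>0 X) (a, b))"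
      if "i \<in> (SIGMA xs : walks_between X (a, b). {yss. list_all2 (\<lambda>ys p. ys \<in> walks_between X p) yss (steps xs)})" for i
      using t that by (cases i) (simp only: nested_index prod.case)
    obtain h where h: "h \<in> hom V (edge (\<Gamma>0 (\<Gamma>0 X)) (a, b)) (edge (\<Gamma>0 X) (a, b))"
      "\<And>i. i \<in> (SIGMA xs : walks_between X (a, b). {yss. list_all2 (\<lambda>ys p. ys \<in> walks_between X p) yss (steps xs)}) \<Longrightarrow>
        h \<bullet> (\<lambda>(xs, yss). inn (\<Gamma>0 X) xs \<bullet> E1 (map (inn X) yss)) i
          = (\<lambda>(xs, yss). inn X (join_walk xs yss) \<bullet> \<sigma> (map (walk_edges X) yss)) i"
      using coproduct_ex[OF Gamma_double_coproduct[OF X ab] o gt] by blast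
    have "h \<bullet> inn (\<Gamma>0 X) xs \<bullet> E1 (map (inn X) yss) = inn X (join_walk xs yss) \<bullet> \<sigma> (map (walk_edges X) yss)"
      if "nested_walk X xs yss \<and> (hd xs, last xs) = (a, b)" for xs yss
      using h(2)[of "(xs, yss)"] that by (simp only: nested_index prod.case)
    then show ?thesis using h(1) by blast
  qed
  moreover have "h = h'" if "?P h" "?P h'" for h h'
    using that by (intro inn_double_epi[OF X ab, of h _ h']) auto
  ultimately have "\<exists>!h. ?P h" by blast
  from theI'[OF this]
  have "?P (vmor (Gamma_mult V E X) (a, b))"
    using ab by (simp add: Gamma_mult_def)
  then show "vmor (Gamma_mult V E X) (a, b) \<in> hom V (edge (\<Gamma>0 (\<Gamma>0 X)) (a, b)) (edge (\<Gamma>0 X) (a, b))"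
    "\<And>xs yss. nested_walk X xs yss \<Longrightarrow> hd xs = a \<Longrightarrow> last xs = b \<Longrightarrow>
      vmor (Gamma_mult V E X) (a, b) \<bullet> inn (\<Gamma>0 X) xs \<bullet> E1 (map (inn X) yss)
      = inn X (join_walk xs yss) \<bullet> \<sigma> (map (walk_edges X) yss)"
    by blast+
qed

lemma Gamma_mult_ar: "X \<in> vgraphs small V \<Longrightarrow> Gamma_mult V E X \<in> Ar (GV small V)"
  using Gamma_mult_props(1) by (intro GV_arI) (auto simp: Gamma_mult_def simp del: hom_def)

lemma Gamma_unit_ar:
  assumes X: "X \<in> vgraphs small V"
  shows "Gamma_unit V E X \<in> Ar (GV small V)"
proof (rule GV_arI)
  fix a b assume "a \<in> verts (vsrc (Gamma_unit V E X))" "b \<in> verts (vsrc (Gamma_unit V E X))"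
  then have ab: "a \<in> verts X" "b \<in> verts X" by simp_all
  have w: "[a, b] \<in> walks X" using ab by (simp add: walks_simps)
  show "vmor (Gamma_unit V E X) (a, b) \<in> hom V (edge (vsrc (Gamma_unit V E X)) (a, b))
    (edge (vtgt (Gamma_unit V E X)) (vfun (Gamma_unit V E X) a, vfun (Gamma_unit V E X) b))"
    using ab inn_typed[OF X w] vgraphs_edge[OF X ab] by (simp add: hom_iff)
qed (use X in \<open>auto simp: Gamma_unit_def\<close>)

end

section \<open>Distributive laws\<close>

text \<open>Isolates the typing shared by a given distributive law and by
  \<open>dist_law_of\<close>, so that the reduction of the laws to homs is made once for
  both.\<close>

locale object_family = enriched V E T small
  for V :: "('o, 'm) cat" and E and T and small :: "'a set \<Rightarrow> bool" +
  fixes l :: "('a, 'o) vgraph \<Rightarrow> ('a, 'o, 'm) vmap"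
  assumes l_ar: "X \<in> vgraphs small V \<Longrightarrow> l X \<in> Ar (GV small V)"
    and l_src: "X \<in> vgraphs small V \<Longrightarrow> vsrc (l X) = Gamma_obj V E (G_obj T X)"
    and l_tgt: "X \<in> vgraphs small V \<Longrightarrow> vtgt (l X) = G_obj T (Gamma_obj V E X)"
    and l_fun: "X \<in> vgraphs small V \<Longrightarrow> vfun (l X) = (\<lambda>a\<in>verts X. a)"
begin

abbreviation "GT \<equiv> G_obj T"

lemma GT_vgraph [simp]: "X \<in> vgraphs small V \<Longrightarrow> GT X \<in> vgraphs small V"
  by (rule G_obj_vgraphs[OF T.unit.G.cat_functor_axioms])

lemma l_vmor:
  assumes X: "X \<in> vgraphs small V" and ab: "a \<in> verts X" "b \<in> verts X"
  shows "vmor (l X) (a, b) \<in> Ar V" "Dom V (vmor (l X) (a, b)) = edge (\<Gamma>0 (GT X)) (a, b)"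
    "Cod V (vmor (l X) (a, b)) = T0 (edge (\<Gamma>0 X) (a, b))"
  using GV_arD(4-6)[OF l_ar[OF X], of a b] ab by (simp_all add: l_src[OF X] l_tgt[OF X] l_fun[OF X])

definition "nat_eq f a b \<longleftrightarrow> vmor (l (vtgt f)) (vfun f a, vfun f b) \<bullet> vmor (Gamma_arr V E (farr (G_func T) f)) (a, b)
    = T1 (vmor (Gamma_arr V E f) (a, b)) \<bullet> vmor (l (vsrc f)) (a, b)"

definition "unitS_eq X a b \<longleftrightarrow> vmor (l X) (a, b) \<bullet> inn (GT X) [a, b] \<bullet> u (T0 (edge X (a, b)))
    = T1 (inn X [a, b] \<bullet> u (edge X (a, b)))"

definition "unitT_eq X a b \<longleftrightarrow>
    vmor (l X) (a, b) \<bullet> vmor (Gamma_arr V E (m_unit (G_monad T) X)) (a, b) = \<eta> (edge (\<Gamma>0 X) (a, b))"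

definition "multS_eq X a b \<longleftrightarrow> vmor (l X) (a, b) \<bullet> vmor (Gamma_mult V E (GT X)) (a, b)
    = T1 (vmor (Gamma_mult V E X) (a, b)) \<bullet> vmor (l (\<Gamma>0 X)) (a, b) \<bullet> vmor (Gamma_arr V E (l X)) (a, b)"

definition "multT_eq X a b \<longleftrightarrow> vmor (l X) (a, b) \<bullet> vmor (Gamma_arr V E (m_mult (G_monad T) X)) (a, b)
    = \<mu> (edge (\<Gamma>0 X) (a, b)) \<bullet> T1 (vmor (l X) (a, b)) \<bullet> vmor (l (GT X)) (a, b)"

definition "componentwise \<longleftrightarrow>
    (\<forall>f\<in>Ar (GV small V). \<forall>a\<in>verts (vsrc f). \<forall>b\<in>verts (vsrc f). nat_eq f a b) \<and>
    (\<forall>X\<in>vgraphs small V. \<forall>a\<in>verts X. \<forall>b\<in>verts X.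
      unitS_eq X a b \<and> unitT_eq X a b \<and> multS_eq X a b \<and> multT_eq X a b)"

text \<open>On vertices the two sides of each equation agree, both being the identity or, for
  naturality, f; only the homs remain to be compared.\<close>

lemma distributive_law_iff: "distributive_law (GV small V) (G_monad T) (Gamma V E) l \<longleftrightarrow> componentwise"
proof -
  interpret GV: category "GV small V" by (rule category_GV[OF category_axioms])
  interpret G: monad "GV small V" "G_monad T" by (rule monad_G[OF T.monad_axioms])
  note GT = G.unit.G.cat_functor_axioms
  have tf: "farr (G_func T) f \<in> Ar (GV small V)" if "f \<in> Ar (GV small V)" for f
    using G.T.arr(1)[OF that] by simp
  have um: "m_unit (G_monad T) X \<in> Ar (GV small V)" "m_mult (G_monad T) X \<in> Ar (GV small V)" if "X \<in> vgraphs small V" for X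
    using G.unit_typed(1)[of X] G.mult_typed(1)[of X] that by (simp_all del: G_simps)
  note ars = l_ar Gamma_arr_ar tf um Gamma_mult_ar Gamma_unit_ar Gamma_vgraph GT_vgraph
  have ext: "G_obj (id_func :: ('o, 'm, 'o, 'm) func) X = X" if "X \<in> vgraphs small V" for X :: "('a, 'o) vgraph"
    using vgraphs_extensional[OF that] by simp
  have eqI: "f = g \<longleftrightarrow> (\<forall>a\<in>verts (vsrc f). \<forall>b\<in>verts (vsrc f). vmor f (a, b) = vmor g (a, b))"
    if "f \<in> Ar (GV small V)" "g \<in> Ar (GV small V)" "vsrc f = vsrc g" "vtgt f = vtgt g"
      "\<forall>a\<in>verts (vsrc f). vfun f a = vfun g a" for f g
    using vmap_eqI[OF that(1-4)] that(5) by auto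
  have nat: "(Comp (GV small V) (l Y) (farr (Gamma V E \<circ>\<^sub>F G_monad T) f) = Comp (GV small V) (farr (G_monad T \<circ>\<^sub>F Gamma V E) f) (l X))
      \<longleftrightarrow> (\<forall>a\<in>verts X. \<forall>b\<in>verts X. nat_eq f a b)" if f: "f \<in> Ar (GV small V)" "vsrc f = X" "vtgt f = Y" for f X Y
  proof -
    note F = GV_arD[OF f(1), unfolded f(2,3)]
    note S = l_src[OF F(1)] l_src[OF F(2)] l_tgt[OF F(1)] l_tgt[OF F(2)] l_fun[OF F(1)] l_fun[OF F(2)]
    show ?thesis
      by (subst eqI) (auto simp: S f F nat_eq_def ars intro!: GV.comp_typed(1))
  qed
  have 1: "(Comp (GV small V) (l X) (m_unit (Gamma V E) (fobj (G_monad T) X)) = farr (G_monad T) (m_unit (Gamma V E) X))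
      \<longleftrightarrow> (\<forall>a\<in>verts X. \<forall>b\<in>verts X. unitS_eq X a b)" if X: "X \<in> vgraphs small V" for X
    by (subst eqI) (auto simp: X l_src l_tgt l_fun unitS_eq_def ars intro!: GV.comp_typed(1))
  have 2: "(Comp (GV small V) (l X) (farr (Gamma V E) (m_unit (G_monad T) X)) = m_unit (G_monad T) (fobj (Gamma V E) X))
      \<longleftrightarrow> (\<forall>a\<in>verts X. \<forall>b\<in>verts X. unitT_eq X a b)" if X: "X \<in> vgraphs small V" for X
    by (subst eqI) (auto simp: X l_src l_tgt l_fun unitT_eq_def ext[OF Gamma_vgraph[OF X]] ext[OF X] ars[simplified] intro!: GV.comp_typed(1))
  have 3: "(Comp (GV small V) (l X) (m_mult (Gamma V E) (fobj (G_monad T) X))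
       = Comp (GV small V) (farr (G_monad T) (m_mult (Gamma V E) X)) (Comp (GV small V) (l (fobj (Gamma V E) X)) (farr (Gamma V E) (l X))))
      \<longleftrightarrow> (\<forall>a\<in>verts X. \<forall>b\<in>verts X. multS_eq X a b)" if X: "X \<in> vgraphs small V" for X
    by (subst eqI) (auto simp: X l_src l_tgt l_fun multS_eq_def ars intro!: GV.comp_typed(1))
  have 4: "(Comp (GV small V) (l X) (farr (Gamma V E) (m_mult (G_monad T) X))
       = Comp (GV small V) (m_mult (G_monad T) (fobj (Gamma V E) X)) (Comp (GV small V) (farr (G_monad T) (l X)) (l (fobj (G_monad T) X))))
      \<longleftrightarrow> (\<forall>a\<in>verts X. \<forall>b\<in>verts X. multT_eq X a b)" if X: "X \<in> vgraphs small V" for X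
    by (subst eqI) (auto simp: X l_src l_tgt l_fun multT_eq_def ars[simplified] intro!: GV.comp_typed(1))
  have 0: "nat_trans (GV small V) (GV small V) (Gamma V E \<circ>\<^sub>F G_monad T) (G_monad T \<circ>\<^sub>F Gamma V E) l
     \<longleftrightarrow> (\<forall>f\<in>Ar (GV small V). \<forall>a\<in>verts (vsrc f). \<forall>b\<in>verts (vsrc f). nat_eq f a b)"
  proof
    assume "nat_trans (GV small V) (GV small V) (Gamma V E \<circ>\<^sub>F G_monad T) (G_monad T \<circ>\<^sub>F Gamma V E) l"
    then interpret N: nat_trans "GV small V" "GV small V" "Gamma V E \<circ>\<^sub>F G_monad T" "G_monad T \<circ>\<^sub>F Gamma V E" l .
    show "\<forall>f\<in>Ar (GV small V). \<forall>a\<in>verts (vsrc f). \<forall>b\<in>verts (vsrc f). nat_eq f a b"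
    proof
      fix f assume f: "f \<in> Ar (GV small V)"
      then have "f \<in> hom (GV small V) (vsrc f) (vtgt f)" by (simp add: hom_iff)
      from N.natural[OF this] show "\<forall>a\<in>verts (vsrc f). \<forall>b\<in>verts (vsrc f). nat_eq f a b"
        using nat[OF f refl refl] by simp
    qed
  next
    assume n: "\<forall>f\<in>Ar (GV small V). \<forall>a\<in>verts (vsrc f). \<forall>b\<in>verts (vsrc f). nat_eq f a b"
    show "nat_trans (GV small V) (GV small V) (Gamma V E \<circ>\<^sub>F G_monad T) (G_monad T \<circ>\<^sub>F Gamma V E) l"
    proof (intro nat_trans.intro nat_trans_axioms.intro cat_functor_comp[OF GT cat_functor_Gamma] cat_functor_comp[OF cat_functor_Gamma GT])
      fix X assume "X \<in> Ob (GV small V)"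
      then show "l X \<in> hom (GV small V) (fobj (Gamma V E \<circ>\<^sub>F G_monad T) X) (fobj (G_monad T \<circ>\<^sub>F Gamma V E) X)"
        using l_ar l_src l_tgt by (simp add: hom_iff)
    next
      fix f X Y assume "f \<in> hom (GV small V) X Y"
      then have f: "f \<in> Ar (GV small V)" "vsrc f = X" "vtgt f = Y" by (auto simp: hom_iff)
      show "Comp (GV small V) (l Y) (farr (Gamma V E \<circ>\<^sub>F G_monad T) f) = Comp (GV small V) (farr (G_monad T \<circ>\<^sub>F Gamma V E) f) (l X)"
        using nat[OF f] n f by blast
    qed
  qed
  show ?thesis
    unfolding distributive_law_def componentwise_def 0 using 1 2 3 4 by auto
qed

lemma Gamma_arr_GT:
  assumes f: "f \<in> Ar (GV small V)" "vsrc f = X" "vtgt f = Y" and xs: "xs \<in> walks X"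
  shows "vmor (Gamma_arr V E (farr (G_func T) f)) (hd xs, last xs) \<in> Ar V"
    "Dom V (vmor (Gamma_arr V E (farr (G_func T) f)) (hd xs, last xs)) = edge (\<Gamma>0 (GT X)) (hd xs, last xs)"
    "Cod V (vmor (Gamma_arr V E (farr (G_func T) f)) (hd xs, last xs)) = edge (\<Gamma>0 (GT Y)) (vfun f (hd xs), vfun f (last xs))"
    "vmor (Gamma_arr V E (farr (G_func T) f)) (hd xs, last xs) \<bullet> inn (GT X) xs
      = inn (GT Y) (map (vfun f) xs) \<bullet> E1 (map (\<lambda>p. T1 (vmor f p)) (steps xs))"
proof -
  interpret G: monad "GV small V" "G_monad T" by (rule monad_G[OF T.monad_axioms])
  have tf: "farr (G_func T) f \<in> Ar (GV small V)" using G.T.arr(1)[OF f(1)] by simp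
  have s: "xs \<in> walks (vsrc (farr (G_func T) f))" using xs f by simp
  show "vmor (Gamma_arr V E (farr (G_func T) f)) (hd xs, last xs) \<in> Ar V"
    "Dom V (vmor (Gamma_arr V E (farr (G_func T) f)) (hd xs, last xs)) = edge (\<Gamma>0 (GT X)) (hd xs, last xs)"
    "Cod V (vmor (Gamma_arr V E (farr (G_func T) f)) (hd xs, last xs)) = edge (\<Gamma>0 (GT Y)) (vfun f (hd xs), vfun f (last xs))"
    using Gamma_arr_typed[OF tf s] f by simp_all
  show "vmor (Gamma_arr V E (farr (G_func T) f)) (hd xs, last xs) \<bullet> inn (GT X) xs
    = inn (GT Y) (map (vfun f) xs) \<bullet> E1 (map (\<lambda>p. T1 (vmor f p)) (steps xs))"
    using Gamma_arr_in[OF tf s] by (simp add: f steps_restrict[OF xs] cong del: map_cong)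
qed

end

text \<open>Expresses that l acts on each summand of \<Gamma>E through \<tau>. For
  \<open>dist_law_of\<close> this holds by construction, and for a given law \<tau> is read off at
  linear graphs; the computations on summands therefore serve both directions of the
  bijection.\<close>

locale corresponding = object_family V E T small l
  for V :: "('o, 'm) cat" and E and T and small :: "'a set \<Rightarrow> bool" and l +
  fixes \<tau>
  assumes t_typed: "\<forall>X\<in>set Xs. X \<in> Ob V \<Longrightarrow> \<tau> Xs \<in> hom V (fobj E (map (fobj T) Xs)) (fobj T (fobj E Xs))"
    and t_natural: "\<forall>f\<in>set fs. f \<in> Ar V \<Longrightarrow>
      Comp V (\<tau> (map (Cod V) fs)) (farr E (map (farr T) fs)) = Comp V (farr T (farr E fs)) (\<tau> (map (Dom V) fs))"
    and corr: "X \<in> vgraphs small V \<Longrightarrow> xs \<in> walks X \<Longrightarrow>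
      Comp V (vmor (l X) (hd xs, last xs)) (Gamma_in V E (G_obj T X) xs)
      = Comp V (farr T (Gamma_in V E X xs)) (\<tau> (walk_edges X xs))"
begin

lemma tau_typed [simp]:
  assumes "\<forall>X\<in>set Xs. X \<in> Ob V"
  shows "\<tau> Xs \<in> Ar V" "Dom V (\<tau> Xs) = E0 (map T0 Xs)" "Cod V (\<tau> Xs) = T0 (E0 Xs)"
  using t_typed[OF assms] by (auto simp: hom_iff)

lemma t_natural_map:
  assumes "\<And>i. i \<in> set Is \<Longrightarrow> f i \<in> Ar V \<and> Dom V (f i) = a i \<and> Cod V (f i) = b i"
  shows "\<tau> (map b Is) \<bullet> E1 (map (\<lambda>i. T1 (f i)) Is) = T1 (E1 (map f Is)) \<bullet> \<tau> (map a Is)"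
proof -
  have "map (Dom V) (map f Is) = map a Is" "map (Cod V) (map f Is) = map b Is" using assms by auto
  then show ?thesis using t_natural[of "map f Is"] assms by (simp add: comp_def)
qed

context
  fixes X xs
  assumes X [simp]: "X \<in> vgraphs small V" and xs [simp]: "xs \<in> walks X"
begin

lemmas ends [simp] = walk_ends[OF xs]

lemma edges_ob [simp]: "\<forall>A\<in>set (walk_edges X xs). A \<in> Ob V"
  by (rule walk_edges_ob[OF X xs])

lemma we_GT: "walk_edges (GT X) xs = map T0 (walk_edges X xs)"
  by (rule walk_edges_G_obj[OF xs])

lemmas in_X = inn_typed[OF X xs]

lemma in_GT: "inn (GT X) xs \<in> Ar V" "Dom V (inn (GT X) xs) = E0 (map T0 (walk_edges X xs))"
    "Cod V (inn (GT X) xs) = edge (\<Gamma>0 (GT X)) (hd xs, last xs)"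
  using inn_typed[OF GT_vgraph[OF X], of xs] by (simp_all add: we_GT)

lemmas l_X = l_vmor[OF X walk_ends(1)[OF xs] walk_ends(2)[OF xs]]
lemmas corr_X = corr[OF X xs]

lemma edge_Gamma_ob [simp]: "edge (\<Gamma>0 X) (hd xs, last xs) \<in> Ob V"
  using vgraphs_edge[OF Gamma_vgraph[OF X]] by simp

text \<open>This and the following lemmas evaluate the sides of the laws of l on coproduct
  injections. Each side becomes T of an injection after the corresponding side of a law of \<tau>,
  so the laws of l and of \<tau> differ only by that common factor.\<close>

lemma unitT_left: "vmor (l X) (hd xs, last xs) \<bullet> vmor (Gamma_arr V E (m_unit (G_monad T) X)) (hd xs, last xs) \<bullet> inn X xs
    = T1 (inn X xs) \<bullet> \<tau> (walk_edges X xs) \<bullet> E1 (map \<eta> (walk_edges X xs))"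
proof -
  interpret G: monad "GV small V" "G_monad T" by (rule monad_G[OF T.monad_axioms])
  let ?f = "G_trans (id_func :: ('o, 'm, 'o, 'm) func) T \<eta> X"
  have ext: "G_obj id_func X = X" using vgraphs_extensional[OF X] by simp
  have f: "?f \<in> Ar (GV small V)" using G.unit_typed(1)[of X] by simp
  have s: "xs \<in> walks (vsrc ?f)" using ext by simp
  note T = Gamma_arr_typed[OF f s]
  have 1: "vmor (Gamma_arr V E ?f) (hd xs, last xs) \<bullet> inn X xs = inn (GT X) xs \<bullet> E1 (map \<eta> (walk_edges X xs))"
    using Gamma_arr_in[OF f s] by (simp add: ext walk_map_restrict_id[OF xs] steps_map_restrict[OF xs] cong del: map_cong)
  show ?thesis
    using 1 T corr_X[THEN reassoc] in_X in_GT l_X by (simp add: ext)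
qed

lemma unitT_right: "\<eta> (edge (\<Gamma>0 X) (hd xs, last xs)) \<bullet> inn X xs = T1 (inn X xs) \<bullet> \<eta> (E0 (walk_edges X xs))"
  using in_X by (simp add: T.unit_natural)

lemma multT_left: "vmor (l X) (hd xs, last xs) \<bullet> vmor (Gamma_arr V E (m_mult (G_monad T) X)) (hd xs, last xs) \<bullet> inn (GT (GT X)) xs
    = T1 (inn X xs) \<bullet> \<tau> (walk_edges X xs) \<bullet> E1 (map \<mu> (walk_edges X xs))"
proof -
  interpret G: monad "GV small V" "G_monad T" by (rule monad_G[OF T.monad_axioms])
  let ?f = "G_trans (T \<circ>\<^sub>F T) T \<mu> X"
  have f: "?f \<in> Ar (GV small V)" using G.mult_typed(1)[of X] by simp
  have s: "xs \<in> walks (vsrc ?f)" by simp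
  note T = Gamma_arr_typed[OF f s]
  have i: "inn (GT (GT X)) xs \<in> Ar V" "Cod V (inn (GT (GT X)) xs) = edge (\<Gamma>0 (GT (GT X))) (hd xs, last xs)"
    using inn_typed[OF GT_vgraph[OF GT_vgraph[OF X]], of xs] by simp_all
  have 1: "vmor (Gamma_arr V E ?f) (hd xs, last xs) \<bullet> inn (GT (GT X)) xs = inn (GT X) xs \<bullet> E1 (map \<mu> (walk_edges X xs))"
    using Gamma_arr_in[OF f s] by (simp add: walk_map_restrict_id[OF xs] steps_map_restrict[OF xs] cong del: map_cong)
  show ?thesis
    using 1 T i corr_X[THEN reassoc] in_X in_GT l_X by simp
qed

end

lemma multT_right:
  assumes X: "X \<in> vgraphs small V" and xs: "xs \<in> walks X"
  shows "\<mu> (edge (\<Gamma>0 X) (hd xs, last xs)) \<bullet> T1 (vmor (l X) (hd xs, last xs)) \<bullet> vmor (l (GT X)) (hd xs, last xs) \<bullet> inn (GT (GT X)) xs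
    = T1 (inn X xs) \<bullet> \<mu> (E0 (walk_edges X xs)) \<bullet> T1 (\<tau> (walk_edges X xs)) \<bullet> \<tau> (map T0 (walk_edges X xs))"
proof -
  have xs': "xs \<in> walks (GT X)" using xs by simp
  have o: "\<forall>A\<in>set (walk_edges X xs). A \<in> Ob V" "\<forall>A\<in>set (map T0 (walk_edges X xs)). A \<in> Ob V"
    using edges_ob[OF X xs] by simp_all
  have 1: "vmor (l (GT X)) (hd xs, last xs) \<bullet> inn (GT (GT X)) xs = T1 (inn (GT X) xs) \<bullet> \<tau> (map T0 (walk_edges X xs))"
    using corr_X[OF GT_vgraph[OF X] xs'] by (simp add: we_GT[OF X xs])
  have 2: "T1 (vmor (l X) (hd xs, last xs)) \<bullet> T1 (inn (GT X) xs) = T1 (T1 (inn X xs)) \<bullet> T1 (\<tau> (walk_edges X xs))"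
    using corr_X[OF X xs, THEN T_lift] in_GT[OF X xs] l_X[OF X xs] in_X[OF X xs] o by (simp add: T.T.arr_comp)
  show ?thesis
    using 1 2[THEN reassoc] edge_Gamma_ob[OF X xs] in_GT[OF X xs] l_X[OF X xs] in_X[OF X xs] o by (simp add: T.mult_natural')
qed

lemma nat_left:
  assumes f: "f \<in> Ar (GV small V)" "vsrc f = X" "vtgt f = Y" and xs: "xs \<in> walks X"
  shows "vmor (l Y) (vfun f (hd xs), vfun f (last xs)) \<bullet> vmor (Gamma_arr V E (farr (G_func T) f)) (hd xs, last xs) \<bullet> inn (GT X) xs
     = T1 (inn Y (map (vfun f) xs)) \<bullet> \<tau> (walk_edges Y (map (vfun f) xs)) \<bullet> E1 (map (\<lambda>p. T1 (vmor f p)) (steps xs))"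
proof -
  note F = GV_arD[OF f(1), unfolded f(2,3)]
  have ys: "map (vfun f) xs \<in> walks Y" using walks_map[OF f(1)] f xs by simp
  note e = walk_map_ends[OF xs, of "vfun f"]
  note T = Gamma_arr_GT[OF f xs]
  have E: "E1 (map (\<lambda>p. T1 (vmor f p)) (steps xs)) \<in> Ar V"
    "Cod V (E1 (map (\<lambda>p. T1 (vmor f p)) (steps xs))) = E0 (map T0 (walk_edges Y (map (vfun f) xs)))"
  proof -
    note W = walk_edges_map[OF f(1), unfolded f, OF xs]
    show "E1 (map (\<lambda>p. T1 (vmor f p)) (steps xs)) \<in> Ar V" using W(3) by simp
    show "Cod V (E1 (map (\<lambda>p. T1 (vmor f p)) (steps xs))) = E0 (map T0 (walk_edges Y (map (vfun f) xs)))"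
      unfolding W(2)[symmetric] using W(3) by simp
  qed
  show ?thesis
    using E T e corr_X[OF F(2) ys, THEN reassoc] in_GT[OF F(2) ys] l_X[OF F(2) ys] in_X[OF F(2) ys] edges_ob[OF F(2) ys]
      in_GT[OF F(1) xs]
    by (simp add: f cong del: map_cong)
qed

lemma nat_right:
  assumes f: "f \<in> Ar (GV small V)" "vsrc f = X" "vtgt f = Y" and xs: "xs \<in> walks X"
  shows "T1 (vmor (Gamma_arr V E f) (hd xs, last xs)) \<bullet> vmor (l X) (hd xs, last xs) \<bullet> inn (GT X) xs
     = T1 (inn Y (map (vfun f) xs)) \<bullet> T1 (E1 (map (vmor f) (steps xs))) \<bullet> \<tau> (walk_edges X xs)"
proof -
  note F = GV_arD[OF f(1), unfolded f(2,3)]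
  have ys: "map (vfun f) xs \<in> walks Y" using walks_map[OF f(1)] f xs by simp
  note T = Gamma_arr_typed[OF f(1), unfolded f, OF xs]
  have 1: "T1 (vmor (Gamma_arr V E f) (hd xs, last xs)) \<bullet> T1 (inn X xs) = T1 (inn Y (map (vfun f) xs)) \<bullet> T1 (E1 (map (vmor f) (steps xs)))"
    using Gamma_arr_in[OF f(1), unfolded f, OF xs, THEN T_lift] T in_X[OF F(1) xs] in_X[OF F(2) ys] E1_graph_map[OF f(1), unfolded f, OF xs]
    by (simp add: T.T.arr_comp cong del: map_cong)
  show ?thesis
    using 1[THEN reassoc] T corr_X[OF F(1) xs] in_X[OF F(1) xs] edges_ob[OF F(1) xs] in_X[OF F(2) ys] E1_graph_map[OF f(1), unfolded f, OF xs]
    by (simp cong del: map_cong)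
qed

lemma nat_sides:
  assumes f: "f \<in> Ar (GV small V)" "vsrc f = X" "vtgt f = Y" and xs: "xs \<in> walks X"
  shows "\<tau> (walk_edges Y (map (vfun f) xs)) \<bullet> E1 (map (\<lambda>p. T1 (vmor f p)) (steps xs)) = T1 (E1 (map (vmor f) (steps xs))) \<bullet> \<tau> (walk_edges X xs)"
proof -
  note W = walk_edges_map[OF f(1), unfolded f, OF xs]
  show ?thesis
    unfolding W(1,2)[symmetric] by (rule t_natural_map) (use W(3) in auto)
qed

context
  fixes X xs yss
  assumes X [simp]: "X \<in> vgraphs small V" and n: "nested_walk X xs yss"
begin

lemmas N = nested_walkD[OF n]

lemma nested_ob [simp]: "\<forall>ys\<in>set yss. \<forall>A\<in>set (walk_edges X ys). A \<in> Ob V"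
  using walk_edges_ob[OF X N(2)] by blast

lemma nested_GT: "map (walk_edges (GT X)) yss = map (map T0) (map (walk_edges X) yss)"
  using N(2) by (simp add: walk_edges_G_obj)

lemma multS_left: "vmor (l X) (hd xs, last xs) \<bullet> vmor (Gamma_mult V E (GT X)) (hd xs, last xs) \<bullet> inn (\<Gamma>0 (GT X)) xs \<bullet> E1 (map (inn (GT X)) yss)
    = T1 (inn X (join_walk xs yss)) \<bullet> \<tau> (concat (map (walk_edges X) yss)) \<bullet> \<sigma> (map (map T0) (map (walk_edges X) yss))"
proof -
  have v: "hd xs \<in> verts X" "last xs \<in> verts X" using walk_ends[OF N(1)] by auto
  have 1: "vmor (Gamma_mult V E (GT X)) (hd xs, last xs) \<bullet> inn (\<Gamma>0 (GT X)) xs \<bullet> E1 (map (inn (GT X)) yss)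
      = inn (GT X) (join_walk xs yss) \<bullet> \<sigma> (map (map T0) (map (walk_edges X) yss))"
    using Gamma_mult_props(2)[OF GT_vgraph[OF X], of "hd xs" "last xs" xs yss] n v unfolding nested_GT[symmetric] by simp
  have S: "\<sigma> (map (map T0) (map (walk_edges X) yss)) \<in> Ar V"
    "Cod V (\<sigma> (map (map T0) (map (walk_edges X) yss))) = E0 (map T0 (concat (map (walk_edges X) yss)))"
    by simp_all
  have o: "\<forall>A\<in>set (concat (map (walk_edges X) yss)). A \<in> Ob V"
    using edges_ob[OF X N(3)] N(6) by simp
  show ?thesis
    unfolding 1 using corr_X[OF X N(3), THEN reassoc] S in_GT[OF X N(3)] in_X[OF X N(3)] l_vmor[OF X v] o tau_typed[OF o]
    by (simp add: N(4-6) del: map_concat mts_typed map_map)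
qed

text \<open>The inner l acts edge by edge, so the correspondence is used in every inner walk (2) and
  then on the outer one (c). Naturality of \<tau> along the injections (3) brings these together,
  and there the multiplication of \<Gamma>E turns them into \<sigma> (4).\<close>

lemma multS_right: "T1 (vmor (Gamma_mult V E X) (hd xs, last xs)) \<bullet> vmor (l (\<Gamma>0 X)) (hd xs, last xs)
    \<bullet> vmor (Gamma_arr V E (l X)) (hd xs, last xs) \<bullet> inn (\<Gamma>0 (GT X)) xs \<bullet> E1 (map (inn (GT X)) yss)
    = T1 (inn X (join_walk xs yss)) \<bullet> T1 (\<sigma> (map (walk_edges X) yss)) \<bullet> \<tau> (map E0 (map (walk_edges X) yss)) \<bullet> E1 (map \<tau> (map (walk_edges X) yss))"
proof -
  note GX = Gamma_vgraph[OF X]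
  have v: "hd xs \<in> verts X" "last xs \<in> verts X" using walk_ends[OF N(1)] by auto
  have xsG: "xs \<in> walks (\<Gamma>0 X)" using N(1) by simp
  have st: "p \<in> set (steps xs) \<Longrightarrow> fst p \<in> verts X \<and> snd p \<in> verts X" for p
    using steps_walk[OF N(1), of "fst p" "snd p"] by simp
  have hl: "map (vmor (l X)) (steps xs) = map (\<lambda>ys. vmor (l X) (hd ys, last ys)) yss"
    unfolding N(7)[symmetric] by simp
  have E: "E1 (map (inn (GT X)) yss) \<in> Ar V" "Cod V (E1 (map (inn (GT X)) yss)) = E0 (walk_edges (\<Gamma>0 (GT X)) xs)"
    using inn_nested_typed[OF GT_vgraph[OF X], of xs yss] n by simp_all
  have s: "xs \<in> walks (vsrc (l X))" using N(1) by (simp add: l_src)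
  have 1: "vmor (Gamma_arr V E (l X)) (hd xs, last xs) \<bullet> inn (\<Gamma>0 (GT X)) xs = inn (GT (\<Gamma>0 X)) xs \<bullet> E1 (map (vmor (l X)) (steps xs))"
    using Gamma_arr_in[OF l_ar[OF X] s] by (simp add: l_src l_tgt l_fun walk_map_restrict_id[OF N(1)] cong del: map_cong)
  have 2: "E1 (map (vmor (l X)) (steps xs)) \<bullet> E1 (map (inn (GT X)) yss)
      = E1 (map (\<lambda>ys. T1 (inn X ys)) yss) \<bullet> E1 (map (\<lambda>ys. \<tau> (walk_edges X ys)) yss)"
  proof -
    have "E1 (map (\<lambda>ys. vmor (l X) (hd ys, last ys)) yss) \<bullet> E1 (map (inn (GT X)) yss)
      = E1 (map (\<lambda>ys. T1 (inn X ys) \<bullet> \<tau> (walk_edges X ys)) yss)"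
      by (rule E_lift) (use N(2) corr_X[OF X] in_GT[OF X] l_X[OF X] in auto)
    also have "\<dots> = E1 (map (\<lambda>ys. T1 (inn X ys)) yss) \<bullet> E1 (map (\<lambda>ys. \<tau> (walk_edges X ys)) yss)"
      by (rule E.arr_comp) (use N(2) in_X[OF X] in auto)
    finally show ?thesis unfolding hl .
  qed
  have W: "walk_edges (\<Gamma>0 X) xs = map (\<lambda>ys. edge (\<Gamma>0 X) (hd ys, last ys)) yss"
    unfolding walk_edges_def N(7)[symmetric] by simp
  have 3: "\<tau> (walk_edges (\<Gamma>0 X) xs) \<bullet> E1 (map (\<lambda>ys. T1 (inn X ys)) yss) = T1 (E1 (map (inn X) yss)) \<bullet> \<tau> (map E0 (map (walk_edges X) yss))"
    unfolding W using t_natural_map[of yss "inn X" "\<lambda>ys. E0 (walk_edges X ys)" "\<lambda>ys. edge (\<Gamma>0 X) (hd ys, last ys)"] N(2) in_X[OF X] by simp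
  note T = Gamma_arr_typed[OF l_ar[OF X] s]
  have E2: "E1 (map (vmor (l X)) (steps xs)) \<in> Ar V" "Dom V (E1 (map (vmor (l X)) (steps xs))) = E0 (walk_edges (\<Gamma>0 (GT X)) xs)"
     "Cod V (E1 (map (vmor (l X)) (steps xs))) = E0 (map T0 (walk_edges (\<Gamma>0 X) xs))"
    using E1_graph_map[OF l_ar[OF X] s] we_GT[OF GX xsG] by (simp_all add: l_src l_tgt l_fun walk_map_restrict_id[OF N(1)] cong del: map_cong)
  have E3: "E1 (map (\<lambda>ys. T1 (inn X ys)) yss) \<in> Ar V" "Cod V (E1 (map (\<lambda>ys. T1 (inn X ys)) yss)) = E0 (map T0 (walk_edges (\<Gamma>0 X) xs))"
     "Dom V (E1 (map (\<lambda>ys. T1 (inn X ys)) yss)) = E0 (map (\<lambda>ys. T0 (E0 (walk_edges X ys))) yss)"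
    unfolding W using N(2) in_X[OF X] by simp_all
  have E4: "E1 (map (\<lambda>ys. \<tau> (walk_edges X ys)) yss) \<in> Ar V"
     "Cod V (E1 (map (\<lambda>ys. \<tau> (walk_edges X ys)) yss)) = E0 (map (\<lambda>ys. T0 (E0 (walk_edges X ys))) yss)"
    by simp_all
  have I: "inn (\<Gamma>0 (GT X)) xs \<in> Ar V" "Dom V (inn (\<Gamma>0 (GT X)) xs) = E0 (walk_edges (\<Gamma>0 (GT X)) xs)"
    "Cod V (inn (\<Gamma>0 (GT X)) xs) = edge (\<Gamma>0 (\<Gamma>0 (GT X))) (hd xs, last xs)"
    using inn_typed[OF Gamma_vgraph[OF GT_vgraph[OF X]], of xs] N(1) by simp_all
  have M: "vmor (Gamma_mult V E X) (hd xs, last xs) \<in> Ar V" "Dom V (vmor (Gamma_mult V E X) (hd xs, last xs)) = edge (\<Gamma>0 (\<Gamma>0 X)) (hd xs, last xs)"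
    using Gamma_mult_props(1)[OF X v] by (auto simp: hom_iff)
  note J = inn_nested_typed[OF X n]
  have 4: "T1 (vmor (Gamma_mult V E X) (hd xs, last xs)) \<bullet> T1 (inn (\<Gamma>0 X) xs) \<bullet> T1 (E1 (map (inn X) yss))
     = T1 (inn X (join_walk xs yss)) \<bullet> T1 (\<sigma> (map (walk_edges X) yss))"
    using arg_cong[OF Gamma_mult_props(2)[OF X v n refl refl], of T1] M J in_X[OF GX xsG] in_X[OF X N(3)] N(6)
    by (simp add: T.T.arr_comp)
  have c: "vmor (l (\<Gamma>0 X)) (hd xs, last xs) \<bullet> inn (GT (\<Gamma>0 X)) xs = T1 (inn (\<Gamma>0 X) xs) \<bullet> \<tau> (walk_edges (\<Gamma>0 X) xs)"
    by (rule corr_X[OF GX xsG])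
  note t = tau_typed[OF edges_ob[OF GX xsG]]
  have t2: "\<tau> (map E0 (map (walk_edges X) yss)) \<in> Ar V" "Dom V (\<tau> (map E0 (map (walk_edges X) yss))) = E0 (map (\<lambda>ys. T0 (E0 (walk_edges X ys))) yss)"
     "Cod V (\<tau> (map E0 (map (walk_edges X) yss))) = T0 (E0 (map E0 (map (walk_edges X) yss)))"
    by simp_all
  have "vmor (Gamma_arr V E (l X)) (hd xs, last xs) \<bullet> inn (\<Gamma>0 (GT X)) xs \<bullet> E1 (map (inn (GT X)) yss)
    = inn (GT (\<Gamma>0 X)) xs \<bullet> E1 (map (\<lambda>ys. T1 (inn X ys)) yss) \<bullet> E1 (map (\<lambda>ys. \<tau> (walk_edges X ys)) yss)"
    using 1[THEN reassoc, of "E1 (map (inn (GT X)) yss)"] I E E2 T 2 in_GT[OF GX xsG] by (simp add: l_src l_tgt l_fun)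
  then have "T1 (vmor (Gamma_mult V E X) (hd xs, last xs)) \<bullet> vmor (l (\<Gamma>0 X)) (hd xs, last xs)
    \<bullet> vmor (Gamma_arr V E (l X)) (hd xs, last xs) \<bullet> inn (\<Gamma>0 (GT X)) xs \<bullet> E1 (map (inn (GT X)) yss)
    = T1 (vmor (Gamma_mult V E X) (hd xs, last xs)) \<bullet> (vmor (l (\<Gamma>0 X)) (hd xs, last xs)
    \<bullet> inn (GT (\<Gamma>0 X)) xs) \<bullet> E1 (map (\<lambda>ys. T1 (inn X ys)) yss) \<bullet> E1 (map (\<lambda>ys. \<tau> (walk_edges X ys)) yss)"
    using l_X[OF GX xsG] in_GT[OF GX xsG] E3 E4 by simp
  also have "\<dots> = T1 (vmor (Gamma_mult V E X) (hd xs, last xs)) \<bullet> T1 (inn (\<Gamma>0 X) xs) \<bullet>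
     (\<tau> (walk_edges (\<Gamma>0 X) xs) \<bullet> E1 (map (\<lambda>ys. T1 (inn X ys)) yss)) \<bullet> E1 (map (\<lambda>ys. \<tau> (walk_edges X ys)) yss)"
    unfolding c using t E3 E4 in_X[OF GX xsG] by simp
  also have "\<dots> = (T1 (vmor (Gamma_mult V E X) (hd xs, last xs)) \<bullet> T1 (inn (\<Gamma>0 X) xs) \<bullet> T1 (E1 (map (inn X) yss))) \<bullet>
     \<tau> (map E0 (map (walk_edges X) yss)) \<bullet> E1 (map (\<lambda>ys. \<tau> (walk_edges X ys)) yss)"
    unfolding 3 using t2 E4 J in_X[OF GX xsG] M by simp
  also have "\<dots> = T1 (inn X (join_walk xs yss)) \<bullet> T1 (\<sigma> (map (walk_edges X) yss)) \<bullet> \<tau> (map E0 (map (walk_edges X) yss)) \<bullet> E1 (map \<tau> (map (walk_edges X) yss))"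
    unfolding 4 using t2 E4 in_X[OF X N(3)] N(6) by simp
  finally show ?thesis .
qed

end

end

context corresponding
begin

text \<open>Arrows out of a hom of \<Gamma>E are determined on the injections, and arrows out of its
  square on the nested injections. There the preceding evaluations reduce each law to one of
  \<tau>.\<close>

lemma componentwiseI:
  assumes tau_unit: "\<And>X. X \<in> Ob V \<Longrightarrow> \<tau> [X] \<bullet> u (T0 X) = T1 (u X)"
    and tau_subst: "\<And>Xss. \<forall>Xs\<in>set Xss. \<forall>X\<in>set Xs. X \<in> Ob V \<Longrightarrow>
      \<tau> (concat Xss) \<bullet> \<sigma> (map (map T0) Xss) = T1 (\<sigma> Xss) \<bullet> \<tau> (map E0 Xss) \<bullet> E1 (map \<tau> Xss)"
    and tau_eta: "\<And>Xs. \<forall>X\<in>set Xs. X \<in> Ob V \<Longrightarrow> \<tau> Xs \<bullet> E1 (map \<eta> Xs) = \<eta> (E0 Xs)"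
    and tau_mu: "\<And>Xs. \<forall>X\<in>set Xs. X \<in> Ob V \<Longrightarrow> \<tau> Xs \<bullet> E1 (map \<mu> Xs) = \<mu> (E0 Xs) \<bullet> T1 (\<tau> Xs) \<bullet> \<tau> (map T0 Xs)"
  shows componentwise
proof -
  interpret G: monad "GV small V" "G_monad T" by (rule monad_G[OF T.monad_axioms])
  have nat: "nat_eq f a b" if f: "f \<in> Ar (GV small V)" and ab: "a \<in> verts (vsrc f)" "b \<in> verts (vsrc f)" for f a b
    unfolding nat_eq_def
  proof (rule inn_epi[of "GT (vsrc f)" a b])
    note F = GV_arD[OF f]
    have tf: "farr (G_func T) f \<in> Ar (GV small V)" using G.T.arr(1)[OF f] by simp
    note h = Gamma_arr_hom(1)[OF tf, of a b] Gamma_arr_hom(1)[OF f, of a b]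
      l_vmor[OF F(1) ab] l_vmor[OF F(2), of "vfun f a" "vfun f b"]
    have fab: "vfun f a \<in> verts (vtgt f)" "vfun f b \<in> verts (vtgt f)" using F(3) ab by auto
    have o: "edge (\<Gamma>0 (vtgt f)) (vfun f a, vfun f b) \<in> Ob V"
      using vgraphs_edge[OF Gamma_vgraph[OF F(2)]] fab by simp
    show "vmor (l (vtgt f)) (vfun f a, vfun f b) \<bullet> vmor (Gamma_arr V E (farr (G_func T) f)) (a, b)
        \<in> hom V (edge (\<Gamma>0 (GT (vsrc f))) (a, b)) (T0 (edge (\<Gamma>0 (vtgt f)) (vfun f a, vfun f b)))"
      "T1 (vmor (Gamma_arr V E f) (a, b)) \<bullet> vmor (l (vsrc f)) (a, b)
        \<in> hom V (edge (\<Gamma>0 (GT (vsrc f))) (a, b)) (T0 (edge (\<Gamma>0 (vtgt f)) (vfun f a, vfun f b)))"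
      using h ab fab by (auto simp: hom_iff)
    fix xs assume "xs \<in> walks (GT (vsrc f))" and e: "hd xs = a" "last xs = b"
    then have xs: "xs \<in> walks (vsrc f)" by simp
    show "(vmor (l (vtgt f)) (vfun f a, vfun f b) \<bullet> vmor (Gamma_arr V E (farr (G_func T) f)) (a, b)) \<bullet> inn (GT (vsrc f)) xs
      = (T1 (vmor (Gamma_arr V E f) (a, b)) \<bullet> vmor (l (vsrc f)) (a, b)) \<bullet> inn (GT (vsrc f)) xs"
      using nat_left[OF f refl refl xs] nat_right[OF f refl refl xs] nat_sides[OF f refl refl xs] h in_GT[OF F(1) xs] ab fab
      unfolding e by (simp add: hom_iff)
  qed (use ab GV_arD[OF f] in simp_all)
  have X: "unitS_eq X a b \<and> unitT_eq X a b \<and> multS_eq X a b \<and> multT_eq X a b"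
    if X: "X \<in> vgraphs small V" and ab: "a \<in> verts X" "b \<in> verts X" for X a b
  proof (intro conjI)
    note GX = GT_vgraph[OF X]
    have o: "edge X (a, b) \<in> Ob V" "edge (\<Gamma>0 X) (a, b) \<in> Ob V"
      using vgraphs_edge[OF X ab] vgraphs_edge[OF Gamma_vgraph[OF X], of a b] ab by simp_all
    have ab': "a \<in> verts (GT X)" "b \<in> verts (GT X)" using ab by simp_all
    note lv = l_vmor[OF X ab] l_vmor[OF GX ab']
    have w: "[a, b] \<in> walks X" using ab by (simp add: walks_simps)
    have we: "walk_edges X [a, b] = [edge X (a, b)]" by (simp add: walk_edges_def steps_def)
    show "unitS_eq X a b"
      using corr_X[OF X w, THEN reassoc] in_X[OF X w] in_GT[OF X w] lv o tau_unit[of "edge X (a, b)"]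
      by (simp add: unitS_eq_def we T.T.arr_comp)
    show "unitT_eq X a b"
      unfolding unitT_eq_def
    proof (rule inn_epi[OF X ab])
      have f: "m_unit (G_monad T) X \<in> Ar (GV small V)" "vsrc (m_unit (G_monad T) X) = X"
        "vtgt (m_unit (G_monad T) X) = GT X"
        using G.unit_typed[of X] X vgraphs_extensional[OF X] by simp_all
      have v: "vfun (m_unit (G_monad T) X) = (\<lambda>a\<in>verts X. a)" by simp
      have h: "vmor (Gamma_arr V E (m_unit (G_monad T) X)) (a, b) \<in> hom V (edge (\<Gamma>0 X) (a, b)) (edge (\<Gamma>0 (GT X)) (a, b))"
        using Gamma_arr_hom(1)[OF f(1), of a b] ab unfolding f v by simp
      show "vmor (l X) (a, b) \<bullet> vmor (Gamma_arr V E (m_unit (G_monad T) X)) (a, b) \<in> hom V (edge (\<Gamma>0 X) (a, b)) (T0 (edge (\<Gamma>0 X) (a, b)))"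
        "\<eta> (edge (\<Gamma>0 X) (a, b)) \<in> hom V (edge (\<Gamma>0 X) (a, b)) (T0 (edge (\<Gamma>0 X) (a, b)))"
        using h lv o by (auto simp: hom_iff)
      fix xs assume xs: "xs \<in> walks X" and e: "hd xs = a" "last xs = b"
      show "(vmor (l X) (a, b) \<bullet> vmor (Gamma_arr V E (m_unit (G_monad T) X)) (a, b)) \<bullet> inn X xs = \<eta> (edge (\<Gamma>0 X) (a, b)) \<bullet> inn X xs"
        using unitT_left[OF X xs] unitT_right[OF X xs] tau_eta[OF edges_ob[OF X xs]] h lv in_X[OF X xs]
        unfolding e by (simp add: hom_iff e del: G_simps)
    qed
    show "multS_eq X a b"
      unfolding multS_eq_def
    proof (rule inn_double_epi[OF GX, of a b])
      have h: "vmor (Gamma_mult V E (GT X)) (a, b) \<in> hom V (edge (\<Gamma>0 (\<Gamma>0 (GT X))) (a, b)) (edge (\<Gamma>0 (GT X)) (a, b))"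
        "vmor (Gamma_mult V E X) (a, b) \<in> hom V (edge (\<Gamma>0 (\<Gamma>0 X)) (a, b)) (edge (\<Gamma>0 X) (a, b))"
        using Gamma_mult_props(1)[OF GX, of a b] Gamma_mult_props(1)[OF X ab] ab by simp_all
      have k: "vmor (Gamma_arr V E (l X)) (a, b) \<in> hom V (edge (\<Gamma>0 (\<Gamma>0 (GT X))) (a, b)) (edge (\<Gamma>0 (GT (\<Gamma>0 X))) (a, b))"
        using Gamma_arr_hom(1)[OF l_ar[OF X], of a b] ab by (simp add: l_src[OF X] l_tgt[OF X] l_fun[OF X])
      note lg = l_vmor[OF Gamma_vgraph[OF X], of a b]
      show "vmor (l X) (a, b) \<bullet> vmor (Gamma_mult V E (GT X)) (a, b) \<in> hom V (edge (\<Gamma>0 (\<Gamma>0 (GT X))) (a, b)) (T0 (edge (\<Gamma>0 X) (a, b)))"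
        "T1 (vmor (Gamma_mult V E X) (a, b)) \<bullet> vmor (l (\<Gamma>0 X)) (a, b) \<bullet> vmor (Gamma_arr V E (l X)) (a, b)
         \<in> hom V (edge (\<Gamma>0 (\<Gamma>0 (GT X))) (a, b)) (T0 (edge (\<Gamma>0 X) (a, b)))"
        using h k lg lv ab by (auto simp: hom_iff)
      fix xs yss assume n': "nested_walk (GT X) xs yss" and e: "hd xs = a" "last xs = b"
      then have n: "nested_walk X xs yss" by simp
      have I: "inn (\<Gamma>0 (GT X)) xs \<in> Ar V" "Dom V (inn (\<Gamma>0 (GT X)) xs) = E0 (walk_edges (\<Gamma>0 (GT X)) xs)"
        "Cod V (inn (\<Gamma>0 (GT X)) xs) = edge (\<Gamma>0 (\<Gamma>0 (GT X))) (a, b)"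
        using inn_typed[OF Gamma_vgraph[OF GX], of xs] nested_walkD(1)[OF n] e by simp_all
      note E = inn_nested_typed[OF GX n']
      show "(vmor (l X) (a, b) \<bullet> vmor (Gamma_mult V E (GT X)) (a, b)) \<bullet> inn (\<Gamma>0 (GT X)) xs \<bullet> E1 (map (inn (GT X)) yss)
        = (T1 (vmor (Gamma_mult V E X) (a, b)) \<bullet> vmor (l (\<Gamma>0 X)) (a, b) \<bullet> vmor (Gamma_arr V E (l X)) (a, b))
          \<bullet> inn (\<Gamma>0 (GT X)) xs \<bullet> E1 (map (inn (GT X)) yss)"
        using multS_left[OF X n] multS_right[OF X n] tau_subst[of "map (walk_edges X) yss"] nested_ob[OF X n] h k lg lv I E ab
        unfolding e by (simp add: hom_iff del: map_concat map_map)
    qed (use ab in simp_all)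
    show "multT_eq X a b"
      unfolding multT_eq_def
    proof (rule inn_epi[OF GT_vgraph[OF GX], of a b])
      have f: "m_mult (G_monad T) X \<in> Ar (GV small V)" "vsrc (m_mult (G_monad T) X) = GT (GT X)"
        "vtgt (m_mult (G_monad T) X) = GT X"
        using G.mult_typed[of X] X by simp_all
      have v: "vfun (m_mult (G_monad T) X) = (\<lambda>a\<in>verts X. a)" by simp
      have h: "vmor (Gamma_arr V E (m_mult (G_monad T) X)) (a, b) \<in> hom V (edge (\<Gamma>0 (GT (GT X))) (a, b)) (edge (\<Gamma>0 (GT X)) (a, b))"
        using Gamma_arr_hom(1)[OF f(1), of a b] ab unfolding f v by simp
      show "vmor (l X) (a, b) \<bullet> vmor (Gamma_arr V E (m_mult (G_monad T) X)) (a, b) \<in> hom V (edge (\<Gamma>0 (GT (GT X))) (a, b)) (T0 (edge (\<Gamma>0 X) (a, b)))"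
        "\<mu> (edge (\<Gamma>0 X) (a, b)) \<bullet> T1 (vmor (l X) (a, b)) \<bullet> vmor (l (GT X)) (a, b) \<in> hom V (edge (\<Gamma>0 (GT (GT X))) (a, b)) (T0 (edge (\<Gamma>0 X) (a, b)))"
        using h lv o ab by (auto simp: hom_iff)
      fix xs assume "xs \<in> walks (GT (GT X))" and e: "hd xs = a" "last xs = b"
      then have xs: "xs \<in> walks X" by simp
      have i: "inn (GT (GT X)) xs \<in> Ar V" "Cod V (inn (GT (GT X)) xs) = edge (\<Gamma>0 (GT (GT X))) (a, b)"
        using inn_typed[OF GT_vgraph[OF GX], of xs] xs e by simp_all
      show "(vmor (l X) (a, b) \<bullet> vmor (Gamma_arr V E (m_mult (G_monad T) X)) (a, b)) \<bullet> inn (GT (GT X)) xs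
        = (\<mu> (edge (\<Gamma>0 X) (a, b)) \<bullet> T1 (vmor (l X) (a, b)) \<bullet> vmor (l (GT X)) (a, b)) \<bullet> inn (GT (GT X)) xs"
        using multT_left[OF X xs] multT_right[OF X xs] tau_mu[OF edges_ob[OF X xs]] h lv i o ab
        unfolding e by (simp add: hom_iff e del: G_simps)
    qed (use ab in simp_all)
  qed
  show ?thesis unfolding componentwise_def using nat X by blast
qed

end

section \<open>Distributive laws from \<tau>\<close>

context enriched
begin

lemma dist_law_of_props:
  assumes d: "\<tau> \<in> monoidal_monad_data V E T"
  shows "corresponding V E T small (dist_law_of small V E T \<tau>) \<tau>"
proof -
  interpret monoidal_monad V E T \<tau> by (rule monoidalI[OF d])
  let ?l = "dist_law_of small V E T \<tau>"
  have v: "G_obj T X \<in> vgraphs small V" "G_obj T (\<Gamma>0 X) \<in> vgraphs small V" if "X \<in> vgraphs small V" for X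
    using G_obj_vgraphs[OF T.unit.G.cat_functor_axioms that]
      G_obj_vgraphs[OF T.unit.G.cat_functor_axioms Gamma_vgraph[OF that]] by simp_all
  have s: "vsrc (?l X) = \<Gamma>0 (G_obj T X)" "vtgt (?l X) = G_obj T (\<Gamma>0 X)" "vfun (?l X) = (\<lambda>a\<in>verts X. a)"
    "vmor (?l X) = (\<lambda>p\<in>vpairs X. Gamma_copair V E (G_obj T X) p (edge (G_obj T (\<Gamma>0 X)) p)
       (\<lambda>xs. T1 (inn X xs) \<bullet> \<tau> (walk_edges X xs)))" if "X \<in> vgraphs small V" for X
    using that by (simp_all add: dist_law_of_def)
  have P: "vmor (?l X) (a, b) \<in> hom V (edge (\<Gamma>0 (G_obj T X)) (a, b)) (T0 (edge (\<Gamma>0 X) (a, b)))"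
    "\<And>xs. xs \<in> walks X \<Longrightarrow> hd xs = a \<Longrightarrow> last xs = b \<Longrightarrow>
       vmor (?l X) (a, b) \<bullet> inn (G_obj T X) xs = T1 (inn X xs) \<bullet> \<tau> (walk_edges X xs)"
    if X: "X \<in> vgraphs small V" and ab: "a \<in> verts X" "b \<in> verts X" for X a b
  proof -
    have "T0 (edge (\<Gamma>0 X) (a, b)) \<in> Ob V"
      using vgraphs_edge[OF Gamma_vgraph[OF X], of a b] ab by simp
    moreover have "T1 (inn X xs) \<bullet> \<tau> (walk_edges X xs) \<in> hom V (E0 (walk_edges (G_obj T X) xs)) (T0 (edge (\<Gamma>0 X) (a, b)))"
      if xs: "xs \<in> walks X" "hd xs = a" "last xs = b" for xs
      using inn_typed[OF X xs(1)] walk_edges_ob[OF X xs(1)] xs by (simp add: hom_iff walk_edges_G_obj)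
    ultimately show "vmor (?l X) (a, b) \<in> hom V (edge (\<Gamma>0 (G_obj T X)) (a, b)) (T0 (edge (\<Gamma>0 X) (a, b)))"
      "\<And>xs. xs \<in> walks X \<Longrightarrow> hd xs = a \<Longrightarrow> last xs = b \<Longrightarrow>
       vmor (?l X) (a, b) \<bullet> inn (G_obj T X) xs = T1 (inn X xs) \<bullet> \<tau> (walk_edges X xs)"
      using Gamma_copair_props[OF v(1)[OF X], of a b] ab by (simp_all add: s[OF X])
  qed
  show ?thesis
  proof (intro corresponding.intro object_family.intro object_family_axioms.intro corresponding_axioms.intro enriched_axioms)
    fix X :: "('a, 'o) vgraph" assume X: "X \<in> vgraphs small V"
    show "?l X \<in> Ar (GV small V)"
    proof (rule GV_arI)
      fix a b assume "a \<in> verts (vsrc (?l X))" "b \<in> verts (vsrc (?l X))"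
      then show "vmor (?l X) (a, b) \<in> hom V (edge (vsrc (?l X)) (a, b)) (edge (vtgt (?l X)) (vfun (?l X) a, vfun (?l X) b))"
        using P(1)[OF X, of a b] by (simp add: s[OF X])
    qed (use v[OF X] X in \<open>auto simp: s\<close>)
  next
    fix X :: "('a, 'o) vgraph" and xs assume X: "X \<in> vgraphs small V" and xs: "xs \<in> walks X"
    show "vmor (?l X) (hd xs, last xs) \<bullet> inn (G_obj T X) xs = T1 (inn X xs) \<bullet> \<tau> (walk_edges X xs)"
      by (rule P(2)[OF X walk_ends(1)[OF xs] walk_ends(2)[OF xs] xs refl refl])
  next
    fix fs assume f: "\<forall>f\<in>set fs. f \<in> Ar V"
    show "\<tau> (map (Cod V) fs) \<bullet> E1 (map T1 fs) = T1 (E1 fs) \<bullet> \<tau> (map (Dom V) fs)"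
      using tau_natural[of fs "\<lambda>f. f" "Dom V" "Cod V"] f by simp
  qed (auto simp: s hom_iff)
qed

lemma dist_law_of_in_data:
  assumes d: "\<tau> \<in> monoidal_monad_data V E T"
  shows "dist_law_of small V E T \<tau> \<in> dist_law_data small V E T"
proof -
  interpret monoidal_monad V E T \<tau> by (rule monoidalI[OF d])
  interpret L: corresponding V E T small "dist_law_of small V E T \<tau>" \<tau> by (rule dist_law_of_props[OF d])
  have "L.componentwise"
    by (rule L.componentwiseI) (fact tau_unit tau_subst tau_eta tau_mu)+
  then show ?thesis
    unfolding dist_law_data_def using L.distributive_law_iff L.l_fun by (simp add: dist_law_of_def)
qed

end

section \<open>Linear graphs and maps out of them\<close>

context enriched
begin

lemma consecutive_walk:
  "ws \<noteq> [] \<Longrightarrow> hd ws = vx k \<Longrightarrow> \<forall>p\<in>set (steps ws). \<exists>i. p = (vx i, vx (Suc i)) \<Longrightarrow>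
    ws = map vx [k..<k + length ws]"
proof (induction ws arbitrary: k rule: induct_list012)
  case (3 a b ws)
  then have "b = vx (Suc k)" by auto
  then have "b # ws = map vx [Suc k..<Suc k + length (b # ws)]"
    by (intro 3(2)) (use 3(5) in auto)
  moreover have "[k..<k + length (a # b # ws)] = k # [Suc k..<Suc k + length (b # ws)]"
    by (simp add: upt_conv_Cons del: upt_Suc)
  ultimately show ?case using 3(4) by (simp only: list.map list.sel)
qed simp_all

definition lineG :: "'o list \<Rightarrow> ('a, 'o) vgraph" where
  "lineG Xs = \<lparr>verts = vx ` {..length Xs}, edge = (\<lambda>p\<in>vx ` {..length Xs} \<times> vx ` {..length Xs}.
     if ix (snd p) = Suc (ix (fst p)) then Xs ! ix (fst p) else zero)\<rparr>"

lemma lineG_verts: "verts (lineG Xs) = vx ` {..length Xs}"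
  by (simp add: lineG_def)

lemma lineG_edge: "a \<in> verts (lineG Xs) \<Longrightarrow> b \<in> verts (lineG Xs) \<Longrightarrow>
    edge (lineG Xs) (a, b) = (if ix b = Suc (ix a) then Xs ! ix a else zero)"
  by (simp add: lineG_def)

lemma line_walk: "path (length Xs) \<in> walks (lineG Xs)"
  by (auto simp: walks_simps path_def lineG_verts simp del: upt_Suc)

lemma line_ends [simp]: "vx 0 \<in> verts (lineG Xs)" "vx (length Xs) \<in> verts (lineG Xs)"
  by (auto simp: lineG_verts)

lemma line_edges [simp]: "walk_edges (lineG Xs) (path (length Xs)) = Xs"
  by (intro nth_equalityI) (auto simp: walk_edges_def steps_path lineG_def)

text \<open>A walk from 0 to n whose steps all lead from some i to i + 1 is the full path. Any other
  walk takes a step of another kind, for instance a loop, and its hom is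
  \<open>zero\<close>.\<close>

lemma line_walk_initial:
  assumes ws: "ws \<in> walks (lineG Xs)" "hd ws = vx 0" "last ws = vx (length Xs)" and ne: "ws \<noteq> path (length Xs)"
  shows "zero \<in> set (walk_edges (lineG Xs) ws)"
proof (rule ccontr)
  assume z: "zero \<notin> set (walk_edges (lineG Xs) ws)"
  have "\<exists>i. p = (vx i, vx (Suc i))" if p: "p \<in> set (steps ws)" for p
  proof -
    obtain a b where ab: "p = (a, b)" by (cases p)
    have v: "a \<in> verts (lineG Xs)" "b \<in> verts (lineG Xs)" using steps_walk[OF ws(1)] p ab by auto
    have "edge (lineG Xs) (a, b) \<noteq> zero" using z p ab by (force simp: walk_edges_def)
    then have "ix b = Suc (ix a)" using lineG_edge[OF v] by presburger
    then show ?thesis using v ab by (auto simp: lineG_verts)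
  qed
  moreover have w: "ws \<noteq> []" using ws(1) by (simp add: walks_simps)
  ultimately have e: "ws = map vx [0..<length ws]"
    using consecutive_walk[OF w ws(2)] by simp
  then have "last ws = last (map vx [0..<length ws])" by simp
  then have "last ws = vx (length ws - 1)" using w by (simp add: last_map)
  with ws(3) have "length ws - 1 = length Xs" by simp
  with w have "length ws = Suc (length Xs)" by (cases ws) simp_all
  with e ne show False by (simp add: path_def)
qed

definition retr :: "'o list \<Rightarrow> 'm" where
  "retr Xs = Gamma_copair V E (lineG Xs) (vx 0, vx (length Xs)) (E0 Xs)
     (\<lambda>ws. if ws = path (length Xs) then Id V (E0 Xs) else ini (E0 (walk_edges (lineG Xs) ws)) (E0 Xs))"

context
  fixes Xs :: "'o list"
  assumes Xs [simp]: "\<forall>X\<in>set Xs. X \<in> Ob V"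
begin

lemma lineG_vgraph [simp]: "lineG Xs \<in> vgraphs small V"
  unfolding vgraphs_def by (auto simp: lineG_def intro!: small_finite)

lemma line_initial:
  assumes "ws \<in> walks (lineG Xs)" "hd ws = vx 0" "last ws = vx (length Xs)" "ws \<noteq> path (length Xs)"
  shows "initial (E0 (walk_edges (lineG Xs) ws))"
  by (rule tensor_initial[OF line_walk_initial[OF assms] initial_zero walk_edges_ob[OF lineG_vgraph assms(1)]])

lemma line_inn:
  "inn (lineG Xs) (path (length Xs)) \<in> Ar V" "Dom V (inn (lineG Xs) (path (length Xs))) = E0 Xs"
  "Cod V (inn (lineG Xs) (path (length Xs))) = edge (\<Gamma>0 (lineG Xs)) (vx 0, vx (length Xs))"
  using inn_typed[OF lineG_vgraph line_walk] by simp_all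

lemma retr_props:
  "retr Xs \<in> Ar V" "Dom V (retr Xs) = edge (\<Gamma>0 (lineG Xs)) (vx 0, vx (length Xs))" "Cod V (retr Xs) = E0 Xs"
  "retr Xs \<bullet> inn (lineG Xs) (path (length Xs)) = Id V (E0 Xs)"
  "inn (lineG Xs) (path (length Xs)) \<bullet> retr Xs = Id V (edge (\<Gamma>0 (lineG Xs)) (vx 0, vx (length Xs)))"
proof -
  let ?p = "path (length Xs)"
  let ?g = "\<lambda>ws. if ws = ?p then Id V (E0 Xs) else ini (E0 (walk_edges (lineG Xs) ws)) (E0 Xs)"
  have g: "?g ws \<in> hom V (E0 (walk_edges (lineG Xs) ws)) (E0 Xs)"
    if "ws \<in> walks (lineG Xs)" "hd ws = vx 0" "last ws = vx (length Xs)" for ws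
    using ini_hom[OF line_initial[OF that], of "E0 Xs"] by (simp add: hom_iff)
  have o: "E0 Xs \<in> Ob V" by simp
  have P: "retr Xs \<in> hom V (edge (\<Gamma>0 (lineG Xs)) (vx 0, vx (length Xs))) (E0 Xs)"
    "retr Xs \<bullet> inn (lineG Xs) ?p = ?g ?p"
    unfolding retr_def by (rule Gamma_copair_props[OF lineG_vgraph line_ends o], rule g, assumption+)+
      (simp_all add: line_walk)
  show r: "retr Xs \<in> Ar V" "Dom V (retr Xs) = edge (\<Gamma>0 (lineG Xs)) (vx 0, vx (length Xs))" "Cod V (retr Xs) = E0 Xs"
    using P(1) by (auto simp: hom_iff)
  show s: "retr Xs \<bullet> inn (lineG Xs) ?p = Id V (E0 Xs)"
    using P(2) by simp
  have e: "edge (\<Gamma>0 (lineG Xs)) (vx 0, vx (length Xs)) \<in> Ob V"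
    using vgraphs_edge[OF Gamma_vgraph[OF lineG_vgraph]] by simp
  show "inn (lineG Xs) ?p \<bullet> retr Xs = Id V (edge (\<Gamma>0 (lineG Xs)) (vx 0, vx (length Xs)))"
  proof (rule inn_epi[OF lineG_vgraph line_ends])
    fix ws assume ws: "ws \<in> walks (lineG Xs)" "hd ws = vx 0" "last ws = vx (length Xs)"
    show "(inn (lineG Xs) ?p \<bullet> retr Xs) \<bullet> inn (lineG Xs) ws
      = Id V (edge (\<Gamma>0 (lineG Xs)) (vx 0, vx (length Xs))) \<bullet> inn (lineG Xs) ws"
    proof (cases "ws = ?p")
      case True
      then show ?thesis using s r line_inn by simp
    next
      case False
      show ?thesis
        by (rule initial_eq[OF line_initial[OF ws False]])
          (use inn_typed[OF lineG_vgraph ws(1)] ws r line_inn e in simp_all)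
    qed
  qed (use r line_inn e in \<open>simp_all add: hom_iff\<close>)
qed

text \<open>T of the injection has T of \<open>retr\<close> as a left inverse. Equations about
  \<tau> can thus be checked after this injection, where they become laws of l at a linear
  graph.\<close>

lemma line_cancel:
  assumes "T1 (inn (lineG Xs) (path (length Xs))) \<bullet> f = T1 (inn (lineG Xs) (path (length Xs))) \<bullet> g"
    and "f \<in> Ar V" "g \<in> Ar V" "Cod V f = T0 (E0 Xs)" "Cod V g = T0 (E0 Xs)"
  shows "f = g"
proof -
  have "T1 (retr Xs) \<bullet> T1 (inn (lineG Xs) (path (length Xs))) = Id V (T0 (E0 Xs))"
    using arg_cong[OF retr_props(4), of T1] retr_props(1-3) line_inn by (simp add: T.T.arr_comp)
  from this[THEN reassoc] have "T1 (retr Xs) \<bullet> T1 (inn (lineG Xs) (path (length Xs))) \<bullet> h = h"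
    if "h \<in> Ar V" "Cod V h = T0 (E0 Xs)" for h
    using that retr_props(1-3) line_inn by simp
  from this[OF assms(2,4)] this[OF assms(3,5)] show ?thesis
    unfolding assms(1) by simp
qed

end

text \<open>The counterpart of \<open>ext\<close> for graphs: X carries no composition, so only the
  neighbouring homs receive the given arrows, and all others start from \<open>zero\<close>.\<close>

definition line_map :: "'o list \<Rightarrow> ('a, 'o) vgraph \<Rightarrow> 'a list \<Rightarrow> 'm list \<Rightarrow> ('a, 'o, 'm) vmap" where
  "line_map Xs X xs gs = \<lparr>vsrc = lineG Xs, vtgt = X, vfun = (\<lambda>a\<in>verts (lineG Xs). xs ! ix a),
     vmor = (\<lambda>p\<in>vpairs (lineG Xs). if ix (snd p) = Suc (ix (fst p)) then gs ! ix (fst p)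
       else ini zero (edge X (xs ! ix (fst p), xs ! ix (snd p))))\<rparr>"

context
  fixes Xs X xs gs
  assumes Xs [simp]: "\<forall>X\<in>set Xs. X \<in> Ob V" and X [simp]: "X \<in> vgraphs small V" and xs [simp]: "xs \<in> walks X"
    and gs: "\<forall>g\<in>set gs. g \<in> Ar V" "map (Dom V) gs = Xs" "map (Cod V) gs = walk_edges X xs"
begin

lemma line_lengths: "length gs = length Xs" "length xs = Suc (length Xs)"
proof -
  show g: "length gs = length Xs" using arg_cong[OF gs(2), of length] by simp
  have "length xs - 1 = length Xs" using arg_cong[OF gs(3), of length] g by (simp add: walk_edges_def length_steps)
  then show "length xs = Suc (length Xs)" using xs by (cases xs) (auto simp: walks_simps)
qed

lemma line_map_simps [simp]:
  "vsrc (line_map Xs X xs gs) = lineG Xs" "vtgt (line_map Xs X xs gs) = X"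
  "map (vfun (line_map Xs X xs gs)) (path (length Xs)) = xs"
  "map (vmor (line_map Xs X xs gs)) (steps (path (length Xs))) = gs"
proof -
  show "map (vfun (line_map Xs X xs gs)) (path (length Xs)) = xs"
    by (rule nth_equalityI) (auto simp: line_map_def path_def line_lengths lineG_verts simp del: upt_Suc)
  show "map (vmor (line_map Xs X xs gs)) (steps (path (length Xs))) = gs"
    by (rule nth_equalityI) (auto simp: line_map_def steps_path line_lengths lineG_verts)
qed (simp_all add: line_map_def)

lemma line_map_ends [simp]:
  "vfun (line_map Xs X xs gs) (vx 0) = hd xs" "vfun (line_map Xs X xs gs) (vx (length Xs)) = last xs"
  using xs line_lengths by (auto simp: line_map_def walks_simps hd_conv_nth last_conv_nth)

lemma line_map_ar: "line_map Xs X xs gs \<in> Ar (GV small V)"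
proof (rule GV_arI)
  have v: "xs ! i \<in> verts X" if "i \<le> length Xs" for i
    using xs that line_lengths by (auto simp: walks_simps)
  show "\<And>a. a \<in> verts (vsrc (line_map Xs X xs gs)) \<Longrightarrow> vfun (line_map Xs X xs gs) a \<in> verts (vtgt (line_map Xs X xs gs))"
    using v by (auto simp: line_map_def lineG_verts)
  fix a b assume "a \<in> verts (vsrc (line_map Xs X xs gs))" "b \<in> verts (vsrc (line_map Xs X xs gs))"
  then have ab: "a \<in> verts (lineG Xs)" "b \<in> verts (lineG Xs)" by simp_all
  then obtain i j where ij: "a = vx i" "b = vx j" "i \<le> length Xs" "j \<le> length Xs" by (auto simp: lineG_verts)
  have m: "vmor (line_map Xs X xs gs) (a, b) = (if j = Suc i then gs ! i else ini zero (edge X (xs ! i, xs ! j)))"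
    using ab ij by (simp add: line_map_def)
  have e: "edge (lineG Xs) (a, b) = (if j = Suc i then Xs ! i else zero)"
    using lineG_edge[OF ab] ij by simp
  have "vmor (line_map Xs X xs gs) (a, b) \<in> hom V (edge (lineG Xs) (a, b)) (edge X (xs ! i, xs ! j))"
  proof (cases "j = Suc i")
    case True
    then have i: "i < length Xs" using ij by simp
    have "Dom V (gs ! i) = Xs ! i" "Cod V (gs ! i) = walk_edges X xs ! i"
      using arg_cong[OF gs(2), of "\<lambda>l. l ! i"] arg_cong[OF gs(3), of "\<lambda>l. l ! i"] i line_lengths by simp_all
    moreover have "walk_edges X xs ! i = edge X (xs ! i, xs ! Suc i)"
      using i line_lengths by (simp add: walk_edges_def steps_def nth_tl)
    ultimately show ?thesis using True i gs(1) line_lengths by (simp add: m e hom_iff)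
  next
    case False
    have "edge X (xs ! i, xs ! j) \<in> Ob V" by (rule vgraphs_edge[OF X v[OF ij(3)] v[OF ij(4)]])
    from ini_hom[OF initial_zero this] show ?thesis unfolding m e using False by simp
  qed
  then show "vmor (line_map Xs X xs gs) (a, b) \<in> hom V (edge (vsrc (line_map Xs X xs gs)) (a, b))
      (edge (vtgt (line_map Xs X xs gs)) (vfun (line_map Xs X xs gs) a, vfun (line_map Xs X xs gs) b))"
    using ab ij by (simp add: line_map_def)
qed (simp_all add: line_map_def)

end

end

section \<open>Reading \<tau> off a distributive law\<close>

locale componentwise_family = object_family V E T small l
  for V :: "('o, 'm) cat" and E and T and small :: "'a set \<Rightarrow> bool" and l +
  assumes componentwise: componentwise
begin

lemma
  shows nat_eq: "f \<in> Ar (GV small V) \<Longrightarrow> a \<in> verts (vsrc f) \<Longrightarrow> b \<in> verts (vsrc f) \<Longrightarrow> nat_eq f a b"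
    and unitS_eq: "X \<in> vgraphs small V \<Longrightarrow> a \<in> verts X \<Longrightarrow> b \<in> verts X \<Longrightarrow> unitS_eq X a b"
    and unitT_eq: "X \<in> vgraphs small V \<Longrightarrow> a \<in> verts X \<Longrightarrow> b \<in> verts X \<Longrightarrow> unitT_eq X a b"
    and multS_eq: "X \<in> vgraphs small V \<Longrightarrow> a \<in> verts X \<Longrightarrow> b \<in> verts X \<Longrightarrow> multS_eq X a b"
    and multT_eq: "X \<in> vgraphs small V \<Longrightarrow> a \<in> verts X \<Longrightarrow> b \<in> verts X \<Longrightarrow> multT_eq X a b"
  using componentwise unfolding componentwise_def by blast+

text \<open>The source is a coproduct over walks of \<open>GT (lineG Xs)\<close>, whose homs
  \<open>T0 zero\<close> need not be initial; so there only the injection of the full path is used.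
  On the target side T is applied to a hom that \<open>retr\<close> identifies with
  \<open>E0 Xs\<close>.\<close>

definition t where
  "t Xs = T1 (retr Xs) \<bullet> vmor (l (lineG Xs)) (vx 0, vx (length Xs)) \<bullet> inn (GT (lineG Xs)) (path (length Xs))"

lemma GT_line_inn:
  assumes Xs: "\<forall>X\<in>set Xs. X \<in> Ob V"
  shows "inn (GT (lineG Xs)) (path (length Xs)) \<in> Ar V" "Dom V (inn (GT (lineG Xs)) (path (length Xs))) = E0 (map T0 Xs)"
    "Cod V (inn (GT (lineG Xs)) (path (length Xs))) = edge (\<Gamma>0 (GT (lineG Xs))) (vx 0, vx (length Xs))"
  using inn_typed[OF GT_vgraph[OF lineG_vgraph[OF Xs]], of "path (length Xs)"] by (simp_all add: line_walk walk_edges_G_obj)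

lemma t_typed:
  assumes Xs: "\<forall>X\<in>set Xs. X \<in> Ob V"
  shows "t Xs \<in> Ar V" "Dom V (t Xs) = E0 (map T0 Xs)" "Cod V (t Xs) = T0 (E0 Xs)"
  unfolding t_def using retr_props(1-3)[OF Xs] l_vmor[OF lineG_vgraph[OF Xs] line_ends] GT_line_inn[OF Xs] by simp_all

text \<open>Holds because the injection and \<open>retr\<close> are inverse to each other; it
  characterizes \<open>t\<close> without mention of \<open>retr\<close>.\<close>

lemma line_corr:
  assumes Xs: "\<forall>X\<in>set Xs. X \<in> Ob V"
  shows "vmor (l (lineG Xs)) (vx 0, vx (length Xs)) \<bullet> inn (GT (lineG Xs)) (path (length Xs))
    = T1 (inn (lineG Xs) (path (length Xs))) \<bullet> t Xs"
proof -
  note R = retr_props[OF Xs] and I = line_inn[OF Xs] and L = l_vmor[OF lineG_vgraph[OF Xs] line_ends] and G = GT_line_inn[OF Xs]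
  have "T1 (inn (lineG Xs) (path (length Xs))) \<bullet> T1 (retr Xs) = Id V (T0 (edge (\<Gamma>0 (lineG Xs)) (vx 0, vx (length Xs))))"
    using arg_cong[OF R(5), of T1] R(1-3) I vgraphs_edge[OF Gamma_vgraph[OF lineG_vgraph[OF Xs]]] by (simp add: T.T.arr_comp)
  from this[THEN reassoc] show ?thesis
    unfolding t_def using R(1-3) I L G by simp
qed

text \<open>Naturality of l along the map out of the linear graph carries \<open>line_corr\<close>
  to the walk \<open>xs\<close>. With identities for \<open>gs\<close> this yields the
  correspondence on X, and for a linear graph in place of X it yields naturality of
  \<open>t\<close>.\<close>

lemma graph_corr:
  assumes X: "X \<in> vgraphs small V" and xs: "xs \<in> walks X"
    and gs: "\<forall>g\<in>set gs. g \<in> Ar V" "map (Cod V) gs = walk_edges X xs"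
  shows "vmor (l X) (hd xs, last xs) \<bullet> inn (GT X) xs \<bullet> E1 (map T1 gs) = T1 (inn X xs) \<bullet> T1 (E1 gs) \<bullet> t (map (Dom V) gs)"
proof -
  define Xs where "Xs = map (Dom V) gs"
  have Xs: "\<forall>X\<in>set Xs. X \<in> Ob V" using gs by (auto simp: Xs_def)
  note lm = Xs X xs gs(1) Xs_def[symmetric] gs(2)
  define f where "f = line_map Xs X xs gs"
  let ?p = "path (length Xs)"
  have f: "f \<in> Ar (GV small V)" "vsrc f = lineG Xs" "vtgt f = X" "map (vfun f) ?p = xs"
    "map (vmor f) (steps ?p) = gs" "vfun f (vx 0) = hd xs" "vfun f (vx (length Xs)) = last xs"
    unfolding f_def by (rule line_map_ar[OF lm] line_map_simps[OF lm] line_map_ends[OF lm])+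
  have p: "?p \<in> walks (lineG Xs)" by (rule line_walk)
  have m: "map (\<lambda>p. T1 (vmor f p)) (steps ?p) = map T1 gs" unfolding f(5)[symmetric] by simp
  note A = Gamma_arr_GT[OF f(1-3) p, unfolded m f path_props]
  note B = Gamma_arr_typed[OF f(1), unfolded f(2,3), OF p, unfolded f path_props]
  have C: "vmor (Gamma_arr V E f) (vx 0, vx (length Xs)) \<bullet> inn (lineG Xs) ?p = inn X xs \<bullet> E1 gs"
    using Gamma_arr_in[OF f(1), unfolded f(2,3), OF p] unfolding f path_props .
  note I = line_inn[OF Xs] and L = l_vmor[OF lineG_vgraph[OF Xs] line_ends] and G = GT_line_inn[OF Xs] and t = t_typed[OF Xs]
  note LX = l_vmor[OF X walk_ends(1)[OF xs] walk_ends(2)[OF xs]]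
  have E: "E1 gs \<in> Ar V" "Dom V (E1 gs) = E0 Xs" "Cod V (E1 gs) = E0 (walk_edges X xs)"
    using gs unfolding Xs_def by simp_all
  have N: "vmor (l X) (hd xs, last xs) \<bullet> vmor (Gamma_arr V E (farr (G_func T) f)) (vx 0, vx (length Xs))
    = T1 (vmor (Gamma_arr V E f) (vx 0, vx (length Xs))) \<bullet> vmor (l (lineG Xs)) (vx 0, vx (length Xs))"
    using nat_eq[OF f(1), of "vx 0" "vx (length Xs)"] unfolding nat_eq_def f by simp
  have "vmor (l X) (hd xs, last xs) \<bullet> inn (GT X) xs \<bullet> E1 (map T1 gs)
    = (vmor (l X) (hd xs, last xs) \<bullet> vmor (Gamma_arr V E (farr (G_func T) f)) (vx 0, vx (length Xs))) \<bullet> inn (GT (lineG Xs)) ?p"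
    using A(1-3) LX G unfolding A(4)[symmetric] by simp
  also have "\<dots> = T1 (vmor (Gamma_arr V E f) (vx 0, vx (length Xs))) \<bullet> T1 (inn (lineG Xs) ?p) \<bullet> t Xs"
    unfolding N using L G B line_corr[OF Xs] by simp
  also have "\<dots> = T1 (vmor (Gamma_arr V E f) (vx 0, vx (length Xs)) \<bullet> inn (lineG Xs) ?p) \<bullet> t Xs"
    using B I t by (simp add: T.T.arr_comp)
  also have "\<dots> = T1 (inn X xs) \<bullet> T1 (E1 gs) \<bullet> t Xs"
    unfolding C using E inn_typed[OF X xs] t by (simp add: T.T.arr_comp)
  finally show ?thesis unfolding Xs_def .
qed

lemma corr_t:
  assumes X: "X \<in> vgraphs small V" and xs: "xs \<in> walks X"
  shows "vmor (l X) (hd xs, last xs) \<bullet> inn (GT X) xs = T1 (inn X xs) \<bullet> t (walk_edges X xs)"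
proof -
  note o = walk_edges_ob[OF X xs]
  have i: "inn (GT X) xs \<in> Ar V" "Dom V (inn (GT X) xs) = E0 (map T0 (walk_edges X xs))"
    using inn_typed[OF GT_vgraph[OF X], of xs] xs by (simp_all add: walk_edges_G_obj)
  have m: "map (Cod V) (map (Id V) (walk_edges X xs)) = walk_edges X xs" "map (Dom V) (map (Id V) (walk_edges X xs)) = walk_edges X xs"
    using o by (simp_all add: map_idI)
  have E: "E1 (map T1 (map (Id V) (walk_edges X xs))) = Id V (E0 (map T0 (walk_edges X xs)))"
    "E1 (map (Id V) (walk_edges X xs)) = Id V (E0 (walk_edges X xs))"
    using o E.arr_id[of "map T0 (walk_edges X xs)"] E.arr_id[of "walk_edges X xs"] by (simp_all)
  show ?thesis
    using graph_corr[OF X xs _ m(1)] inn_typed[OF X xs] i o t_typed[OF o] unfolding m(2) E by simp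
qed

lemma corresponding_t: "corresponding V E T small l t"
proof (intro corresponding.intro object_family_axioms corresponding_axioms.intro)
  fix Xs assume "\<forall>X\<in>set Xs. X \<in> Ob V"
  then show "t Xs \<in> hom V (E0 (map T0 Xs)) (T0 (E0 Xs))"
    using t_typed[of Xs] by (simp add: hom_iff)
next
  fix fs assume f: "\<forall>f\<in>set fs. f \<in> Ar V"
  let ?Ys = "map (Cod V) fs"
  have Ys: "\<forall>X\<in>set ?Ys. X \<in> Ob V" and Xs: "\<forall>X\<in>set (map (Dom V) fs). X \<in> Ob V" using f by auto
  note I = line_inn[OF Ys] and G = GT_line_inn[OF Ys] and L = l_vmor[OF lineG_vgraph[OF Ys] line_ends]
  have 1: "vmor (l (lineG ?Ys)) (vx 0, vx (length ?Ys)) \<bullet> inn (GT (lineG ?Ys)) (path (length ?Ys)) \<bullet> E1 (map T1 fs)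
    = T1 (inn (lineG ?Ys) (path (length ?Ys))) \<bullet> T1 (E1 fs) \<bullet> t (map (Dom V) fs)"
    using graph_corr[OF lineG_vgraph[OF Ys] line_walk[of ?Ys] f] by (simp del: length_map)
  have E: "E1 (map T1 fs) \<in> Ar V" "Cod V (E1 (map T1 fs)) = E0 (map T0 ?Ys)" "E1 fs \<in> Ar V" "Cod V (E1 fs) = E0 ?Ys"
    "Dom V (E1 fs) = E0 (map (Dom V) fs)"
    using f by simp_all
  show "t ?Ys \<bullet> E1 (map T1 fs) = T1 (E1 fs) \<bullet> t (map (Dom V) fs)"
  proof (rule line_cancel[OF Ys])
    show "T1 (inn (lineG ?Ys) (path (length ?Ys))) \<bullet> t ?Ys \<bullet> E1 (map T1 fs)
      = T1 (inn (lineG ?Ys) (path (length ?Ys))) \<bullet> T1 (E1 fs) \<bullet> t (map (Dom V) fs)"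
      unfolding 1[symmetric] using line_corr[OF Ys, THEN reassoc, of "E1 (map T1 fs)"] I G L t_typed[OF Ys] E
      by (simp del: length_map)
  qed (use t_typed[OF Ys] t_typed[OF Xs] E in simp_all)
next
  fix X :: "('a, 'o) vgraph" and xs assume "X \<in> vgraphs small V" "xs \<in> walks X"
  then show "vmor (l X) (hd xs, last xs) \<bullet> inn (GT X) xs = T1 (inn X xs) \<bullet> t (walk_edges X xs)"
    by (rule corr_t)
qed

sublocale C: corresponding V E T small l t
  by (rule corresponding_t)

end

context componentwise_family
begin

context
  fixes Xs
  assumes Xs: "\<forall>X\<in>set Xs. X \<in> Ob V"
begin

lemmas line = lineG_vgraph[OF Xs] line_walk[of Xs]

lemma line_Gamma_ob: "edge (\<Gamma>0 (lineG Xs)) (vx 0, vx (length Xs)) \<in> Ob V"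
  using vgraphs_edge[OF Gamma_vgraph[OF line(1)]] by simp

text \<open>The law of l at the linear graph, evaluated on the full path, after which the injection
  is cancelled. The other laws of \<open>t\<close> are obtained in the same way.\<close>

lemma t_eta: "t Xs \<bullet> E1 (map \<eta> Xs) = \<eta> (E0 Xs)"
proof (rule line_cancel[OF Xs])
  interpret G: monad "GV small V" "G_monad T" by (rule monad_G[OF T.monad_axioms])
  note I = line_inn[OF Xs]
  have f: "m_unit (G_monad T) (lineG Xs) \<in> Ar (GV small V)" "vsrc (m_unit (G_monad T) (lineG Xs)) = lineG Xs"
    "vtgt (m_unit (G_monad T) (lineG Xs)) = GT (lineG Xs)"
    using G.unit_typed[of "lineG Xs"] line(1) vgraphs_extensional[OF line(1)] by simp_all
  have v: "vfun (m_unit (G_monad T) (lineG Xs)) = (\<lambda>a\<in>verts (lineG Xs). a)" by simp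
  have h: "vmor (Gamma_arr V E (m_unit (G_monad T) (lineG Xs))) (vx 0, vx (length Xs))
     \<in> hom V (edge (\<Gamma>0 (lineG Xs)) (vx 0, vx (length Xs))) (edge (\<Gamma>0 (GT (lineG Xs))) (vx 0, vx (length Xs)))"
    using Gamma_arr_hom(1)[OF f(1), of "vx 0" "vx (length Xs)"] line_ends[of Xs] unfolding f v by simp
  note L = l_vmor[OF line(1) line_ends]
  have "T1 (inn (lineG Xs) (path (length Xs))) \<bullet> t Xs \<bullet> E1 (map \<eta> Xs)
    = (vmor (l (lineG Xs)) (vx 0, vx (length Xs)) \<bullet> vmor (Gamma_arr V E (m_unit (G_monad T) (lineG Xs))) (vx 0, vx (length Xs)))
      \<bullet> inn (lineG Xs) (path (length Xs))"
    using C.unitT_left[OF line] h L I by (simp add: hom_iff del: G_simps)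
  then show "T1 (inn (lineG Xs) (path (length Xs))) \<bullet> t Xs \<bullet> E1 (map \<eta> Xs) = T1 (inn (lineG Xs) (path (length Xs))) \<bullet> \<eta> (E0 Xs)"
    using C.unitT_right[OF line] unitT_eq[OF line(1) line_ends, unfolded unitT_eq_def] by (simp del: G_simps)
qed (use t_typed[OF Xs] Xs in simp_all)

lemma t_mu: "t Xs \<bullet> E1 (map \<mu> Xs) = \<mu> (E0 Xs) \<bullet> T1 (t Xs) \<bullet> t (map T0 Xs)"
proof (rule line_cancel[OF Xs])
  interpret G: monad "GV small V" "G_monad T" by (rule monad_G[OF T.monad_axioms])
  have o: "\<forall>X\<in>set (map T0 Xs). X \<in> Ob V" using Xs by simp
  note I = line_inn[OF Xs]
  have f: "m_mult (G_monad T) (lineG Xs) \<in> Ar (GV small V)" "vsrc (m_mult (G_monad T) (lineG Xs)) = GT (GT (lineG Xs))"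
    "vtgt (m_mult (G_monad T) (lineG Xs)) = GT (lineG Xs)"
    using G.mult_typed[of "lineG Xs"] line(1) by simp_all
  have v: "vfun (m_mult (G_monad T) (lineG Xs)) = (\<lambda>a\<in>verts (lineG Xs). a)" by simp
  have h: "vmor (Gamma_arr V E (m_mult (G_monad T) (lineG Xs))) (vx 0, vx (length Xs))
     \<in> hom V (edge (\<Gamma>0 (GT (GT (lineG Xs)))) (vx 0, vx (length Xs))) (edge (\<Gamma>0 (GT (lineG Xs))) (vx 0, vx (length Xs)))"
    using Gamma_arr_hom(1)[OF f(1), of "vx 0" "vx (length Xs)"] line_ends[of Xs] unfolding f v by simp
  have e: "vx 0 \<in> verts (GT (lineG Xs))" "vx (length Xs) \<in> verts (GT (lineG Xs))" using line_ends[of Xs] by simp_all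
  note L = l_vmor[OF line(1) line_ends] l_vmor[OF GT_vgraph[OF line(1)] e]
  have i: "inn (GT (GT (lineG Xs))) (path (length Xs)) \<in> Ar V"
    "Cod V (inn (GT (GT (lineG Xs))) (path (length Xs))) = edge (\<Gamma>0 (GT (GT (lineG Xs)))) (vx 0, vx (length Xs))"
    using inn_typed[OF GT_vgraph[OF GT_vgraph[OF line(1)]], of "path (length Xs)"] line(2) by simp_all
  have "T1 (inn (lineG Xs) (path (length Xs))) \<bullet> t Xs \<bullet> E1 (map \<mu> Xs)
    = (vmor (l (lineG Xs)) (vx 0, vx (length Xs)) \<bullet> vmor (Gamma_arr V E (m_mult (G_monad T) (lineG Xs))) (vx 0, vx (length Xs)))
      \<bullet> inn (GT (GT (lineG Xs))) (path (length Xs))"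
    using C.multT_left[OF line] h L i by (simp add: hom_iff del: G_simps)
  also have "\<dots> = T1 (inn (lineG Xs) (path (length Xs))) \<bullet> \<mu> (E0 Xs) \<bullet> T1 (t Xs) \<bullet> t (map T0 Xs)"
    unfolding multT_eq[OF line(1) line_ends, unfolded multT_eq_def]
    using C.multT_right[OF line] L i line_Gamma_ob by simp
  finally show "T1 (inn (lineG Xs) (path (length Xs))) \<bullet> t Xs \<bullet> E1 (map \<mu> Xs)
    = T1 (inn (lineG Xs) (path (length Xs))) \<bullet> \<mu> (E0 Xs) \<bullet> T1 (t Xs) \<bullet> t (map T0 Xs)" .
qed (use t_typed[OF Xs] t_typed[of "map T0 Xs"] Xs in simp_all)

end

lemma t_unit:
  assumes A: "A \<in> Ob V"
  shows "t [A] \<bullet> u (T0 A) = T1 (u A)"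
proof -
  have Xs: "\<forall>X\<in>set [A]. X \<in> Ob V" using A by simp
  have p: "path (length [A]) = [vx 0, vx (length [A])]" by (simp add: path_def)
  note w = lineG_vgraph[OF Xs] line_walk[of "[A]"]
  have e: "edge (lineG [A]) (vx 0, vx (length [A])) = A" using lineG_edge[OF line_ends, of "[A]"] by simp
  note I = line_inn[OF Xs, unfolded p] and G = GT_line_inn[OF Xs, unfolded p] and L = l_vmor[OF w(1) line_ends]
  have 1: "vmor (l (lineG [A])) (vx 0, vx (length [A])) \<bullet> inn (GT (lineG [A])) [vx 0, vx (length [A])] \<bullet> u (T0 A)
    = T1 (inn (lineG [A]) [vx 0, vx (length [A])] \<bullet> u A)"
    using unitS_eq[OF w(1) line_ends, unfolded unitS_eq_def e] .
  show ?thesis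
  proof (rule line_cancel[OF Xs, unfolded p])
    show "T1 (inn (lineG [A]) [vx 0, vx (length [A])]) \<bullet> t [A] \<bullet> u (T0 A) = T1 (inn (lineG [A]) [vx 0, vx (length [A])]) \<bullet> T1 (u A)"
      using 1 line_corr[OF Xs, unfolded p, THEN reassoc, of "u (T0 A)"] I G L t_typed[OF Xs] A
      by (simp add: T.T.arr_comp del: list.size)
  qed (use t_typed[OF Xs] A in simp_all)
qed

text \<open>Cutting the full path into pieces of the lengths of the members of \<open>Xss\<close>
  realizes \<open>Xss\<close> as the edges of a nested walk. There the law for the multiplication of
  \<Gamma>E is evaluated.\<close>

lemma t_subst:
  assumes Xss: "\<forall>Xs\<in>set Xss. \<forall>X\<in>set Xs. X \<in> Ob V"
  shows "t (concat Xss) \<bullet> \<sigma> (map (map T0) Xss) = T1 (\<sigma> Xss) \<bullet> t (map E0 Xss) \<bullet> E1 (map t Xss)"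
proof -
  let ?X = "concat Xss"
  let ?P = "lineG ?X"
  have X: "\<forall>X\<in>set ?X. X \<in> Ob V" using Xss by auto
  note w = lineG_vgraph[OF X] line_walk[of ?X]
  have "length (path (length ?X)) = Suc (sum_list (map length Xss))" by (simp add: length_concat)
  then obtain ws yss where n: "nested_walk ?P ws yss" and j: "join_walk ws yss = path (length ?X)"
    and len: "map length yss = map Suc (map length Xss)"
    using split_walk[OF w(2)] by blast
  note N = nested_walkD[OF n]
  have W: "map (walk_edges ?P) yss = Xss"
  proof (rule concat_lengths_eq)
    show "map length (map (walk_edges ?P) yss) = map length Xss"
      using arg_cong[OF len, of "map (\<lambda>n. n - 1)"] by (simp add: walk_edges_def length_steps o_def)
    show "concat (map (walk_edges ?P) yss) = concat Xss"
      using N(6) j line_edges[of ?X] by simp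
  qed
  have e: "hd ws = vx 0" "last ws = vx (length ?X)" using N(4,5) unfolding j by simp_all
  have n': "nested_walk (GT ?P) ws yss" using n by simp
  have v: "vx 0 \<in> verts (GT ?P)" "vx (length ?X) \<in> verts (GT ?P)" using line_ends[of ?X] by simp_all
  have M: "vmor (Gamma_mult V E (GT ?P)) (vx 0, vx (length ?X)) \<in> hom V (edge (\<Gamma>0 (\<Gamma>0 (GT ?P))) (vx 0, vx (length ?X))) (edge (\<Gamma>0 (GT ?P)) (vx 0, vx (length ?X)))"
    "vmor (Gamma_mult V E ?P) (vx 0, vx (length ?X)) \<in> hom V (edge (\<Gamma>0 (\<Gamma>0 ?P)) (vx 0, vx (length ?X))) (edge (\<Gamma>0 ?P) (vx 0, vx (length ?X)))"
    using Gamma_mult_props(1)[OF GT_vgraph[OF w(1)] v] Gamma_mult_props(1)[OF w(1) line_ends] .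
  have K: "vmor (Gamma_arr V E (l ?P)) (vx 0, vx (length ?X)) \<in> hom V (edge (\<Gamma>0 (\<Gamma>0 (GT ?P))) (vx 0, vx (length ?X))) (edge (\<Gamma>0 (GT (\<Gamma>0 ?P))) (vx 0, vx (length ?X)))"
    using Gamma_arr_hom(1)[OF l_ar[OF w(1)], of "vx 0" "vx (length ?X)"] v by (simp add: l_src[OF w(1)] l_tgt[OF w(1)] l_fun[OF w(1)])
  have vG: "vx 0 \<in> verts (\<Gamma>0 ?P)" "vx (length ?X) \<in> verts (\<Gamma>0 ?P)" using line_ends[of ?X] by simp_all
  note L = l_vmor[OF w(1) line_ends] l_vmor[OF Gamma_vgraph[OF w(1)] vG]
  have I: "inn (\<Gamma>0 (GT ?P)) ws \<in> Ar V" "Dom V (inn (\<Gamma>0 (GT ?P)) ws) = E0 (walk_edges (\<Gamma>0 (GT ?P)) ws)"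
    "Cod V (inn (\<Gamma>0 (GT ?P)) ws) = edge (\<Gamma>0 (\<Gamma>0 (GT ?P))) (vx 0, vx (length ?X))"
    using inn_typed[OF Gamma_vgraph[OF GT_vgraph[OF w(1)]], of ws] N(1) e by simp_all
  note J = inn_nested_typed[OF GT_vgraph[OF w(1)] n']
  have S: "\<sigma> (map (map T0) Xss) \<in> Ar V" "Cod V (\<sigma> (map (map T0) Xss)) = E0 (map T0 ?X)"
    "\<sigma> Xss \<in> Ar V" "Dom V (\<sigma> Xss) = E0 (map E0 Xss)" "Cod V (\<sigma> Xss) = E0 ?X"
    using Xss by simp_all
  have o: "\<forall>X\<in>set (map E0 Xss). X \<in> Ob V" using Xss by simp
  have Et: "E1 (map t Xss) \<in> Ar V" "Cod V (E1 (map t Xss)) = E0 (map T0 (map E0 Xss))"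
    using Xss t_typed by simp_all
  show ?thesis
  proof (rule line_cancel[OF X])
    have "T1 (inn ?P (path (length ?X))) \<bullet> t ?X \<bullet> \<sigma> (map (map T0) Xss)
      = (vmor (l ?P) (vx 0, vx (length ?X)) \<bullet> vmor (Gamma_mult V E (GT ?P)) (vx 0, vx (length ?X)))
        \<bullet> inn (\<Gamma>0 (GT ?P)) ws \<bullet> E1 (map (inn (GT ?P)) yss)"
      using C.multS_left[OF w(1) n, unfolded W e j] M L I J by (simp add: hom_iff)
    also have "\<dots> = T1 (inn ?P (path (length ?X))) \<bullet> T1 (\<sigma> Xss) \<bullet> t (map E0 Xss) \<bullet> E1 (map t Xss)"
      unfolding multS_eq[OF w(1) line_ends, unfolded multS_eq_def]
      using C.multS_right[OF w(1) n, unfolded W e j] M L I J K by (simp add: hom_iff)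
    finally show "T1 (inn ?P (path (length ?X))) \<bullet> t ?X \<bullet> \<sigma> (map (map T0) Xss)
      = T1 (inn ?P (path (length ?X))) \<bullet> T1 (\<sigma> Xss) \<bullet> t (map E0 Xss) \<bullet> E1 (map t Xss)" .
  qed (use t_typed[OF X] t_typed[OF o] S Et in simp_all)
qed

lemma t_data: "restrict t (lists (Ob V)) \<in> monoidal_monad_data V E T"
proof -
  let ?t = "restrict t (lists (Ob V))"
  have [simp]: "?t Xs = t Xs" if "\<forall>X\<in>set Xs. X \<in> Ob V" for Xs
    using that by simp
  have "nat_trans (seq_cat V) V (E \<circ>\<^sub>F seq_func T) (T \<circ>\<^sub>F E) ?t"
  proof (intro nat_trans.intro nat_trans_axioms.intro cat_functor_comp[OF cat_functor_seq_func functor_E] cat_functor_comp[OF functor_E] T.unit.G.cat_functor_axioms)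
    fix Xs assume "Xs \<in> Ob (seq_cat V)"
    then show "?t Xs \<in> hom V (fobj (E \<circ>\<^sub>F seq_func T) Xs) (fobj (T \<circ>\<^sub>F E) Xs)"
      using t_typed[of Xs] by (simp add: hom_iff)
  next
    fix fs Xs Ys assume "fs \<in> hom (seq_cat V) Xs Ys"
    then have fs: "\<forall>f\<in>set fs. f \<in> Ar V" "Xs = map (Dom V) fs" "Ys = map (Cod V) fs" by (auto simp: hom_iff)
    have o: "\<forall>X\<in>set Xs. X \<in> Ob V" "\<forall>X\<in>set Ys. X \<in> Ob V" using fs by auto
    have "t Ys \<bullet> E1 (map T1 fs) = T1 (E1 fs) \<bullet> t Xs"
      unfolding fs(2,3) by (rule C.t_natural[OF fs(1)])
    then show "?t Ys \<bullet> farr (E \<circ>\<^sub>F seq_func T) fs = farr (T \<circ>\<^sub>F E) fs \<bullet> ?t Xs"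
      using o by simp
  qed
  moreover have "map ?t Xss = map t Xss" if "\<forall>Xs\<in>set Xss. \<forall>X\<in>set Xs. X \<in> Ob V" for Xss
    using that by simp
  ultimately show ?thesis
    unfolding monoidal_monad_data_def using t_unit t_subst t_eta t_mu by auto
qed

end

section \<open>The bijection with distributive laws\<close>

context enriched
begin

text \<open>The correspondence at the linear graph of \<open>Xs\<close> fixes \<tau> up to T of an
  injection, which \<open>line_cancel\<close> removes. This gives injectivity of
  \<open>dist_law_of\<close>.\<close>

lemma corresponding_unique:
  assumes a: "corresponding V E T small l \<tau>" and b: "corresponding V E T small l \<tau>'" and Xs: "\<forall>X\<in>set Xs. X \<in> Ob V"
  shows "\<tau> Xs = \<tau>' Xs"
proof (rule line_cancel[OF Xs])
  note w = lineG_vgraph[OF Xs] line_walk[of Xs]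
  show "T1 (inn (lineG Xs) (path (length Xs))) \<bullet> \<tau> Xs = T1 (inn (lineG Xs) (path (length Xs))) \<bullet> \<tau>' Xs"
    using corresponding.corr[OF a w] corresponding.corr[OF b w] unfolding line_edges by (rule trans[OF sym])
qed (rule corresponding.tau_typed[OF a Xs] corresponding.tau_typed[OF b Xs])+

text \<open>The law built from \<open>t\<close> and the given law both correspond to
  \<open>t\<close>, hence agree on every injection and therefore on every hom.\<close>

lemma dist_law_of_t:
  assumes l: "l \<in> dist_law_data small V E T"
  shows "\<exists>\<tau>\<in>monoidal_monad_data V E T. dist_law_of small V E T \<tau> = l"
proof -
  have lx: "l \<in> extensional (vgraphs small V)" and d: "distributive_law (GV small V) (G_monad T) (Gamma V E) l"
    and lf: "\<And>X a. X \<in> vgraphs small V \<Longrightarrow> a \<in> verts X \<Longrightarrow> vfun (l X) a = a"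
    using l by (simp_all add: dist_law_data_def)
  interpret N: nat_trans "GV small V" "GV small V" "Gamma V E \<circ>\<^sub>F G_monad T" "G_monad T \<circ>\<^sub>F Gamma V E" l
    using d by (simp add: distributive_law_def)
  have lt: "l X \<in> Ar (GV small V)" "vsrc (l X) = \<Gamma>0 (G_obj T X)" "vtgt (l X) = G_obj T (\<Gamma>0 X)" if "X \<in> vgraphs small V" for X
    using N.component[of X] that by (simp_all add: hom_iff)
  interpret O: object_family V E T small l
  proof
    fix X :: "('a, 'o) vgraph" assume X: "X \<in> vgraphs small V"
    show "vfun (l X) = (\<lambda>a\<in>verts X. a)"
    proof (rule extensionalityI[of _ "verts X"])
      show "vfun (l X) \<in> extensional (verts X)"
        using GV_arD(7)[OF lt(1)[OF X]] lt(2)[OF X] by simp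
    qed (simp_all add: lf X)
  qed (use lt in simp_all)
  interpret F: componentwise_family V E T small l
    by (intro componentwise_family.intro O.object_family_axioms componentwise_family_axioms.intro) (use d O.distributive_law_iff in blast)
  let ?t = "restrict F.t (lists (Ob V))"
  interpret D: corresponding V E T small "dist_law_of small V E T ?t" ?t
    by (rule dist_law_of_props[OF F.t_data])
  have "dist_law_of small V E T ?t = l"
  proof (rule extensionalityI[OF _ lx])
    fix X assume X: "X \<in> vgraphs small V"
    show "dist_law_of small V E T ?t X = l X"
    proof (rule vmap_eqI[OF D.l_ar[OF X] lt(1)[OF X]])
      fix a b assume "a \<in> verts (vsrc (dist_law_of small V E T ?t X))" "b \<in> verts (vsrc (dist_law_of small V E T ?t X))"
      then have ab: "a \<in> verts X" "b \<in> verts X" by (simp_all add: D.l_src[OF X])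
      show "vmor (dist_law_of small V E T ?t X) (a, b) = vmor (l X) (a, b)"
      proof (rule inn_epi[of "G_obj T X" a b])
        fix xs assume xs: "xs \<in> walks (G_obj T X)" "hd xs = a" "last xs = b"
        then show "vmor (dist_law_of small V E T ?t X) (a, b) \<bullet> inn (G_obj T X) xs = vmor (l X) (a, b) \<bullet> inn (G_obj T X) xs"
          using D.corr_X[OF X, of xs] F.corr_t[OF X, of xs] walk_edges_ob[OF X, of xs] by simp
      qed (use X ab D.l_vmor[OF X ab] O.l_vmor[OF X ab] in \<open>simp_all add: hom_iff D.GT_vgraph\<close>)
    qed (use X in \<open>simp_all add: D.l_src D.l_tgt D.l_fun lt O.l_fun\<close>)
  qed (simp add: dist_law_of_def)
  then show ?thesis using F.t_data by blast
qed

theorem bij_dist_law_of: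
  "bij_betw (dist_law_of small V E T) (monoidal_monad_data V E T) (dist_law_data small V E T)"
proof (rule bij_betw_imageI)
  show "inj_on (dist_law_of small V E T) (monoidal_monad_data V E T)"
  proof (rule inj_onI)
    fix \<tau> \<tau>' assume d: "\<tau> \<in> monoidal_monad_data V E T" "\<tau>' \<in> monoidal_monad_data V E T"
      and eq: "dist_law_of small V E T \<tau> = dist_law_of small V E T \<tau>'"
    show "\<tau> = \<tau>'"
      using corresponding_unique[OF dist_law_of_props[OF d(1)] dist_law_of_props[OF d(2), folded eq]]
      by (rule monoidal_eqI[OF d])
  qed
  show "dist_law_of small V E T ` monoidal_monad_data V E T = dist_law_data small V E T"
    using dist_law_of_in_data dist_law_of_t by blast
qed

end

theorem theorem5p1p1:
  fixes V :: "('o, 'm) cat"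
    and E :: "('o, 'm) multitensor_struct"
    and T :: "('o, 'm) monad_struct"
    and small :: "'a set \<Rightarrow> bool"
  assumes "category V"
    and "multitensor V E"
    and "monad V T"
    and "small_universe small"
  shows "bij_betw (subst_of V E T) (monoidal_monad_data V E T) (composite_data V E T) \<and>
    (has_coproducts small V \<and> distributive small V E \<longrightarrow>
      bij_betw (dist_law_of small V E T)
        (monoidal_monad_data V E T) (dist_law_data small V E T) \<and>
      bij_betw (lifting_of small V E T)
        (monoidal_monad_data V E T) (liftings small V E (G_monad T)) \<and>
      (\<forall>\<tau>\<in>monoidal_monad_data V E T.
        let TE = composite_struct V E T (subst_of V E T \<tau>);
            T' = lifting_of small V E T \<tau>
        in \<exists>K. cat_iso (ECat small V TE) (alg_cat (ECat small V E) T') K \<and>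
             func_eq (ECat small V TE) (ecat_forget \<circ>\<^sub>F alg_forget \<circ>\<^sub>F K) ecat_forget))"
proof -
  interpret tensor_monad V E T
    by (rule tensor_monad.intro[OF assms(2,3)])
  have "bij_betw (dist_law_of small V E T) (monoidal_monad_data V E T) (dist_law_data small V E T) \<and>
      bij_betw (lifting_of small V E T) (monoidal_monad_data V E T) (liftings small V E (G_monad T)) \<and>
      (\<forall>\<tau>\<in>monoidal_monad_data V E T.
        let TE = composite_struct V E T (subst_of V E T \<tau>);
            T' = lifting_of small V E T \<tau>
        in \<exists>K. cat_iso (ECat small V TE) (alg_cat (ECat small V E) T') K \<and>
             func_eq (ECat small V TE) (ecat_forget \<circ>\<^sub>F alg_forget \<circ>\<^sub>F K) ecat_forget)"
    if d: "has_coproducts small V \<and> distributive small V E"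
  proof -
    interpret enriched V E T small
      by (intro enriched.intro tensor_monad_axioms enriched_axioms.intro) (use assms(4) d in auto)
    have "\<exists>K. cat_iso (ECat small V (composite (subst_of V E T \<tau>))) (alg_cat (ECat small V E) (lifting_of small V E T \<tau>)) K \<and>
        func_eq (ECat small V (composite (subst_of V E T \<tau>))) (ecat_forget \<circ>\<^sub>F alg_forget \<circ>\<^sub>F K) ecat_forget"
      if \<tau>: "\<tau> \<in> monoidal_monad_data V E T" for \<tau>
      using monoidal_monad.algebra_iso[OF monoidalI[OF \<tau>], of small]
      unfolding monoidal_monad.m_def[OF monoidalI[OF \<tau>]] .
    with bij_dist_law_of bij_lifting_of show ?thesis
      unfolding Let_def by blast
  qed
  with bij_subst_of show ?thesis by blast
qed

end
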